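(* Let $L>0$ and $\mu>0$, and let $\mathcal{A}_a^{\mu}$ be the antisymmetric part of the weighted Kirchhoff Laplacian on the ladder graph $\mathcal{G}$ (defined in the context). For $\mu\geq 1$ the discrete spectrum of $\mathcal{A}_{a}^{\mu}$ is empty. For $0<\mu<1$, there exist either one or two eigenvalues of $\mathcal{A}_a^\mu$ in each gap of $\mathcal{A}_{a}^{\mu}$.
   Context: Let $L>0$. $\mathcal{G}\subset\mathbb{R}^2$ is the infinite ladder graph with vertices $M_j^{\pm}=(j,\pm L/2)$, $j\in\mathbb{Z}$ (set $\mathcal{M}$), vertical edges $e_j=\{j\}\times(-L/2,L/2)$ and horizontal edges $e_{j+1/2}^{\pm}=(j,j+1)\times\{\pm L/2\}$ (set of all edges $\mathcal{E}$). $\mathcal{E}(M)$ is the set of edges having $M$ as an endpoint. For $\mu>0$ the weight $w^\mu:\mathcal{E}\to\mathbb{R}^+$ is $w^\mu(e_0)=\mu$ and $w^\mu(e)=1$ for $e\neq e_0$. $L_2^\mu(\mathcal{G})$ is the space of functions $u$ with $u\in L_2(e)$ for all $e$ and $\|u\|^2=\sum_e w^\mu(e)\|u\|^2_{L_2(e)}<\infty$. $H^2(\mathcal{G})$ is the space of $u\in L_2^\mu(\mathcal{G})$ continuous on $\mathcal{G}$ with $u\in H^2(e)$ for all $e$ and $\sum_e\|u\|^2_{H^2(e)}<\infty$. Writing $u_e=u|_e$, the self-adjoint operator $\mathcal{A}^\mu$ on $L_2^\mu(\mathcal{G})$ is $(\mathcal{A}^\mu u)_e=-u_e''$ with domain $\{u\in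 H^2(\mathcal{G}):\sum_{e\in\mathcal{E}(M)}w^\mu(e)u_e'(M)=0\ \forall M\in\mathcal{M}\}$, where $u_e'(M)$ is the derivative at $M$ in the outgoing direction. $\mathcal{A}_a^\mu$ is the restriction of $\mathcal{A}^\mu$ to the invariant subspace of functions with $u(x,y)=-u(x,-y)$. A gap of $\mathcal{A}_a^\mu$ is a maximal open interval of $(0,\infty)$ not intersecting its essential spectrum. The discrete spectrum consists of the isolated eigenvalues of finite multiplicity. *)

theory Defs
  imports "HOL-Analysis.Analysis"
begin

section \<open>Square-integrable and Sobolev functions on a bounded open interval\<close>

text \<open>
  Elements of an \<open>L\<^sub>2\<close> space are represented by functions; two functions represent the same
  element iff their difference has norm zero.
\<close>

definition L2_on :: "real \<Rightarrow> real \<Rightarrow> (real \<Rightarrow> complex) set" where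
  "L2_on a b = {f \<in> borel_measurable (lebesgue_on {a<..<b}).
                  integrable (lebesgue_on {a<..<b}) (\<lambda>t. (norm (f t))\<^sup>2)}"

definition L2_norm_sq :: "real \<Rightarrow> real \<Rightarrow> (real \<Rightarrow> complex) \<Rightarrow> real" where
  "L2_norm_sq a b f = integral\<^sup>L (lebesgue_on {a<..<b}) (\<lambda>t. (norm (f t))\<^sup>2)"

text \<open>
  Weak derivatives are tested against \<open>C\<^sup>1\<close> functions with compact support in the open interval,
  and Sobolev spaces of order two are defined by iterating those of order one, as is usual in
  dimension one (Brezis).
\<close>

definition C1_test_function :: "real \<Rightarrow> real \<Rightarrow> (real \<Rightarrow> real) \<Rightarrow> (real \<Rightarrow> real) \<Rightarrow> bool" where
  "C1_test_function a b \<phi> \<phi>' \<longleftrightarrow>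
     (\<forall>x. (\<phi> has_real_derivative \<phi>' x) (at x)) \<and> continuous_on UNIV \<phi>' \<and>
     (\<exists>c d. a < c \<and> d < b \<and> (\<forall>x. x \<notin> {c..d} \<longrightarrow> \<phi> x = 0))"

definition is_weak_deriv ::
  "real \<Rightarrow> real \<Rightarrow> (real \<Rightarrow> complex) \<Rightarrow> (real \<Rightarrow> complex) \<Rightarrow> bool" where
  "is_weak_deriv a b f g \<longleftrightarrow>
     (\<forall>\<phi> \<phi>'. C1_test_function a b \<phi> \<phi>' \<longrightarrow>
        integral\<^sup>L (lebesgue_on {a<..<b}) (\<lambda>t. \<phi>' t *\<^sub>R f t) =
        - integral\<^sup>L (lebesgue_on {a<..<b}) (\<lambda>t. \<phi> t *\<^sub>R g t))"

definition H1_on :: "real \<Rightarrow> real \<Rightarrow> (real \<Rightarrow> complex) set" where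
  "H1_on a b = {f \<in> L2_on a b. \<exists>g \<in> L2_on a b. is_weak_deriv a b f g}"

text \<open>For \<open>f\<close> in \<open>H1_on a b\<close> the chosen representative is unique up to a null set.\<close>

definition weak_deriv :: "real \<Rightarrow> real \<Rightarrow> (real \<Rightarrow> complex) \<Rightarrow> (real \<Rightarrow> complex)" where
  "weak_deriv a b f = (SOME g. g \<in> L2_on a b \<and> is_weak_deriv a b f g)"

definition H2_on :: "real \<Rightarrow> real \<Rightarrow> (real \<Rightarrow> complex) set" where
  "H2_on a b = {f \<in> H1_on a b. weak_deriv a b f \<in> H1_on a b}"

definition H2_norm_sq :: "real \<Rightarrow> real \<Rightarrow> (real \<Rightarrow> complex) \<Rightarrow> real" where
  "H2_norm_sq a b f =
     L2_norm_sq a b f + L2_norm_sq a b (weak_deriv a b f) +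
     L2_norm_sq a b (weak_deriv a b (weak_deriv a b f))"


section \<open>The ladder graph\<close>

text \<open>\<open>Vertical j\<close> is \<open>{j} \<times> (-L/2, L/2)\<close>; \<open>Upper j\<close> and \<open>Lower j\<close> are \<open>(j, j + 1) \<times> {\<plusminus> L/2}\<close>.\<close>

datatype edge = Vertical int | Upper int | Lower int

fun edge_lo :: "real \<Rightarrow> edge \<Rightarrow> real" where
  "edge_lo L (Vertical j) = - L / 2"
| "edge_lo L (Upper j) = of_int j"
| "edge_lo L (Lower j) = of_int j"

fun edge_hi :: "real \<Rightarrow> edge \<Rightarrow> real" where
  "edge_hi L (Vertical j) = L / 2"
| "edge_hi L (Upper j) = of_int j + 1"
| "edge_hi L (Lower j) = of_int j + 1"

fun edge_point :: "real \<Rightarrow> edge \<Rightarrow> real \<Rightarrow> real \<times> real" where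
  "edge_point L (Vertical j) t = (of_int j, t)"
| "edge_point L (Upper j) t = (t, L / 2)"
| "edge_point L (Lower j) t = (t, - L / 2)"

definition vertices :: "real \<Rightarrow> (real \<times> real) set" where
  "vertices L = {(of_int j, s * L / 2) | (j :: int) s. s \<in> {-1, 1}}"

definition ladder :: "real \<Rightarrow> (real \<times> real) set" where
  "ladder L = vertices L \<union> (\<Union>e. edge_point L e ` {edge_lo L e<..<edge_hi L e})"

definition incident_edges :: "real \<Rightarrow> real \<times> real \<Rightarrow> edge set" where
  "incident_edges L M =
     {e. M = edge_point L e (edge_lo L e) \<or> M = edge_point L e (edge_hi L e)}"

definition weight :: "real \<Rightarrow> edge \<Rightarrow> real" where
  "weight \<mu> e = (if e = Vertical 0 then \<mu> else 1)"

text \<open>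
  Functions on the graph are functions on the plane of which only the values on the graph are used.
\<close>

type_synonym graph_fun = "real \<times> real \<Rightarrow> complex"

definition on_edge :: "real \<Rightarrow> graph_fun \<Rightarrow> edge \<Rightarrow> real \<Rightarrow> complex" where
  "on_edge L u e t = u (edge_point L e t)"

text \<open>
  One-sided derivative at the endpoint \<open>M\<close> of \<open>e\<close>, directed from \<open>M\<close> into \<open>e\<close>.  It exists for
  functions that are \<open>H\<^sup>2\<close> on \<open>e\<close> and continuous up to the endpoints, and equals the trace of the
  weak derivative.
\<close>

definition outgoing_deriv :: "real \<Rightarrow> graph_fun \<Rightarrow> edge \<Rightarrow> real \<times> real \<Rightarrow> complex" where
  "outgoing_deriv L u e M =
     (let a = edge_lo L e; b = edge_hi L e in
      if M = edge_point L e a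
      then vector_derivative (on_edge L u e) (at a within {a..b})
      else - vector_derivative (on_edge L u e) (at b within {a..b}))"


section \<open>The weighted Kirchhoff Laplacian\<close>

definition L2_graph :: "real \<Rightarrow> real \<Rightarrow> graph_fun set" where
  "L2_graph L \<mu> =
     {u. (\<forall>e. on_edge L u e \<in> L2_on (edge_lo L e) (edge_hi L e)) \<and>
         (\<lambda>e. weight \<mu> e * L2_norm_sq (edge_lo L e) (edge_hi L e) (on_edge L u e))
           summable_on UNIV}"

definition L2_graph_norm :: "real \<Rightarrow> real \<Rightarrow> graph_fun \<Rightarrow> real" where
  "L2_graph_norm L \<mu> u =
     sqrt (\<Sum>\<^sub>\<infinity>e. weight \<mu> e * L2_norm_sq (edge_lo L e) (edge_hi L e) (on_edge L u e))"

definition H2_graph :: "real \<Rightarrow> real \<Rightarrow> graph_fun set" where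
  "H2_graph L \<mu> =
     {u \<in> L2_graph L \<mu>. continuous_on (ladder L) u \<and>
        (\<forall>e. on_edge L u e \<in> H2_on (edge_lo L e) (edge_hi L e)) \<and>
        (\<lambda>e. H2_norm_sq (edge_lo L e) (edge_hi L e) (on_edge L u e)) summable_on UNIV}"

definition Laplacian_domain :: "real \<Rightarrow> real \<Rightarrow> graph_fun set" where
  "Laplacian_domain L \<mu> =
     {u \<in> H2_graph L \<mu>. \<forall>M \<in> vertices L.
        (\<Sum>e \<in> incident_edges L M. of_real (weight \<mu> e) * outgoing_deriv L u e M) = 0}"

text \<open>Operators are given by their graphs, i.e. as sets of pairs of representatives.\<close>

definition Laplacian :: "real \<Rightarrow> real \<Rightarrow> (graph_fun \<times> graph_fun) set" where
  "Laplacian L \<mu> =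
     {(u, f). u \<in> Laplacian_domain L \<mu> \<and> f \<in> L2_graph L \<mu> \<and>
        (\<forall>e. let a = edge_lo L e; b = edge_hi L e in
           AE t in lebesgue_on {a<..<b}.
             on_edge L f e t = - weak_deriv a b (weak_deriv a b (on_edge L u e)) t)}"

definition antisymmetric :: "real \<Rightarrow> graph_fun \<Rightarrow> bool" where
  "antisymmetric L u \<longleftrightarrow> (\<forall>(x, y) \<in> ladder L. u (x, y) = - u (x, - y))"

definition L2_antisym :: "real \<Rightarrow> real \<Rightarrow> graph_fun set" where
  "L2_antisym L \<mu> = {u \<in> L2_graph L \<mu>. antisymmetric L u}"

definition Laplacian_antisym :: "real \<Rightarrow> real \<Rightarrow> (graph_fun \<times> graph_fun) set" where
  "Laplacian_antisym L \<mu> = Laplacian L \<mu> \<inter> (L2_antisym L \<mu> \<times> L2_antisym L \<mu>)"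


section \<open>Spectral notions for operators on a space of function representatives\<close>

text \<open>
  \<open>X\<close> is the set of representatives of the elements of a Hilbert space, \<open>N\<close> its norm (a seminorm
  on representatives) and \<open>T\<close> the graph of a linear operator.  The estimate in the resolvent set
  expresses both injectivity of \<open>T - z\<close> and boundedness of its inverse.
\<close>

definition resolvent_set ::
  "('p \<Rightarrow> complex) set \<Rightarrow> (('p \<Rightarrow> complex) \<Rightarrow> real) \<Rightarrow>
   (('p \<Rightarrow> complex) \<times> ('p \<Rightarrow> complex)) set \<Rightarrow> complex set" where
  "resolvent_set X N T =
     {z. (\<forall>f \<in> X. \<exists>(u, g) \<in> T. N (\<lambda>p. g p - z * u p - f p) = 0) \<and>
         (\<exists>C. \<forall>(u, g) \<in> T. N u \<le> C * N (\<lambda>p. g p - z * u p))}"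

definition op_spectrum ::
  "('p \<Rightarrow> complex) set \<Rightarrow> (('p \<Rightarrow> complex) \<Rightarrow> real) \<Rightarrow>
   (('p \<Rightarrow> complex) \<times> ('p \<Rightarrow> complex)) set \<Rightarrow> complex set" where
  "op_spectrum X N T = - resolvent_set X N T"

definition eigenspace ::
  "(('p \<Rightarrow> complex) \<Rightarrow> real) \<Rightarrow> (('p \<Rightarrow> complex) \<times> ('p \<Rightarrow> complex)) set \<Rightarrow>
   complex \<Rightarrow> ('p \<Rightarrow> complex) set" where
  "eigenspace N T z = {u. \<exists>g. (u, g) \<in> T \<and> N (\<lambda>p. g p - z * u p) = 0}"

definition is_eigenvalue ::
  "(('p \<Rightarrow> complex) \<Rightarrow> real) \<Rightarrow> (('p \<Rightarrow> complex) \<times> ('p \<Rightarrow> complex)) set \<Rightarrow>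
   complex \<Rightarrow> bool" where
  "is_eigenvalue N T z \<longleftrightarrow> (\<exists>u \<in> eigenspace N T z. N u \<noteq> 0)"

definition finite_multiplicity ::
  "(('p \<Rightarrow> complex) \<Rightarrow> real) \<Rightarrow> (('p \<Rightarrow> complex) \<times> ('p \<Rightarrow> complex)) set \<Rightarrow>
   complex \<Rightarrow> bool" where
  "finite_multiplicity N T z \<longleftrightarrow>
     (\<exists>B. finite B \<and> B \<subseteq> eigenspace N T z \<and>
        (\<forall>u \<in> eigenspace N T z. \<exists>c. N (\<lambda>p. u p - (\<Sum>b \<in> B. c b * b p)) = 0))"

definition discrete_spectrum ::
  "('p \<Rightarrow> complex) set \<Rightarrow> (('p \<Rightarrow> complex) \<Rightarrow> real) \<Rightarrow>
   (('p \<Rightarrow> complex) \<times> ('p \<Rightarrow> complex)) set \<Rightarrow> complex set" where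
  "discrete_spectrum X N T =
     {z. is_eigenvalue N T z \<and> finite_multiplicity N T z \<and> z isolated_in op_spectrum X N T}"

text \<open>For self-adjoint operators all the usual definitions of the essential spectrum agree.\<close>

definition essential_spectrum ::
  "('p \<Rightarrow> complex) set \<Rightarrow> (('p \<Rightarrow> complex) \<Rightarrow> real) \<Rightarrow>
   (('p \<Rightarrow> complex) \<times> ('p \<Rightarrow> complex)) set \<Rightarrow> complex set" where
  "essential_spectrum X N T = op_spectrum X N T - discrete_spectrum X N T"

definition free_interval :: "complex set \<Rightarrow> real set \<Rightarrow> bool" where
  "free_interval S I \<longleftrightarrow>
     I \<noteq> {} \<and> open I \<and> is_interval I \<and> I \<subseteq> {0<..} \<and> of_real ` I \<inter> S = {}"

definition is_gap ::
  "('p \<Rightarrow> complex) set \<Rightarrow> (('p \<Rightarrow> complex) \<Rightarrow> real) \<Rightarrow>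
   (('p \<Rightarrow> complex) \<times> ('p \<Rightarrow> complex)) set \<Rightarrow> real set \<Rightarrow> bool" where
  "is_gap X N T I \<longleftrightarrow>
     free_interval (essential_spectrum X N T) I \<and>
     (\<forall>J. free_interval (essential_spectrum X N T) J \<and> I \<subseteq> J \<longrightarrow> J = I)"

end

theory Submission
  imports Defs "HOL-Library.Function_Algebras"
begin

text \<open>
  On an edge a solution of \<open>- u'' = z * u\<close> with \<open>z = \<omega>\<^sup>2\<close> is determined by two numbers, and an
  antisymmetric function is determined by its values on the upper horizontal edges and the vertical
  ones, where it is odd.  Eliminating the edges, the eigenvalue equation becomes, for the values \<open>v j\<close>
  at the upper vertices,
  
      \<open>v (j + 1) + v (j - 1) = (2 * cos \<omega> + w j * s) * v j\<close>,  \<open>s = sin \<omega> * cot (\<omega> * L / 2)\<close>,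
  
  with \<open>w 0 = \<mu>\<close> and \<open>w j = 1\<close> otherwise (lemma \<open>vertex_system_iff_recurrence\<close>).  This is a periodic
  problem perturbed at a single vertex.  Writing \<open>r + 1 / r = 2 * cos \<omega> + s\<close> with \<open>\<bar>r\<bar> \<le> 1\<close>, square-summable
  solutions exist on the half-lines only if \<open>\<bar>r\<bar> < 1\<close>, they are multiples of \<open>r ^ \<bar>j\<bar>\<close>, and the equation at
  \<open>j = 0\<close> reads \<open>1 / r - r = (1 - \<mu>) * s\<close> (\<open>eigenvalue_imp\<close>, \<open>eigenvalue_if\<close>).  If this equation fails, the
  recurrence with an arbitrary square-summable right-hand side is solved by geometric series plus a
  rank-one correction, so \<open>z\<close> is in the resolvent set (\<open>mem_resolvent_set\<close>).  If \<open>\<bar>r\<bar> = 1\<close>, or if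
  \<open>sin \<omega> = 0\<close>, a source on a single pair of edges cannot be matched (\<open>mem_spectrum\<close>); when both sines
  vanish there are infinitely many eigenfunctions with compact support (\<open>infinite_multiplicity\<close>).  So on
  the positive half-axis, up to the zeros of \<open>sin (\<omega> * L / 2)\<close>, the essential spectrum is
  \<open>\<bar>2 * cos \<omega> + s\<bar> \<le> 2\<close> together with the zeros of \<open>sin \<omega>\<close>.
  
  For \<open>\<mu> \<ge> 1\<close> and \<open>z > 0\<close> the numbers \<open>s\<close> and \<open>1 / r - r\<close> both have the sign of \<open>r\<close>, which contradicts
  \<open>1 / r - r = (1 - \<mu>) * s\<close> (\<open>no_positive_eigenvalue\<close>).  For \<open>z\<close> outside \<open>(0, \<infinity>)\<close> the operator, being
  non-negative, has no eigenvalues; here this is read off from the recurrence by a sign argument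
  for the quotients of the two fundamental solutions (\<open>no_eigenvalue_off_positive\<close>).
  
  For \<open>\<mu> < 1\<close> eliminating \<open>r\<close> turns the eigenvalue condition into
  \<open>4 * cot \<omega> + k * cot (\<omega> * L / 2) - 4 * tan (\<omega> * L / 2) = 0\<close> with \<open>k = \<mu> * (2 - \<mu>) < 1\<close>.  The left-hand side
  decreases from \<open>\<infinity>\<close> to \<open>- \<infinity>\<close> between consecutive poles, so there is exactly one zero between any two.
  The gap condition is that the same expression with \<open>k = 1\<close> has the sign of \<open>cot (\<omega> * L / 2)\<close>; by the same
  monotonicity it defines a connected set between two poles, which contains the zero.  The only poles
  inside a gap are zeros of \<open>sin (\<omega> * L / 2)\<close>, and two of these are separated by a zero of the cosine, which
  lies in a band.  Hence a gap contains one or two zeros (\<open>gap_eigenvalue_count\<close>).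
  
  The analytic part consists of the passage between weak and classical derivatives on an interval
  (\<open>H2_data_imp_H2_on\<close>, \<open>H2_on_imp_H2_data\<close>), Duhamel's formula (\<open>Duhamel_forward\<close>, \<open>Duhamel_H2_data\<close>), and
  the correspondence between solutions on the ladder and square-summable sequences
  (\<open>vertex_system_of_solution\<close>, \<open>solution_of_vertex_system\<close>).
\<close>

section \<open>Integrals over a bounded interval\<close>

lemma integrable_lebesgue_on_interval_iff:
  fixes f :: "real \<Rightarrow> complex"
  shows "integrable (lebesgue_on {a<..<b}) f \<longleftrightarrow> f absolutely_integrable_on {a..b}"
proof -
  have "integrable (lebesgue_on {a<..<b}) f \<longleftrightarrow> f absolutely_integrable_on {a<..<b}"
    by (simp add: integrable_restrict_space set_integrable_def)
  also have "\<dots> \<longleftrightarrow> f absolutely_integrable_on {a..b}"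
    using absolutely_integrable_on_open_interval[of a b f] by simp
  finally show ?thesis .
qed

lemma integral_lebesgue_on_interval:
  fixes f :: "real \<Rightarrow> complex"
  assumes "f absolutely_integrable_on {a..b}"
  shows "integral\<^sup>L (lebesgue_on {a<..<b}) f = integral {a..b} f"
  using assms integrable_lebesgue_on_interval_iff[of a b f]
  by (simp add: lebesgue_integral_eq_integral integral_open_interval_real)

lemma AE_lebesgue_on_interval_iff:
  "(AE t in lebesgue_on {a<..<b}. P t) \<longleftrightarrow> (\<exists>N. negligible N \<and> (\<forall>t\<in>{a..b} - N. P t))"
  for a b :: real
proof
  assume "AE t in lebesgue_on {a<..<b}. P t"
  then obtain N where N: "N \<in> null_sets (lebesgue_on {a<..<b})" "{t \<in> {a<..<b}. \<not> P t} \<subseteq> N"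
    by (auto simp: eventually_ae_filter)
  then have "negligible N"
    by (simp add: negligible_iff_null_sets null_sets_restrict_space)
  then have "negligible (N \<union> {a, b})"
    by (auto simp: negligible_Un)
  moreover have "P t" if "t \<in> {a..b} - (N \<union> {a, b})" for t
    using that N(2) by (auto simp: less_le)
  ultimately show "\<exists>N. negligible N \<and> (\<forall>t\<in>{a..b} - N. P t)" by blast
next
  assume "\<exists>N. negligible N \<and> (\<forall>t\<in>{a..b} - N. P t)"
  then obtain N where N: "negligible N" "\<forall>t\<in>{a..b} - N. P t" by blast
  have "AE t in lebesgue. t \<notin> N"
    using N(1) by (simp add: negligible_iff_null_sets AE_not_in)
  then have "AE t in lebesgue. t \<in> {a<..<b} \<longrightarrow> P t"
    by eventually_elim (use N(2) in auto)
  then show "AE t in lebesgue_on {a<..<b}. P t"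
    by (subst AE_restrict_space_iff) auto
qed

lemma absolutely_integrable_mult_continuous:
  fixes g y :: "real \<Rightarrow> complex"
  assumes "g absolutely_integrable_on {a..b}" "continuous_on {a..b} y"
  shows "(\<lambda>s. g s * y s) absolutely_integrable_on {a..b}"
proof -
  have "(\<lambda>s. y s * g s) absolutely_integrable_on {a..b}"
  proof (rule absolutely_integrable_bounded_measurable_product[where h = "(*)" and f = y, OF _ _ _ _ assms(1)])
    show "bilinear ((*) :: complex \<Rightarrow> complex \<Rightarrow> complex)"
      by (simp add: bilinear_conv_bounded_bilinear bounded_bilinear_mult)
    show "y \<in> borel_measurable (lebesgue_on {a..b})"
      using assms(2) by (simp add: continuous_imp_measurable_on_sets_lebesgue)
    show "bounded (y ` {a..b})"
      using assms(2) by (simp add: compact_continuous_image compact_imp_bounded)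
  qed auto
  then show ?thesis by (simp add: mult.commute)
qed

lemma absolutely_integrable_subinterval:
  fixes g :: "real \<Rightarrow> complex"
  assumes "g absolutely_integrable_on {a..b}" "a \<le> c" "d \<le> b"
  shows "g absolutely_integrable_on {c..d}"
  using assms by (intro set_integrable_subset[OF assms(1)]) auto

lemma continuous_on_indefinite_integral:
  fixes g :: "real \<Rightarrow> complex"
  assumes "g absolutely_integrable_on {a..b}"
  shows "continuous_on {a..b} (\<lambda>t. k + integral {a..t} g)"
proof -
  have "g integrable_on {a..b}"
    using assms absolutely_integrable_on_def by blast
  from indefinite_integral_continuous_1[OF this] show ?thesis
    by (intro continuous_intros)
qed

text \<open>
  A function whose increments are dominated by those of a monotone function times the length of the
  interval is constant: summing over an equidistant partition gains a factor \<open>1/n\<close>.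
\<close>

lemma constant_if_increments_small:
  fixes F :: "real \<Rightarrow> complex" and M :: "real \<Rightarrow> real"
  assumes "a \<le> b"
    and le: "\<And>s t. a \<le> s \<Longrightarrow> s \<le> t \<Longrightarrow> t \<le> b \<Longrightarrow> norm (F t - F s) \<le> (t - s) * (M t - M s)"
  shows "F b = F a"
proof -
  have bound: "norm (F b - F a) \<le> (b - a) * (M b - M a) / real n" if n: "n > 0" for n :: nat
  proof -
    define x where "x i = a + (b - a) * real i / real n" for i
    have x0: "x 0 = a" and xn: "x n = b" using n by (auto simp: x_def)
    have mono: "x i \<le> x j" if "i \<le> j" for i j
      unfolding x_def using that n \<open>a \<le> b\<close> by (intro add_left_mono divide_right_mono mult_left_mono) auto
    have rng: "a \<le> x i \<and> x i \<le> b" if "i \<le> n" for i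
      using mono[of 0 i] mono[of i n] that x0 xn by auto
    have step: "x (Suc i) - x i = (b - a) / real n" for i
      using n by (simp add: x_def field_simps)
    have "F b - F a = (\<Sum>i<n. F (x (Suc i)) - F (x i))"
      using sum_lessThan_telescope[of "\<lambda>i. F (x i)" n] by (simp add: x0 xn)
    also have "norm \<dots> \<le> (\<Sum>i<n. norm (F (x (Suc i)) - F (x i)))"
      by (rule norm_sum)
    also have "\<dots> \<le> (\<Sum>i<n. (b - a) / real n * (M (x (Suc i)) - M (x i)))"
    proof (rule sum_mono)
      fix i assume "i \<in> {..<n}"
      then have "norm (F (x (Suc i)) - F (x i)) \<le> (x (Suc i) - x i) * (M (x (Suc i)) - M (x i))"
        using rng[of i] rng[of "Suc i"] mono[of i "Suc i"] by (intro le) auto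
      then show "norm (F (x (Suc i)) - F (x i)) \<le> (b - a) / real n * (M (x (Suc i)) - M (x i))"
        by (simp add: step)
    qed
    also have "\<dots> = (b - a) / real n * (M b - M a)"
      unfolding sum_distrib_left[symmetric] sum_lessThan_telescope[of "\<lambda>i. M (x i)"] x0 xn ..
    finally show ?thesis by simp
  qed
  have "(\<lambda>n. (b - a) * (M b - M a) / real n) \<longlonglongrightarrow> 0"
    by (rule lim_const_over_n)
  then have "norm (F b - F a) \<le> 0"
    by (rule LIMSEQ_le_const) (auto intro!: exI[of _ 1] bound)
  then show ?thesis by simp
qed

text \<open>
  Integration by parts when one factor is only absolutely continuous.  Over \<open>[s, t]\<close> the two sides
  differ by at most a constant times \<open>(t - s)\<close> times the integral of \<open>norm \<circ> g\<close>, so their difference is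
  constant in \<open>t\<close>.
\<close>

lemma integral_by_parts_primitive:
  fixes g y y' :: "real \<Rightarrow> complex"
  assumes ab: "a \<le> b" and g: "g absolutely_integrable_on {a..b}"
    and y: "\<And>s. s \<in> {a..b} \<Longrightarrow> (y has_vector_derivative y' s) (at s within {a..b})"
    and y': "continuous_on {a..b} y'"
  shows "integral {a..b} (\<lambda>s. g s * y s + integral {a..s} g * y' s) = integral {a..b} g * y b"
proof -
  define G where "G t = integral {a..t} g" for t
  define h where "h s = g s * y s + G s * y' s" for s
  define F where "F t = G t * y t - integral {a..t} h" for t
  have conty: "continuous_on {a..b} y"
    using has_vector_derivative_continuous[OF y] by (simp add: continuous_on_eq_continuous_within)
  have contG: "continuous_on {a..b} G"
    unfolding G_def using continuous_on_indefinite_integral[OF g, of 0] by simp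
  have "(\<lambda>s. G s * y' s) absolutely_integrable_on {a..b}"
    using contG y' by (intro absolutely_integrable_continuous_real continuous_intros)
  then have h: "h absolutely_integrable_on {a..b}"
    unfolding h_def using absolutely_integrable_mult_continuous[OF g conty]
    by (rule set_integral_add(1)[rotated])
  have "compact (y' ` {a..b})" using y' by (simp add: compact_continuous_image)
  then obtain K where K: "K > 0" "\<And>s. s \<in> {a..b} \<Longrightarrow> norm (y' s) \<le> K"
    using compact_imp_bounded bounded_pos by (metis imageI)
  have gn: "(\<lambda>s. norm (g s)) integrable_on {c..d}" and gi: "g integrable_on {c..d}"
    and hi: "h integrable_on {c..d}"
    if "a \<le> c" "d \<le> b" for c d
    using absolutely_integrable_subinterval[OF g that] absolutely_integrable_subinterval[OF h that]
    by (auto simp: absolutely_integrable_on_def)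
  define M where "M t = 2 * K * integral {a..t} (\<lambda>s. norm (g s))" for t
  have "norm (F t - F s) \<le> (t - s) * (M t - M s)" if st: "a \<le> s" "s \<le> t" "t \<le> b" for s t
  proof -
    have Gd: "G t - G s = integral {s..t} g" if "a \<le> s" "s \<le> t" "t \<le> b" for s t
      using Henstock_Kurzweil_Integration.integral_combine[of a s t g] gi[of a t] that
      by (simp add: G_def algebra_simps)
    have Md: "M t - M s = 2 * K * integral {s..t} (\<lambda>s. norm (g s))"
      using Henstock_Kurzweil_Integration.integral_combine[of a s t "\<lambda>s. norm (g s)"] gn[of a t] st
      by (simp add: M_def flip: right_diff_distrib)
    have Hd: "integral {a..t} h = integral {a..s} h + integral {s..t} h"
      using Henstock_Kurzweil_Integration.integral_combine[of a s t h] hi[of a t] st by simp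
    have yd: "(y' has_integral y t - y s) {s..t}"
      by (rule fundamental_theorem_of_calculus)
         (use st in \<open>auto intro!: has_vector_derivative_within_subset[OF y]\<close>)
    have i1: "((\<lambda>\<sigma>. g \<sigma> * y t) has_integral integral {s..t} g * y t) {s..t}"
      by (intro has_integral_mult_left integrable_integral gi) (use st in auto)
    have i2: "((\<lambda>\<sigma>. G s * y' \<sigma>) has_integral G s * (y t - y s)) {s..t}"
      by (intro has_integral_mult_right yd)
    have i3: "(h has_integral integral {s..t} h) {s..t}"
      by (intro integrable_integral hi) (use st in auto)
    have "((\<lambda>\<sigma>. g \<sigma> * y t + G s * y' \<sigma> - h \<sigma>) has_integral
        (integral {s..t} g * y t + G s * (y t - y s) - integral {s..t} h)) {s..t}"
      by (intro has_integral_diff has_integral_add i1 i2 i3)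
    moreover have "integral {s..t} g * y t + G s * (y t - y s) - integral {s..t} h = F t - F s"
      using Gd[OF st] Hd by (simp add: F_def algebra_simps flip: Gd[OF st])
    ultimately have hasF: "((\<lambda>\<sigma>. g \<sigma> * y t + G s * y' \<sigma> - h \<sigma>) has_integral (F t - F s)) {s..t}"
      by simp
    define I where "I = integral {s..t} (\<lambda>s. norm (g s))"
    have pw: "norm (g \<sigma> * y t + G s * y' \<sigma> - h \<sigma>) \<le> K * (t - s) * norm (g \<sigma>) + I * K"
      if \<sigma>: "\<sigma> \<in> {s..t}" for \<sigma>
    proof -
      have "norm (integral {\<sigma>..t} y') \<le> K * (t - \<sigma>)"
        using \<sigma> st K(2) y' by (intro integral_bound continuous_on_subset[OF y']) auto
      moreover have "(y' has_integral y t - y \<sigma>) {\<sigma>..t}"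
        by (rule fundamental_theorem_of_calculus)
           (use \<sigma> st in \<open>auto intro!: has_vector_derivative_within_subset[OF y]\<close>)
      ultimately have yt: "norm (y t - y \<sigma>) \<le> K * (t - \<sigma>)"
        by (simp add: integral_unique)
      have "norm (integral {s..\<sigma>} g) \<le> integral {s..\<sigma>} (\<lambda>s. norm (g s))"
        by (rule Henstock_Kurzweil_Integration.integral_norm_bound_integral) (use \<sigma> st gi gn in auto)
      also have "\<dots> \<le> I"
        unfolding I_def by (rule integral_subset_le) (use \<sigma> st gn in auto)
      finally have Gt: "norm (G s - G \<sigma>) \<le> I"
        using Gd[of s \<sigma>] \<sigma> st by (simp add: norm_minus_commute)
      have "g \<sigma> * y t + G s * y' \<sigma> - h \<sigma> = g \<sigma> * (y t - y \<sigma>) + (G s - G \<sigma>) * y' \<sigma>"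
        by (simp add: h_def algebra_simps)
      also have "norm \<dots> \<le> norm (g \<sigma>) * (K * (t - \<sigma>)) + I * K"
        using yt Gt K(2)[of \<sigma>] \<sigma> st order_trans[OF norm_ge_zero Gt]
        by (intro order_trans[OF norm_triangle_ineq] add_mono) (auto simp: norm_mult intro!: mult_mono)
      also have "\<dots> \<le> norm (g \<sigma>) * (K * (t - s)) + I * K"
        using \<sigma> K(1) by (intro add_right_mono mult_left_mono) auto
      finally show ?thesis by (simp add: mult_ac)
    qed
    have "((\<lambda>\<sigma>. K * (t - s) * norm (g \<sigma>) + I * K) has_integral
        (K * (t - s) * I + (t - s) * (I * K))) {s..t}"
      unfolding I_def
      using has_integral_const_real[of "I * K" s t] st
      by (intro has_integral_add has_integral_mult_right integrable_integral gn)
         (auto simp: I_def scaleR_conv_of_real)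
    then have "norm (F t - F s) \<le> K * (t - s) * I + (t - s) * (I * K)"
      using Henstock_Kurzweil_Integration.integral_norm_bound_integral[of
          "\<lambda>\<sigma>. g \<sigma> * y t + G s * y' \<sigma> - h \<sigma>" "{s..t}" "\<lambda>\<sigma>. K * (t - s) * norm (g \<sigma>) + I * K"]
        pw hasF by (simp add: has_integral_iff)
    also have "\<dots> = (t - s) * (M t - M s)"
      by (simp add: Md I_def algebra_simps)
    finally show ?thesis .
  qed
  then have "F b = F a" by (rule constant_if_increments_small[OF ab])
  then show ?thesis by (simp add: F_def G_def h_def[abs_def])
qed

lemma L2_on_imp_absolutely_integrable:
  assumes "f \<in> L2_on a b"
  shows "f absolutely_integrable_on {a..b}"
proof -
  have "finite_measure (lebesgue_on {a<..<b})"
    by (rule finite_measure_lebesgue_on) simp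
  then have "integrable (lebesgue_on {a<..<b}) (\<lambda>t. 1 + (norm (f t))\<^sup>2)"
    using assms by (auto simp: L2_on_def intro!: finite_measure.integrable_const)
  moreover have "norm (f t) \<le> norm (1 + (norm (f t))\<^sup>2)" for t
  proof -
    have "0 \<le> (norm (f t) - 1)\<^sup>2" by simp
    then have "2 * norm (f t) \<le> 1 + (norm (f t))\<^sup>2" by (simp add: power2_diff)
    then have "norm (f t) \<le> 1 + (norm (f t))\<^sup>2" using norm_ge_zero[of "f t"] by linarith
    then show ?thesis by simp
  qed
  ultimately have "integrable (lebesgue_on {a<..<b}) f"
    using assms by (intro Bochner_Integration.integrable_bound[of _ "\<lambda>t. 1 + (norm (f t))\<^sup>2" f])
      (auto simp: L2_on_def)
  then show ?thesis by (simp add: integrable_lebesgue_on_interval_iff)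
qed

lemma norm_add_sq_le: "(norm (x + y))\<^sup>2 \<le> 2 * (norm x)\<^sup>2 + 2 * (norm y)\<^sup>2"
  for x y :: complex
proof -
  have "(norm (x + y))\<^sup>2 \<le> (norm x + norm y)\<^sup>2"
    by (intro power_mono norm_triangle_ineq) auto
  also have "\<dots> \<le> 2 * (norm x)\<^sup>2 + 2 * (norm y)\<^sup>2"
    using zero_le_power2[of "norm x - norm y"] by (simp add: power2_sum power2_diff)
  finally show ?thesis .
qed

lemma L2_on_add:
  assumes "f \<in> L2_on a b" "g \<in> L2_on a b"
  shows "(\<lambda>t. f t + g t) \<in> L2_on a b"
    and "L2_norm_sq a b (\<lambda>t. f t + g t) \<le> 2 * L2_norm_sq a b f + 2 * L2_norm_sq a b g"
proof -
  let ?M = "lebesgue_on {a<..<b}"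
  have meas: "(\<lambda>t. f t + g t) \<in> borel_measurable ?M"
    using assms by (auto simp: L2_on_def)
  have int: "integrable ?M (\<lambda>t. 2 * (norm (f t))\<^sup>2 + 2 * (norm (g t))\<^sup>2)"
    using assms by (auto simp: L2_on_def)
  have int2: "integrable ?M (\<lambda>t. (norm (f t + g t))\<^sup>2)"
    by (rule Bochner_Integration.integrable_bound[OF int])
       (use meas norm_add_sq_le in \<open>auto intro!: AE_I2\<close>)
  then show "(\<lambda>t. f t + g t) \<in> L2_on a b"
    using meas by (simp add: L2_on_def)
  have "L2_norm_sq a b (\<lambda>t. f t + g t) \<le> integral\<^sup>L ?M (\<lambda>t. 2 * (norm (f t))\<^sup>2 + 2 * (norm (g t))\<^sup>2)"
    unfolding L2_norm_sq_def by (intro integral_mono int int2 norm_add_sq_le)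
  also have "\<dots> = 2 * L2_norm_sq a b f + 2 * L2_norm_sq a b g"
    using assms by (auto simp: L2_on_def L2_norm_sq_def)
  finally show "L2_norm_sq a b (\<lambda>t. f t + g t) \<le> 2 * L2_norm_sq a b f + 2 * L2_norm_sq a b g" .
qed

lemma L2_on_scale:
  assumes "f \<in> L2_on a b"
  shows "(\<lambda>t. c * f t) \<in> L2_on a b"
    and "L2_norm_sq a b (\<lambda>t. c * f t) = (norm c)\<^sup>2 * L2_norm_sq a b f"
  using assms by (auto simp: L2_on_def L2_norm_sq_def norm_mult power_mult_distrib)

lemma L2_norm_sq_nonneg: "0 \<le> L2_norm_sq a b f"
  by (simp add: L2_norm_sq_def)

lemma L2_on_continuous:
  assumes "continuous_on {a..b} f"
  shows "f \<in> L2_on a b"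
proof -
  have "f \<in> borel_measurable (lebesgue_on {a<..<b})"
    by (rule continuous_imp_measurable_on_sets_lebesgue)
       (use assms in \<open>auto intro: continuous_on_subset\<close>)
  moreover have "(\<lambda>t. complex_of_real ((norm (f t))\<^sup>2)) absolutely_integrable_on {a..b}"
    using assms by (intro absolutely_integrable_continuous_real continuous_intros)
  then have "integrable (lebesgue_on {a<..<b}) (\<lambda>t. complex_of_real ((norm (f t))\<^sup>2))"
    by (simp add: integrable_lebesgue_on_interval_iff)
  then have "integrable (lebesgue_on {a<..<b}) (\<lambda>t. (norm (f t))\<^sup>2)"
    using complex_of_real_integrable_eq by blast
  ultimately show ?thesis by (simp add: L2_on_def)
qed

lemma L2_norm_sq_cong:
  assumes "f \<in> L2_on a b" "g \<in> L2_on a b" "AE t in lebesgue_on {a<..<b}. f t = g t"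
  shows "L2_norm_sq a b f = L2_norm_sq a b g"
  unfolding L2_norm_sq_def
  by (rule integral_cong_AE) (use assms in \<open>auto simp: L2_on_def\<close>)

lemma L2_norm_sq_eq_0_iff:
  assumes "f \<in> L2_on a b"
  shows "L2_norm_sq a b f = 0 \<longleftrightarrow> (AE t in lebesgue_on {a<..<b}. f t = 0)"
  using assms unfolding L2_norm_sq_def L2_on_def
  by (simp add: integral_nonneg_eq_0_iff_AE)

lemma L2_norm_sq_le_const:
  assumes "f \<in> L2_on a b" "a \<le> b" "\<And>t. t \<in> {a..b} \<Longrightarrow> norm (f t) \<le> K"
  shows "L2_norm_sq a b f \<le> (b - a) * K\<^sup>2"
proof -
  have fm: "finite_measure (lebesgue_on {a<..<b})"
    by (rule finite_measure_lebesgue_on) simp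
  have "L2_norm_sq a b f \<le> integral\<^sup>L (lebesgue_on {a<..<b}) (\<lambda>t. K\<^sup>2)"
    unfolding L2_norm_sq_def
    by (rule integral_mono) (use assms fm in \<open>auto simp: L2_on_def finite_measure.integrable_const intro!: power_mono\<close>)
  also have "\<dots> = (b - a) * K\<^sup>2"
    using \<open>a \<le> b\<close> by (simp add: measure_restrict_space)
  finally show ?thesis .
qed

text \<open>
  Cauchy--Schwarz against the constant function: the variance of \<open>norm \<circ> f\<close> is non-negative.
\<close>

lemma integral_norm_le_L2_norm:
  assumes "f \<in> L2_on a b" "a < b"
  shows "integral {a..b} (\<lambda>t. norm (f t)) \<le> sqrt ((b - a) * L2_norm_sq a b f)"
proof -
  let ?M = "lebesgue_on {a<..<b}"
  have fm: "finite_measure ?M" by (rule finite_measure_lebesgue_on) simp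
  have fi: "integrable ?M f"
    using L2_on_imp_absolutely_integrable[OF assms(1)] by (simp add: integrable_lebesgue_on_interval_iff)
  define m where "m = integral\<^sup>L ?M (\<lambda>t. norm (f t))"
  have int: "integrable ?M (\<lambda>t. norm (f t))" using fi by simp
  have sq: "integrable ?M (\<lambda>t. (norm (f t))\<^sup>2)" using assms by (simp add: L2_on_def)
  have "integral {a..b} (\<lambda>t. norm (f t)) = m"
    unfolding m_def using int by (simp add: lebesgue_integral_eq_integral integral_open_interval_real)
  moreover have "m\<^sup>2 \<le> (b - a) * L2_norm_sq a b f"
  proof -
    define c where "c = m / (b - a)"
    have cm: "c * (b - a) = m" using assms(2) by (simp add: c_def)
    have "0 \<le> integral\<^sup>L ?M (\<lambda>t. (norm (f t) - c)\<^sup>2)" by simp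
    also have "(\<lambda>t. (norm (f t) - c)\<^sup>2) = (\<lambda>t. (norm (f t))\<^sup>2 - 2 * c * norm (f t) + c\<^sup>2)"
      by (auto simp: power2_diff algebra_simps)
    also have "integral\<^sup>L ?M \<dots> = L2_norm_sq a b f - 2 * c * m + c\<^sup>2 * (b - a)"
      using int sq fm assms(2)
      by (simp add: L2_norm_sq_def m_def finite_measure.integrable_const measure_restrict_space)
    finally have "0 \<le> (b - a) * (L2_norm_sq a b f - 2 * c * m + c\<^sup>2 * (b - a))"
      using assms(2) by simp
    also have "\<dots> = (b - a) * L2_norm_sq a b f - 2 * (c * (b - a)) * m + (c * (b - a))\<^sup>2"
      by (simp add: algebra_simps power2_eq_square)
    finally show ?thesis unfolding cm by (simp add: power2_eq_square)
  qed
  ultimately show ?thesis by (simp add: real_le_rsqrt)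
qed

lemma norm_integral_mult_le_L2_norm:
  assumes f: "f \<in> L2_on a b" and "a < b" "t \<in> {a..b}"
    and y: "continuous_on {a..t} y" "\<And>s. s \<in> {a..t} \<Longrightarrow> norm (y s) \<le> K"
  shows "norm (integral {a..t} (\<lambda>s. y s * f s)) \<le> K * sqrt ((b - a) * L2_norm_sq a b f)"
proof -
  have K: "0 \<le> K" using order_trans[OF norm_ge_zero y(2)[of a]] assms(3) by auto
  note fi = L2_on_imp_absolutely_integrable[OF f]
  have fi': "f absolutely_integrable_on {a..t}"
    using absolutely_integrable_subinterval[OF fi] assms(3) by auto
  have nf: "(\<lambda>s. norm (f s)) integrable_on {a..t}" "(\<lambda>s. norm (f s)) integrable_on {a..b}"
    using fi fi' by (auto simp: absolutely_integrable_on_def)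
  have "(\<lambda>s. y s * f s) integrable_on {a..t}"
    using absolutely_integrable_mult_continuous[OF fi' y(1)]
    by (auto simp: absolutely_integrable_on_def mult.commute)
  then have "norm (integral {a..t} (\<lambda>s. y s * f s)) \<le> integral {a..t} (\<lambda>s. K * norm (f s))"
    by (rule Henstock_Kurzweil_Integration.integral_norm_bound_integral)
       (use nf y(2) in \<open>auto simp: norm_mult intro!: mult_right_mono integrable_on_mult_right\<close>)
  also have "\<dots> = K * integral {a..t} (\<lambda>s. norm (f s))" by simp
  also have "\<dots> \<le> K * integral {a..b} (\<lambda>s. norm (f s))"
    by (rule mult_left_mono[OF integral_subset_le]) (use nf assms(3) K in auto)
  also have "\<dots> \<le> K * sqrt ((b - a) * L2_norm_sq a b f)"
    by (intro mult_left_mono integral_norm_le_L2_norm assms K)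
  finally show ?thesis .
qed

section \<open>Weak derivatives and absolutely continuous functions\<close>

lemma scaleR_complex: "r *\<^sub>R z = of_real r * z" for z :: complex
  by (simp add: scaleR_conv_of_real)

lemma C1_test_function_continuous:
  assumes "C1_test_function a b \<phi> \<phi>'"
  shows "continuous_on A \<phi>" "continuous_on A \<phi>'"
proof -
  show "continuous_on A \<phi>"
    using assms by (intro continuous_at_imp_continuous_on ballI DERIV_isCont)
      (auto simp: C1_test_function_def)
  show "continuous_on A \<phi>'"
    using assms by (auto simp: C1_test_function_def intro: continuous_on_subset)
qed

lemma C1_test_function_absolutely_integrable:
  fixes h :: "real \<Rightarrow> complex"
  assumes "C1_test_function a b \<phi> \<phi>'" "h absolutely_integrable_on {a..b}"
  shows "(\<lambda>t. \<phi> t *\<^sub>R h t) absolutely_integrable_on {a..b}"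
    "(\<lambda>t. \<phi>' t *\<^sub>R h t) absolutely_integrable_on {a..b}"
  using absolutely_integrable_mult_continuous[OF assms(2), of "\<lambda>t. of_real (\<phi> t)"]
    absolutely_integrable_mult_continuous[OF assms(2), of "\<lambda>t. of_real (\<phi>' t)"]
    C1_test_function_continuous[OF assms(1), of "{a..b}"]
  by (auto simp: scaleR_complex mult.commute intro!: continuous_on_of_real)

text \<open>
  Integration by parts with the test function as the smooth factor; it vanishes at both ends, so no
  boundary terms remain.
\<close>

lemma is_weak_deriv_primitive:
  assumes ab: "a < b" and g: "g absolutely_integrable_on {a..b}"
    and G: "\<And>t. t \<in> {a..b} \<Longrightarrow> G t = G a + integral {a..t} g"
  shows "is_weak_deriv a b G g"
  unfolding is_weak_deriv_def
proof (intro allI impI)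
  fix \<phi> \<phi>' assume test: "C1_test_function a b \<phi> \<phi>'"
  note cont = C1_test_function_continuous[OF test]
  have der: "((\<lambda>t. of_real (\<phi> t) :: complex) has_vector_derivative of_real (\<phi>' t)) (at t within A)" for t A
  proof -
    have "(\<phi> has_real_derivative \<phi>' t) (at t within A)"
      using test DERIV_subset[of \<phi> "\<phi>' t" t UNIV A] by (simp add: C1_test_function_def)
    then show ?thesis by (rule has_vector_derivative_of_real)
  qed
  have phi0: "\<phi> a = 0" "\<phi> b = 0"
    using test by (auto simp: C1_test_function_def)
  let ?G = "\<lambda>t. integral {a..t} g"
  have i1: "(\<lambda>t. \<phi> t *\<^sub>R g t) absolutely_integrable_on {a..b}"
    using C1_test_function_absolutely_integrable[OF test g] by simp
  have contG: "continuous_on {a..b} ?G"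
    using continuous_on_indefinite_integral[OF g, of 0] by simp
  have i2: "(\<lambda>t. \<phi>' t *\<^sub>R ?G t) absolutely_integrable_on {a..b}"
    by (intro absolutely_integrable_continuous_real continuous_intros cont contG)
  have i3: "((\<lambda>t. \<phi>' t *\<^sub>R G a) has_integral 0) {a..b}"
  proof -
    have "((\<lambda>t. of_real (\<phi>' t) :: complex) has_integral of_real (\<phi> b) - of_real (\<phi> a)) {a..b}"
      using ab by (intro fundamental_theorem_of_calculus der) auto
    from has_integral_mult_left[OF this, of "G a"] show ?thesis
      by (simp add: phi0 scaleR_complex)
  qed
  have z: "integral {a..b} (\<lambda>t. g t * of_real (\<phi> t) + ?G t * of_real (\<phi>' t)) = 0"
    using integral_by_parts_primitive[OF less_imp_le[OF ab] g, of "\<lambda>t. of_real (\<phi> t)" "\<lambda>t. of_real (\<phi>' t)"]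
      der cont by (auto simp: phi0 intro!: continuous_on_of_real)
  have "(\<lambda>t. g t * of_real (\<phi> t) + ?G t * of_real (\<phi>' t)) =
      (\<lambda>t. \<phi> t *\<^sub>R g t + \<phi>' t *\<^sub>R ?G t)"
    by (auto simp: scaleR_complex mult.commute)
  moreover have "integral {a..b} (\<lambda>t. \<phi> t *\<^sub>R g t + \<phi>' t *\<^sub>R ?G t) =
      integral {a..b} (\<lambda>t. \<phi> t *\<^sub>R g t) + integral {a..b} (\<lambda>t. \<phi>' t *\<^sub>R ?G t)"
    using i1 i2 by (intro Henstock_Kurzweil_Integration.integral_add)
       (auto simp: absolutely_integrable_on_def)
  ultimately have s: "integral {a..b} (\<lambda>t. \<phi> t *\<^sub>R g t) + integral {a..b} (\<lambda>t. \<phi>' t *\<^sub>R ?G t) = 0"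
    using z by simp
  have Gi: "(\<lambda>t. \<phi>' t *\<^sub>R G t) absolutely_integrable_on {a..b}"
  proof -
    have "continuous_on {a..b} G"
      by (rule continuous_on_eq[OF continuous_on_indefinite_integral[OF g, of "G a"]])
         (rule G[symmetric])
    then show ?thesis
      by (intro absolutely_integrable_continuous_real continuous_intros cont)
  qed
  have "integral {a..b} (\<lambda>t. \<phi>' t *\<^sub>R G t) = integral {a..b} (\<lambda>t. \<phi>' t *\<^sub>R G a + \<phi>' t *\<^sub>R ?G t)"
    by (rule Henstock_Kurzweil_Integration.integral_cong) (subst G, simp, simp only: scaleR_add_right)
  also have "\<dots> = integral {a..b} (\<lambda>t. \<phi>' t *\<^sub>R ?G t)"
    using i2 i3 by (subst Henstock_Kurzweil_Integration.integral_add)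
      (auto simp: absolutely_integrable_on_def integral_unique has_integral_integrable)
  also have "\<dots> = - integral {a..b} (\<lambda>t. \<phi> t *\<^sub>R g t)"
    using s by (simp add: eq_neg_iff_add_eq_0 add.commute)
  finally show "integral\<^sup>L (lebesgue_on {a<..<b}) (\<lambda>t. \<phi>' t *\<^sub>R G t) =
        - integral\<^sup>L (lebesgue_on {a<..<b}) (\<lambda>t. \<phi> t *\<^sub>R g t)"
    by (simp add: integral_lebesgue_on_interval Gi i1)
qed

lemma DERIV_max_0_squared: "((\<lambda>t. (max 0 t)\<^sup>2) has_real_derivative 2 * max 0 t) (at t)" for t :: real
proof -
  consider "t < 0" | "t > 0" | "t = 0" by linarith
  then show ?thesis
  proof cases
    case 1
    have "((\<lambda>_. 0) has_real_derivative 2 * max 0 t) (at t)" using 1 by simp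
    then show ?thesis
      by (rule has_field_derivative_transform_within_open[of _ _ _ "{..<0}"]) (use 1 in auto)
  next
    case 2
    have "((\<lambda>t. t\<^sup>2) has_real_derivative 2 * max 0 t) (at t)"
      using 2 by (auto intro!: derivative_eq_intros)
    then show ?thesis
      by (rule has_field_derivative_transform_within_open[of _ _ _ "{0<..}"]) (use 2 in auto)
  next
    case 3
    have "isCont (max (0::real)) 0" by (intro continuous_intros)
    then show ?thesis
      unfolding DERIV_caratheodory_within CARAT_DERIV
      using 3 by (intro exI[of _ "max 0"]) (auto simp: max_def power2_eq_square)
  qed
qed

text \<open>
  The square of the positive part is continuously differentiable, so a product of two of them is a test
  function that is positive exactly on \<open>]x, y[\<close>.
\<close>

definition bump :: "real \<Rightarrow> real \<Rightarrow> real \<Rightarrow> real" where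
  "bump x y t = (max 0 (t - x))\<^sup>2 * (max 0 (y - t))\<^sup>2"

definition bump' :: "real \<Rightarrow> real \<Rightarrow> real \<Rightarrow> real" where
  "bump' x y t = 2 * max 0 (t - x) * (max 0 (y - t))\<^sup>2 - (max 0 (t - x))\<^sup>2 * (2 * max 0 (y - t))"

lemma bump_nonneg: "0 \<le> bump x y t"
  by (simp add: bump_def)

lemma bump_pos_iff: "0 < bump x y t \<longleftrightarrow> x < t \<and> t < y"
  by (auto simp: bump_def max_def zero_less_mult_iff)

lemma C1_test_function_bump:
  assumes "a < x" "y < b"
  shows "C1_test_function a b (bump x y) (bump' x y)"
proof -
  have "(bump x y has_real_derivative bump' x y t) (at t)" for t
  proof -
    have 1: "((\<lambda>t. (max 0 (t - x))\<^sup>2) has_real_derivative 2 * max 0 (t - x)) (at t)"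
      using DERIV_chain2[where f = "\<lambda>t. (max 0 t)\<^sup>2" and g = "\<lambda>t. t - x" and x = t and s = UNIV,
          OF DERIV_max_0_squared[of "t - x"], of 1] DERIV_cmult_Id[of 1 t]
      by (simp add: DERIV_diff[where g = "\<lambda>_. x" and E = 0, simplified])
    have 2: "((\<lambda>t. (max 0 (y - t))\<^sup>2) has_real_derivative 2 * max 0 (y - t) * (-1)) (at t)"
      by (rule DERIV_chain2[where f = "\<lambda>t. (max 0 t)\<^sup>2" and g = "\<lambda>t. y - t", OF DERIV_max_0_squared[of "y - t"]])
         (auto intro!: derivative_eq_intros)
    from DERIV_mult[OF 1 2] show ?thesis
      by (simp add: bump_def[abs_def] bump'_def algebra_simps)
  qed
  moreover have "continuous_on UNIV (bump' x y)"
    unfolding bump'_def[abs_def] by (intro continuous_intros)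
  moreover have "bump x y t = 0" if "t \<notin> {x..y}" for t
    using that by (auto simp: bump_def max_def)
  ultimately show ?thesis using assms by (auto simp: C1_test_function_def)
qed

text \<open>The functions \<open>n p / (1 + n p)\<close> approximate the indicator function of the set where \<open>p > 0\<close>.\<close>

lemma C1_test_function_saturate:
  assumes p: "C1_test_function a b p p'" "\<And>t. 0 \<le> p t" and n: "0 \<le> n"
  shows "C1_test_function a b (\<lambda>t. n * p t / (1 + n * p t)) (\<lambda>t. n * p' t / (1 + n * p t)\<^sup>2)"
proof -
  have nz: "1 + n * p t \<noteq> 0" for t
    using p(2)[of t] n mult_nonneg_nonneg[of n "p t"] by linarith
  have "((\<lambda>t. n * p t / (1 + n * p t)) has_real_derivative n * p' t / (1 + n * p t)\<^sup>2) (at t)" for t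
  proof -
    have d: "(p has_real_derivative p' t) (at t)" using p(1) by (simp add: C1_test_function_def)
    show ?thesis
      using nz[of t] by (auto intro!: derivative_eq_intros d simp: power2_eq_square field_simps)
  qed
  moreover have "continuous_on UNIV (\<lambda>t. n * p' t / (1 + n * p t)\<^sup>2)"
    using nz by (intro continuous_intros C1_test_function_continuous[OF p(1)]) auto
  moreover obtain c d where "a < c" "d < b" "\<And>t. t \<notin> {c..d} \<Longrightarrow> p t = 0"
    using p(1) by (auto simp: C1_test_function_def)
  ultimately show ?thesis
    unfolding C1_test_function_def by (metis div_0 mult_zero_right)
qed

text \<open>
  The fundamental lemma of the calculus of variations: testing against smoothed indicator functions
  shows that all integrals of \<open>h\<close> over subintervals vanish, and intervals generate the Borel sets.
\<close>

lemma AE_zero_if_integral_test_zero: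
  fixes h :: "real \<Rightarrow> complex"
  assumes ab: "a < b" and h: "h absolutely_integrable_on {a..b}"
    and test: "\<And>\<phi> \<phi>'. C1_test_function a b \<phi> \<phi>' \<Longrightarrow> integral\<^sup>L (lebesgue_on {a<..<b}) (\<lambda>t. \<phi> t *\<^sub>R h t) = 0"
  shows "AE t in lebesgue_on {a<..<b}. h t = 0"
proof -
  have step1: "integral {x..y} h = 0" if xy: "a < x" "x \<le> y" "y < b" for x y
  proof -
    define \<phi> where "\<phi> n t = real n * bump x y t / (1 + real n * bump x y t)" for n t
    define g where "g t = (if t \<in> {x<..<y} then h t else 0)" for t
    have C1: "C1_test_function a b (\<phi> n) (\<lambda>t. real n * bump' x y t / (1 + real n * bump x y t)\<^sup>2)" for n
      unfolding \<phi>_def[abs_def]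
      by (intro C1_test_function_saturate C1_test_function_bump bump_nonneg) (use xy in auto)
    have i: "(\<lambda>t. \<phi> n t *\<^sub>R h t) absolutely_integrable_on {a..b}" for n
      by (rule C1_test_function_absolutely_integrable(1)[OF C1 h])
    have z: "integral {a..b} (\<lambda>t. \<phi> n t *\<^sub>R h t) = 0" for n
      using test[OF C1] integral_lebesgue_on_interval[OF i] by simp
    have "(\<lambda>n. integral {a..b} (\<lambda>t. \<phi> n t *\<^sub>R h t)) \<longlonglongrightarrow> integral {a..b} g"
    proof (rule dominated_convergence(2))
      show "(\<lambda>t. \<phi> n t *\<^sub>R h t) integrable_on {a..b}" for n
        using i[of n] by (simp add: absolutely_integrable_on_def)
      show "(\<lambda>t. norm (h t)) integrable_on {a..b}"
        using h by (simp add: absolutely_integrable_on_def)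
      show "norm (\<phi> n t *\<^sub>R h t) \<le> norm (h t)" for n t
      proof -
        have nb: "0 \<le> real n * bump x y t" by (simp add: bump_nonneg)
        then have "0 \<le> \<phi> n t" "\<phi> n t \<le> 1"
          unfolding \<phi>_def by (auto intro: divide_nonneg_nonneg divide_le_eq_1[THEN iffD2])
        then show ?thesis by (simp add: mult_left_le_one_le)
      qed
      show "(\<lambda>n. \<phi> n t *\<^sub>R h t) \<longlonglongrightarrow> g t" for t
      proof (cases "t \<in> {x<..<y}")
        case True
        then have p: "0 < bump x y t" by (simp add: bump_pos_iff)
        have "(\<lambda>n. 1 - 1 / (1 + real n * bump x y t)) \<longlonglongrightarrow> 1 - 0"
        proof (intro tendsto_intros)
          have "filterlim (\<lambda>n. 1 + real n * bump x y t) at_top sequentially"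
            by (intro filterlim_tendsto_add_at_top[OF tendsto_const]
                filterlim_at_top_mult_tendsto_pos[OF tendsto_const p] filterlim_real_sequentially)
          then show "(\<lambda>n. 1 / (1 + real n * bump x y t)) \<longlonglongrightarrow> 0"
            by (intro tendsto_divide_0[OF tendsto_const] filterlim_at_top_imp_at_infinity)
        qed
        moreover have "(\<lambda>n. 1 - 1 / (1 + real n * bump x y t)) = (\<lambda>n. \<phi> n t)"
        proof
          fix n
          have "0 \<le> real n * bump x y t" using p by simp
          then have "1 + real n * bump x y t \<noteq> 0" by linarith
          then show "1 - 1 / (1 + real n * bump x y t) = \<phi> n t"
            by (simp add: \<phi>_def field_simps)
        qed
        ultimately have "(\<lambda>n. \<phi> n t *\<^sub>R h t) \<longlonglongrightarrow> 1 *\<^sub>R h t"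
          by (intro tendsto_scaleR tendsto_const) simp
        then show ?thesis using True by (simp add: g_def)
      next
        case False
        then have "bump x y t = 0"
          using bump_pos_iff[of x y t] bump_nonneg[of x y t] by auto
        then show ?thesis using False unfolding g_def \<phi>_def by (simp only: if_False) simp
      qed
    qed
    then have "integral {a..b} g = 0"
      using z by (simp add: LIMSEQ_const_iff)
    moreover have "integral {a..b} g = integral ({a..b} \<inter> {x<..<y}) h"
      unfolding g_def using integral_restrict_Int[of "{a..b}" "{x<..<y}" h] by (simp add: Int_commute)
    moreover have "{a..b} \<inter> {x<..<y} = {x<..<y}" using xy by auto
    ultimately show ?thesis by (simp add: integral_open_interval_real)
  qed
  define H where "H t = integral {a..t} h" for t
  have hi: "h integrable_on {c..d}" if "a \<le> c" "d \<le> b" for c d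
    using absolutely_integrable_subinterval[OF h that] by (simp add: absolutely_integrable_on_def)
  have contH: "continuous_on {a..b} H"
    unfolding H_def using continuous_on_indefinite_integral[OF h, of 0] by simp
  define m where "m = (a + b) / 2"
  have m: "a < m" "m < b" using ab by (auto simp: m_def)
  have eqm: "H t = H m" if "t \<in> {a<..<b}" for t
  proof -
    have "H y = H x" if "a < x" "x \<le> y" "y < b" for x y
      using Henstock_Kurzweil_Integration.integral_combine[of a x y h] hi[of a y] that step1[of x y]
      by (simp add: H_def)
    from this[of t m] this[of m t] m that show ?thesis by fastforce
  qed
  have eqm': "H t = H m" if "t \<in> {a..b}" for t
    using continuous_constant_on_closure[of "{a<..<b}" H "H m" t] contH eqm that ab by simp
  have step2: "integral {a..t} h = 0" if "t \<le> b" for t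
  proof (cases "a \<le> t")
    case True
    then have "H t = H a" using eqm'[of t] eqm'[of a] that ab by simp
    then show ?thesis by (simp add: H_def)
  qed simp
  let ?h = "\<lambda>t. indicator {a..b} t *\<^sub>R h t"
  have int: "integrable lebesgue ?h"
    using h by (simp add: set_integrable_def)
  have borel: "set_lebesgue_integral lebesgue A ?h = 0" if "A \<in> sets borel" for A
  proof -
    have siA: "set_integrable lebesgue A ?h" if "A \<in> sets borel" for A
      unfolding set_integrable_def by (rule integrable_mult_indicator[OF _ int]) (use that in auto)
    have A: "A \<in> sigma_sets UNIV (range atMost)"
      using that unfolding borel_eq_atMost by (simp add: sets_measure_of_conv)
    have sb: "B \<in> sets borel" if "B \<in> sigma_sets UNIV (range atMost)" for B :: "real set"
      using that unfolding borel_eq_atMost by (simp add: sets_measure_of_conv)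
    have tot: "set_lebesgue_integral lebesgue {..x} ?h = 0" for x
    proof -
      have "set_lebesgue_integral lebesgue {..x} ?h = set_lebesgue_integral lebesgue {a..min x b} h"
        unfolding set_lebesgue_integral_def
        by (rule Bochner_Integration.integral_cong) (auto simp: indicator_def)
      also have "\<dots> = integral {a..min x b} h"
        by (intro set_lebesgue_integral_eq_integral absolutely_integrable_subinterval[OF h]) auto
      finally show ?thesis by (simp add: step2)
    qed
    have UN: "set_lebesgue_integral lebesgue UNIV ?h = 0"
    proof -
      have "set_lebesgue_integral lebesgue UNIV ?h = set_lebesgue_integral lebesgue {..b} ?h"
        unfolding set_lebesgue_integral_def
        by (rule Bochner_Integration.integral_cong) (auto simp: indicator_def)
      then show ?thesis by (simp add: tot)
    qed
    have pow: "range atMost \<subseteq> Pow (UNIV :: real set)" by simp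
    have "Int_stable (range (atMost :: real \<Rightarrow> real set))"
      by (auto simp: Int_stable_def intro!: image_eqI[of _ _ "min _ _"])
    then show ?thesis
      using pow A
    proof (induction rule: sigma_sets_induct_disjoint)
      case (basic A)
      then show ?case using tot by auto
    next
      case empty
      show ?case by (simp add: set_lebesgue_integral_def)
    next
      case (compl A)
      have "set_lebesgue_integral lebesgue (A \<union> (UNIV - A)) ?h =
          set_lebesgue_integral lebesgue A ?h + set_lebesgue_integral lebesgue (UNIV - A) ?h"
        by (rule set_integral_Un) (use sb[OF compl(1)] in \<open>auto intro!: siA\<close>)
      then show ?case using compl(2) UN by simp
    next
      case (union A)
      have Ai: "A i \<in> sets borel" for i using union(2) sb by blast
      have "set_lebesgue_integral lebesgue (\<Union>i. A i) ?h = (\<Sum>i. set_lebesgue_integral lebesgue (A i) ?h)"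
        by (rule lebesgue_integral_countable_add)
           (use union Ai in \<open>auto intro!: siA sets.countable_UN simp: disjoint_family_on_def\<close>)
      then show ?case using union(3) by simp
    qed
  qed
  interpret finite_measure "lebesgue_on {a<..<b}"
    by (rule finite_measure_lebesgue_on) simp
  show ?thesis
  proof (rule density_zero)
    show "integrable (lebesgue_on {a<..<b}) h"
      using h by (simp add: integrable_lebesgue_on_interval_iff)
    fix A assume "A \<in> sets (lebesgue_on {a<..<b})"
    then have A: "A \<in> sets lebesgue" "A \<subseteq> {a<..<b}"
      by (auto simp: sets_restrict_space)
    from A(1) obtain S N N' where S: "S \<in> sets lborel" "N' \<in> null_sets lborel" "N \<subseteq> N'" "A = S \<union> N"
      by (rule sets_completionE)
    have N': "AE t in lebesgue. t \<notin> N'"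
      using S(2) by (intro AE_not_in null_sets_completionI)
    have "set_lebesgue_integral (lebesgue_on {a<..<b}) A h = set_lebesgue_integral lebesgue A ?h"
      unfolding set_lebesgue_integral_def using A(2)
      by (subst integral_restrict_space)
         (auto intro!: Bochner_Integration.integral_cong simp: indicator_def)
    also have "\<dots> = set_lebesgue_integral lebesgue S ?h"
      unfolding set_lebesgue_integral_def
    proof (rule integral_cong_AE)
      show "(\<lambda>t. indicat_real A t *\<^sub>R ?h t) \<in> borel_measurable lebesgue"
        using integrable_mult_indicator[OF A(1) int] by (rule borel_measurable_integrable)
      show "(\<lambda>t. indicat_real S t *\<^sub>R ?h t) \<in> borel_measurable lebesgue"
        using integrable_mult_indicator[OF _ int, of S] S(1) by (intro borel_measurable_integrable) auto
      show "AE t in lebesgue. indicat_real A t *\<^sub>R ?h t = indicat_real S t *\<^sub>R ?h t"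
        using N' by eventually_elim (use S in \<open>auto simp: indicator_def\<close>)
    qed
    also have "\<dots> = 0" using borel S(1) by simp
    finally show "set_lebesgue_integral (lebesgue_on {a<..<b}) A h = 0" .
  qed
qed

lemma C1_test_function_scale:
  assumes "C1_test_function a b \<phi> \<phi>'"
  shows "C1_test_function a b (\<lambda>t. c * \<phi> t) (\<lambda>t. c * \<phi>' t)"
  using assms unfolding C1_test_function_def
  by (auto intro!: DERIV_cmult continuous_intros)

text \<open>
  A function with vanishing weak derivative is constant: subtracting from a test function a multiple
  of a fixed one with integral one makes it the derivative of a test function.
\<close>

lemma AE_constant_if_weak_deriv_zero:
  fixes w :: "real \<Rightarrow> complex"
  assumes ab: "a < b" and w: "w absolutely_integrable_on {a..b}"
    and weak: "is_weak_deriv a b w (\<lambda>_. 0)"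
  shows "\<exists>k. AE t in lebesgue_on {a<..<b}. w t = k"
proof -
  define x where "x = (2 * a + b) / 3"
  define y where "y = (a + 2 * b) / 3"
  have xy: "a < x" "x < y" "y < b" using ab by (auto simp: x_def y_def)
  have bump: "C1_test_function a b (bump x y) (bump' x y)"
    using xy by (intro C1_test_function_bump)
  have bi: "bump x y integrable_on {a..b}"
    by (intro integrable_continuous_real C1_test_function_continuous[OF bump])
  have "integral {a..b} (bump x y) > 0"
  proof (rule ccontr)
    assume "\<not> ?thesis"
    moreover have "0 \<le> integral {a..b} (bump x y)"
      using bi bump_nonneg by (intro Henstock_Kurzweil_Integration.integral_nonneg) auto
    ultimately have "integral {a..b} (bump x y) = 0" by simp
    then have "bump x y ((x + y) / 2) = 0"
      using integral_eq_0_iff[of a b "bump x y"] xy ab bump_nonneg C1_test_function_continuous[OF bump]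
      by auto
    moreover have "bump x y ((x + y) / 2) > 0"
      using xy by (simp add: bump_pos_iff)
    ultimately show False by simp
  qed
  define \<rho> where "\<rho> = (\<lambda>t. (1 / integral {a..b} (bump x y)) * bump x y t)"
  obtain \<rho>' where \<rho>: "C1_test_function a b \<rho> \<rho>'"
    using C1_test_function_scale[OF bump, of "1 / integral {a..b} (bump x y)"] unfolding \<rho>_def by blast
  have \<rho>1: "integral {a..b} \<rho> = 1"
    using \<open>integral {a..b} (bump x y) > 0\<close> by (simp add: \<rho>_def)
  define k where "k = integral {a..b} (\<lambda>t. \<rho> t *\<^sub>R w t)"
  have wk: "(\<lambda>t. w t - k) absolutely_integrable_on {a..b}"
    by (intro set_integral_diff(1) w absolutely_integrable_continuous_real continuous_intros)
  have "AE t in lebesgue_on {a<..<b}. w t - k = 0"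
  proof (rule AE_zero_if_integral_test_zero[OF ab wk])
    fix \<eta> \<eta>' assume \<eta>: "C1_test_function a b \<eta> \<eta>'"
    define I where "I = integral {a..b} \<eta>"
    define \<xi> where "\<xi> = (\<lambda>t. \<eta> t - I * \<rho> t)"
    obtain c d where cd: "a < c" "d < b" "\<And>t. t \<notin> {c..d} \<Longrightarrow> \<xi> t = 0"
    proof -
      obtain c1 d1 where 1: "a < c1" "d1 < b" "\<And>t. t \<notin> {c1..d1} \<Longrightarrow> \<eta> t = 0"
        using \<eta> by (auto simp: C1_test_function_def)
      obtain c2 d2 where 2: "a < c2" "d2 < b" "\<And>t. t \<notin> {c2..d2} \<Longrightarrow> \<rho> t = 0"
        using \<rho> by (auto simp: C1_test_function_def)
      show ?thesis
      proof (rule that[of "min c1 c2" "max d1 d2"])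
        fix t assume "t \<notin> {min c1 c2..max d1 d2}"
        then have "t \<notin> {c1..d1}" "t \<notin> {c2..d2}" by auto
        then show "\<xi> t = 0" using 1(3) 2(3) by (simp add: \<xi>_def)
      qed (use 1 2 in auto)
    qed
    have cont: "continuous_on A \<xi>" for A
      unfolding \<xi>_def
      by (intro continuous_intros C1_test_function_continuous[OF \<eta>] C1_test_function_continuous[OF \<rho>])
    have int: "\<xi> integrable_on {u..v}" for u v
      by (intro integrable_continuous_real cont)
    have \<xi>0: "integral {a..b} \<xi> = 0"
    proof -
      have "integral {a..b} \<xi> = integral {a..b} \<eta> - integral {a..b} (\<lambda>t. I * \<rho> t)"
        unfolding \<xi>_def
        by (intro Henstock_Kurzweil_Integration.integral_diff integrable_continuous_real continuous_intros
            C1_test_function_continuous[OF \<eta>] C1_test_function_continuous[OF \<rho>])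
      then show ?thesis by (simp add: \<rho>1 I_def)
    qed
    define \<phi> where "\<phi> t = integral {a..t} \<xi>" for t
    have zero: "integral {u..v} \<xi> = 0" if "v \<le> c \<or> d \<le> u" for u v
    proof -
      have "integral {u..v} \<xi> = integral {u..v} (\<lambda>_. 0)"
      proof (rule integral_spike[of "{c, d}"])
        show "0 = \<xi> t" if "t \<in> {u..v} - {c, d}" for t
          using cd(3)[of t] that \<open>v \<le> c \<or> d \<le> u\<close> by fastforce
      qed auto
      then show ?thesis by simp
    qed
    have out: "\<phi> t = 0" if "t \<notin> {c..d}" for t
    proof (cases "t < c")
      case True then show ?thesis by (simp add: \<phi>_def zero)
    next
      case False
      then have t: "d < t" "c \<le> t" using that by auto
      show ?thesis
      proof (cases "t \<le> b")
        case True
        then have "integral {a..t} \<xi> + integral {t..b} \<xi> = integral {a..b} \<xi>"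
          using t cd by (intro Henstock_Kurzweil_Integration.integral_combine int) auto
        then show ?thesis using t by (simp add: \<phi>_def zero \<xi>0)
      next
        case False
        then have "integral {a..b} \<xi> + integral {b..t} \<xi> = integral {a..t} \<xi>"
          using ab by (intro Henstock_Kurzweil_Integration.integral_combine int) auto
        then show ?thesis using cd by (simp add: \<phi>_def zero \<xi>0)
      qed
    qed
    have "(\<phi> has_real_derivative \<xi> t) (at t)" for t
    proof (cases "t < c")
      case True
      have "((\<lambda>_. 0) has_real_derivative \<xi> t) (at t)" using True cd(3)[of t] by simp
      then show ?thesis
        by (rule has_field_derivative_transform_within_open[of _ _ _ "{..<c}"])
           (use True in \<open>auto simp: out\<close>)
    next
      case False
      have "(\<phi> has_real_derivative \<xi> t) (at t within {a..t+1})"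
        unfolding \<phi>_def
        by (intro integral_has_real_derivative cont) (use False cd in auto)
      moreover have "t \<in> interior {a..t+1}" using False cd(1) by simp
      ultimately show ?thesis using at_within_interior[of t "{a..t+1}"] by simp
    qed
    then have test: "C1_test_function a b \<phi> \<xi>"
      unfolding C1_test_function_def using cont[of UNIV]
      by (intro conjI allI exI[of _ c] exI[of _ d]) (use out cd(1,2) in auto)
    have i\<eta>: "(\<lambda>t. \<eta> t *\<^sub>R w t) absolutely_integrable_on {a..b}"
      and i\<rho>: "(\<lambda>t. \<rho> t *\<^sub>R w t) absolutely_integrable_on {a..b}"
      and i\<xi>: "(\<lambda>t. \<xi> t *\<^sub>R w t) absolutely_integrable_on {a..b}"
      and i\<eta>k: "(\<lambda>t. \<eta> t *\<^sub>R (w t - k)) absolutely_integrable_on {a..b}"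
      using C1_test_function_absolutely_integrable(1)[OF \<eta> w] C1_test_function_absolutely_integrable(1)[OF \<rho> w]
        C1_test_function_absolutely_integrable(2)[OF test w] C1_test_function_absolutely_integrable(1)[OF \<eta> wk]
      by blast+
    have "integral\<^sup>L (lebesgue_on {a<..<b}) (\<lambda>t. \<xi> t *\<^sub>R w t) = 0"
      using weak test unfolding is_weak_deriv_def by simp
    then have "0 = integral {a..b} (\<lambda>t. \<xi> t *\<^sub>R w t)"
      using integral_lebesgue_on_interval[OF i\<xi>] by simp
    also have "\<dots> = integral {a..b} (\<lambda>t. \<eta> t *\<^sub>R w t - I *\<^sub>R (\<rho> t *\<^sub>R w t))"
      by (simp add: \<xi>_def scaleR_diff_left)
    also have "\<dots> = integral {a..b} (\<lambda>t. \<eta> t *\<^sub>R w t) - I *\<^sub>R k"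
      unfolding k_def using i\<eta> i\<rho>
      by (intro integral_unique has_integral_diff has_integral_cmul integrable_integral)
         (simp_all only: absolutely_integrable_on_def)
    also have "\<dots> = integral {a..b} (\<lambda>t. \<eta> t *\<^sub>R (w t - k))"
    proof -
      have "((\<lambda>t. \<eta> t *\<^sub>R k) has_integral I *\<^sub>R k) {a..b}"
        unfolding I_def
        by (intro has_integral_scaleR_left integrable_integral integrable_continuous_real
            C1_test_function_continuous[OF \<eta>])
      moreover have "((\<lambda>t. \<eta> t *\<^sub>R w t) has_integral integral {a..b} (\<lambda>t. \<eta> t *\<^sub>R w t)) {a..b}"
        using i\<eta> by (simp add: absolutely_integrable_on_def integrable_integral)
      ultimately have "((\<lambda>t. \<eta> t *\<^sub>R w t - \<eta> t *\<^sub>R k) has_integral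
          (integral {a..b} (\<lambda>t. \<eta> t *\<^sub>R w t) - I *\<^sub>R k)) {a..b}"
        by (rule has_integral_diff[rotated])
      then show ?thesis by (simp add: scaleR_diff_right integral_unique)
    qed
    finally show "integral\<^sup>L (lebesgue_on {a<..<b}) (\<lambda>t. \<eta> t *\<^sub>R (w t - k)) = 0"
      by (simp add: integral_lebesgue_on_interval[OF i\<eta>k])
  qed
  then show ?thesis by auto
qed

lemma integral_test_cong_AE:
  assumes "f absolutely_integrable_on {a..b}" "g absolutely_integrable_on {a..b}"
    and "AE t in lebesgue_on {a<..<b}. f t = g t" and "C1_test_function a b \<phi> \<phi>'"
  shows "integral\<^sup>L (lebesgue_on {a<..<b}) (\<lambda>t. \<phi> t *\<^sub>R f t) = integral\<^sup>L (lebesgue_on {a<..<b}) (\<lambda>t. \<phi> t *\<^sub>R g t)"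
    "integral\<^sup>L (lebesgue_on {a<..<b}) (\<lambda>t. \<phi>' t *\<^sub>R f t) = integral\<^sup>L (lebesgue_on {a<..<b}) (\<lambda>t. \<phi>' t *\<^sub>R (g t :: complex))"
proof -
  note i = C1_test_function_absolutely_integrable[OF assms(4) assms(1), folded integrable_lebesgue_on_interval_iff]
    C1_test_function_absolutely_integrable[OF assms(4) assms(2), folded integrable_lebesgue_on_interval_iff]
  show "integral\<^sup>L (lebesgue_on {a<..<b}) (\<lambda>t. \<phi> t *\<^sub>R f t) = integral\<^sup>L (lebesgue_on {a<..<b}) (\<lambda>t. \<phi> t *\<^sub>R g t)"
    by (rule integral_cong_AE) (use i assms(3) in \<open>auto intro: borel_measurable_integrable\<close>)
  show "integral\<^sup>L (lebesgue_on {a<..<b}) (\<lambda>t. \<phi>' t *\<^sub>R f t) = integral\<^sup>L (lebesgue_on {a<..<b}) (\<lambda>t. \<phi>' t *\<^sub>R g t)"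
    by (rule integral_cong_AE) (use i assms(3) in \<open>auto intro: borel_measurable_integrable\<close>)
qed

lemma is_weak_deriv_cong_AE:
  assumes "is_weak_deriv a b f g"
    and "f absolutely_integrable_on {a..b}" "f' absolutely_integrable_on {a..b}"
    and "g absolutely_integrable_on {a..b}" "g' absolutely_integrable_on {a..b}"
    and "AE t in lebesgue_on {a<..<b}. f t = f' t" "AE t in lebesgue_on {a<..<b}. g t = g' t"
  shows "is_weak_deriv a b f' g'"
  unfolding is_weak_deriv_def
proof (intro allI impI)
  fix \<phi> \<phi>' assume t: "C1_test_function a b \<phi> \<phi>'"
  show "integral\<^sup>L (lebesgue_on {a<..<b}) (\<lambda>t. \<phi>' t *\<^sub>R f' t) = - integral\<^sup>L (lebesgue_on {a<..<b}) (\<lambda>t. \<phi> t *\<^sub>R g' t)"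
    using assms(1) t integral_test_cong_AE(2)[OF assms(2,3,6) t] integral_test_cong_AE(1)[OF assms(4,5,7) t]
    unfolding is_weak_deriv_def by simp
qed

lemma integral_test_diff:
  assumes "f absolutely_integrable_on {a..b}" "g absolutely_integrable_on {a..b}"
    and "C1_test_function a b \<phi> \<phi>'"
  shows "integral\<^sup>L (lebesgue_on {a<..<b}) (\<lambda>t. \<phi> t *\<^sub>R (f t - g t)) =
      integral\<^sup>L (lebesgue_on {a<..<b}) (\<lambda>t. \<phi> t *\<^sub>R f t) - integral\<^sup>L (lebesgue_on {a<..<b}) (\<lambda>t. \<phi> t *\<^sub>R g t)"
    "integral\<^sup>L (lebesgue_on {a<..<b}) (\<lambda>t. \<phi>' t *\<^sub>R (f t - g t)) =
      integral\<^sup>L (lebesgue_on {a<..<b}) (\<lambda>t. \<phi>' t *\<^sub>R f t) - integral\<^sup>L (lebesgue_on {a<..<b}) (\<lambda>t. \<phi>' t *\<^sub>R (g t :: complex))"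
proof -
  note i = C1_test_function_absolutely_integrable[OF assms(3) assms(1), folded integrable_lebesgue_on_interval_iff]
    C1_test_function_absolutely_integrable[OF assms(3) assms(2), folded integrable_lebesgue_on_interval_iff]
  show "integral\<^sup>L (lebesgue_on {a<..<b}) (\<lambda>t. \<phi> t *\<^sub>R (f t - g t)) =
      integral\<^sup>L (lebesgue_on {a<..<b}) (\<lambda>t. \<phi> t *\<^sub>R f t) - integral\<^sup>L (lebesgue_on {a<..<b}) (\<lambda>t. \<phi> t *\<^sub>R g t)"
    unfolding scaleR_diff_right by (rule Bochner_Integration.integral_diff) (rule i)+
  show "integral\<^sup>L (lebesgue_on {a<..<b}) (\<lambda>t. \<phi>' t *\<^sub>R (f t - g t)) =
      integral\<^sup>L (lebesgue_on {a<..<b}) (\<lambda>t. \<phi>' t *\<^sub>R f t) - integral\<^sup>L (lebesgue_on {a<..<b}) (\<lambda>t. \<phi>' t *\<^sub>R g t)"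
    unfolding scaleR_diff_right by (rule Bochner_Integration.integral_diff) (rule i)+
qed

lemma AE_weak_deriv_unique:
  assumes "a < b" "is_weak_deriv a b f g" "is_weak_deriv a b f g'"
    and g: "g absolutely_integrable_on {a..b}" "g' absolutely_integrable_on {a..b}"
  shows "AE t in lebesgue_on {a<..<b}. g t = g' t"
proof -
  have "AE t in lebesgue_on {a<..<b}. g t - g' t = 0"
  proof (rule AE_zero_if_integral_test_zero[OF assms(1) set_integral_diff(1)[OF g]])
    fix \<phi> \<phi>' assume t: "C1_test_function a b \<phi> \<phi>'"
    show "integral\<^sup>L (lebesgue_on {a<..<b}) (\<lambda>t. \<phi> t *\<^sub>R (g t - g' t)) = 0"
    proof -
      let ?I = "\<lambda>f. integral\<^sup>L (lebesgue_on {a<..<b}) f"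
      have "- ?I (\<lambda>t. \<phi> t *\<^sub>R g t) = ?I (\<lambda>t. \<phi>' t *\<^sub>R f t)"
        using assms(2) t by (simp add: is_weak_deriv_def)
      also have "\<dots> = - ?I (\<lambda>t. \<phi> t *\<^sub>R g' t)"
        using assms(3) t by (simp add: is_weak_deriv_def)
      finally show ?thesis unfolding integral_test_diff(1)[OF g t] by simp
    qed
  qed
  then show ?thesis by simp
qed

text \<open>
  The difference of \<open>f\<close> and a primitive of \<open>g\<close> has vanishing weak derivative.
\<close>

lemma AE_eq_primitive_of_weak_deriv:
  assumes ab: "a < b" and weak: "is_weak_deriv a b f g"
    and f: "f absolutely_integrable_on {a..b}" and g: "g absolutely_integrable_on {a..b}"
  shows "\<exists>k. AE t in lebesgue_on {a<..<b}. f t = k + integral {a..t} g"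
proof -
  define G where "G t = integral {a..t} g" for t
  have G: "is_weak_deriv a b G g"
    by (rule is_weak_deriv_primitive[OF ab g]) (simp add: G_def)
  have Gi: "G absolutely_integrable_on {a..b}"
    unfolding G_def using continuous_on_indefinite_integral[OF g, of 0]
    by (intro absolutely_integrable_continuous_real) simp
  have "is_weak_deriv a b (\<lambda>t. f t - G t) (\<lambda>_. 0)"
    unfolding is_weak_deriv_def
  proof (intro allI impI)
    fix \<phi> \<phi>' assume t: "C1_test_function a b \<phi> \<phi>'"
    show "integral\<^sup>L (lebesgue_on {a<..<b}) (\<lambda>t. \<phi>' t *\<^sub>R (f t - G t)) =
        - integral\<^sup>L (lebesgue_on {a<..<b}) (\<lambda>t. \<phi> t *\<^sub>R 0)"
      using weak G t unfolding integral_test_diff(2)[OF f Gi t] is_weak_deriv_def by simp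
  qed
  from AE_constant_if_weak_deriv_zero[OF ab set_integral_diff(1)[OF f Gi] this]
  obtain k where "AE t in lebesgue_on {a<..<b}. f t - G t = k" by blast
  then have "AE t in lebesgue_on {a<..<b}. f t = k + integral {a..t} g"
    by eventually_elim (auto simp: G_def algebra_simps)
  then show ?thesis by blast
qed

lemma eq_if_AE_eq_continuous:
  fixes f g :: "real \<Rightarrow> complex"
  assumes ab: "a < b" and "continuous_on {a..b} f" "continuous_on {a..b} g"
    and ae: "AE t in lebesgue_on {a<..<b}. f t = g t" and t: "t \<in> {a..b}"
  shows "f t = g t"
proof -
  obtain N where N: "negligible N" "\<forall>t\<in>{a..b} - N. f t = g t"
    using ae unfolding AE_lebesgue_on_interval_iff by blast
  have "{a..b} \<subseteq> closure ({a..b} - N)"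
  proof
    fix x assume x: "x \<in> {a..b}"
    show "x \<in> closure ({a..b} - N)"
      unfolding closure_approachable
    proof (intro allI impI)
      fix e :: real assume e: "e > 0"
      have "max a (x - e) < min b (x + e)" using x e ab by (auto simp: max_def min_def)
      then have "{max a (x - e)<..<min b (x + e)} \<noteq> {}"
        by (metis greaterThanLessThan_empty_iff not_le)
      then have "\<not> negligible {max a (x - e)<..<min b (x + e)}"
        by (intro open_not_negligible) auto
      then have "\<not> {max a (x - e)<..<min b (x + e)} \<subseteq> N"
        using N(1) negligible_subset by blast
      then obtain y where "y \<in> {max a (x - e)<..<min b (x + e)}" "y \<notin> N" by blast
      then show "\<exists>y\<in>{a..b} - N. dist y x < e"
        by (intro bexI[of _ y]) (auto simp: dist_real_def)
    qed
  qed
  moreover have "closure ({a..b} - N) \<subseteq> {a..b}"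
    by (rule closure_minimal) auto
  ultimately have cl: "closure ({a..b} - N) = {a..b}" by blast
  have "(\<lambda>t. f t - g t) t = 0"
    by (rule continuous_constant_on_closure[of "{a..b} - N"])
       (use cl assms(2,3) t N in \<open>auto intro!: continuous_intros\<close>)
  then show ?thesis by simp
qed

section \<open>Second-order Sobolev functions on an interval\<close>

text \<open>
  The classical description: \<open>u1\<close> is the continuous derivative of \<open>u\<close>, and is itself a primitive of
  the square-integrable function \<open>u2\<close>.
\<close>

definition H2_data :: "real \<Rightarrow> real \<Rightarrow> (real \<Rightarrow> complex) \<Rightarrow> (real \<Rightarrow> complex) \<Rightarrow> (real \<Rightarrow> complex) \<Rightarrow> bool" where
  "H2_data a b u u1 u2 \<longleftrightarrow>
     (\<forall>t\<in>{a..b}. u t = u a + integral {a..t} u1) \<and>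
     (\<forall>t\<in>{a..b}. u1 t = u1 a + integral {a..t} u2) \<and> u2 \<in> L2_on a b"

lemma H2_dataD:
  assumes "H2_data a b u u1 u2"
  shows "t \<in> {a..b} \<Longrightarrow> u t = u a + integral {a..t} u1"
    "t \<in> {a..b} \<Longrightarrow> u1 t = u1 a + integral {a..t} u2" "u2 \<in> L2_on a b"
  using assms unfolding H2_data_def by blast+

lemma H2_data_continuous:
  assumes "H2_data a b u u1 u2"
  shows "continuous_on {a..b} u" "continuous_on {a..b} u1"
proof -
  have "u2 absolutely_integrable_on {a..b}"
    using H2_dataD(3)[OF assms] by (rule L2_on_imp_absolutely_integrable)
  then show u1: "continuous_on {a..b} u1"
    by (rule continuous_on_eq[OF continuous_on_indefinite_integral[where k = "u1 a"]])
       (rule H2_dataD(2)[OF assms, symmetric])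
  show "continuous_on {a..b} u"
    by (rule continuous_on_eq[OF continuous_on_indefinite_integral[where k = "u a"]])
       (rule absolutely_integrable_continuous_real[OF u1], rule H2_dataD(1)[OF assms, symmetric])
qed

lemma H2_data_has_vector_derivative:
  assumes "H2_data a b u u1 u2" "t \<in> {a..b}"
  shows "(u has_vector_derivative u1 t) (at t within {a..b})"
proof -
  have "((\<lambda>t. u a + integral {a..t} u1) has_vector_derivative 0 + u1 t) (at t within {a..b})"
    using assms(2) H2_data_continuous(2)[OF assms(1)]
    by (intro has_vector_derivative_add integral_has_vector_derivative) auto
  then have "((\<lambda>t. u a + integral {a..t} u1) has_vector_derivative u1 t) (at t within {a..b})" by simp
  then show ?thesis
    by (intro has_vector_derivative_transform[OF assms(2) H2_dataD(1)[OF assms(1)]])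
qed

text \<open>
  The choice operator in \<open>weak_deriv\<close> picks some representative; uniqueness of weak derivatives compares
  it with any explicitly given one.
\<close>

lemma weak_deriv_AE:
  assumes "a < b" "g \<in> L2_on a b" "is_weak_deriv a b f g"
  shows "weak_deriv a b f \<in> L2_on a b" "is_weak_deriv a b f (weak_deriv a b f)"
    "AE t in lebesgue_on {a<..<b}. weak_deriv a b f t = g t"
proof -
  have *: "weak_deriv a b f \<in> L2_on a b \<and> is_weak_deriv a b f (weak_deriv a b f)"
    unfolding weak_deriv_def by (rule someI[of _ g]) (use assms in auto)
  then show "weak_deriv a b f \<in> L2_on a b" "is_weak_deriv a b f (weak_deriv a b f)" by auto
  with assms show "AE t in lebesgue_on {a<..<b}. weak_deriv a b f t = g t"
    by (intro AE_weak_deriv_unique) (auto intro: L2_on_imp_absolutely_integrable)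
qed

lemma H2_data_imp_H2_on:
  assumes ab: "a < b" and u: "H2_data a b u u1 u2"
  shows "u \<in> H2_on a b"
    and "AE t in lebesgue_on {a<..<b}. weak_deriv a b (weak_deriv a b u) t = u2 t"
    and "H2_norm_sq a b u = L2_norm_sq a b u + L2_norm_sq a b u1 + L2_norm_sq a b u2"
proof -
  note cont = H2_data_continuous[OF u]
  note L2 = cont[THEN L2_on_continuous]
  note u2 = H2_dataD(3)[OF u]
  note ai = L2[THEN L2_on_imp_absolutely_integrable] u2[THEN L2_on_imp_absolutely_integrable]
  have w1: "is_weak_deriv a b u u1"
    by (rule is_weak_deriv_primitive[OF ab ai(2) H2_dataD(1)[OF u]])
  have w2: "is_weak_deriv a b u1 u2"
    by (rule is_weak_deriv_primitive[OF ab ai(3) H2_dataD(2)[OF u]])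
  note d1 = weak_deriv_AE[OF ab L2(2) w1]
  have w2': "is_weak_deriv a b (weak_deriv a b u) u2"
    by (rule is_weak_deriv_cong_AE[OF w2])
       (use d1 ai in \<open>auto intro: L2_on_imp_absolutely_integrable elim: eventually_mono\<close>)
  note d2 = weak_deriv_AE[OF ab u2 w2']
  show "u \<in> H2_on a b"
    using L2 u2 w1 w2' d1 by (auto simp: H2_on_def H1_on_def)
  show "AE t in lebesgue_on {a<..<b}. weak_deriv a b (weak_deriv a b u) t = u2 t" by (rule d2)
  show "H2_norm_sq a b u = L2_norm_sq a b u + L2_norm_sq a b u1 + L2_norm_sq a b u2"
    unfolding H2_norm_sq_def
    using L2_norm_sq_cong[OF d1(1) L2(2) d1(3)] L2_norm_sq_cong[OF d2(1) u2 d2(3)] by simp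
qed

text \<open>
  Applying the primitive representation to the weak derivative and then to \<open>u\<close> itself; for the
  continuous function \<open>u\<close> equality almost everywhere is equality.
\<close>

lemma H2_on_imp_H2_data:
  assumes ab: "a < b" and cont: "continuous_on {a..b} u" and u: "u \<in> H2_on a b"
  shows "\<exists>u1. H2_data a b u u1 (weak_deriv a b (weak_deriv a b u))"
proof -
  define g1 where "g1 = weak_deriv a b u"
  define g2 where "g2 = weak_deriv a b g1"
  obtain h1 where h1: "u \<in> L2_on a b" "h1 \<in> L2_on a b" "is_weak_deriv a b u h1"
    using u by (auto simp: H2_on_def H1_on_def)
  obtain h2 where h2: "h2 \<in> L2_on a b" "is_weak_deriv a b g1 h2"
    using u by (auto simp: H2_on_def H1_on_def g1_def)
  note d1 = weak_deriv_AE[OF ab h1(2,3), folded g1_def]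
  note d2 = weak_deriv_AE[OF ab h2, folded g2_def]
  note ai = h1(1)[THEN L2_on_imp_absolutely_integrable] d1(1)[THEN L2_on_imp_absolutely_integrable]
    d2(1)[THEN L2_on_imp_absolutely_integrable]
  obtain k where k: "AE t in lebesgue_on {a<..<b}. g1 t = k + integral {a..t} g2"
    using AE_eq_primitive_of_weak_deriv[OF ab d2(2) ai(2,3)] by blast
  define u1 where "u1 t = k + integral {a..t} g2" for t
  have u1: "continuous_on {a..b} u1"
    unfolding u1_def by (rule continuous_on_indefinite_integral[OF ai(3)])
  note u1i = absolutely_integrable_continuous_real[OF u1]
  have "is_weak_deriv a b u u1"
    by (rule is_weak_deriv_cong_AE[OF d1(2) ai(1) ai(1) ai(2) u1i]) (use k in \<open>auto simp: u1_def\<close>)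
  from AE_eq_primitive_of_weak_deriv[OF ab this ai(1) u1i]
  obtain l where l: "AE t in lebesgue_on {a<..<b}. u t = l + integral {a..t} u1" by blast
  have eq: "u t = l + integral {a..t} u1" if "t \<in> {a..b}" for t
    by (rule eq_if_AE_eq_continuous[OF ab cont continuous_on_indefinite_integral[OF u1i] l that])
  have "u a = l" using eq[of a] ab by simp
  moreover have "u1 a = k" by (simp add: u1_def)
  ultimately have "H2_data a b u u1 g2"
    unfolding H2_data_def by (intro conjI ballI) (simp_all only: eq d2(1) u1_def)
  then show ?thesis by (auto simp: g1_def g2_def)
qed

section \<open>Solutions of the Helmholtz equation on an interval\<close>

text \<open>
  The solutions of \<open>- u'' = z * u\<close> with initial values \<open>(1, 0)\<close> and \<open>(0, 1)\<close>; both are independent of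
  the choice of the square root of \<open>z\<close>.
\<close>

definition cosz :: "complex \<Rightarrow> real \<Rightarrow> complex" where
  "cosz z t = cos (csqrt z * of_real t)"

definition sinz :: "complex \<Rightarrow> real \<Rightarrow> complex" where
  "sinz z t = (if z = 0 then of_real t else sin (csqrt z * of_real t) / csqrt z)"

lemma cosz_0 [simp]: "cosz z 0 = 1" and sinz_0 [simp]: "sinz z 0 = 0"
  by (auto simp: cosz_def sinz_def)

lemma csqrt_sq [simp]: "csqrt z * csqrt z = z"
  by (metis power2_csqrt power2_eq_square)

lemma z_mult_sinz: "z * sinz z t = csqrt z * sin (csqrt z * of_real t)"
proof (cases "z = 0")
  case False
  then have "z * sinz z t = (csqrt z * csqrt z) * (sin (csqrt z * of_real t) / csqrt z)"
    by (simp add: sinz_def)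
  also have "\<dots> = csqrt z * sin (csqrt z * of_real t)"
    using False by (simp del: csqrt_sq)
  finally show ?thesis .
qed (simp add: sinz_def)

lemma has_vector_derivative_cosz: "(cosz z has_vector_derivative - z * sinz z t) (at t within A)"
proof -
  have "((\<lambda>w. cos (csqrt z * w)) has_field_derivative - (csqrt z * sin (csqrt z * of_real t))) (at (of_real t))"
    by (auto intro!: derivative_eq_intros)
  from has_vector_derivative_real_field[OF this, of A] show ?thesis
    by (simp add: cosz_def[abs_def] z_mult_sinz)
qed

lemma has_vector_derivative_sinz: "(sinz z has_vector_derivative cosz z t) (at t within A)"
proof (cases "z = 0")
  case True
  have "(of_real has_vector_derivative (1 :: complex)) (at t within A)"
    using has_vector_derivative_of_real[OF DERIV_ident] by simp
  then show ?thesis using True by (simp add: sinz_def[abs_def] cosz_def)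
next
  case False
  then have "((\<lambda>w. sin (csqrt z * w) / csqrt z) has_field_derivative cos (csqrt z * of_real t)) (at (of_real t))"
    by (auto intro!: derivative_eq_intros simp: mult.assoc)
  from has_vector_derivative_real_field[OF this, of A] show ?thesis
    using False by (simp add: cosz_def sinz_def[abs_def])
qed

lemma continuous_on_cosz [continuous_intros]:
  assumes "continuous_on A f"
  shows "continuous_on A (\<lambda>t. cosz z (f t))"
  by (rule continuous_on_compose2[OF _ assms, of UNIV])
     (auto intro!: continuous_at_imp_continuous_on has_vector_derivative_continuous[OF has_vector_derivative_cosz])

lemma continuous_on_sinz [continuous_intros]:
  assumes "continuous_on A f"
  shows "continuous_on A (\<lambda>t. sinz z (f t))"
  by (rule continuous_on_compose2[OF _ assms, of UNIV])
     (auto intro!: continuous_at_imp_continuous_on has_vector_derivative_continuous[OF has_vector_derivative_sinz])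

lemma cosz_minus [simp]: "cosz z (- t) = cosz z t" and sinz_minus [simp]: "sinz z (- t) = - sinz z t"
  by (auto simp: cosz_def sinz_def)

lemma cosz_add: "cosz z (s + t) = cosz z s * cosz z t - z * sinz z s * sinz z t"
proof (cases "z = 0")
  case False
  have "z * sinz z s * sinz z t = sin (csqrt z * of_real s) * sin (csqrt z * of_real t)"
    using False unfolding z_mult_sinz by (simp add: sinz_def)
  then show ?thesis by (simp add: cosz_def distrib_left cos_add)
qed (simp add: cosz_def)

lemma sinz_add: "sinz z (s + t) = sinz z s * cosz z t + cosz z s * sinz z t"
  by (auto simp: cosz_def sinz_def distrib_left sin_add add_divide_distrib)

lemma cosz_sinz_sq: "cosz z t * cosz z t + z * sinz z t * sinz z t = 1"
  using cosz_add[of z t "- t"] by simp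

lemma cosz_diff: "cosz z (t - s) = cosz z t * cosz z s + z * sinz z t * sinz z s"
  using cosz_add[of z t "- s"] by simp

lemma sinz_diff: "sinz z (t - s) = sinz z t * cosz z s - cosz z t * sinz z s"
  using sinz_add[of z t "- s"] by simp

lemma cosz_sinz_bounded:
  "\<exists>K\<ge>1. \<forall>t. \<bar>t\<bar> \<le> l \<longrightarrow> norm (cosz z t) \<le> K \<and> norm (sinz z t) \<le> K"
proof -
  have "compact (cosz z ` {-l..l})" "compact (sinz z ` {-l..l})"
    by (auto intro!: compact_continuous_image continuous_intros)
  then obtain K1 K2 where "\<forall>t\<in>{-l..l}. norm (cosz z t) \<le> K1" "\<forall>t\<in>{-l..l}. norm (sinz z t) \<le> K2"
    using compact_imp_bounded bounded_iff by (metis image_eqI)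
  then show ?thesis
    by (intro exI[of _ "max 1 (max K1 K2)"]) (auto simp: le_max_iff_disj abs_le_iff)
qed

lemma has_integral_product_primitive:
  fixes F g y y' :: "real \<Rightarrow> complex"
  assumes ab: "a \<le> b" and g: "g absolutely_integrable_on {a..b}"
    and F: "\<And>t. t \<in> {a..b} \<Longrightarrow> F t = F a + integral {a..t} g"
    and y: "\<And>s. s \<in> {a..b} \<Longrightarrow> (y has_vector_derivative y' s) (at s within {a..b})"
    and y': "continuous_on {a..b} y'"
  shows "((\<lambda>s. g s * y s + F s * y' s) has_integral (F b * y b - F a * y a)) {a..b}"
proof -
  let ?G = "\<lambda>s. integral {a..s} g"
  have conty: "continuous_on {a..b} y"
    using has_vector_derivative_continuous[OF y] by (simp add: continuous_on_eq_continuous_within)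
  have contG: "continuous_on {a..b} ?G"
    using continuous_on_indefinite_integral[OF g, of 0] by simp
  have "(\<lambda>s. ?G s * y' s) absolutely_integrable_on {a..b}"
    by (intro absolutely_integrable_continuous_real continuous_intros contG y')
  with absolutely_integrable_mult_continuous[OF g conty]
  have "(\<lambda>s. g s * y s + ?G s * y' s) absolutely_integrable_on {a..b}"
    by (rule set_integral_add(1))
  then have 1: "((\<lambda>s. g s * y s + ?G s * y' s) has_integral (integral {a..b} g * y b)) {a..b}"
    using integral_by_parts_primitive[OF ab g y y'] by (auto simp: absolutely_integrable_on_def has_integral_iff)
  have "((\<lambda>s. F a * y' s) has_integral (F a * (y b - y a))) {a..b}"
    by (intro has_integral_mult_right fundamental_theorem_of_calculus[OF ab y])
  from has_integral_add[OF 1 this]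
  have "((\<lambda>s. g s * y s + ?G s * y' s + F a * y' s) has_integral (F b * y b - F a * y a)) {a..b}"
    using F[of b] ab by (simp add: algebra_simps)
  then show ?thesis
  proof (rule has_integral_cong[THEN iffD1, rotated])
    fix s assume "s \<in> {a..b}"
    then have "F s = F a + ?G s" by (rule F)
    then show "g s * y s + ?G s * y' s + F a * y' s = g s * y s + F s * y' s"
      by (simp add: distrib_right)
  qed
qed

lemma has_vector_derivative_shifted:
  "((\<lambda>s. sinz z (s - a)) has_vector_derivative cosz z (s - a)) (at s within A)"
  "((\<lambda>s. cosz z (s - a)) has_vector_derivative - z * sinz z (s - a)) (at s within A)"
  "((\<lambda>s. sinz z (a - s)) has_vector_derivative - cosz z (a - s)) (at s within A)"
  "((\<lambda>s. cosz z (a - s)) has_vector_derivative z * sinz z (a - s)) (at s within A)"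
proof -
  have d: "((\<lambda>s. s - a) has_vector_derivative 1) (at s within A)"
    "((\<lambda>s. a - s) has_vector_derivative - 1) (at s within A)"
    by (auto intro!: derivative_eq_intros simp flip: has_real_derivative_iff_has_vector_derivative)
  show "((\<lambda>s. sinz z (s - a)) has_vector_derivative cosz z (s - a)) (at s within A)"
    using vector_diff_chain_within[OF d(1) has_vector_derivative_sinz[of z "s - a"]] by (simp add: o_def)
  show "((\<lambda>s. cosz z (s - a)) has_vector_derivative - z * sinz z (s - a)) (at s within A)"
    using vector_diff_chain_within[OF d(1) has_vector_derivative_cosz[of z "s - a"]] by (simp add: o_def)
  show "((\<lambda>s. sinz z (a - s)) has_vector_derivative - cosz z (a - s)) (at s within A)"
    using vector_diff_chain_within[OF d(2) has_vector_derivative_sinz[of z "a - s"]] by (simp add: o_def)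
  show "((\<lambda>s. cosz z (a - s)) has_vector_derivative z * sinz z (a - s)) (at s within A)"
    using vector_diff_chain_within[OF d(2) has_vector_derivative_cosz[of z "a - s"]] by (simp add: o_def)
qed

text \<open>
  Duhamel's formula: integrating the equation by parts against the two fundamental solutions run
  backwards from \<open>t\<close> leaves only the initial values and the source.
\<close>

lemma Duhamel_forward:
  assumes u: "H2_data a b u u1 u2"
    and eq: "AE t in lebesgue_on {a<..<b}. u2 t = - z * u t - f t" and t: "t \<in> {a..b}"
  shows "u t = u a * cosz z (t - a) + u1 a * sinz z (t - a) - integral {a..t} (\<lambda>s. sinz z (t - s) * f s)"
    and "u1 t = - z * u a * sinz z (t - a) + u1 a * cosz z (t - a) - integral {a..t} (\<lambda>s. cosz z (t - s) * f s)"
proof -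
  note cont = H2_data_continuous[OF u]
  have at: "a \<le> t" using t by simp
  have cont': "continuous_on {a..t} u" "continuous_on {a..t} u1"
    using cont t by (auto elim!: continuous_on_subset)
  have u2i: "u2 absolutely_integrable_on {a..t}"
    using L2_on_imp_absolutely_integrable[OF H2_dataD(3)[OF u]] t
    by (auto elim!: absolutely_integrable_subinterval)
  note u1i = absolutely_integrable_continuous_real[OF cont'(2)]
  have up: "u s = u a + integral {a..s} u1" and u1p: "u1 s = u1 a + integral {a..s} u2"
    if "s \<in> {a..t}" for s
    using H2_dataD(1)[OF u, of s] H2_dataD(2)[OF u, of s] t that by auto
  obtain N where N: "negligible N" "\<forall>t\<in>{a..b} - N. u2 t = - z * u t - f t"
    using eq unfolding AE_lebesgue_on_interval_iff by blast
  note d = has_vector_derivative_shifted[where a = t]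
  \<comment> \<open>integrate \<open>u2\<close> and \<open>u1\<close> by parts against both solutions\<close>
  have 1: "((\<lambda>s. u2 s * sinz z (t - s) + u1 s * - cosz z (t - s)) has_integral
      (u1 t * sinz z (t - t) - u1 a * sinz z (t - a))) {a..t}"
    by (intro has_integral_product_primitive at u2i u1p d continuous_intros)
  have 2: "((\<lambda>s. u1 s * cosz z (t - s) + u s * (z * sinz z (t - s))) has_integral
      (u t * cosz z (t - t) - u a * cosz z (t - a))) {a..t}"
    by (intro has_integral_product_primitive at u1i up d continuous_intros)
  have 3: "((\<lambda>s. u2 s * cosz z (t - s) + u1 s * (z * sinz z (t - s))) has_integral
      (u1 t * cosz z (t - t) - u1 a * cosz z (t - a))) {a..t}"
    by (intro has_integral_product_primitive at u2i u1p d continuous_intros)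
  have 4: "((\<lambda>s. u1 s * sinz z (t - s) + u s * - cosz z (t - s)) has_integral
      (u t * sinz z (t - t) - u a * sinz z (t - a))) {a..t}"
    by (intro has_integral_product_primitive at u1i up d continuous_intros)
  have "((\<lambda>s. - (u2 s * sinz z (t - s) + u1 s * - cosz z (t - s) + (u1 s * cosz z (t - s) + u s * (z * sinz z (t - s)))))
      has_integral - (u1 t * sinz z (t - t) - u1 a * sinz z (t - a) + (u t * cosz z (t - t) - u a * cosz z (t - a)))) {a..t}"
    by (rule has_integral_neg[OF has_integral_add[OF 1 2]])
  then have "((\<lambda>s. sinz z (t - s) * f s) has_integral
      - (u1 t * sinz z (t - t) - u1 a * sinz z (t - a) + (u t * cosz z (t - t) - u a * cosz z (t - a)))) {a..t}"
  proof (rule has_integral_spike[OF N(1), rotated])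
    fix s assume "s \<in> {a..t} - N"
    then have f: "f s = - z * u s - u2 s" using N(2) t by (simp add: algebra_simps)
    show "sinz z (t - s) * f s = - (u2 s * sinz z (t - s) + u1 s * - cosz z (t - s) + (u1 s * cosz z (t - s) + u s * (z * sinz z (t - s))))" by (simp add: f algebra_simps)
  qed
  then show "u t = u a * cosz z (t - a) + u1 a * sinz z (t - a) - integral {a..t} (\<lambda>s. sinz z (t - s) * f s)"
    by (simp add: integral_unique)
  have "((\<lambda>s. - (u2 s * cosz z (t - s) + u1 s * (z * sinz z (t - s)) - z * (u1 s * sinz z (t - s) + u s * - cosz z (t - s))))
      has_integral - (u1 t * cosz z (t - t) - u1 a * cosz z (t - a) - z * (u t * sinz z (t - t) - u a * sinz z (t - a)))) {a..t}"
    by (rule has_integral_neg[OF has_integral_diff[OF 3 has_integral_mult_right[OF 4]]])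
  then have "((\<lambda>s. cosz z (t - s) * f s) has_integral
      - (u1 t * cosz z (t - t) - u1 a * cosz z (t - a) - z * (u t * sinz z (t - t) - u a * sinz z (t - a)))) {a..t}"
  proof (rule has_integral_spike[OF N(1), rotated])
    fix s assume "s \<in> {a..t} - N"
    then have f: "f s = - z * u s - u2 s" using N(2) t by (simp add: algebra_simps)
    show "cosz z (t - s) * f s = - (u2 s * cosz z (t - s) + u1 s * (z * sinz z (t - s)) - z * (u1 s * sinz z (t - s) + u s * - cosz z (t - s)))" by (simp add: f algebra_simps)
  qed
  then show "u1 t = - z * u a * sinz z (t - a) + u1 a * cosz z (t - a) - integral {a..t} (\<lambda>s. cosz z (t - s) * f s)"
    by (simp add: integral_unique)
qed

definition Duhamel :: "complex \<Rightarrow> real \<Rightarrow> (real \<Rightarrow> complex) \<Rightarrow> complex \<Rightarrow> complex \<Rightarrow> real \<Rightarrow> complex" where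
  "Duhamel z a f \<alpha> \<beta> t =
     \<alpha> * cosz z (t - a) + \<beta> * sinz z (t - a) - integral {a..t} (\<lambda>s. sinz z (t - s) * f s)"

definition Duhamel1 :: "complex \<Rightarrow> real \<Rightarrow> (real \<Rightarrow> complex) \<Rightarrow> complex \<Rightarrow> complex \<Rightarrow> real \<Rightarrow> complex" where
  "Duhamel1 z a f \<alpha> \<beta> t =
     - z * \<alpha> * sinz z (t - a) + \<beta> * cosz z (t - a) - integral {a..t} (\<lambda>s. cosz z (t - s) * f s)"

lemma Duhamel_start [simp]: "Duhamel z a f \<alpha> \<beta> a = \<alpha>" "Duhamel1 z a f \<alpha> \<beta> a = \<beta>"
  by (auto simp: Duhamel_def Duhamel1_def)

text \<open>
  The addition theorem separates the variables in the Duhamel integrals, which turns the claim into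
  the product rule for absolutely continuous functions (variation of constants).
\<close>

lemma Duhamel_H2_data:
  assumes ab: "a < b" and f: "f \<in> L2_on a b"
  shows "H2_data a b (Duhamel z a f \<alpha> \<beta>) (Duhamel1 z a f \<alpha> \<beta>) (\<lambda>t. - z * Duhamel z a f \<alpha> \<beta> t - f t)"
proof -
  note fi = L2_on_imp_absolutely_integrable[OF f]
  define gS where "gS s = f s * sinz z (s - a)" for s
  define gC where "gC s = f s * - cosz z (s - a)" for s
  define P where "P t = \<alpha> + integral {a..t} gS" for t
  define Q where "Q t = \<beta> + integral {a..t} gC" for t
  have gS: "gS absolutely_integrable_on {a..b}" and gC: "gC absolutely_integrable_on {a..b}"
    unfolding gS_def gC_def
    by (intro absolutely_integrable_mult_continuous[OF fi] continuous_intros)+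
  have u: "Duhamel z a f \<alpha> \<beta> t = P t * cosz z (t - a) + Q t * sinz z (t - a)"
    and u1: "Duhamel1 z a f \<alpha> \<beta> t = P t * (- z * sinz z (t - a)) + Q t * cosz z (t - a)"
    if t: "t \<in> {a..b}" for t
  proof -
    have iS: "(gS has_integral integral {a..t} gS) {a..t}" and iC: "(gC has_integral integral {a..t} gC) {a..t}"
      using absolutely_integrable_subinterval[OF gS, of a t] absolutely_integrable_subinterval[OF gC, of a t] t
      by (auto simp: absolutely_integrable_on_def integrable_integral)
    have "((\<lambda>s. (- sinz z (t - a)) * gC s - cosz z (t - a) * gS s) has_integral
        ((- sinz z (t - a)) * integral {a..t} gC - cosz z (t - a) * integral {a..t} gS)) {a..t}"
      by (intro has_integral_diff has_integral_mult_right iS iC)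
    also have "(\<lambda>s. (- sinz z (t - a)) * gC s - cosz z (t - a) * gS s) = (\<lambda>s. sinz z (t - s) * f s)"
    proof
      fix s show "(- sinz z (t - a)) * gC s - cosz z (t - a) * gS s = sinz z (t - s) * f s"
      proof -
        have e: "sinz z (t - s) = sinz z (t - a) * cosz z (s - a) - cosz z (t - a) * sinz z (s - a)"
          using sinz_diff[of z "t - a" "s - a"] by simp
        show ?thesis unfolding e by (simp add: gC_def gS_def algebra_simps)
      qed
    qed
    finally show "Duhamel z a f \<alpha> \<beta> t = P t * cosz z (t - a) + Q t * sinz z (t - a)"
      by (simp add: Duhamel_def P_def Q_def integral_unique algebra_simps)
    have "((\<lambda>s. (- cosz z (t - a)) * gC s + z * sinz z (t - a) * gS s) has_integral
        ((- cosz z (t - a)) * integral {a..t} gC + z * sinz z (t - a) * integral {a..t} gS)) {a..t}"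
      by (intro has_integral_add has_integral_mult_right iS iC)
    also have "(\<lambda>s. (- cosz z (t - a)) * gC s + z * sinz z (t - a) * gS s) = (\<lambda>s. cosz z (t - s) * f s)"
    proof
      fix s show "(- cosz z (t - a)) * gC s + z * sinz z (t - a) * gS s = cosz z (t - s) * f s"
      proof -
        have e: "cosz z (t - s) = cosz z (t - a) * cosz z (s - a) + z * sinz z (t - a) * sinz z (s - a)"
          using cosz_diff[of z "t - a" "s - a"] by simp
        show ?thesis unfolding e by (simp add: gC_def gS_def algebra_simps)
      qed
    qed
    finally show "Duhamel1 z a f \<alpha> \<beta> t = P t * (- z * sinz z (t - a)) + Q t * cosz z (t - a)"
      by (simp add: Duhamel1_def P_def Q_def integral_unique algebra_simps)
  qed
  have cP: "continuous_on {a..b} P" and cQ: "continuous_on {a..b} Q"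
    unfolding P_def Q_def by (intro continuous_on_indefinite_integral gS gC)+
  have cu: "continuous_on {a..b} (Duhamel z a f \<alpha> \<beta>)"
    by (rule continuous_on_eq[of _ "\<lambda>t. P t * cosz z (t - a) + Q t * sinz z (t - a)"])
       (auto intro!: continuous_intros cP cQ simp: u)
  have u2: "(\<lambda>t. - z * Duhamel z a f \<alpha> \<beta> t - f t) \<in> L2_on a b"
    using L2_on_add(1)[OF L2_on_scale(1)[OF L2_on_continuous[OF cu], of "- z"] L2_on_scale(1)[OF f, of "-1"]]
    by simp
  have pr: "integral {a..t} (Duhamel1 z a f \<alpha> \<beta>) = Duhamel z a f \<alpha> \<beta> t - \<alpha> \<and>
      integral {a..t} (\<lambda>t. - z * Duhamel z a f \<alpha> \<beta> t - f t) = Duhamel1 z a f \<alpha> \<beta> t - \<beta>"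
    if t: "t \<in> {a..b}" for t
  proof
    have at: "a \<le> t" using t by simp
    have gS': "gS absolutely_integrable_on {a..t}" and gC': "gC absolutely_integrable_on {a..t}"
      using gS gC t by (auto elim!: absolutely_integrable_subinterval)
    have Pp: "P s = P a + integral {a..s} gS" and Qp: "Q s = Q a + integral {a..s} gC" for s
      by (simp_all add: P_def Q_def)
    have PQ: "P a = \<alpha>" "Q a = \<beta>" by (simp_all add: P_def Q_def)
    have 1: "((\<lambda>s. gS s * cosz z (s - a) + P s * (- z * sinz z (s - a))) has_integral
        (P t * cosz z (t - a) - P a * cosz z (a - a))) {a..t}"
      by (intro has_integral_product_primitive at gS' Pp has_vector_derivative_shifted continuous_intros)
    have 2: "((\<lambda>s. gC s * sinz z (s - a) + Q s * cosz z (s - a)) has_integral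
        (Q t * sinz z (t - a) - Q a * sinz z (a - a))) {a..t}"
      by (intro has_integral_product_primitive at gC' Qp has_vector_derivative_shifted continuous_intros)
    have 3: "((\<lambda>s. gS s * sinz z (s - a) + P s * cosz z (s - a)) has_integral
        (P t * sinz z (t - a) - P a * sinz z (a - a))) {a..t}"
      by (intro has_integral_product_primitive at gS' Pp has_vector_derivative_shifted continuous_intros)
    have 4: "((\<lambda>s. gC s * cosz z (s - a) + Q s * (- z * sinz z (s - a))) has_integral
        (Q t * cosz z (t - a) - Q a * cosz z (a - a))) {a..t}"
      by (intro has_integral_product_primitive at gC' Qp has_vector_derivative_shifted continuous_intros)
    have "(Duhamel1 z a f \<alpha> \<beta> has_integral (P t * cosz z (t - a) - P a * cosz z (a - a) +
        (Q t * sinz z (t - a) - Q a * sinz z (a - a)))) {a..t}"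
    proof (rule has_integral_cong[THEN iffD1, OF _ has_integral_add[OF 1 2]])
      fix s assume "s \<in> {a..t}"
      then have "s \<in> {a..b}" using t by auto
      then show "gS s * cosz z (s - a) + P s * (- z * sinz z (s - a)) + (gC s * sinz z (s - a) + Q s * cosz z (s - a))
          = Duhamel1 z a f \<alpha> \<beta> s"
        by (simp add: u1 gS_def gC_def)
    qed
    then show "integral {a..t} (Duhamel1 z a f \<alpha> \<beta>) = Duhamel z a f \<alpha> \<beta> t - \<alpha>"
      using u[OF t] by (simp add: integral_unique PQ)
    have "((\<lambda>t. - z * Duhamel z a f \<alpha> \<beta> t - f t) has_integral ((- z) * (P t * sinz z (t - a) - P a * sinz z (a - a)) +
        (Q t * cosz z (t - a) - Q a * cosz z (a - a)))) {a..t}"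
    proof (rule has_integral_cong[THEN iffD1, OF _ has_integral_add[OF has_integral_mult_right[OF 3] 4]])
      fix s assume "s \<in> {a..t}"
      then have s: "s \<in> {a..b}" using t by auto
      have "(- z) * (gS s * sinz z (s - a) + P s * cosz z (s - a)) + (gC s * cosz z (s - a) + Q s * (- z * sinz z (s - a)))
          = - z * (P s * cosz z (s - a) + Q s * sinz z (s - a))
            - f s * (cosz z (s - a) * cosz z (s - a) + z * sinz z (s - a) * sinz z (s - a))"
        by (simp add: gS_def gC_def algebra_simps)
      then show "(- z) * (gS s * sinz z (s - a) + P s * cosz z (s - a)) + (gC s * cosz z (s - a) + Q s * (- z * sinz z (s - a)))
          = - z * Duhamel z a f \<alpha> \<beta> s - f s"
        using u[OF s] by (simp add: cosz_sinz_sq)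
    qed
    then show "integral {a..t} (\<lambda>t. - z * Duhamel z a f \<alpha> \<beta> t - f t) = Duhamel1 z a f \<alpha> \<beta> t - \<beta>"
      using u1[OF t] by (simp add: integral_unique PQ algebra_simps)
  qed
  show ?thesis
    unfolding H2_data_def using pr u2 by auto
qed

lemma L2_on_cong:
  assumes "\<And>t. t \<in> {a<..<b} \<Longrightarrow> f t = g t"
  shows "f \<in> L2_on a b \<longleftrightarrow> g \<in> L2_on a b" "L2_norm_sq a b f = L2_norm_sq a b g"
proof -
  have "f \<in> borel_measurable (lebesgue_on {a<..<b}) \<longleftrightarrow> g \<in> borel_measurable (lebesgue_on {a<..<b})"
    by (rule measurable_cong) (use assms in simp)
  moreover have "integrable (lebesgue_on {a<..<b}) (\<lambda>t. (norm (f t))\<^sup>2) \<longleftrightarrow>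
      integrable (lebesgue_on {a<..<b}) (\<lambda>t. (norm (g t))\<^sup>2)"
    by (rule Bochner_Integration.integrable_cong) (use assms in auto)
  ultimately show "f \<in> L2_on a b \<longleftrightarrow> g \<in> L2_on a b" by (simp add: L2_on_def)
  show "L2_norm_sq a b f = L2_norm_sq a b g"
    unfolding L2_norm_sq_def by (rule Bochner_Integration.integral_cong) (use assms in auto)
qed

lemma L2_on_subinterval:
  assumes f: "f \<in> L2_on a b" and cd: "a \<le> c" "d \<le> b"
  shows "f \<in> L2_on c d" "L2_norm_sq c d f \<le> L2_norm_sq a b f"
proof -
  have sub: "{c<..<d} \<subseteq> {a<..<b}" using cd by auto
  have meas: "f \<in> borel_measurable (lebesgue_on {c<..<d})"
    using f sub by (auto simp: L2_on_def intro: measurable_restrict_mono)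
  let ?g = "\<lambda>t. (norm (f t))\<^sup>2"
  have 1: "set_integrable lebesgue {a<..<b} ?g"
    using f by (simp add: L2_on_def integrable_restrict_space set_integrable_def)
  have 2: "set_integrable lebesgue {c<..<d} ?g"
    by (rule set_integrable_subset[OF 1]) (use sub in auto)
  then show "f \<in> L2_on c d"
    using meas by (simp add: L2_on_def integrable_restrict_space set_integrable_def)
  show "L2_norm_sq c d f \<le> L2_norm_sq a b f"
    unfolding L2_norm_sq_def
    by (subst (1 2) integral_restrict_space)
       (use 1 2 sub in \<open>auto simp: set_integrable_def indicator_def intro!: integral_mono\<close>)
qed

lemma H2_data_cong:
  assumes "H2_data a b u u1 u2" "a \<le> b"
    and eq: "\<And>t. t \<in> {a..b} \<Longrightarrow> u' t = u t" "\<And>t. t \<in> {a..b} \<Longrightarrow> u2' t = u2 t"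
  shows "H2_data a b u' u1 u2'"
  unfolding H2_data_def
proof (intro conjI ballI)
  show "u2' \<in> L2_on a b"
    using H2_dataD(3)[OF assms(1)] L2_on_cong(1)[of a b u2' u2] eq(2) by simp
  fix t assume t: "t \<in> {a..b}"
  have "u' t = u t" "u' a = u a" using eq(1) t by auto
  with H2_dataD(1)[OF assms(1) t] show "u' t = u' a + integral {a..t} u1" by metis
  have "integral {a..t} u2' = integral {a..t} u2"
    by (rule Henstock_Kurzweil_Integration.integral_cong) (use eq(2) t in auto)
  with H2_dataD(2)[OF assms(1) t] show "u1 t = u1 a + integral {a..t} u2'" by metis
qed

lemma H2_data_scale:
  assumes "H2_data a b u u1 u2"
  shows "H2_data a b (\<lambda>t. c * u t) (\<lambda>t. c * u1 t) (\<lambda>t. c * u2 t)"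
  unfolding H2_data_def
proof (intro conjI ballI)
  show "(\<lambda>t. c * u2 t) \<in> L2_on a b" by (rule L2_on_scale(1)[OF H2_dataD(3)[OF assms]])
  fix t assume t: "t \<in> {a..b}"
  show "c * u t = c * u a + integral {a..t} (\<lambda>t. c * u1 t)"
    by (subst H2_dataD(1)[OF assms t]) (simp add: distrib_left)
  show "c * u1 t = c * u1 a + integral {a..t} (\<lambda>t. c * u2 t)"
    by (subst H2_dataD(2)[OF assms t]) (simp add: distrib_left)
qed

lemma H2_data_integrable:
  assumes "H2_data a b u u1 u2" "a \<le> c" "d \<le> b"
  shows "u1 integrable_on {c..d}" "u2 integrable_on {c..d}"
proof -
  show "u1 integrable_on {c..d}"
    by (intro integrable_continuous_real continuous_on_subset[OF H2_data_continuous(2)[OF assms(1)]])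
       (use assms(2,3) in auto)
  show "u2 integrable_on {c..d}"
    using absolutely_integrable_subinterval[OF L2_on_imp_absolutely_integrable[OF H2_dataD(3)[OF assms(1)]] assms(2,3)]
    by (simp add: absolutely_integrable_on_def)
qed

lemma H2_data_has_integral:
  assumes "H2_data a b u u1 u2" "a \<le> c" "c \<le> d" "d \<le> b"
  shows "(u1 has_integral u d - u c) {c..d}" "(u2 has_integral u1 d - u1 c) {c..d}"
proof -
  have c: "c \<in> {a..b}" and d: "d \<in> {a..b}" using assms by auto
  note int = H2_data_integrable[OF assms(1)]
  have "integral {a..c} u1 + integral {c..d} u1 = integral {a..d} u1"
    using assms by (intro Henstock_Kurzweil_Integration.integral_combine int) auto
  then have "integral {c..d} u1 = u d - u c"
    by (subst H2_dataD(1)[OF assms(1) c], subst H2_dataD(1)[OF assms(1) d]) (simp add: algebra_simps)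
  then show "(u1 has_integral u d - u c) {c..d}"
    using int(1)[of c d] assms by (simp add: has_integral_iff)
  have "integral {a..c} u2 + integral {c..d} u2 = integral {a..d} u2"
    using assms by (intro Henstock_Kurzweil_Integration.integral_combine int) auto
  then have "integral {c..d} u2 = u1 d - u1 c"
    by (subst H2_dataD(2)[OF assms(1) c], subst H2_dataD(2)[OF assms(1) d]) (simp add: algebra_simps)
  then show "(u2 has_integral u1 d - u1 c) {c..d}"
    using int(2)[of c d] assms by (simp add: has_integral_iff)
qed

lemma H2_dataI:
  assumes "\<And>t. t \<in> {a..b} \<Longrightarrow> (u1 has_integral u t - u a) {a..t}"
    "\<And>t. t \<in> {a..b} \<Longrightarrow> (u2 has_integral u1 t - u1 a) {a..t}" "u2 \<in> L2_on a b"
  shows "H2_data a b u u1 u2"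
  unfolding H2_data_def
proof (intro conjI ballI)
  fix t assume t: "t \<in> {a..b}"
  show "u t = u a + integral {a..t} u1" using integral_unique[OF assms(1)[OF t]] by simp
  show "u1 t = u1 a + integral {a..t} u2" using integral_unique[OF assms(2)[OF t]] by simp
qed (rule assms(3))

lemma H2_data_subinterval:
  assumes "H2_data a b u u1 u2" "a \<le> c" "d \<le> b"
  shows "H2_data c d u u1 u2"
  by (rule H2_dataI)
     (use assms H2_data_has_integral[OF assms(1)] L2_on_subinterval(1)[OF H2_dataD(3)[OF assms(1)]] in auto)

text \<open>
  Antisymmetric functions are odd on vertical edges, so those edges are solved from their centre
  upwards and reflected.
\<close>

lemma H2_data_odd_extension:
  assumes H: "H2_data 0 l u u1 u2" and l: "0 < l" and u0: "u 0 = 0"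
    and u2: "u2 \<in> L2_on (- l) l" "\<And>t. t \<in> {0..l} \<Longrightarrow> u2 (- t) = - u2 t"
  shows "H2_data (- l) l (\<lambda>t. if 0 \<le> t then u t else - u (- t)) (\<lambda>t. u1 \<bar>t\<bar>) u2"
proof (rule H2_dataI[OF _ _ u2(1)])
  let ?u = "\<lambda>t. if 0 \<le> t then u t else - u (- t)"
  fix t assume t: "t \<in> {-l..l}"
  have neg: "((\<lambda>s. u1 \<bar>s\<bar>) has_integral ?u s - ?u (- l)) {-l..s} \<and> (u2 has_integral u1 \<bar>s\<bar> - u1 \<bar>- l\<bar>) {-l..s}"
    if s: "s \<in> {-l..0}" for s
  proof
    have "((\<lambda>x. u1 (- x)) has_integral u l - u (- s)) {-l..-(-s)}"
      unfolding has_integral_reflect_real using s by (intro H2_data_has_integral[OF H]) auto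
    then have "((\<lambda>x. u1 (- x)) has_integral u l - u (- s)) {-l..s}" by simp
    then have "((\<lambda>x. u1 \<bar>x\<bar>) has_integral u l - u (- s)) {-l..s}"
      by (rule has_integral_cong[THEN iffD1, rotated]) (use s in auto)
    moreover have "?u s - ?u (- l) = u l - u (- s)" using s l u0 by auto
    ultimately show "((\<lambda>s. u1 \<bar>s\<bar>) has_integral ?u s - ?u (- l)) {-l..s}" by simp
    have "((\<lambda>x. u2 (- x)) has_integral u1 l - u1 (- s)) {-l..-(-s)}"
      unfolding has_integral_reflect_real using s by (intro H2_data_has_integral[OF H]) auto
    then have "((\<lambda>x. u2 (- x)) has_integral u1 l - u1 (- s)) {-l..s}" by simp
    then have "((\<lambda>x. - u2 (- x)) has_integral - (u1 l - u1 (- s))) {-l..s}"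
      by (rule has_integral_neg)
    then have "(u2 has_integral - (u1 l - u1 (- s))) {-l..s}"
      by (rule has_integral_cong[THEN iffD1, rotated]) (use s u2(2)[of "- _"] in auto)
    then show "(u2 has_integral u1 \<bar>s\<bar> - u1 \<bar>- l\<bar>) {-l..s}" using s l by simp
  qed
  have pos: "((\<lambda>s. u1 \<bar>s\<bar>) has_integral ?u s - ?u 0) {0..s} \<and> (u2 has_integral u1 \<bar>s\<bar> - u1 \<bar>0\<bar>) {0..s}"
    if s: "s \<in> {0..l}" for s
  proof
    have "(u1 has_integral u s - u 0) {0..s}"
      using s by (intro H2_data_has_integral[OF H]) auto
    then have "((\<lambda>x. u1 \<bar>x\<bar>) has_integral u s - u 0) {0..s}"
      by (rule has_integral_cong[THEN iffD1, rotated]) auto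
    then show "((\<lambda>s. u1 \<bar>s\<bar>) has_integral ?u s - ?u 0) {0..s}" using s by simp
    have "(u2 has_integral u1 s - u1 0) {0..s}"
      using s by (intro H2_data_has_integral[OF H]) auto
    then show "(u2 has_integral u1 \<bar>s\<bar> - u1 \<bar>0\<bar>) {0..s}" using s by simp
  qed
  show "((\<lambda>s. u1 \<bar>s\<bar>) has_integral ?u t - ?u (- l)) {-l..t}"
  proof (cases "t \<le> 0")
    case False
    with has_integral_combine[OF _ _ neg[of 0, THEN conjunct1] pos[of t, THEN conjunct1]] t l
    show ?thesis by (simp add: add.commute)
  next
    case True
    then show ?thesis using neg[of t] t by simp
  qed
  show "(u2 has_integral u1 \<bar>t\<bar> - u1 \<bar>- l\<bar>) {-l..t}"
  proof (cases "t \<le> 0")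
    case False
    with has_integral_combine[OF _ _ neg[of 0, THEN conjunct2] pos[of t, THEN conjunct2]] t l
    show ?thesis by simp
  next
    case True
    then show ?thesis using neg[of t] t by simp
  qed
qed

text \<open>
  The initial values of a second-order Sobolev function are controlled by \<open>L\<^sub>2\<close> norms alone: testing
  with linear polynomials that are biorthogonal to \<open>1\<close> and \<open>t\<close> isolates the two coefficients of the
  affine part.
\<close>

lemma H2_data_trace:
  assumes H: "H2_data a (a + 1) u u1 u2"
  shows "(norm (u a))\<^sup>2 \<le> 72 * (L2_norm_sq a (a + 1) u + L2_norm_sq a (a + 1) u2)"
    and "(norm (u1 a))\<^sup>2 \<le> 72 * (L2_norm_sq a (a + 1) u + L2_norm_sq a (a + 1) u2)"
proof -
  define b where "b = a + 1"
  have ab: "a < b" "b - a = 1" by (auto simp: b_def)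
  note H = assms[folded b_def]
  note cont = H2_data_continuous[OF H]
  have uL2: "u \<in> L2_on a b" by (rule L2_on_continuous[OF cont(1)])
  note u2L2 = H2_dataD(3)[OF H]
  define e where "e = sqrt (L2_norm_sq a b u2)"
  define m where "m = sqrt (L2_norm_sq a b u)"
  define q where "q t = u t - u a - u1 a * of_real (t - a)" for t
  have b1: "norm (u1 t - u1 a) \<le> e" if t: "t \<in> {a..b}" for t
  proof -
    have "norm (integral {a..t} (\<lambda>s. 1 * u2 s)) \<le> 1 * sqrt ((b - a) * L2_norm_sq a b u2)"
      by (rule norm_integral_mult_le_L2_norm[OF u2L2 ab(1) t]) auto
    moreover have "integral {a..t} u2 = u1 t - u1 a"
      using H2_data_has_integral(2)[OF H, of a t] t by (simp add: integral_unique)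
    ultimately show ?thesis using ab(2) by (simp add: e_def)
  qed
  have qb: "norm (q t) \<le> e" if t: "t \<in> {a..b}" for t
  proof -
    have "((\<lambda>_. u1 a) has_integral (t - a) *\<^sub>R u1 a) {a..t}"
      using has_integral_const_real[of "u1 a" a t] t by simp
    then have 1: "((\<lambda>s. u1 s - u1 a) has_integral (u t - u a - (t - a) *\<^sub>R u1 a)) {a..t}"
      using t by (intro has_integral_diff H2_data_has_integral[OF H]) auto
    have "norm (u t - u a - (t - a) *\<^sub>R u1 a) \<le> e * (t - a)"
      using has_integral_bound[of e "\<lambda>s. u1 s - u1 a" "u t - u a - (t - a) *\<^sub>R u1 a" a t] 1 b1 t
      by (simp add: e_def L2_norm_sq_nonneg)
    also have "\<dots> \<le> e * 1"
      using t ab by (intro mult_left_mono) (auto simp: e_def L2_norm_sq_nonneg)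
    finally show ?thesis by (simp add: q_def scaleR_conv_of_real mult.commute)
  qed
  have qc: "continuous_on {a..b} q" unfolding q_def by (intro continuous_intros cont)
  have key: "norm k \<le> 6 * (m + e)"
    if P: "((\<lambda>t. (u t - q t) * of_real (p t)) has_integral k) {a..b}"
      and p: "continuous_on {a..b} p" "\<And>t. t \<in> {a..b} \<Longrightarrow> \<bar>p t\<bar> \<le> 6" for k p
  proof -
    have iu: "(\<lambda>t. norm (u t)) integrable_on {a..b}"
      by (intro integrable_continuous_real continuous_intros cont)
    have B: "((\<lambda>t. 6 * norm (u t) + 6 * e) has_integral (6 * integral {a..b} (\<lambda>t. norm (u t)) + 6 * e)) {a..b}"
    proof -
      have "((\<lambda>_. 6 * e) has_integral 6 * e) {a..b}"
        using has_integral_const_real[of "6 * e" a b] ab by simp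
      from has_integral_add[OF has_integral_mult_right[OF integrable_integral[OF iu]] this]
      show ?thesis .
    qed
    have "norm ((u t - q t) * of_real (p t)) \<le> 6 * norm (u t) + 6 * e" if t: "t \<in> {a..b}" for t
    proof -
      have "norm ((u t - q t) * of_real (p t)) \<le> (norm (u t) + e) * 6"
        unfolding norm_mult
        using qb[OF t] p(2)[OF t] norm_triangle_ineq4[of "u t" "q t"] norm_ge_zero[of "u t"]
        by (intro mult_mono) (auto simp: e_def L2_norm_sq_nonneg)
      then show ?thesis by simp
    qed
    then have "norm k \<le> 6 * integral {a..b} (\<lambda>t. norm (u t)) + 6 * e"
      using Henstock_Kurzweil_Integration.integral_norm_bound_integral[of "\<lambda>t. (u t - q t) * of_real (p t)" "{a..b}"
          "\<lambda>t. 6 * norm (u t) + 6 * e"] P B by (auto simp: has_integral_iff)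
    also have "integral {a..b} (\<lambda>t. norm (u t)) \<le> m"
      using integral_norm_le_L2_norm[OF uL2 ab(1)] ab(2) by (simp add: m_def)
    finally show ?thesis by simp
  qed
  have uq: "u t - q t = u a + u1 a * of_real (t - a)" for t by (simp add: q_def)
  have 1: "((\<lambda>t. (u t - q t) * of_real (4 - 6 * (t - a))) has_integral u a) {a..b}"
  proof -
    define A :: "complex \<Rightarrow> complex" where
      "A w = u a * (4 * (w - of_real a) - 3 * (w - of_real a)^2) + u1 a * (2 * (w - of_real a)^2 - 2 * (w - of_real a)^3)" for w
    have dA: "(A has_field_derivative (u a + u1 a * of_real (t - a)) * of_real (4 - 6 * (t - a))) (at (of_real t))" for t
      unfolding A_def by (auto intro!: derivative_eq_intros simp: algebra_simps power2_eq_square)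
    have "((\<lambda>t. (u a + u1 a * of_real (t - a)) * of_real (4 - 6 * (t - a))) has_integral
        (A (of_real b) - A (of_real a))) {a..b}"
      by (rule fundamental_theorem_of_calculus[OF less_imp_le[OF ab(1)] has_vector_derivative_real_field[OF dA]])
    moreover have "A (of_real b) - A (of_real a) = u a" by (simp add: A_def b_def)
    ultimately show ?thesis by (simp only: uq)
  qed
  have 2: "((\<lambda>t. (u t - q t) * of_real (12 * (t - a) - 6)) has_integral u1 a) {a..b}"
  proof -
    define A :: "complex \<Rightarrow> complex" where
      "A w = u a * (6 * (w - of_real a)^2 - 6 * (w - of_real a)) + u1 a * (4 * (w - of_real a)^3 - 3 * (w - of_real a)^2)" for w
    have dA: "(A has_field_derivative (u a + u1 a * of_real (t - a)) * of_real (12 * (t - a) - 6)) (at (of_real t))" for t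
      unfolding A_def by (auto intro!: derivative_eq_intros simp: algebra_simps power2_eq_square)
    have "((\<lambda>t. (u a + u1 a * of_real (t - a)) * of_real (12 * (t - a) - 6)) has_integral
        (A (of_real b) - A (of_real a))) {a..b}"
      by (rule fundamental_theorem_of_calculus[OF less_imp_le[OF ab(1)] has_vector_derivative_real_field[OF dA]])
    moreover have "A (of_real b) - A (of_real a) = u1 a" by (simp add: A_def b_def)
    ultimately show ?thesis by (simp only: uq)
  qed
  have sq: "x\<^sup>2 \<le> 72 * (L2_norm_sq a (a + 1) u + L2_norm_sq a (a + 1) u2)" if "0 \<le> x" "x \<le> 6 * (m + e)" for x
  proof -
    have "x\<^sup>2 \<le> (6 * (m + e))\<^sup>2" using that by (intro power_mono)
    also have "\<dots> \<le> 72 * (m\<^sup>2 + e\<^sup>2)"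
      using zero_le_power2[of "m - e"] by (simp add: power_mult_distrib power2_sum power2_diff)
    finally show ?thesis by (simp add: m_def e_def L2_norm_sq_nonneg b_def)
  qed
  show "(norm (u a))\<^sup>2 \<le> 72 * (L2_norm_sq a (a + 1) u + L2_norm_sq a (a + 1) u2)"
    by (rule sq[OF _ key[OF 1]]) (auto intro!: continuous_intros simp: b_def)
  show "(norm (u1 a))\<^sup>2 \<le> 72 * (L2_norm_sq a (a + 1) u + L2_norm_sq a (a + 1) u2)"
    by (rule sq[OF _ key[OF 2]]) (auto intro!: continuous_intros simp: b_def)
qed

lemma sum3_sq_le: "(x + y + w)\<^sup>2 \<le> 3 * (x\<^sup>2 + y\<^sup>2 + w\<^sup>2)" for x y w :: real
  using zero_le_power2[of "x - y"] zero_le_power2[of "x - w"] zero_le_power2[of "y - w"]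
  by (simp add: power2_eq_square algebra_simps)

text \<open>
  One constant serves all intervals of the same length, which makes the bounds summable over the edges.
\<close>

lemma Duhamel_bound:
  assumes l: "0 < l"
  shows "\<exists>K\<ge>0. \<forall>a f \<alpha> \<beta> t. f \<in> L2_on a (a + l) \<longrightarrow> t \<in> {a..a + l} \<longrightarrow>
    (norm (Duhamel z a f \<alpha> \<beta> t))\<^sup>2 \<le> K * ((norm \<alpha>)\<^sup>2 + (norm \<beta>)\<^sup>2 + L2_norm_sq a (a + l) f) \<and>
    (norm (Duhamel1 z a f \<alpha> \<beta> t))\<^sup>2 \<le> K * ((norm \<alpha>)\<^sup>2 + (norm \<beta>)\<^sup>2 + L2_norm_sq a (a + l) f)"
proof -
  obtain B where B: "B \<ge> 1" "\<And>t. \<bar>t\<bar> \<le> l \<Longrightarrow> norm (cosz z t) \<le> B" "\<And>t. \<bar>t\<bar> \<le> l \<Longrightarrow> norm (sinz z t) \<le> B"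
    using cosz_sinz_bounded[of l z] by blast
  define R where "R = B * (1 + norm z) * (1 + sqrt l)"
  have R: "B * norm z \<le> R" "B \<le> R" "B * sqrt l \<le> R"
  proof -
    have "B * norm z * 1 \<le> B * (1 + norm z) * (1 + sqrt l)" "B * 1 * 1 \<le> B * (1 + norm z) * (1 + sqrt l)"
      "B * 1 * sqrt l \<le> B * (1 + norm z) * (1 + sqrt l)"
      using B(1) l by (intro mult_mono; simp)+
    then show "B * norm z \<le> R" "B \<le> R" "B * sqrt l \<le> R" by (simp_all add: R_def)
  qed
  have R0: "0 \<le> R" using R(2) B(1) by simp
  have "(norm (Duhamel z a f \<alpha> \<beta> t))\<^sup>2 \<le> 3 * R\<^sup>2 * ((norm \<alpha>)\<^sup>2 + (norm \<beta>)\<^sup>2 + L2_norm_sq a (a + l) f) \<and>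
    (norm (Duhamel1 z a f \<alpha> \<beta> t))\<^sup>2 \<le> 3 * R\<^sup>2 * ((norm \<alpha>)\<^sup>2 + (norm \<beta>)\<^sup>2 + L2_norm_sq a (a + l) f)"
    if f: "f \<in> L2_on a (a + l)" and t: "t \<in> {a..a + l}" for a f \<alpha> \<beta> t
  proof -
    have ta: "\<bar>t - a\<bar> \<le> l" using t by auto
    define n where "n = sqrt (L2_norm_sq a (a + l) f)"
    have n0: "0 \<le> n" by (simp add: n_def L2_norm_sq_nonneg)
    have I: "norm (integral {a..t} (\<lambda>s. sinz z (t - s) * f s)) \<le> R * n"
      "norm (integral {a..t} (\<lambda>s. cosz z (t - s) * f s)) \<le> R * n"
    proof -
      have "norm (integral {a..t} (\<lambda>s. sinz z (t - s) * f s)) \<le> B * sqrt ((a + l - a) * L2_norm_sq a (a + l) f)"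
        by (rule norm_integral_mult_le_L2_norm[OF f]) (use l t B(3) in \<open>auto intro!: continuous_intros\<close>)
      also have "\<dots> = B * sqrt l * n" by (simp add: n_def real_sqrt_mult)
      also have "\<dots> \<le> R * n" by (rule mult_right_mono[OF R(3) n0])
      finally show "norm (integral {a..t} (\<lambda>s. sinz z (t - s) * f s)) \<le> R * n" .
      have "norm (integral {a..t} (\<lambda>s. cosz z (t - s) * f s)) \<le> B * sqrt ((a + l - a) * L2_norm_sq a (a + l) f)"
        by (rule norm_integral_mult_le_L2_norm[OF f]) (use l t B(2) in \<open>auto intro!: continuous_intros\<close>)
      also have "\<dots> = B * sqrt l * n" by (simp add: n_def real_sqrt_mult)
      also have "\<dots> \<le> R * n" by (rule mult_right_mono[OF R(3) n0])
      finally show "norm (integral {a..t} (\<lambda>s. cosz z (t - s) * f s)) \<le> R * n" .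
    qed
    have c: "norm (cosz z (t - a)) \<le> R" "norm (sinz z (t - a)) \<le> R" "norm (z * sinz z (t - a)) \<le> R"
    proof -
      show "norm (cosz z (t - a)) \<le> R" using B(2)[OF ta] R(2) by linarith
      show "norm (sinz z (t - a)) \<le> R" using B(3)[OF ta] R(2) by linarith
      have "norm z * norm (sinz z (t - a)) \<le> norm z * B"
        by (rule mult_left_mono[OF B(3)[OF ta]]) simp
      then show "norm (z * sinz z (t - a)) \<le> R" using R(1) by (simp add: norm_mult mult.commute)
    qed
    have fin: "y\<^sup>2 \<le> 3 * R\<^sup>2 * ((norm \<alpha>)\<^sup>2 + (norm \<beta>)\<^sup>2 + L2_norm_sq a (a + l) f)"
      if "0 \<le> y" "y \<le> R * norm \<alpha> + R * norm \<beta> + R * n" for y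
    proof -
      have "y\<^sup>2 \<le> (R * norm \<alpha> + R * norm \<beta> + R * n)\<^sup>2" using that by (intro power_mono)
      also have "\<dots> \<le> 3 * ((R * norm \<alpha>)\<^sup>2 + (R * norm \<beta>)\<^sup>2 + (R * n)\<^sup>2)" by (rule sum3_sq_le)
      also have "\<dots> = 3 * R\<^sup>2 * ((norm \<alpha>)\<^sup>2 + (norm \<beta>)\<^sup>2 + n\<^sup>2)"
        by (simp add: power_mult_distrib algebra_simps)
      also have "n\<^sup>2 = L2_norm_sq a (a + l) f" by (simp add: n_def L2_norm_sq_nonneg)
      finally show ?thesis .
    qed
    have m: "norm (x * y) \<le> R * norm x" if "norm y \<le> R" for x y :: complex
      using mult_left_mono[OF that norm_ge_zero[of x]] by (simp add: norm_mult mult.commute)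
    show ?thesis
    proof
      show "(norm (Duhamel z a f \<alpha> \<beta> t))\<^sup>2 \<le> 3 * R\<^sup>2 * ((norm \<alpha>)\<^sup>2 + (norm \<beta>)\<^sup>2 + L2_norm_sq a (a + l) f)"
      proof (rule fin)
        show "norm (Duhamel z a f \<alpha> \<beta> t) \<le> R * norm \<alpha> + R * norm \<beta> + R * n"
          unfolding Duhamel_def
          by (intro order_trans[OF norm_triangle_ineq4] add_mono order_trans[OF norm_triangle_ineq] m c I)
      qed simp
      show "(norm (Duhamel1 z a f \<alpha> \<beta> t))\<^sup>2 \<le> 3 * R\<^sup>2 * ((norm \<alpha>)\<^sup>2 + (norm \<beta>)\<^sup>2 + L2_norm_sq a (a + l) f)"
      proof (rule fin)
        have "- z * \<alpha> * sinz z (t - a) = \<alpha> * - (z * sinz z (t - a))" by simp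
        moreover have "norm (\<alpha> * - (z * sinz z (t - a))) \<le> R * norm \<alpha>"
          by (rule m) (use c(3) in simp)
        ultimately have "norm (- z * \<alpha> * sinz z (t - a)) \<le> R * norm \<alpha>" by metis
        then show "norm (Duhamel1 z a f \<alpha> \<beta> t) \<le> R * norm \<alpha> + R * norm \<beta> + R * n"
          unfolding Duhamel1_def
          by (intro order_trans[OF norm_triangle_ineq4] add_mono order_trans[OF norm_triangle_ineq] m c I)
      qed simp
    qed
  qed
  then show ?thesis by (intro exI[of _ "3 * R\<^sup>2"]) auto
qed

section \<open>Second-order recurrences on the integers\<close>

text \<open>
  The recurrence factors through \<open>v (j + 1) - r * v j\<close>, which is multiplied by \<open>1 / r\<close> at each step and
  hence cannot decay unless it is zero.  Modulus one is included: then \<open>v\<close> itself has constant modulus,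
  which rules out decaying solutions in the bands.
\<close>

lemma recurrence_decaying_nat:
  fixes v :: "nat \<Rightarrow> complex"
  assumes r: "r \<noteq> 0" "norm r \<le> 1"
    and rec: "\<And>j. v (Suc (Suc j)) + v j = (r + 1 / r) * v (Suc j)"
    and lim: "v \<longlonglongrightarrow> 0"
  shows "v j = v 0 * r ^ j"
proof -
  define x where "x j = v (Suc j) - r * v j" for j
  have "r * x (Suc j) = x j" for j
  proof -
    have "r * v (Suc (Suc j)) = (r * r + 1) * v (Suc j) - r * v j"
      using rec[of j] r(1) by (simp add: field_simps)
    then show ?thesis by (simp add: x_def algebra_simps)
  qed
  then have x: "r ^ j * x j = x 0" for j
    by (induction j) (simp_all add: mult.assoc mult.left_commute flip: mult.commute[of "r ^ _"])
  have "norm (x 0) \<le> norm (x j)" for j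
    using x[of j] r(2) mult_left_le_one_le[of "norm (x j)" "norm r ^ j"]
    by (metis norm_ge_zero norm_mult norm_power power_le_one zero_le_power)
  moreover have "x \<longlonglongrightarrow> 0"
    unfolding x_def using tendsto_diff[OF LIMSEQ_Suc[OF lim] tendsto_mult[OF tendsto_const lim, of r]] by simp
  ultimately have "norm (x 0) \<le> 0"
    by (intro LIMSEQ_le_const[of "\<lambda>j. norm (x j)"] tendsto_norm_zero) auto
  then have "x 0 = 0" by simp
  then have "x j = 0" for j using x[of j] r(1) by simp
  then have "v (Suc j) = r * v j" for j by (simp add: x_def)
  then show ?thesis by (induction j) auto
qed

definition decays :: "(int \<Rightarrow> complex) \<Rightarrow> bool" where
  "decays v \<longleftrightarrow> (\<lambda>n. v (int n)) \<longlonglongrightarrow> 0 \<and> (\<lambda>n. v (- int n)) \<longlonglongrightarrow> 0"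

lemma decays_diff:
  assumes "decays v" "decays w"
  shows "decays (\<lambda>j. v j - w j)"
  using assms tendsto_diff[of _ 0 _ _ 0] by (fastforce simp: decays_def)

lemma recurrence_decaying_int:
  fixes v :: "int \<Rightarrow> complex"
  assumes r: "r \<noteq> 0" "norm r \<le> 1"
    and rec: "\<And>j. j \<noteq> 0 \<Longrightarrow> v (j + 1) + v (j - 1) = (r + 1 / r) * v j"
    and lim: "decays v"
  shows "v j = v 0 * r ^ nat \<bar>j\<bar>"
proof (cases "j \<ge> 0")
  case True
  have "v (int n) = v (int 0) * r ^ n" for n
  proof (rule recurrence_decaying_nat[OF r])
    show "v (int (Suc (Suc j))) + v (int j) = (r + 1 / r) * v (int (Suc j))" for j
      using rec[of "int (Suc j)"] by (simp add: add.commute add.left_commute)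
  qed (use lim in \<open>simp add: decays_def\<close>)
  from this[of "nat j"] True show ?thesis by simp
next
  case False
  have "v (- int n) = v (- int 0) * r ^ n" for n
  proof (rule recurrence_decaying_nat[OF r])
    show "v (- int (Suc (Suc j))) + v (- int j) = (r + 1 / r) * v (- int (Suc j))" for j
      using rec[of "- int (Suc j)"] by (simp add: algebra_simps)
  qed (use lim in \<open>simp add: decays_def\<close>)
  from this[of "nat (- j)"] False show ?thesis by simp
qed

lemma constant_modulus_decaying:
  assumes "\<And>j. norm (v (j + 1)) = norm (v j)" "decays v"
  shows "v j = 0"
proof -
  have step: "norm (v (int n)) = norm (v 0) \<and> norm (v (- int n)) = norm (v 0)" for n
  proof (induction n)
    case (Suc n)
    have "norm (v (- int (Suc n))) = norm (v (- int n))"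
      using assms(1)[of "- int (Suc n)"] by simp
    moreover have "norm (v (int (Suc n))) = norm (v (int n))"
      using assms(1)[of "int n"] by (simp add: add.commute)
    ultimately show ?case using Suc by metis
  qed simp
  then have "(\<lambda>n. norm (v 0)) \<longlonglongrightarrow> 0"
    using tendsto_norm_zero[of "\<lambda>n. v (int n)" sequentially] assms(2) by (simp add: decays_def)
  then have "v 0 = 0" by (simp add: LIMSEQ_const_iff)
  then show ?thesis using step[of "nat \<bar>j\<bar>"] by (cases "j \<ge> 0") auto
qed

section \<open>Square-summable sequences\<close>

definition l2 :: "(int \<Rightarrow> complex) \<Rightarrow> bool" where
  "l2 h \<longleftrightarrow> (\<lambda>j. (norm (h j))\<^sup>2) summable_on UNIV"

definition l2n :: "(int \<Rightarrow> complex) \<Rightarrow> real" where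
  "l2n h = (\<Sum>\<^sub>\<infinity>j. (norm (h j))\<^sup>2)"

lemma summable_infsum_le:
  fixes f :: "'a \<Rightarrow> real"
  assumes "\<And>x. 0 \<le> f x" "\<And>F. finite F \<Longrightarrow> sum f F \<le> B"
  shows "f summable_on UNIV" "infsum f UNIV \<le> B"
proof -
  show s: "f summable_on UNIV"
    by (rule nonneg_bdd_above_summable_on) (use assms in \<open>auto intro!: bdd_aboveI[of _ B]\<close>)
  show "infsum f UNIV \<le> B"
    by (rule infsum_le_finite_sums[OF s]) (use assms in auto)
qed

lemma l2I:
  assumes "\<And>j. (norm (h j))\<^sup>2 \<le> g j" "g summable_on UNIV"
  shows "l2 h" "l2n h \<le> infsum g UNIV"
proof -
  show s: "l2 h"
    unfolding l2_def by (rule summable_on_comparison_test[OF assms(2)]) (use assms in auto)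
  then show "l2n h \<le> infsum g UNIV"
    unfolding l2n_def l2_def by (rule infsum_mono) (use assms in auto)
qed

lemma l2n_nonneg: "0 \<le> l2n h"
  unfolding l2n_def by (rule infsum_nonneg) simp

lemma l2_sum_le: "l2 h \<Longrightarrow> finite F \<Longrightarrow> (\<Sum>j\<in>F. (norm (h j))\<^sup>2) \<le> l2n h"
  unfolding l2_def l2n_def by (rule finite_sum_le_infsum) auto

lemma l2_bound: "l2 h \<Longrightarrow> (norm (h j))\<^sup>2 \<le> l2n h"
  using l2_sum_le[of h "{j}"] by simp

lemma l2_scale:
  assumes "l2 h"
  shows "l2 (\<lambda>j. c * h j)" "l2n (\<lambda>j. c * h j) = (norm c)\<^sup>2 * l2n h"
  using assms by (auto simp: l2_def l2n_def norm_mult power_mult_distrib infsum_cmult_right'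
      intro: summable_on_cmult_right)

lemma l2_add:
  assumes "l2 g" "l2 h"
  shows "l2 (\<lambda>j. g j + h j)" "l2n (\<lambda>j. g j + h j) \<le> 2 * l2n g + 2 * l2n h"
proof -
  have s: "(\<lambda>j. 2 * (norm (g j))\<^sup>2 + 2 * (norm (h j))\<^sup>2) summable_on UNIV"
    using assms unfolding l2_def by (intro summable_on_add summable_on_cmult_right)
  note * = l2I[of "\<lambda>j. g j + h j", OF norm_add_sq_le s]
  show "l2 (\<lambda>j. g j + h j)" by (rule *)
  have "(\<Sum>\<^sub>\<infinity>j. 2 * (norm (g j))\<^sup>2 + 2 * (norm (h j))\<^sup>2) = 2 * l2n g + 2 * l2n h"
    using assms unfolding l2_def l2n_def
    by (subst infsum_add) (auto intro: summable_on_cmult_right simp: infsum_cmult_right')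
  with *(2) show "l2n (\<lambda>j. g j + h j) \<le> 2 * l2n g + 2 * l2n h" by simp
qed

lemma l2_reindex:
  assumes "bij \<pi>"
  shows "l2 (\<lambda>j. h (\<pi> j)) \<longleftrightarrow> l2 h" "l2n (\<lambda>j. h (\<pi> j)) = l2n h"
  using summable_on_reindex_bij_betw[of \<pi> UNIV UNIV "\<lambda>j. (norm (h j))\<^sup>2"]
    infsum_reindex_bij_betw[of \<pi> UNIV UNIV "\<lambda>j. (norm (h j))\<^sup>2"] assms
  by (auto simp: l2_def l2n_def)

lemma bij_int_shift: "bij (\<lambda>j::int. j + c)" "bij (\<lambda>j::int. - j)"
  by (rule o_bij[of "\<lambda>j. j - c"], auto simp: fun_eq_iff)
     (rule o_bij[of "\<lambda>j. - j"], auto simp: fun_eq_iff)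

lemma l2_decays:
  assumes "l2 h"
  shows "decays h"
proof -
  have *: "(\<lambda>n. h (\<pi> n)) \<longlonglongrightarrow> 0" if "inj \<pi>" for \<pi> :: "nat \<Rightarrow> int"
  proof -
    have "(\<lambda>j. (norm (h j))\<^sup>2) summable_on range \<pi>"
      using assms unfolding l2_def by (rule summable_on_subset_banach) auto
    then have "(\<lambda>n. (norm (h (\<pi> n)))\<^sup>2) summable_on UNIV"
      using summable_on_reindex[OF that, of "\<lambda>j. (norm (h j))\<^sup>2"] by (simp add: o_def)
    then have "summable (\<lambda>n. (norm (h (\<pi> n)))\<^sup>2)"
      by (rule summable_on_imp_summable)
    then have "(\<lambda>n. (norm (h (\<pi> n)))\<^sup>2) \<longlonglongrightarrow> 0"
      by (rule summable_LIMSEQ_zero)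
    then have "(\<lambda>n. sqrt ((norm (h (\<pi> n)))\<^sup>2)) \<longlonglongrightarrow> sqrt 0"
      by (rule tendsto_real_sqrt)
    then show ?thesis by (simp add: tendsto_norm_zero_iff)
  qed
  from *[of int] *[of "\<lambda>n. - int n"] show ?thesis
    by (auto simp: decays_def inj_def)
qed

lemma l2_geometric:
  assumes "norm r < 1"
  shows "l2 (\<lambda>j. r ^ nat \<bar>j\<bar>)"
proof -
  define q where "q = (norm r)\<^sup>2"
  have q: "0 \<le> q" "q < 1" using assms by (auto simp: q_def power_less_one_iff abs_square_less_1)
  have g: "summable (\<lambda>n. norm (q ^ n))"
    using q by (simp add: summable_geometric norm_power)
  have g': "(\<lambda>n. q ^ n) summable_on (UNIV :: nat set)"
    using g by (rule norm_summable_imp_summable_on)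
  have "(\<lambda>j. q ^ nat \<bar>j\<bar>) summable_on range (int)"
    using g' by (subst summable_on_reindex) (auto simp: o_def inj_def)
  moreover have "(\<lambda>j. q ^ nat \<bar>j\<bar>) summable_on range (\<lambda>n. - int n)"
    using g' by (subst summable_on_reindex) (auto simp: o_def inj_def)
  ultimately have "(\<lambda>j. q ^ nat \<bar>j\<bar>) summable_on (range int \<union> range (\<lambda>n. - int n))"
    by (rule summable_on_union)
  moreover have "range int \<union> range (\<lambda>n. - int n) = UNIV"
  proof -
    have "j \<in> range int \<union> range (\<lambda>n. - int n)" for j
      by (cases j rule: int_cases2) auto
    then show ?thesis by blast
  qed
  ultimately have "(\<lambda>j. q ^ nat \<bar>j\<bar>) summable_on UNIV" by simp
  moreover have "(norm (r ^ nat \<bar>j\<bar>))\<^sup>2 = q ^ nat \<bar>j\<bar>" for j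
    by (simp add: q_def norm_power power_mult[symmetric] mult.commute)
  ultimately show ?thesis by (simp add: l2_def)
qed

text \<open>
  The first-order recurrence is inverted by a geometric series.  Its norm is estimated without
  computing convolutions: the recurrence bounds the norm over a window by \<open>norm r\<close> times the norm
  over the shifted window, which exceeds the window by one, uniformly bounded, term.
\<close>

lemma first_order_recurrence_l2:
  assumes r: "norm r < 1"
  shows "\<exists>K\<ge>0. \<forall>h. l2 h \<longrightarrow> (\<exists>x. l2 x \<and> l2n x \<le> K * l2n h \<and> (\<forall>j. x j = r * x (j - 1) + h j))"
proof -
  define q where "q = norm r"
  have q: "0 \<le> q" "q < 1" using r by (auto simp: q_def)
  define c where "c = (q / (1 - q) + 1) / (1 - q)"
  have c: "0 \<le> c" using q by (simp add: c_def)
  have "\<exists>x. l2 x \<and> l2n x \<le> c\<^sup>2 * l2n h \<and> (\<forall>j. x j = r * x (j - 1) + h j)" if h: "l2 h" for h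
  proof -
    define H where "H = sqrt (l2n h)"
    have H0: "0 \<le> H" by (simp add: H_def l2n_nonneg)
    have hb: "norm (h j) \<le> H" for j
      using l2_bound[OF h, of j] by (simp add: H_def real_le_rsqrt)
    have sq: "summable (\<lambda>n. q ^ n * H)"
      using q by (intro summable_mult2 summable_geometric) simp
    have tb: "norm (r ^ n * h k) \<le> q ^ n * H" for n k
      using hb[of k] q by (simp add: norm_mult norm_power q_def mult_left_mono)
    have sm: "summable (\<lambda>n. r ^ n * h (j - int n))" for j
      by (rule summable_comparison_test'[OF sq]) (rule tb)
    define x where "x j = (\<Sum>n. r ^ n * h (j - int n))" for j
    have rec: "x j = r * x (j - 1) + h j" for j
    proof -
      have "x j = (\<Sum>n. r ^ Suc n * h (j - int (Suc n))) + h j"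
        unfolding x_def using suminf_split_head[OF sm[of j]] by simp
      also have "(\<lambda>n. r ^ Suc n * h (j - int (Suc n))) = (\<lambda>n. r * (r ^ n * h (j - 1 - int n)))"
        by (auto simp: algebra_simps)
      also have "(\<Sum>n. r * (r ^ n * h (j - 1 - int n))) = r * x (j - 1)"
        unfolding x_def by (rule suminf_mult[OF sm])
      finally show ?thesis .
    qed
    have xb: "norm (x j) \<le> H / (1 - q)" for j
    proof -
      have "norm (x j) \<le> (\<Sum>n. q ^ n * H)"
        unfolding x_def by (rule norm_suminf_le[OF _ sq]) (rule tb)
      also have "\<dots> = (\<Sum>n. q ^ n) * H"
        using q by (intro suminf_mult2[symmetric] summable_geometric) simp
      also have "\<dots> = H / (1 - q)"
        using q by (simp add: suminf_geometric)
      finally show ?thesis .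
    qed
    have main: "L2_set (\<lambda>j. norm (x j)) {-N..N} \<le> c * H" for N :: int
    proof -
      let ?A = "{-N..N}"
      let ?X = "L2_set (\<lambda>j. norm (x j)) ?A"
      have "(\<Sum>j\<in>?A. (norm (x (j - 1)))\<^sup>2) = (\<Sum>j\<in>{-N-1..N-1}. (norm (x j))\<^sup>2)"
        by (rule sum.reindex_bij_witness[of _ "\<lambda>j. j + 1" "\<lambda>j. j - 1"]) auto
      also have "\<dots> \<le> (\<Sum>j\<in>insert (-N-1) ?A. (norm (x j))\<^sup>2)"
        by (rule sum_mono2) auto
      also have "\<dots> = (norm (x (-N-1)))\<^sup>2 + ?X\<^sup>2"
        by (simp add: L2_set_def sum_nonneg)
      also have "\<dots> \<le> (norm (x (-N-1)) + ?X)\<^sup>2"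
        by (simp add: power2_sum)
      finally have "(\<Sum>j\<in>?A. (norm (x (j - 1)))\<^sup>2) \<le> (norm (x (-N-1)) + ?X)\<^sup>2" .
      then have shift: "L2_set (\<lambda>j. norm (x (j - 1))) ?A \<le> norm (x (-N-1)) + ?X"
        unfolding L2_set_def by (intro real_le_lsqrt) (auto simp: sum_nonneg intro!: add_nonneg_nonneg)
      have "?X \<le> L2_set (\<lambda>j. q * norm (x (j - 1)) + norm (h j)) ?A"
      proof (rule L2_set_mono)
        show "norm (x j) \<le> q * norm (x (j - 1)) + norm (h j)" for j
          using norm_triangle_ineq[of "r * x (j - 1)" "h j"] rec[of j] by (simp add: norm_mult q_def)
      qed simp
      also have "\<dots> \<le> L2_set (\<lambda>j. q * norm (x (j - 1))) ?A + L2_set (\<lambda>j. norm (h j)) ?A"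
        by (rule L2_set_triangle_ineq)
      also have "L2_set (\<lambda>j. q * norm (x (j - 1))) ?A = q * L2_set (\<lambda>j. norm (x (j - 1))) ?A"
        using q by (simp add: L2_set_right_distrib)
      also have "\<dots> \<le> q * (H / (1 - q) + ?X)"
        using shift xb[of "-N-1"] q by (intro mult_left_mono) auto
      also have "L2_set (\<lambda>j. norm (h j)) ?A \<le> H"
        unfolding L2_set_def H_def using l2_sum_le[OF h, of ?A] by simp
      finally have "(1 - q) * ?X \<le> (q / (1 - q) + 1) * H"
        by (simp add: algebra_simps)
      then have "?X \<le> (q / (1 - q) + 1) * H / (1 - q)"
        using q by (simp add: pos_le_divide_eq mult.commute)
      then show ?thesis by (simp add: c_def)
    qed
    have "(\<Sum>j\<in>F. (norm (x j))\<^sup>2) \<le> (c * H)\<^sup>2" if fin: "finite F" for F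
    proof -
      obtain N where N: "F \<subseteq> {-N..N}"
      proof
        show "F \<subseteq> {- (\<Sum>j\<in>F. \<bar>j\<bar>)..(\<Sum>j\<in>F. \<bar>j\<bar>)}"
        proof
          fix j assume "j \<in> F"
          then have "\<bar>j\<bar> \<le> (\<Sum>j\<in>F. \<bar>j\<bar>)" using fin by (intro member_le_sum) auto
          then show "j \<in> {- (\<Sum>j\<in>F. \<bar>j\<bar>)..(\<Sum>j\<in>F. \<bar>j\<bar>)}" by auto
        qed
      qed
      have "(\<Sum>j\<in>F. (norm (x j))\<^sup>2) \<le> (\<Sum>j\<in>{-N..N}. (norm (x j))\<^sup>2)"
        using N by (intro sum_mono2) auto
      also have "\<dots> = (L2_set (\<lambda>j. norm (x j)) {-N..N})\<^sup>2"
        by (simp add: L2_set_def sum_nonneg)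
      also have "\<dots> \<le> (c * H)\<^sup>2"
        using main[of N] by (intro power_mono) auto
      finally show ?thesis .
    qed
    note * = summable_infsum_le[of "\<lambda>j. (norm (x j))\<^sup>2", OF _ this]
    have "l2 x" using *(1) by (simp add: l2_def)
    moreover have "l2n x \<le> c\<^sup>2 * l2n h"
      using *(2) by (simp add: l2n_def H_def power_mult_distrib l2n_nonneg[unfolded l2n_def])
    ultimately show ?thesis using rec by blast
  qed
  then show ?thesis by (intro exI[of _ "c\<^sup>2"]) auto
qed

text \<open>
  The full-line recurrence is the composition of two first-order ones, and the modified
  coefficient at \<open>0\<close> is a rank-one perturbation along the decaying solution.
\<close>

lemma second_order_recurrence_l2:
  assumes r: "r \<noteq> 0" "norm r < 1" and d: "1 / r - r \<noteq> d"
  shows "\<exists>K\<ge>0. \<forall>h. l2 h \<longrightarrow> (\<exists>v. l2 v \<and> l2n v \<le> K * l2n h \<and>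
    (\<forall>j. v (j + 1) + v (j - 1) - (r + 1 / r) * v j + (if j = 0 then d * v 0 else 0) = h j))"
proof -
  obtain K1 where K1: "K1 \<ge> 0"
    "\<And>h. l2 h \<Longrightarrow> \<exists>x. l2 x \<and> l2n x \<le> K1 * l2n h \<and> (\<forall>j. x j = r * x (j - 1) + h j)"
    using first_order_recurrence_l2[OF r(2)] by blast
  define e where "e = r - 1 / r"
  have e: "e \<noteq> 0" "e + d \<noteq> 0"
  proof
    assume "e = 0"
    then have "r * r = 1" using r(1) by (simp add: e_def field_simps)
    then have "norm r * norm r = 1" by (metis norm_mult norm_one)
    moreover have "norm r * norm r < 1" using r(2) abs_square_less_1[of "norm r"]
      by (simp add: power2_eq_square)
    ultimately show False by simp
  next
    show "e + d \<noteq> 0" using d by (auto simp: e_def add_eq_0_iff)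
  qed
  define \<rho> where "\<rho> = (\<lambda>j. r ^ nat \<bar>j\<bar>)"
  have \<rho>: "l2 \<rho>" using l2_geometric[OF r(2)] by (simp add: \<rho>_def)
  have \<rho>rec: "\<rho> (j + 1) + \<rho> (j - 1) - (r + 1 / r) * \<rho> j = (if j = 0 then e else 0)" for j
  proof -
    consider "j = 0" | n where "j = int (Suc n)" | n where "j = - int (Suc n)"
      by (cases j rule: int_cases3) (auto dest: gr0_implies_Suc)
    then show ?thesis
    proof cases
      case 1 then show ?thesis by (simp add: \<rho>_def e_def)
    next
      case 2
      then have "nat \<bar>j + 1\<bar> = Suc (Suc n)" "nat \<bar>j - 1\<bar> = n" "nat \<bar>j\<bar> = Suc n" "j \<noteq> 0" by auto
      then show ?thesis using r(1) by (simp add: \<rho>_def field_simps)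
    next
      case 3
      then have "nat \<bar>j + 1\<bar> = n" "nat \<bar>j - 1\<bar> = Suc (Suc n)" "nat \<bar>j\<bar> = Suc n" "j \<noteq> 0" by auto
      then show ?thesis using r(1) by (simp add: \<rho>_def field_simps)
    qed
  qed
  define c where "c = 1 / (norm e)\<^sup>2"
  define k where "k = (norm (d / (e + d)))\<^sup>2"
  define K where "K = 2 * (c * (8 * K1 + 4)) + 2 * (k * l2n \<rho> * (c * (8 * K1 + 4)))"
  have "\<exists>v. l2 v \<and> l2n v \<le> K * l2n h \<and>
    (\<forall>j. v (j + 1) + v (j - 1) - (r + 1 / r) * v j + (if j = 0 then d * v 0 else 0) = h j)"
    if h: "l2 h" for h
  proof -
    obtain x where x: "l2 x" "l2n x \<le> K1 * l2n h" "\<And>j. x j = r * x (j - 1) + h j"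
      using K1(2)[OF h] by blast
    have h': "l2 (\<lambda>j. h (- j))" "l2n (\<lambda>j. h (- j)) = l2n h"
      using h l2_reindex[OF bij_int_shift(2), of h] by auto
    obtain y' where y': "l2 y'" "l2n y' \<le> K1 * l2n h" "\<And>j. y' j = r * y' (j - 1) + h (- j)"
      using K1(2)[OF h'(1)] h'(2) by metis
    define y where "y j = y' (- j)" for j
    have y: "l2 y" "l2n y \<le> K1 * l2n h"
      using y'(1,2) l2_reindex[OF bij_int_shift(2), of y'] by (auto simp: y_def[abs_def])
    have yrec: "y j = r * y (j + 1) + h j" for j
    proof -
      have "- j - 1 = - (j + 1)" by simp
      from y'(3)[of "- j", unfolded this] show ?thesis by (simp only: y_def minus_minus)
    qed
    define G where "G j = (1 / e) * ((x j + y j) + (-1) * h j)" for j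
    have l: "l2 (\<lambda>j. x j + y j)" "l2 (\<lambda>j. (-1) * h j)"
      using l2_add(1)[OF x(1) y(1)] l2_scale(1)[OF h, of "-1"] by auto
    have G: "l2 G" unfolding G_def by (intro l2_scale l2_add x y h)
    have "l2n G = c * l2n (\<lambda>j. (x j + y j) + (-1) * h j)"
      unfolding G_def c_def using l2_scale(2)[OF l2_add(1)[OF l], of "1 / e"]
      by (simp add: norm_divide power_divide)
    also have "\<dots> \<le> c * (2 * (2 * l2n x + 2 * l2n y) + 2 * l2n (\<lambda>j. (-1) * h j))"
      using l2_add(2)[OF l] l2_add(2)[OF x(1) y(1)] by (intro mult_left_mono) (auto simp: c_def)
    also have "\<dots> \<le> c * (2 * (2 * (K1 * l2n h) + 2 * (K1 * l2n h)) + 2 * l2n h)"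
      using x(2) y(2) l2_scale(2)[OF h, of "-1"] by (intro mult_left_mono) (auto simp: c_def)
    also have "\<dots> \<le> c * (8 * K1 + 4) * l2n h"
      using l2n_nonneg[of h] by (simp add: c_def algebra_simps divide_right_mono)
    finally have Gn: "l2n G \<le> c * (8 * K1 + 4) * l2n h" .
    have Grec: "G (j + 1) + G (j - 1) - (r + 1 / r) * G j = h j" for j
    proof -
      have x1: "x (j + 1) = r * x j + h (j + 1)" using x(3)[of "j + 1"] by simp
      have x2: "x (j - 1) = (x j - h j) / r" using x(3)[of j] r(1) by (simp add: field_simps)
      have y1: "y (j - 1) = r * y j + h (j - 1)" using yrec[of "j - 1"] by simp
      have y2: "y (j + 1) = (y j - h j) / r" using yrec[of j] r(1) by (simp add: field_simps)
      have "e * (G (j + 1) + G (j - 1) - (r + 1 / r) * G j) =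
          (x (j + 1) + y (j + 1) - h (j + 1)) + (x (j - 1) + y (j - 1) - h (j - 1))
            - (r + 1 / r) * (x j + y j - h j)"
        using e(1) by (simp add: G_def field_simps)
      also have "\<dots> = e * h j"
        unfolding x1 x2 y1 y2 e_def using r(1) by (simp add: field_simps)
      finally show ?thesis using e(1) by simp
    qed
    define \<alpha> where "\<alpha> = - d * G 0 / (e + d)"
    define v where "v j = G j + \<alpha> * \<rho> j" for j
    have "l2 v" unfolding v_def by (intro l2_add l2_scale G \<rho>)
    moreover have "l2n v \<le> K * l2n h"
    proof -
      have "l2n v \<le> 2 * l2n G + 2 * ((norm \<alpha>)\<^sup>2 * l2n \<rho>)"
        unfolding v_def using l2_add(2)[OF G l2_scale(1)[OF \<rho>, of \<alpha>]] l2_scale(2)[OF \<rho>, of \<alpha>] by simp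
      also have "(norm \<alpha>)\<^sup>2 = k * (norm (G 0))\<^sup>2"
        by (simp add: \<alpha>_def k_def norm_mult norm_divide power_mult_distrib power_divide)
      also have "2 * l2n G + 2 * (k * (norm (G 0))\<^sup>2 * l2n \<rho>) \<le> 2 * l2n G + 2 * (k * l2n G * l2n \<rho>)"
        using l2_bound[OF G, of 0] l2n_nonneg[of \<rho>]
        by (intro add_left_mono mult_left_mono mult_right_mono) (auto simp: k_def)
      also have "\<dots> = (2 + 2 * (k * l2n \<rho>)) * l2n G" by (simp add: algebra_simps)
      also have "\<dots> \<le> (2 + 2 * (k * l2n \<rho>)) * (c * (8 * K1 + 4) * l2n h)"
        using Gn l2n_nonneg[of \<rho>] by (intro mult_left_mono) (auto simp: k_def)
      also have "\<dots> = K * l2n h" by (simp add: K_def algebra_simps)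
      finally show ?thesis .
    qed
    moreover have "v (j + 1) + v (j - 1) - (r + 1 / r) * v j + (if j = 0 then d * v 0 else 0) = h j" for j
    proof -
      have "v (j + 1) + v (j - 1) - (r + 1 / r) * v j =
          (G (j + 1) + G (j - 1) - (r + 1 / r) * G j) + \<alpha> * (\<rho> (j + 1) + \<rho> (j - 1) - (r + 1 / r) * \<rho> j)"
        by (simp add: v_def algebra_simps)
      also have "\<dots> = h j + \<alpha> * (if j = 0 then e else 0)" by (simp only: Grec \<rho>rec)
      finally have *: "v (j + 1) + v (j - 1) - (r + 1 / r) * v j = h j + \<alpha> * (if j = 0 then e else 0)" .
      have "\<alpha> * (e + d) = - d * G 0" using e(2) by (simp add: \<alpha>_def)
      moreover have "\<alpha> * e + d * v 0 = \<alpha> * (e + d) + d * G 0"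
        by (simp add: v_def \<rho>_def algebra_simps)
      ultimately have "\<alpha> * e + d * v 0 = 0" by simp
      then show ?thesis using * by (auto simp: algebra_simps)
    qed
    ultimately show ?thesis by blast
  qed
  moreover have "K \<ge> 0"
    unfolding K_def k_def c_def using K1(1) l2n_nonneg[of \<rho>] by (intro add_nonneg_nonneg mult_nonneg_nonneg) auto
  ultimately show ?thesis by blast
qed

section \<open>Functions on the ladder\<close>

lemma on_edge_simps [simp]:
  "on_edge L u (Vertical j) = (\<lambda>t. u (of_int j, t))"
  "on_edge L u (Upper j) = (\<lambda>t. u (t, L / 2))"
  "on_edge L u (Lower j) = (\<lambda>t. u (t, - L / 2))"
  by (auto simp: on_edge_def)

lemma edge_cases_UNIV: "(UNIV :: edge set) = range Vertical \<union> (range Upper \<union> range Lower)"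
proof -
  have "e \<in> range Vertical \<union> (range Upper \<union> range Lower)" for e by (cases e) auto
  then show ?thesis by blast
qed

lemma summable_edges_iff:
  fixes g :: "edge \<Rightarrow> real"
  shows "g summable_on UNIV \<longleftrightarrow> (\<lambda>j. g (Vertical j)) summable_on UNIV \<and>
      (\<lambda>j. g (Upper j)) summable_on UNIV \<and> (\<lambda>j. g (Lower j)) summable_on UNIV"
proof -
  have r: "(\<lambda>j. g (Vertical j)) summable_on UNIV \<longleftrightarrow> g summable_on range Vertical"
    "(\<lambda>j. g (Upper j)) summable_on UNIV \<longleftrightarrow> g summable_on range Upper"
    "(\<lambda>j. g (Lower j)) summable_on UNIV \<longleftrightarrow> g summable_on range Lower"
    by (subst summable_on_reindex; auto simp: inj_def o_def)+
  show ?thesis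
    unfolding r by (subst edge_cases_UNIV) (auto intro: summable_on_union summable_on_subset_banach[of g UNIV]
      elim: summable_on_subset_banach)
qed

lemma infsum_edges:
  fixes g :: "edge \<Rightarrow> real"
  assumes "g summable_on UNIV"
  shows "infsum g UNIV = (\<Sum>\<^sub>\<infinity>j. g (Vertical j)) + ((\<Sum>\<^sub>\<infinity>j. g (Upper j)) + (\<Sum>\<^sub>\<infinity>j. g (Lower j)))"
proof -
  have r: "(\<Sum>\<^sub>\<infinity>j. g (Vertical j)) = infsum g (range Vertical)"
    "(\<Sum>\<^sub>\<infinity>j. g (Upper j)) = infsum g (range Upper)"
    "(\<Sum>\<^sub>\<infinity>j. g (Lower j)) = infsum g (range Lower)"
    by (subst infsum_reindex; auto simp: inj_def o_def)+
  have s: "g summable_on A" for A by (rule summable_on_subset_banach[OF assms]) auto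
  show ?thesis
    unfolding r by (subst edge_cases_UNIV, subst infsum_Un_disjoint, (rule s)+, force)
      (subst infsum_Un_disjoint, (rule s)+, auto)
qed

definition edge_norm_sq :: "real \<Rightarrow> graph_fun \<Rightarrow> edge \<Rightarrow> real" where
  "edge_norm_sq L f e = L2_norm_sq (edge_lo L e) (edge_hi L e) (on_edge L f e)"

lemma edge_norm_sq_nonneg: "0 \<le> edge_norm_sq L f e"
  by (simp add: edge_norm_sq_def L2_norm_sq_nonneg)

locale weighted_ladder =
  fixes L \<mu> :: real
  assumes L: "L > 0" and mu: "\<mu> > 0"
begin

abbreviation "X \<equiv> L2_antisym L \<mu>"
abbreviation "N \<equiv> L2_graph_norm L \<mu>"
abbreviation "A \<equiv> Laplacian_antisym L \<mu>"

definition w :: "int \<Rightarrow> real" where "w j = weight \<mu> (Vertical j)"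

lemma w_simps: "w 0 = \<mu>" "j \<noteq> 0 \<Longrightarrow> w j = 1"
  by (auto simp: w_def weight_def)

lemma edge_lo_less: "edge_lo L e < edge_hi L e"
  using L by (cases e) auto

lemma weight_bounds: "0 < weight \<mu> e" "weight \<mu> e \<le> 1 + \<mu>" "1 \<le> (1 + 1 / \<mu>) * weight \<mu> e"
  using mu by (auto simp: weight_def distrib_right)

definition nsq :: "graph_fun \<Rightarrow> real" where
  "nsq f = (\<Sum>\<^sub>\<infinity>e. weight \<mu> e * edge_norm_sq L f e)"

lemma N_eq: "N f = sqrt (nsq f)"
  by (simp add: L2_graph_norm_def nsq_def edge_norm_sq_def)

lemma nsq_nonneg: "0 \<le> nsq f"
  unfolding nsq_def using weight_bounds(1) edge_norm_sq_nonneg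
  by (intro infsum_nonneg mult_nonneg_nonneg) (auto intro: less_imp_le)

lemma summable_weight_iff:
  fixes g :: "edge \<Rightarrow> real"
  assumes "\<And>e. 0 \<le> g e"
  shows "(\<lambda>e. weight \<mu> e * g e) summable_on UNIV \<longleftrightarrow> g summable_on UNIV"
proof
  assume "(\<lambda>e. weight \<mu> e * g e) summable_on UNIV"
  then have "(\<lambda>e. (1 + 1 / \<mu>) * (weight \<mu> e * g e)) summable_on UNIV" by (rule summable_on_cmult_right)
  then show "g summable_on UNIV"
    by (rule summable_on_comparison_test)
       (use assms weight_bounds(3) mult_right_mono[OF weight_bounds(3) assms] in \<open>auto simp: mult.assoc\<close>)
next
  assume "g summable_on UNIV"
  then have "(\<lambda>e. (1 + \<mu>) * g e) summable_on UNIV" by (rule summable_on_cmult_right)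
  then show "(\<lambda>e. weight \<mu> e * g e) summable_on UNIV"
    by (rule summable_on_comparison_test)
       (use assms weight_bounds(1,2) in \<open>auto intro!: mult_right_mono mult_nonneg_nonneg less_imp_le[OF weight_bounds(1)]\<close>)
qed

lemma L2_graph_iff:
  "f \<in> L2_graph L \<mu> \<longleftrightarrow>
    (\<forall>e. on_edge L f e \<in> L2_on (edge_lo L e) (edge_hi L e)) \<and> edge_norm_sq L f summable_on UNIV"
  unfolding L2_graph_def using summable_weight_iff[of "edge_norm_sq L f"] edge_norm_sq_nonneg
  by (simp add: edge_norm_sq_def[abs_def])

lemma L2_graph_add:
  assumes "f \<in> L2_graph L \<mu>" "g \<in> L2_graph L \<mu>"
  shows "(\<lambda>p. f p + g p) \<in> L2_graph L \<mu>"
proof -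
  have o: "on_edge L (\<lambda>p. f p + g p) e = (\<lambda>t. on_edge L f e t + on_edge L g e t)" for e
    by (auto simp: on_edge_def)
  have "(\<lambda>e. 2 * edge_norm_sq L f e + 2 * edge_norm_sq L g e) summable_on UNIV"
    using assms by (intro summable_on_add summable_on_cmult_right) (auto simp: L2_graph_iff)
  then have "edge_norm_sq L (\<lambda>p. f p + g p) summable_on UNIV"
    by (rule summable_on_comparison_test)
       (use assms in \<open>auto simp: edge_norm_sq_nonneg edge_norm_sq_def[of L "\<lambda>p. f p + g p"] o L2_norm_sq_nonneg
          simp: L2_graph_iff edge_norm_sq_def intro!: L2_on_add(2)\<close>)
  then show ?thesis using assms by (auto simp: L2_graph_iff o intro!: L2_on_add)
qed

lemma L2_graph_scale:
  assumes "f \<in> L2_graph L \<mu>"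
  shows "(\<lambda>p. c * f p) \<in> L2_graph L \<mu>"
proof -
  have o: "on_edge L (\<lambda>p. c * f p) e = (\<lambda>t. c * on_edge L f e t)" for e
    by (auto simp: on_edge_def)
  have "edge_norm_sq L (\<lambda>p. c * f p) = (\<lambda>e. (norm c)\<^sup>2 * edge_norm_sq L f e)"
    using assms by (auto simp: edge_norm_sq_def o L2_graph_iff L2_on_scale(2))
  then show ?thesis using assms
    by (auto simp: L2_graph_iff o intro!: L2_on_scale(1) summable_on_cmult_right)
qed

lemma L2_graph_diff:
  assumes "f \<in> L2_graph L \<mu>" "g \<in> L2_graph L \<mu>"
  shows "(\<lambda>p. f p - c * g p) \<in> L2_graph L \<mu>"
  using L2_graph_add[OF assms(1) L2_graph_scale[OF assms(2), of "- c"]] by simp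

lemma N_eq_0_iff:
  assumes "f \<in> L2_graph L \<mu>"
  shows "N f = 0 \<longleftrightarrow> (\<forall>e. AE t in lebesgue_on {edge_lo L e<..<edge_hi L e}. on_edge L f e t = 0)"
proof -
  have s: "(\<lambda>e. weight \<mu> e * edge_norm_sq L f e) summable_on UNIV"
    using assms by (simp add: summable_weight_iff edge_norm_sq_nonneg L2_graph_iff)
  have nn: "0 \<le> weight \<mu> e * edge_norm_sq L f e" for e
    by (intro mult_nonneg_nonneg edge_norm_sq_nonneg less_imp_le[OF weight_bounds(1)])
  have "nsq f = 0 \<longleftrightarrow> (\<forall>e. edge_norm_sq L f e = 0)"
  proof
    assume 0: "nsq f = 0"
    show "\<forall>e. edge_norm_sq L f e = 0"
    proof
      fix e
      have "(\<Sum>e\<in>{e}. weight \<mu> e * edge_norm_sq L f e) \<le> nsq f"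
        unfolding nsq_def by (rule finite_sum_le_infsum[OF s]) (use nn in auto)
      then show "edge_norm_sq L f e = 0" using 0 nn[of e] weight_bounds(1)[of e] by simp
    qed
  next
    assume "\<forall>e. edge_norm_sq L f e = 0"
    then show "nsq f = 0" by (simp add: nsq_def)
  qed
  moreover have "edge_norm_sq L f e = 0 \<longleftrightarrow> (AE t in lebesgue_on {edge_lo L e<..<edge_hi L e}. on_edge L f e t = 0)" for e
    unfolding edge_norm_sq_def by (rule L2_norm_sq_eq_0_iff) (use assms in \<open>simp add: L2_graph_iff\<close>)
  ultimately show ?thesis by (simp add: N_eq)
qed

lemma edge_norms_le:
  assumes "f \<in> L2_graph L \<mu>"
  shows "(\<lambda>j. edge_norm_sq L f (Upper j)) summable_on UNIV"
    "(\<lambda>j. edge_norm_sq L f (Vertical j)) summable_on UNIV"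
    "infsum (edge_norm_sq L f) UNIV \<le> (1 + 1 / \<mu>) * nsq f"
    "(\<Sum>\<^sub>\<infinity>j. edge_norm_sq L f (Upper j)) \<le> (1 + 1 / \<mu>) * nsq f"
    "(\<Sum>\<^sub>\<infinity>j. edge_norm_sq L f (Vertical j)) \<le> (1 + 1 / \<mu>) * nsq f"
proof -
  have s: "edge_norm_sq L f summable_on UNIV" using assms by (simp add: L2_graph_iff)
  then show "(\<lambda>j. edge_norm_sq L f (Upper j)) summable_on UNIV"
    "(\<lambda>j. edge_norm_sq L f (Vertical j)) summable_on UNIV"
    by (simp_all add: summable_edges_iff)
  have s2: "(\<lambda>e. weight \<mu> e * edge_norm_sq L f e) summable_on UNIV"
    using s by (simp add: summable_weight_iff edge_norm_sq_nonneg)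
  have "infsum (edge_norm_sq L f) UNIV \<le> (\<Sum>\<^sub>\<infinity>e. (1 + 1 / \<mu>) * (weight \<mu> e * edge_norm_sq L f e))"
    by (rule infsum_mono[OF s summable_on_cmult_right[OF s2]])
       (use mult_right_mono[OF weight_bounds(3) edge_norm_sq_nonneg] in \<open>auto simp: mult.assoc\<close>)
  then show *: "infsum (edge_norm_sq L f) UNIV \<le> (1 + 1 / \<mu>) * nsq f"
    by (simp add: nsq_def infsum_cmult_right')
  have nn: "0 \<le> (\<Sum>\<^sub>\<infinity>j. edge_norm_sq L f (g j))" for g :: "int \<Rightarrow> edge"
    by (intro infsum_nonneg edge_norm_sq_nonneg)
  show "(\<Sum>\<^sub>\<infinity>j. edge_norm_sq L f (Upper j)) \<le> (1 + 1 / \<mu>) * nsq f"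
    "(\<Sum>\<^sub>\<infinity>j. edge_norm_sq L f (Vertical j)) \<le> (1 + 1 / \<mu>) * nsq f"
    using * nn[of Vertical] nn[of Upper] nn[of Lower] unfolding infsum_edges[OF s] by linarith+
qed

lemma mem_ladder_iff: "(x, y) \<in> ladder L \<longleftrightarrow> y = L / 2 \<or> y = - L / 2 \<or> (x \<in> \<int> \<and> - L / 2 \<le> y \<and> y \<le> L / 2)"
proof
  assume "(x, y) \<in> ladder L"
  then consider "(x, y) \<in> vertices L" | e where "(x, y) \<in> edge_point L e ` {edge_lo L e<..<edge_hi L e}"
    by (auto simp: ladder_def)
  then show "y = L / 2 \<or> y = - L / 2 \<or> (x \<in> \<int> \<and> - L / 2 \<le> y \<and> y \<le> L / 2)"
  proof cases
    case 1 then show ?thesis by (auto simp: vertices_def)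
  next
    case (2 e) then show ?thesis by (cases e) auto
  qed
next
  have hor: "(x, L / 2) \<in> ladder L \<and> (x, - L / 2) \<in> ladder L" for x
  proof (cases "x \<in> \<int>")
    case True
    then obtain j where j: "x = of_int j" by (auto elim: Ints_cases)
    have "(x, 1 * L / 2) \<in> vertices L" "(x, (-1) * L / 2) \<in> vertices L"
      unfolding vertices_def j by blast+
    then show ?thesis by (simp add: ladder_def)
  next
    case False
    have "x \<noteq> of_int \<lfloor>x\<rfloor>" using False by (metis Ints_of_int)
    then have "of_int \<lfloor>x\<rfloor> < x" using of_int_floor_le[of x] by linarith
    moreover have "x < of_int \<lfloor>x\<rfloor> + 1" by linarith
    ultimately have x: "x \<in> {of_int \<lfloor>x\<rfloor><..<of_int \<lfloor>x\<rfloor> + 1}" by simp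
    then have "(x, L / 2) \<in> edge_point L (Upper \<lfloor>x\<rfloor>) ` {edge_lo L (Upper \<lfloor>x\<rfloor>)<..<edge_hi L (Upper \<lfloor>x\<rfloor>)}"
      "(x, - L / 2) \<in> edge_point L (Lower \<lfloor>x\<rfloor>) ` {edge_lo L (Lower \<lfloor>x\<rfloor>)<..<edge_hi L (Lower \<lfloor>x\<rfloor>)}"
      by auto
    then show ?thesis unfolding ladder_def by blast
  qed
  assume "y = L / 2 \<or> y = - L / 2 \<or> (x \<in> \<int> \<and> - L / 2 \<le> y \<and> y \<le> L / 2)"
  then consider "y = L / 2" | "y = - L / 2" | j where "x = of_int j" "- L / 2 < y" "y < L / 2"
    by (auto simp: less_le elim: Ints_cases)
  then show "(x, y) \<in> ladder L"
  proof cases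
    case 3
    then have "(x, y) \<in> edge_point L (Vertical j) ` {edge_lo L (Vertical j)<..<edge_hi L (Vertical j)}" by auto
    then show ?thesis unfolding ladder_def by blast
  qed (use hor in auto)
qed

lemma antisymmetricD:
  assumes "antisymmetric L u"
  shows "u (x, - L / 2) = - u (x, L / 2)"
    "- L / 2 \<le> y \<Longrightarrow> y \<le> L / 2 \<Longrightarrow> u (of_int j, - y) = - u (of_int j, y)"
    "u (of_int j, 0) = 0"
proof -
  have *: "u (x, y) = - u (x, - y)" if "(x, y) \<in> ladder L" for x y
    using assms that by (auto simp: antisymmetric_def)
  show "u (x, - L / 2) = - u (x, L / 2)" using *[of x "L / 2"] by (simp add: mem_ladder_iff)
  show 1: "u (of_int j, - y) = - u (of_int j, y)" if "- L / 2 \<le> y" "y \<le> L / 2" for y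
    using *[of "of_int j" y] that by (simp add: mem_ladder_iff)
  show "u (of_int j, 0) = 0" using 1[of 0] L by simp
qed

lemma edge_image_subset_ladder: "edge_point L e ` {edge_lo L e..edge_hi L e} \<subseteq> ladder L"
  by (cases e) (auto simp: mem_ladder_iff)

lemma continuous_on_edge_point: "continuous_on S (edge_point L e)"
proof -
  have "edge_point L (Vertical j) = (\<lambda>t. (of_int j, t))" "edge_point L (Upper j) = (\<lambda>t. (t, L / 2))"
    "edge_point L (Lower j) = (\<lambda>t. (t, - L / 2))" for j
    by (auto simp: fun_eq_iff)
  then show ?thesis by (cases e) (auto intro!: continuous_intros)
qed

lemma continuous_on_on_edge:
  assumes "continuous_on (ladder L) u"
  shows "continuous_on {edge_lo L e..edge_hi L e} (on_edge L u e)"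
  unfolding on_edge_def
  by (rule continuous_on_compose2[OF assms continuous_on_edge_point edge_image_subset_ladder])

lemma incident_edges_upper: "incident_edges L (of_int j, L / 2) = {Vertical j, Upper j, Upper (j - 1)}"
proof (intro set_eqI)
  fix e
  have i: "real_of_int j = of_int k + 1 \<longleftrightarrow> k = j - 1" for k
    by (metis add_diff_cancel_right' diff_add_cancel of_int_1 of_int_add of_int_eq_iff)
  show "e \<in> incident_edges L (of_int j, L / 2) \<longleftrightarrow> e \<in> {Vertical j, Upper j, Upper (j - 1)}"
    using L by (cases e) (auto simp: incident_edges_def i)
qed

lemma incident_edges_lower: "incident_edges L (of_int j, - L / 2) = {Vertical j, Lower j, Lower (j - 1)}"
proof (intro set_eqI)
  fix e
  have i: "real_of_int j = of_int k + 1 \<longleftrightarrow> k = j - 1" for k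
    by (metis add_diff_cancel_right' diff_add_cancel of_int_1 of_int_add of_int_eq_iff)
  show "e \<in> incident_edges L (of_int j, - L / 2) \<longleftrightarrow> e \<in> {Vertical j, Lower j, Lower (j - 1)}"
    using L by (cases e) (auto simp: incident_edges_def i)
qed

lemma Kirchhoff_sums:
  assumes H: "\<And>e. H2_data (edge_lo L e) (edge_hi L e) (on_edge L u e) (U1 e) (U2 e)"
  shows "(\<Sum>e \<in> incident_edges L (of_int j, L / 2). of_real (weight \<mu> e) * outgoing_deriv L u e (of_int j, L / 2)) =
      U1 (Upper j) (of_int j) - U1 (Upper (j - 1)) (of_int j) - of_real (w j) * U1 (Vertical j) (L / 2)"
    and "(\<Sum>e \<in> incident_edges L (of_int j, - L / 2). of_real (weight \<mu> e) * outgoing_deriv L u e (of_int j, - L / 2)) =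
      U1 (Lower j) (of_int j) - U1 (Lower (j - 1)) (of_int j) + of_real (w j) * U1 (Vertical j) (- L / 2)"
proof -
  have vd: "vector_derivative (on_edge L u e) (at t within {edge_lo L e..edge_hi L e}) = U1 e t"
    if "t \<in> {edge_lo L e..edge_hi L e}" for e t
    using vector_derivative_within_cbox[OF edge_lo_less[of e], of t "on_edge L u e" "U1 e t"]
      H2_data_has_vector_derivative[OF H that] that by simp
  have o: "outgoing_deriv L u e M = (if M = edge_point L e (edge_lo L e) then U1 e (edge_lo L e) else - U1 e (edge_hi L e))" for e M
    using vd[of "edge_lo L e" e] vd[of "edge_hi L e" e] edge_lo_less[of e]
    by (simp add: outgoing_deriv_def Let_def)
  show "(\<Sum>e \<in> incident_edges L (of_int j, L / 2). of_real (weight \<mu> e) * outgoing_deriv L u e (of_int j, L / 2)) =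
      U1 (Upper j) (of_int j) - U1 (Upper (j - 1)) (of_int j) - of_real (w j) * U1 (Vertical j) (L / 2)"
    unfolding incident_edges_upper using L by (simp add: o w_def weight_def)
  show "(\<Sum>e \<in> incident_edges L (of_int j, - L / 2). of_real (weight \<mu> e) * outgoing_deriv L u e (of_int j, - L / 2)) =
      U1 (Lower j) (of_int j) - U1 (Lower (j - 1)) (of_int j) + of_real (w j) * U1 (Vertical j) (- L / 2)"
    unfolding incident_edges_lower using L by (simp add: o w_def weight_def)
qed

section \<open>Reduction of the resolvent equation to a system of sequences\<close>

text \<open>
  On each edge a solution of \<open>(A - z) u = f\<close> is given by Duhamel's formula: on an upper edge by the
  value \<open>v j\<close> and slope \<open>a j\<close> at its left end, on a vertical edge (where it is odd) by the slope
  \<open>c j\<close> at the centre; the lower edges mirror the upper ones.  What remains are the continuity and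
  Kirchhoff conditions at the upper vertices.
\<close>

definition upper_val :: "complex \<Rightarrow> graph_fun \<Rightarrow> (int \<Rightarrow> complex) \<Rightarrow> (int \<Rightarrow> complex) \<Rightarrow> int \<Rightarrow> real \<Rightarrow> complex" where
  "upper_val z f v a j = Duhamel z (of_int j) (\<lambda>s. f (s, L / 2)) (v j) (a j)"

definition upper_slope :: "complex \<Rightarrow> graph_fun \<Rightarrow> (int \<Rightarrow> complex) \<Rightarrow> (int \<Rightarrow> complex) \<Rightarrow> int \<Rightarrow> real \<Rightarrow> complex" where
  "upper_slope z f v a j = Duhamel1 z (of_int j) (\<lambda>s. f (s, L / 2)) (v j) (a j)"

definition vertical_val :: "complex \<Rightarrow> graph_fun \<Rightarrow> (int \<Rightarrow> complex) \<Rightarrow> int \<Rightarrow> real \<Rightarrow> complex" where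
  "vertical_val z f c j = Duhamel z 0 (\<lambda>s. f (of_int j, s)) 0 (c j)"

definition vertical_slope :: "complex \<Rightarrow> graph_fun \<Rightarrow> (int \<Rightarrow> complex) \<Rightarrow> int \<Rightarrow> real \<Rightarrow> complex" where
  "vertical_slope z f c j = Duhamel1 z 0 (\<lambda>s. f (of_int j, s)) 0 (c j)"

definition vertex_system ::
  "complex \<Rightarrow> graph_fun \<Rightarrow> (int \<Rightarrow> complex) \<Rightarrow> (int \<Rightarrow> complex) \<Rightarrow> (int \<Rightarrow> complex) \<Rightarrow> bool" where
  "vertex_system z f v a c \<longleftrightarrow> (\<forall>j.
     upper_val z f v a j (of_int j + 1) = v (j + 1) \<and>
     vertical_val z f c j (L / 2) = v j \<and>
     a j - upper_slope z f v a (j - 1) (of_int j) = of_real (w j) * vertical_slope z f c j (L / 2))"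

lemma edge_data:
  assumes "(u, g) \<in> A"
  obtains U1 U2 where
    "\<And>e. H2_data (edge_lo L e) (edge_hi L e) (on_edge L u e) (U1 e) (U2 e)"
    "\<And>e. AE t in lebesgue_on {edge_lo L e<..<edge_hi L e}. on_edge L g e t = - U2 e t"
    "(\<lambda>e. L2_norm_sq (edge_lo L e) (edge_hi L e) (on_edge L u e) +
          L2_norm_sq (edge_lo L e) (edge_hi L e) (U2 e)) summable_on UNIV"
proof -
  define U2 where "U2 e = weak_deriv (edge_lo L e) (edge_hi L e) (weak_deriv (edge_lo L e) (edge_hi L e) (on_edge L u e))" for e
  have u: "continuous_on (ladder L) u" "\<And>e. on_edge L u e \<in> H2_on (edge_lo L e) (edge_hi L e)"
    "(\<lambda>e. H2_norm_sq (edge_lo L e) (edge_hi L e) (on_edge L u e)) summable_on UNIV"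
    using assms by (auto simp: Laplacian_antisym_def Laplacian_def Laplacian_domain_def H2_graph_def)
  have g: "AE t in lebesgue_on {edge_lo L e<..<edge_hi L e}. on_edge L g e t = - U2 e t" for e
    using assms unfolding Laplacian_antisym_def Laplacian_def U2_def by (auto simp: Let_def)
  have "\<exists>u1. H2_data (edge_lo L e) (edge_hi L e) (on_edge L u e) u1 (U2 e)" for e
    unfolding U2_def
    by (rule H2_on_imp_H2_data[OF edge_lo_less continuous_on_on_edge[OF u(1)] u(2)])
  then obtain U1 where U1: "\<And>e. H2_data (edge_lo L e) (edge_hi L e) (on_edge L u e) (U1 e) (U2 e)"
    by metis
  have "(\<lambda>e. L2_norm_sq (edge_lo L e) (edge_hi L e) (on_edge L u e) +
          L2_norm_sq (edge_lo L e) (edge_hi L e) (U2 e)) summable_on UNIV"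
    by (rule summable_on_comparison_test[OF u(3)])
       (auto simp: H2_norm_sq_def U2_def L2_norm_sq_nonneg)
  with that U1 g show ?thesis by blast
qed

lemma AE_lebesgue_on_subinterval:
  fixes a b c d :: real
  assumes "AE t in lebesgue_on {a<..<b}. P t" "a \<le> c" "d \<le> b"
  shows "AE t in lebesgue_on {c<..<d}. P t"
  using assms unfolding AE_lebesgue_on_interval_iff by fastforce

text \<open>
  The values and slopes at the left ends of the horizontal edges are square-summable by the trace
  estimate, summed over the edges.
\<close>

lemma vertex_system_of_solution:
  assumes ug: "(u, g) \<in> A" and f: "\<And>p. f p = g p - z * u p"
  obtains v a c where "vertex_system z f v a c" "l2 v" "l2 a"
    "\<And>j t. t \<in> {of_int j..of_int j + 1} \<Longrightarrow> u (t, L / 2) = upper_val z f v a j t"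
    "\<And>j t. t \<in> {0..L / 2} \<Longrightarrow> u (of_int j, t) = vertical_val z f c j t"
proof -
  obtain U1 U2 where H: "\<And>e. H2_data (edge_lo L e) (edge_hi L e) (on_edge L u e) (U1 e) (U2 e)"
    and ae: "\<And>e. AE t in lebesgue_on {edge_lo L e<..<edge_hi L e}. on_edge L g e t = - U2 e t"
    and sm: "(\<lambda>e. L2_norm_sq (edge_lo L e) (edge_hi L e) (on_edge L u e) +
          L2_norm_sq (edge_lo L e) (edge_hi L e) (U2 e)) summable_on UNIV"
    by (rule edge_data[OF ug]) (rule that, assumption+)
  have asym: "antisymmetric L u"
    using ug by (auto simp: Laplacian_antisym_def L2_antisym_def)
  have ae': "AE t in lebesgue_on {edge_lo L e<..<edge_hi L e}. U2 e t = - z * on_edge L u e t - on_edge L f e t" for e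
    using ae[of e] by eventually_elim (simp add: on_edge_def f)
  define v where "v j = u (of_int j, L / 2)" for j
  define a where "a j = U1 (Upper j) (of_int j)" for j
  define c where "c j = U1 (Vertical j) 0" for j
  have up: "u (t, L / 2) = upper_val z f v a j t \<and> U1 (Upper j) t = upper_slope z f v a j t"
    if t: "t \<in> {of_int j..of_int j + 1}" for j t
  proof -
    have H': "H2_data (of_int j) (of_int j + 1) (\<lambda>t. u (t, L / 2)) (U1 (Upper j)) (U2 (Upper j))"
      using H[of "Upper j"] by simp
    have e: "AE t in lebesgue_on {of_int j<..<of_int j + 1}. U2 (Upper j) t = - z * u (t, L / 2) - f (t, L / 2)"
      using ae'[of "Upper j"] by (simp only: edge_lo.simps edge_hi.simps on_edge_simps)
    show ?thesis
      using Duhamel_forward[OF H' e t]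
      by (simp add: upper_val_def upper_slope_def Duhamel_def Duhamel1_def v_def a_def)
  qed
  have vert: "u (of_int j, t) = vertical_val z f c j t \<and> U1 (Vertical j) t = vertical_slope z f c j t"
    if t: "t \<in> {0..L / 2}" for j t
  proof -
    have H': "H2_data 0 (L / 2) (\<lambda>t. u (of_int j, t)) (U1 (Vertical j)) (U2 (Vertical j))"
      using H2_data_subinterval[OF H[of "Vertical j"], of 0 "L / 2"] L by simp
    have "AE t in lebesgue_on {0<..<L / 2}. U2 (Vertical j) t = - z * on_edge L u (Vertical j) t - on_edge L f (Vertical j) t"
      by (rule AE_lebesgue_on_subinterval[OF ae']) (use L in auto)
    then have e: "AE t in lebesgue_on {0<..<L / 2}. U2 (Vertical j) t = - z * u (of_int j, t) - f (of_int j, t)"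
      by simp
    show ?thesis
      using Duhamel_forward[OF H' e t] antisymmetricD(3)[OF asym, of j]
      by (simp add: vertical_val_def vertical_slope_def Duhamel_def Duhamel1_def c_def)
  qed
  have "vertex_system z f v a c"
    unfolding vertex_system_def
  proof (intro allI conjI)
    fix j
    show "upper_val z f v a j (of_int j + 1) = v (j + 1)"
      using up[of "of_int j + 1" j] by (simp add: v_def)
    show "vertical_val z f c j (L / 2) = v j"
      using vert[of "L / 2" j] L by (simp add: v_def)
    have "(of_int j, 1 * L / 2) \<in> vertices L" unfolding vertices_def by blast
    then have "(\<Sum>e \<in> incident_edges L (of_int j, L / 2). of_real (weight \<mu> e) * outgoing_deriv L u e (of_int j, L / 2)) = 0"
      using ug by (auto simp: Laplacian_antisym_def Laplacian_def Laplacian_domain_def)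
    then have "a j - U1 (Upper (j - 1)) (of_int j) = of_real (w j) * U1 (Vertical j) (L / 2)"
      unfolding Kirchhoff_sums(1)[OF H] by (simp add: a_def)
    moreover have "U1 (Upper (j - 1)) (of_int j) = upper_slope z f v a (j - 1) (of_int j)"
      using up[of "of_int j" "j - 1"] by simp
    moreover have "U1 (Vertical j) (L / 2) = vertical_slope z f c j (L / 2)"
      using vert[of "L / 2" j] L by simp
    ultimately show "a j - upper_slope z f v a (j - 1) (of_int j) = of_real (w j) * vertical_slope z f c j (L / 2)"
      by simp
  qed
  moreover have "l2 v" "l2 a"
  proof -
    let ?g = "\<lambda>j. 72 * (L2_norm_sq (of_int j) (of_int j + 1) (\<lambda>t. u (t, L / 2)) + L2_norm_sq (of_int j) (of_int j + 1) (U2 (Upper j)))"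
    have s: "?g summable_on UNIV"
    proof (rule summable_on_cmult_right)
      show "(\<lambda>j. L2_norm_sq (of_int j) (of_int j + 1) (\<lambda>t. u (t, L / 2)) +
          L2_norm_sq (of_int j) (of_int j + 1) (U2 (Upper j))) summable_on UNIV"
        using sm unfolding summable_edges_iff by simp
    qed
    have H': "H2_data (of_int j) (of_int j + 1) (\<lambda>t. u (t, L / 2)) (U1 (Upper j)) (U2 (Upper j))" for j
      using H[of "Upper j"] by simp
    show "l2 v" by (rule l2I(1)[OF _ s]) (use H2_data_trace(1)[OF H'] in \<open>simp add: v_def\<close>)
    show "l2 a" by (rule l2I(1)[OF _ s]) (use H2_data_trace(2)[OF H'] in \<open>simp add: a_def\<close>)
  qed
  ultimately show ?thesis
    using that[of v a c] up vert by blast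
qed

end

context weighted_ladder begin

text \<open>
  Continuity is local, and near each point only finitely many closed edges meet.
\<close>

lemma continuous_on_ladder:
  assumes cont: "\<And>e. continuous_on {edge_lo L e..edge_hi L e} (on_edge L u e)"
  shows "continuous_on (ladder L) u"
proof -
  let ?E = "\<lambda>e. edge_point L e ` {edge_lo L e..edge_hi L e}"
  have edge: "continuous_on (?E e) u" for e
  proof -
    define \<pi> :: "real \<times> real \<Rightarrow> real" where "\<pi> = (case e of Vertical j \<Rightarrow> snd | _ \<Rightarrow> fst)"
    have c\<pi>: "continuous_on (?E e) \<pi>"
      by (cases e) (auto simp: \<pi>_def intro!: continuous_intros continuous_on_fst continuous_on_snd)
    have \<pi>: "\<pi> (edge_point L e t) = t" for t by (cases e) (auto simp: \<pi>_def)
    show ?thesis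
    proof (rule continuous_on_eq)
      show "continuous_on (?E e) (\<lambda>q. on_edge L u e (\<pi> q))"
        by (rule continuous_on_compose2[OF cont c\<pi>]) (auto simp: \<pi>)
      show "on_edge L u e (\<pi> q) = u q" if "q \<in> ?E e" for q
        using that by (auto simp: \<pi> on_edge_def)
    qed
  qed
  have closed: "closed (?E e)" for e
    by (intro compact_imp_closed compact_continuous_image continuous_on_edge_point) auto
  have "continuous (at p within ladder L) u" if p: "p \<in> ladder L" for p
  proof -
    define n where "n = \<lfloor>fst p\<rfloor>"
    define F where "F = Vertical ` {n-1..n+1} \<union> Upper ` {n-1..n+1} \<union> Lower ` {n-1..n+1}"
    define T :: "(real \<times> real) set" where "T = {of_int n - 1<..<of_int n + 2} \<times> UNIV"
    have F: "continuous_on (\<Union>e\<in>F. ?E e) u"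
      by (rule continuous_on_closed_Union) (auto simp: F_def intro: closed edge)
    have sub: "ladder L \<inter> T \<subseteq> (\<Union>e\<in>F. ?E e)"
    proof
      fix q assume q: "q \<in> ladder L \<inter> T"
      obtain x y where xy: "q = (x, y)" by (cases q)
      have x: "of_int n - 1 < x" "x < of_int n + 2" using q by (auto simp: T_def xy)
      then have fl: "\<lfloor>x\<rfloor> \<in> {n-1..n+1}" by (auto simp: le_floor_iff floor_le_iff)
      have fx: "of_int \<lfloor>x\<rfloor> \<le> x \<and> x \<le> of_int \<lfloor>x\<rfloor> + 1" by linarith
      from q have "y = L / 2 \<or> y = - L / 2 \<or> (x \<in> \<int> \<and> - L / 2 \<le> y \<and> y \<le> L / 2)"
        by (simp add: xy mem_ladder_iff)
      then consider "y = L / 2" | "y = - L / 2" | "x \<in> \<int>" "- L / 2 \<le> y" "y \<le> L / 2" by blast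
      then show "q \<in> (\<Union>e\<in>F. ?E e)"
      proof cases
        case 1
        then have "q \<in> ?E (Upper \<lfloor>x\<rfloor>)" using fx by (auto simp: xy)
        then show ?thesis using fl unfolding F_def by blast
      next
        case 2
        then have "q \<in> ?E (Lower \<lfloor>x\<rfloor>)" using fx by (auto simp: xy)
        then show ?thesis using fl unfolding F_def by blast
      next
        case 3
        then have "x = of_int \<lfloor>x\<rfloor>" by (metis Ints_cases floor_of_int)
        then have "q \<in> ?E (Vertical \<lfloor>x\<rfloor>)" using 3 by (auto simp: xy)
        then show ?thesis using fl unfolding F_def by blast
      qed
    qed
    have opT: "open T" unfolding T_def by (intro open_Times) auto
    have pT: "p \<in> T" unfolding T_def n_def by (cases p) (simp, linarith)
    have "continuous_on (ladder L \<inter> T) u" by (rule continuous_on_subset[OF F sub])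
    then have "continuous (at p within ladder L \<inter> T) u"
      using p pT by (simp add: continuous_on_eq_continuous_within)
    moreover have "at p within ladder L \<inter> T = at p within ladder L"
      by (rule at_within_nhd[OF pT opT]) auto
    ultimately show ?thesis by simp
  qed
  then show ?thesis by (simp add: continuous_on_eq_continuous_within)
qed

text \<open>
  The function with the given edge data.  At a vertex the formulas of the adjacent edges agree by the
  vertex conditions, so any of them may be chosen there.
\<close>

definition glue :: "complex \<Rightarrow> graph_fun \<Rightarrow> (int \<Rightarrow> complex) \<Rightarrow> (int \<Rightarrow> complex) \<Rightarrow> (int \<Rightarrow> complex) \<Rightarrow> graph_fun" where
  "glue z f v a c p = (case p of (x, y) \<Rightarrow>
     if y = L / 2 then upper_val z f v a \<lfloor>x\<rfloor> x
     else if y = - L / 2 then - upper_val z f v a \<lfloor>x\<rfloor> x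
     else if 0 \<le> y then vertical_val z f c \<lfloor>x\<rfloor> y
     else - vertical_val z f c \<lfloor>x\<rfloor> (- y))"

lemma glue_upper:
  assumes sys: "vertex_system z f v a c" and t: "t \<in> {of_int j..of_int j + 1}"
  shows "glue z f v a c (t, L / 2) = upper_val z f v a j t"
    "glue z f v a c (t, - L / 2) = - upper_val z f v a j t"
proof -
  have "upper_val z f v a \<lfloor>t\<rfloor> t = upper_val z f v a j t"
  proof (cases "t = of_int j + 1")
    case True
    then have "t = of_int (j + 1)" by simp
    then have "\<lfloor>t\<rfloor> = j + 1" by (simp only: floor_of_int)
    then show ?thesis using sys True by (simp add: vertex_system_def upper_val_def)
  next
    case False
    then have "\<lfloor>t\<rfloor> = j" using t by (auto intro!: floor_unique simp: less_le)
    then show ?thesis by simp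
  qed
  then show "glue z f v a c (t, L / 2) = upper_val z f v a j t"
    "glue z f v a c (t, - L / 2) = - upper_val z f v a j t"
    using L by (auto simp: glue_def)
qed

lemma glue_vertical:
  assumes sys: "vertex_system z f v a c" and y: "y \<in> {- L / 2..L / 2}"
  shows "glue z f v a c (of_int j, y) = (if 0 \<le> y then vertical_val z f c j y else - vertical_val z f c j (- y))"
proof -
  have "vertical_val z f c j (L / 2) = upper_val z f v a j (of_int j)"
    using sys by (simp add: vertex_system_def upper_val_def)
  then show ?thesis using L by (auto simp: glue_def)
qed

lemma glue_antisymmetric:
  assumes sys: "vertex_system z f v a c"
  shows "antisymmetric L (glue z f v a c)"
proof -
  have "glue z f v a c (x, y) = - glue z f v a c (x, - y)" if m: "(x, y) \<in> ladder L" for x y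
  proof -
    consider "y = L / 2" | "y = - L / 2" | j where "x = of_int j" "y \<in> {- L / 2..L / 2}" "y \<noteq> L / 2" "y \<noteq> - L / 2"
      using m by (auto simp: mem_ladder_iff elim: Ints_cases)
    then show ?thesis
    proof cases
      case 3
      have "- y \<in> {- L / 2..L / 2}" using 3(2) by auto
      with glue_vertical[OF sys 3(2)] glue_vertical[OF sys this]
      show ?thesis by (auto simp: 3(1) vertical_val_def)
    qed (use L in \<open>auto simp: glue_def\<close>)
  qed
  then show ?thesis by (auto simp: antisymmetric_def)
qed

text \<open>
  Conversely, square-summable solutions of the vertex conditions glue to an element of the domain,
  with norm controlled by the data.
\<close>

lemma solution_of_vertex_system:
  "\<exists>K\<ge>0. \<forall>f v a c. f \<in> X \<longrightarrow> l2 v \<longrightarrow> l2 a \<longrightarrow> l2 c \<longrightarrow> vertex_system z f v a c \<longrightarrow>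
     (glue z f v a c, \<lambda>p. f p + z * glue z f v a c p) \<in> A \<and>
     nsq (glue z f v a c) \<le> K * (l2n v + l2n a + l2n c + nsq f)"
proof -
  obtain K1 where K1: "K1 \<ge> 0" "\<And>b f \<alpha> \<beta> t. f \<in> L2_on b (b + 1) \<Longrightarrow> t \<in> {b..b + 1} \<Longrightarrow>
    (norm (Duhamel z b f \<alpha> \<beta> t))\<^sup>2 \<le> K1 * ((norm \<alpha>)\<^sup>2 + (norm \<beta>)\<^sup>2 + L2_norm_sq b (b + 1) f) \<and>
    (norm (Duhamel1 z b f \<alpha> \<beta> t))\<^sup>2 \<le> K1 * ((norm \<alpha>)\<^sup>2 + (norm \<beta>)\<^sup>2 + L2_norm_sq b (b + 1) f)"
    using Duhamel_bound[of 1 z] by auto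
  obtain K2 where K2: "K2 \<ge> 0" "\<And>b f \<alpha> \<beta> t. f \<in> L2_on b (b + L / 2) \<Longrightarrow> t \<in> {b..b + L / 2} \<Longrightarrow>
    (norm (Duhamel z b f \<alpha> \<beta> t))\<^sup>2 \<le> K2 * ((norm \<alpha>)\<^sup>2 + (norm \<beta>)\<^sup>2 + L2_norm_sq b (b + L / 2) f) \<and>
    (norm (Duhamel1 z b f \<alpha> \<beta> t))\<^sup>2 \<le> K2 * ((norm \<alpha>)\<^sup>2 + (norm \<beta>)\<^sup>2 + L2_norm_sq b (b + L / 2) f)"
    using Duhamel_bound[of "L / 2" z] L by auto
  define K where "K = K1 + K2"
  have K: "0 \<le> K" "K1 \<le> K" "K2 \<le> K" using K1(1) K2(1) by (auto simp: K_def)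
  define l where "l = 1 + L"
  have l: "0 \<le> l" "edge_hi L e - edge_lo L e \<le> l" for e
    using L by (cases e; simp add: l_def)+
  define C where "C = (2 + 2 * (norm z)\<^sup>2) * (l * K) + 2"
  define K' where "K' = (1 + \<mu>) * (l * K) * (4 + 3 * (1 + 1 / \<mu>))"
  have "(glue z f v a c, \<lambda>p. f p + z * glue z f v a c p) \<in> A \<and>
     nsq (glue z f v a c) \<le> K' * (l2n v + l2n a + l2n c + nsq f)"
    if f: "f \<in> X" and v: "l2 v" and a: "l2 a" and c: "l2 c" and sys: "vertex_system z f v a c" for f v a c
  proof -
    define u where "u = glue z f v a c"
    define g where "g p = f p + z * u p" for p
    have fL2: "f \<in> L2_graph L \<mu>" and fa: "antisymmetric L f" using f by (auto simp: L2_antisym_def)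
    have foe: "on_edge L f e \<in> L2_on (edge_lo L e) (edge_hi L e)" for e
      using fL2 by (simp add: L2_graph_iff)
    have ua: "antisymmetric L u" unfolding u_def by (rule glue_antisymmetric[OF sys])
    have fU: "(\<lambda>s. f (s, L / 2)) \<in> L2_on (of_int j) (of_int j + 1)" for j
      using foe[of "Upper j"] by simp
    have fV: "(\<lambda>s. f (of_int j, s)) \<in> L2_on (- L / 2) (L / 2)" for j
      using foe[of "Vertical j"] by simp
    have fV0: "(\<lambda>s. f (of_int j, s)) \<in> L2_on 0 (L / 2)"
      "L2_norm_sq 0 (L / 2) (\<lambda>s. f (of_int j, s)) \<le> edge_norm_sq L f (Vertical j)" for j
      using L2_on_subinterval[OF fV, of 0 "L / 2"] L by (auto simp: edge_norm_sq_def)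
    define U1 where "U1 e = (case e of Vertical j \<Rightarrow> (\<lambda>t. vertical_slope z f c j \<bar>t\<bar>)
      | Upper j \<Rightarrow> upper_slope z f v a j | Lower j \<Rightarrow> (\<lambda>t. (-1) * upper_slope z f v a j t))" for e
    define U2 where "U2 e t = - z * on_edge L u e t - on_edge L f e t" for e t
    have HU: "H2_data (of_int j) (of_int j + 1) (upper_val z f v a j) (upper_slope z f v a j)
        (\<lambda>t. - z * upper_val z f v a j t - f (t, L / 2))" for j
      unfolding upper_val_def upper_slope_def by (rule Duhamel_H2_data) (use fU in auto)
    have HV: "H2_data 0 (L / 2) (vertical_val z f c j) (vertical_slope z f c j)
        (\<lambda>t. - z * vertical_val z f c j t - f (of_int j, t))" for j
      unfolding vertical_val_def vertical_slope_def by (rule Duhamel_H2_data) (use fV0 L in auto)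
    have H: "H2_data (edge_lo L e) (edge_hi L e) (on_edge L u e) (U1 e) (U2 e)" for e
    proof (cases e)
      case (Upper j)
      show ?thesis unfolding Upper
        by (rule H2_data_cong[where u = "upper_val z f v a j" and ?u2.0 = "\<lambda>t. - z * upper_val z f v a j t - f (t, L / 2)"])
           (use HU[of j] glue_upper(1)[OF sys] in \<open>auto simp: U1_def U2_def u_def\<close>)
    next
      case (Lower j)
      show ?thesis unfolding Lower
        by (rule H2_data_cong[where u = "\<lambda>t. (-1) * upper_val z f v a j t"
              and ?u2.0 = "\<lambda>t. (-1) * (- z * upper_val z f v a j t - f (t, L / 2))"])
           (use H2_data_scale[OF HU[of j], of "-1"] glue_upper(2)[OF sys] antisymmetricD(1)[OF fa]
            in \<open>auto simp: U1_def U2_def u_def\<close>)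
    next
      case (Vertical j)
      let ?V = "\<lambda>t. if 0 \<le> t then vertical_val z f c j t else - vertical_val z f c j (- t)"
      have ue: "u (of_int j, t) = ?V t" if "t \<in> {- L / 2..L / 2}" for t
        unfolding u_def using glue_vertical[OF sys that] by simp
      have H0: "H2_data 0 (L / 2) (vertical_val z f c j) (vertical_slope z f c j) (U2 (Vertical j))"
        by (rule H2_data_cong[OF HV[of j]]) (use L ue in \<open>auto simp: U2_def\<close>)
      have Vc: "continuous_on {- L / 2..L / 2} ?V"
      proof -
        have c0: "continuous_on {0..L / 2} (vertical_val z f c j)" by (rule H2_data_continuous(1)[OF HV])
        have "continuous_on ({- L / 2..0} \<union> {0..L / 2}) (\<lambda>t. if t \<in> {- L / 2..0} then - vertical_val z f c j (- t) else vertical_val z f c j t)"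
        proof (rule continuous_on_cases)
          show "continuous_on {- L / 2..0} (\<lambda>t. - vertical_val z f c j (- t))"
            by (intro continuous_intros continuous_on_compose2[OF c0]) auto
        qed (use c0 in \<open>auto simp: vertical_val_def\<close>)
        moreover have "{- L / 2..0} \<union> {0..L / 2} = {- L / 2..L / 2}" using L by auto
        ultimately have "continuous_on {- L / 2..L / 2} (\<lambda>t. if t \<in> {- L / 2..0} then - vertical_val z f c j (- t) else vertical_val z f c j t)"
          by simp
        then show ?thesis
          by (rule continuous_on_eq) (auto simp: vertical_val_def)
      qed
      have "U2 (Vertical j) \<in> L2_on (- L / 2) (L / 2)"
      proof -
        have "(\<lambda>t. - z * ?V t + (-1) * f (of_int j, t)) \<in> L2_on (- L / 2) (L / 2)"
          by (intro L2_on_add(1) L2_on_scale(1) L2_on_continuous[OF Vc] fV)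
        then show ?thesis
          by (rule L2_on_cong(1)[THEN iffD1, rotated]) (use ue in \<open>auto simp: U2_def\<close>)
      qed
      then have u2: "U2 (Vertical j) \<in> L2_on (- (L / 2)) (L / 2)" by simp
      have "H2_data (- (L / 2)) (L / 2) ?V (\<lambda>t. vertical_slope z f c j \<bar>t\<bar>) (U2 (Vertical j))"
      proof (rule H2_data_odd_extension[OF H0 _ _ u2])
        fix t assume "t \<in> {0..L / 2}"
        then show "U2 (Vertical j) (- t) = - U2 (Vertical j) t"
          using antisymmetricD(2)[OF fa, of t j] antisymmetricD(2)[OF ua, of t j] L by (simp add: U2_def)
      qed (use L in \<open>auto simp: vertical_val_def\<close>)
      then have HV': "H2_data (- L / 2) (L / 2) ?V (\<lambda>t. vertical_slope z f c j \<bar>t\<bar>) (U2 (Vertical j))" by simp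
      show ?thesis unfolding Vertical
        using H2_data_cong[OF HV', of "\<lambda>t. u (of_int j, t)" "U2 (Vertical j)"] ue L by (simp add: U1_def)
    qed
    note HH = H2_data_imp_H2_on[OF edge_lo_less H]
    define Y where "Y e = (case e of Vertical j \<Rightarrow> (norm (c j))\<^sup>2 + edge_norm_sq L f (Vertical j)
      | Upper j \<Rightarrow> (norm (v j))\<^sup>2 + (norm (a j))\<^sup>2 + edge_norm_sq L f (Upper j)
      | Lower j \<Rightarrow> (norm (v j))\<^sup>2 + (norm (a j))\<^sup>2 + edge_norm_sq L f (Upper j))" for e
    have fLow: "edge_norm_sq L f (Lower j) = edge_norm_sq L f (Upper j)" for j
      using L2_on_scale(2)[OF fU[of j], of "-1"] antisymmetricD(1)[OF fa] by (simp add: edge_norm_sq_def)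
    have Y0: "0 \<le> Y e" for e by (cases e) (auto simp: Y_def edge_norm_sq_nonneg)
    have fY: "edge_norm_sq L f e \<le> Y e" for e by (cases e) (auto simp: Y_def fLow)
    have upb: "(norm (upper_val z f v a j t))\<^sup>2 \<le> K * Y (Upper j)" "(norm (upper_slope z f v a j t))\<^sup>2 \<le> K * Y (Upper j)"
      if "t \<in> {of_int j..of_int j + 1}" for j t
    proof -
      have "K1 * Y (Upper j) \<le> K * Y (Upper j)" by (rule mult_right_mono[OF K(2) Y0])
      then show "(norm (upper_val z f v a j t))\<^sup>2 \<le> K * Y (Upper j)" "(norm (upper_slope z f v a j t))\<^sup>2 \<le> K * Y (Upper j)"
        using K1(2)[OF fU that, of "v j" "a j"]
        by (auto simp: upper_val_def upper_slope_def Y_def edge_norm_sq_def)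
    qed
    have vb: "(norm (vertical_val z f c j t))\<^sup>2 \<le> K * Y (Vertical j)" "(norm (vertical_slope z f c j t))\<^sup>2 \<le> K * Y (Vertical j)"
      if t: "t \<in> {0..L / 2}" for j t
    proof -
      have "K2 * ((norm (0::complex))\<^sup>2 + (norm (c j))\<^sup>2 + L2_norm_sq 0 (0 + L / 2) (\<lambda>s. f (of_int j, s))) \<le> K * Y (Vertical j)"
        using fV0(2)[of j] K by (intro mult_mono) (auto simp: Y_def L2_norm_sq_nonneg)
      moreover have "t \<in> {0..0 + L / 2}" "(\<lambda>s. f (of_int j, s)) \<in> L2_on 0 (0 + L / 2)" using t fV0(1) by auto
      ultimately show "(norm (vertical_val z f c j t))\<^sup>2 \<le> K * Y (Vertical j)" "(norm (vertical_slope z f c j t))\<^sup>2 \<le> K * Y (Vertical j)"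
        using K2(2)[of "\<lambda>s. f (of_int j, s)" 0 t 0 "c j"]
        unfolding vertical_val_def vertical_slope_def by linarith+
    qed
    have pw: "(norm (on_edge L u e t))\<^sup>2 \<le> K * Y e \<and> (norm (U1 e t))\<^sup>2 \<le> K * Y e"
      if t: "t \<in> {edge_lo L e..edge_hi L e}" for e t
    proof (cases e)
      case (Upper j)
      then show ?thesis using t upb[of t j] glue_upper(1)[OF sys, of t j] by (simp add: u_def U1_def)
    next
      case (Lower j)
      moreover have "Y (Lower j) = Y (Upper j)" by (simp add: Y_def)
      ultimately show ?thesis using t upb[of t j] glue_upper(2)[OF sys, of t j] by (simp add: u_def U1_def)
    next
      case (Vertical j)
      then have t': "t \<in> {- L / 2..L / 2}" using t by simp
      then have abs: "\<bar>t\<bar> \<in> {0..L / 2}" by auto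
      show ?thesis using glue_vertical[OF sys t', of j] vb[OF abs, of j]
        by (auto simp: Vertical u_def U1_def split: if_splits)
    qed
    have L2u: "on_edge L u e \<in> L2_on (edge_lo L e) (edge_hi L e)" and L2U1: "U1 e \<in> L2_on (edge_lo L e) (edge_hi L e)" for e
      using H2_data_continuous[OF H] by (auto intro: L2_on_continuous)
    have L2b: "L2_norm_sq (edge_lo L e) (edge_hi L e) h \<le> l * K * Y e"
      if h: "h \<in> L2_on (edge_lo L e) (edge_hi L e)" "\<And>t. t \<in> {edge_lo L e..edge_hi L e} \<Longrightarrow> (norm (h t))\<^sup>2 \<le> K * Y e" for h e
    proof -
      have "L2_norm_sq (edge_lo L e) (edge_hi L e) h \<le> (edge_hi L e - edge_lo L e) * (sqrt (K * Y e))\<^sup>2"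
        by (rule L2_norm_sq_le_const[OF h(1)]) (use h(2) edge_lo_less[of e] in \<open>auto intro: real_le_rsqrt\<close>)
      also have "\<dots> \<le> l * (K * Y e)"
        using l(2)[of e] K(1) Y0[of e] by (simp add: mult_right_mono)
      finally show ?thesis by simp
    qed
    have ub: "edge_norm_sq L u e \<le> l * K * Y e" for e
      unfolding edge_norm_sq_def by (rule L2b[OF L2u]) (use pw in auto)
    have U1b: "L2_norm_sq (edge_lo L e) (edge_hi L e) (U1 e) \<le> l * K * Y e" for e
      by (rule L2b[OF L2U1]) (use pw in auto)
    have U2b: "L2_norm_sq (edge_lo L e) (edge_hi L e) (U2 e) \<le> 2 * ((norm z)\<^sup>2 * (l * K * Y e)) + 2 * Y e" for e
    proof -
      have "U2 e = (\<lambda>t. - z * on_edge L u e t + (-1) * on_edge L f e t)" by (auto simp: U2_def)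
      then have "L2_norm_sq (edge_lo L e) (edge_hi L e) (U2 e) \<le>
          2 * ((norm z)\<^sup>2 * edge_norm_sq L u e) + 2 * edge_norm_sq L f e"
        using L2_on_add(2)[OF L2_on_scale(1)[OF L2u[of e], of "- z"] L2_on_scale(1)[OF foe[of e], of "-1"]]
          L2_on_scale(2)[OF L2u[of e], of "- z"] L2_on_scale(2)[OF foe[of e], of "-1"]
        by (simp add: edge_norm_sq_def)
      also have "\<dots> \<le> 2 * ((norm z)\<^sup>2 * (l * K * Y e)) + 2 * Y e"
        using ub[of e] fY[of e] by (intro add_mono mult_left_mono) auto
      finally show ?thesis .
    qed
    have H2b: "H2_norm_sq (edge_lo L e) (edge_hi L e) (on_edge L u e) \<le> C * Y e" for e
    proof -
      have "H2_norm_sq (edge_lo L e) (edge_hi L e) (on_edge L u e) \<le>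
          l * K * Y e + l * K * Y e + (2 * ((norm z)\<^sup>2 * (l * K * Y e)) + 2 * Y e)"
        unfolding HH(3) using ub[of e, unfolded edge_norm_sq_def] U1b[of e] U2b[of e] by linarith
      also have "\<dots> = C * Y e" by (simp add: C_def algebra_simps)
      finally show ?thesis .
    qed
    note fs = edge_norms_le[OF fL2]
    have sY: "Y summable_on UNIV"
      unfolding summable_edges_iff using v a c fs by (auto simp: Y_def l2_def intro!: summable_on_add)
    have uL2: "u \<in> L2_graph L \<mu>"
      unfolding L2_graph_iff
    proof (intro conjI allI L2u)
      show "edge_norm_sq L u summable_on UNIV"
        by (rule summable_on_comparison_test[OF summable_on_cmult_right[OF sY, of "l * K"]])
           (use ub edge_norm_sq_nonneg in auto)
    qed
    have gL2: "g \<in> L2_graph L \<mu>"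
      unfolding g_def by (intro L2_graph_add fL2 L2_graph_scale uL2)
    have ga: "antisymmetric L g"
      using ua fa unfolding antisymmetric_def g_def by (auto simp: algebra_simps split: prod.splits)
    have uH2: "u \<in> H2_graph L \<mu>"
      unfolding H2_graph_def
    proof (intro CollectI conjI allI uL2 HH(1))
      show "continuous_on (ladder L) u"
        by (rule continuous_on_ladder[OF H2_data_continuous(1)[OF H]])
      show "(\<lambda>e. H2_norm_sq (edge_lo L e) (edge_hi L e) (on_edge L u e)) summable_on UNIV"
        by (rule summable_on_comparison_test[OF summable_on_cmult_right[OF sY, of C]])
           (use H2b in \<open>auto simp: H2_norm_sq_def L2_norm_sq_nonneg\<close>)
    qed
    have Kir: "U1 (Upper j) (of_int j) - U1 (Upper (j - 1)) (of_int j) - of_real (w j) * U1 (Vertical j) (L / 2) = 0"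
      "U1 (Lower j) (of_int j) - U1 (Lower (j - 1)) (of_int j) + of_real (w j) * U1 (Vertical j) (- L / 2) = 0" for j
    proof -
      have "a j - upper_slope z f v a (j - 1) (of_int j) = of_real (w j) * vertical_slope z f c j (L / 2)"
        using sys by (simp add: vertex_system_def)
      then have "a j = upper_slope z f v a (j - 1) (of_int j) + of_real (w j) * vertical_slope z f c j (L / 2)"
        by (simp add: algebra_simps)
      moreover have "upper_slope z f v a j (of_int j) = a j" by (simp add: upper_slope_def)
      ultimately show "U1 (Upper j) (of_int j) - U1 (Upper (j - 1)) (of_int j) - of_real (w j) * U1 (Vertical j) (L / 2) = 0"
        "U1 (Lower j) (of_int j) - U1 (Lower (j - 1)) (of_int j) + of_real (w j) * U1 (Vertical j) (- L / 2) = 0"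
        using L by (simp_all add: U1_def)
    qed
    have dom: "u \<in> Laplacian_domain L \<mu>"
      unfolding Laplacian_domain_def
    proof (intro CollectI conjI uH2 ballI)
      fix M assume "M \<in> vertices L"
      then obtain j s where "M = (of_int j, s * L / 2)" "s \<in> {-1, 1}"
        by (auto simp: vertices_def)
      then have "M = (of_int j, L / 2) \<or> M = (of_int j, - L / 2)" by auto
      then show "(\<Sum>e \<in> incident_edges L M. of_real (weight \<mu> e) * outgoing_deriv L u e M) = 0"
        using Kirchhoff_sums[OF H, of j] Kir[of j] by auto
    qed
    have ae: "AE t in lebesgue_on {edge_lo L e<..<edge_hi L e}. on_edge L g e t =
        - weak_deriv (edge_lo L e) (edge_hi L e) (weak_deriv (edge_lo L e) (edge_hi L e) (on_edge L u e)) t" for e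
      using HH(2)[of e] by eventually_elim (simp add: U2_def g_def on_edge_def)
    have "(u, g) \<in> A"
      unfolding Laplacian_antisym_def Laplacian_def L2_antisym_def Let_def
      using dom gL2 uL2 ua ga ae by simp
    moreover have "nsq u \<le> K' * (l2n v + l2n a + l2n c + nsq f)"
    proof -
      have "nsq u \<le> (\<Sum>\<^sub>\<infinity>e. ((1 + \<mu>) * (l * K)) * Y e)"
        unfolding nsq_def
      proof (rule infsum_mono)
        show "(\<lambda>e. weight \<mu> e * edge_norm_sq L u e) summable_on UNIV"
          using uL2 by (simp add: summable_weight_iff edge_norm_sq_nonneg L2_graph_iff)
        show "(\<lambda>e. (1 + \<mu>) * (l * K) * Y e) summable_on UNIV" by (rule summable_on_cmult_right[OF sY])
        fix e
        have "weight \<mu> e * edge_norm_sq L u e \<le> (1 + \<mu>) * (l * K * Y e)"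
          using weight_bounds(1,2)[of e] ub[of e] mu by (intro mult_mono) (auto simp: edge_norm_sq_nonneg)
        then show "weight \<mu> e * edge_norm_sq L u e \<le> (1 + \<mu>) * (l * K) * Y e" by (simp add: mult.assoc)
      qed
      also have "\<dots> = (1 + \<mu>) * (l * K) * infsum Y UNIV" by (simp add: infsum_cmult_right')
      also have "\<dots> \<le> (1 + \<mu>) * (l * K) * ((4 + 3 * (1 + 1 / \<mu>)) * (l2n v + l2n a + l2n c + nsq f))"
      proof (rule mult_left_mono)
        have 1: "(\<Sum>\<^sub>\<infinity>j. (norm (c j))\<^sup>2 + edge_norm_sq L f (Vertical j)) = l2n c + (\<Sum>\<^sub>\<infinity>j. edge_norm_sq L f (Vertical j))"
          using c fs unfolding l2_def l2n_def by (intro infsum_add)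
        have 2: "(\<Sum>\<^sub>\<infinity>j. (norm (v j))\<^sup>2 + (norm (a j))\<^sup>2 + edge_norm_sq L f (Upper j)) =
            l2n v + l2n a + (\<Sum>\<^sub>\<infinity>j. edge_norm_sq L f (Upper j))"
          using v a fs unfolding l2_def l2n_def by (subst infsum_add; (subst infsum_add)?; auto intro!: summable_on_add)
        have "infsum Y UNIV = (l2n c + (\<Sum>\<^sub>\<infinity>j. edge_norm_sq L f (Vertical j))) +
            2 * (l2n v + l2n a + (\<Sum>\<^sub>\<infinity>j. edge_norm_sq L f (Upper j)))"
          unfolding infsum_edges[OF sY] using 1 2 by (simp add: Y_def)
        also have "\<dots> \<le> (l2n c + (1 + 1 / \<mu>) * nsq f) + 2 * (l2n v + l2n a + (1 + 1 / \<mu>) * nsq f)"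
          by (intro add_mono mult_left_mono fs(4,5) order.refl) simp
        also have "\<dots> = 2 * l2n v + 2 * l2n a + l2n c + 3 * (1 + 1 / \<mu>) * nsq f"
          by (simp add: algebra_simps)
        also have "\<dots> \<le> (4 + 3 * (1 + 1 / \<mu>)) * (l2n v + l2n a + l2n c + nsq f)"
        proof -
          define m where "m = 3 * (1 + 1 / \<mu>)"
          have m: "0 \<le> m" using mu by (simp add: m_def)
          have nn: "0 \<le> l2n v" "0 \<le> l2n a" "0 \<le> l2n c" "0 \<le> nsq f" by (auto intro: l2n_nonneg nsq_nonneg)
          have "0 \<le> m * (l2n v + l2n a + l2n c)" using m nn by simp
          then show ?thesis unfolding m_def[symmetric] using nn by (simp add: algebra_simps)
        qed
        finally show "infsum Y UNIV \<le> (4 + 3 * (1 + 1 / \<mu>)) * (l2n v + l2n a + l2n c + nsq f)" .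
        show "0 \<le> (1 + \<mu>) * (l * K)" using mu l(1) K(1) by simp
      qed
      finally show ?thesis by (simp add: K'_def mult.assoc)
    qed
    ultimately show ?thesis by (simp add: u_def g_def[abs_def])
  qed
  moreover have "K' \<ge> 0" using mu l(1) K(1) by (simp add: K'_def)
  ultimately show ?thesis by blast
qed

end

section \<open>Solving the vertex system\<close>

context weighted_ladder begin

text \<open>
  The contributions of the right-hand side to value and slope at the far end of an upper edge and of the
  upper half of a vertical edge.
\<close>

definition srcS :: "complex \<Rightarrow> graph_fun \<Rightarrow> int \<Rightarrow> complex" where
  "srcS z f j = integral {of_int j..of_int j + 1} (\<lambda>s. sinz z (of_int j + 1 - s) * f (s, L / 2))"

definition srcC :: "complex \<Rightarrow> graph_fun \<Rightarrow> int \<Rightarrow> complex" where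
  "srcC z f j = integral {of_int j..of_int j + 1} (\<lambda>s. cosz z (of_int j + 1 - s) * f (s, L / 2))"

definition vsrcS :: "complex \<Rightarrow> graph_fun \<Rightarrow> int \<Rightarrow> complex" where
  "vsrcS z f j = integral {0..L / 2} (\<lambda>s. sinz z (L / 2 - s) * f (of_int j, s))"

definition vsrcC :: "complex \<Rightarrow> graph_fun \<Rightarrow> int \<Rightarrow> complex" where
  "vsrcC z f j = integral {0..L / 2} (\<lambda>s. cosz z (L / 2 - s) * f (of_int j, s))"

lemma vertex_system_iff:
  "vertex_system z f v a c \<longleftrightarrow> (\<forall>j.
     v (j + 1) = v j * cosz z 1 + a j * sinz z 1 - srcS z f j \<and>
     v j = c j * sinz z (L / 2) - vsrcS z f j \<and>
     a j - (- z * v (j - 1) * sinz z 1 + a (j - 1) * cosz z 1 - srcC z f (j - 1)) =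
       of_real (w j) * (c j * cosz z (L / 2) - vsrcC z f j))"
proof -
  have 1: "upper_val z f v a j (of_int j + 1) = v j * cosz z 1 + a j * sinz z 1 - srcS z f j" for j
    by (simp add: upper_val_def Duhamel_def srcS_def)
  have 2: "vertical_val z f c j (L / 2) = c j * sinz z (L / 2) - vsrcS z f j" for j
    by (simp add: vertical_val_def Duhamel_def vsrcS_def)
  have 3: "vertical_slope z f c j (L / 2) = c j * cosz z (L / 2) - vsrcC z f j" for j
    by (simp add: vertical_slope_def Duhamel1_def vsrcC_def)
  have 4: "upper_slope z f v a (j - 1) (of_int j) =
      - z * v (j - 1) * sinz z 1 + a (j - 1) * cosz z 1 - srcC z f (j - 1)" for j
    by (simp add: upper_slope_def Duhamel1_def srcC_def)
  show ?thesis unfolding vertex_system_def 1 2 3 4 by metis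
qed

text \<open>
  With \<open>z = \<omega>\<^sup>2\<close> this is \<open>sin \<omega> * cot (\<omega> * L / 2)\<close>: the odd solution on a vertical edge acts on the
  horizontal line as a point coupling of this strength, multiplied by the weight.
\<close>

definition trace_coeff :: "complex \<Rightarrow> complex" where
  "trace_coeff z = sinz z 1 * cosz z (L / 2) / sinz z (L / 2)"

definition slope_of :: "complex \<Rightarrow> graph_fun \<Rightarrow> (int \<Rightarrow> complex) \<Rightarrow> int \<Rightarrow> complex" where
  "slope_of z f v j = (v (j + 1) - cosz z 1 * v j + srcS z f j) / sinz z 1"

definition centre_of :: "complex \<Rightarrow> graph_fun \<Rightarrow> (int \<Rightarrow> complex) \<Rightarrow> int \<Rightarrow> complex" where
  "centre_of z f v j = (v j + vsrcS z f j) / sinz z (L / 2)"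

definition rhs_of :: "complex \<Rightarrow> graph_fun \<Rightarrow> int \<Rightarrow> complex" where
  "rhs_of z f j = - srcS z f j + cosz z 1 * srcS z f (j - 1) - sinz z 1 * srcC z f (j - 1) +
     of_real (w j) * (trace_coeff z * vsrcS z f j - sinz z 1 * vsrcC z f j)"

text \<open>Eliminating the slopes leaves a three-term recurrence for the vertex values.\<close>

lemma vertex_system_iff_recurrence:
  assumes S: "sinz z 1 \<noteq> 0" "sinz z (L / 2) \<noteq> 0"
  shows "vertex_system z f v a c \<longleftrightarrow> a = slope_of z f v \<and> c = centre_of z f v \<and>
    (\<forall>j. v (j + 1) + v (j - 1) - (2 * cosz z 1 + of_real (w j) * trace_coeff z) * v j = rhs_of z f j)"
proof -
  have sq: "cosz z 1 * cosz z 1 + z * sinz z 1 * sinz z 1 = 1" by (rule cosz_sinz_sq)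
  have a: "v (j + 1) = v j * cosz z 1 + a j * sinz z 1 - srcS z f j \<longleftrightarrow> a j = slope_of z f v j" for j
    using S(1) by (auto simp: slope_of_def field_simps)
  have c: "v j = c j * sinz z (L / 2) - vsrcS z f j \<longleftrightarrow> c j = centre_of z f v j" for j
    using S(2) by (auto simp: centre_of_def field_simps)
  have k: "slope_of z f v j - (- z * v (j - 1) * sinz z 1 + slope_of z f v (j - 1) * cosz z 1 - srcC z f (j - 1)) =
       of_real (w j) * (centre_of z f v j * cosz z (L / 2) - vsrcC z f j) \<longleftrightarrow>
     v (j + 1) + v (j - 1) - (2 * cosz z 1 + of_real (w j) * trace_coeff z) * v j = rhs_of z f j" for j
  proof -
    define s where "s = trace_coeff z"
    have s: "sinz z 1 * (centre_of z f v j * cosz z (L / 2)) = s * (v j + vsrcS z f j)"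
      by (simp add: centre_of_def s_def trace_coeff_def)
    have e1: "sinz z 1 * slope_of z f v j = v (j + 1) - cosz z 1 * v j + srcS z f j" for j
      using S(1) by (simp add: slope_of_def)
    have e2: "sinz z 1 * slope_of z f v (j - 1) = v j - cosz z 1 * v (j - 1) + srcS z f (j - 1)"
      using e1[of "j - 1"] by simp
    have "sinz z 1 * (slope_of z f v j - (- z * v (j - 1) * sinz z 1 + slope_of z f v (j - 1) * cosz z 1 - srcC z f (j - 1)))
        = sinz z 1 * slope_of z f v j + z * sinz z 1 * sinz z 1 * v (j - 1)
          - cosz z 1 * (sinz z 1 * slope_of z f v (j - 1)) + sinz z 1 * srcC z f (j - 1)"
      by (simp add: algebra_simps)
    also have "\<dots> = v (j + 1) - 2 * cosz z 1 * v j + (cosz z 1 * cosz z 1 + z * sinz z 1 * sinz z 1) * v (j - 1)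
        + srcS z f j - cosz z 1 * srcS z f (j - 1) + sinz z 1 * srcC z f (j - 1)"
      unfolding e1 e2 by (simp add: algebra_simps)
    also have "\<dots> = v (j + 1) - 2 * cosz z 1 * v j + v (j - 1)
        + srcS z f j - cosz z 1 * srcS z f (j - 1) + sinz z 1 * srcC z f (j - 1)"
      unfolding sq by simp
    finally have l: "sinz z 1 * (slope_of z f v j - (- z * v (j - 1) * sinz z 1 + slope_of z f v (j - 1) * cosz z 1 - srcC z f (j - 1)))
        = v (j + 1) - 2 * cosz z 1 * v j + v (j - 1) + srcS z f j - cosz z 1 * srcS z f (j - 1) + sinz z 1 * srcC z f (j - 1)" .
    have r: "sinz z 1 * (of_real (w j) * (centre_of z f v j * cosz z (L / 2) - vsrcC z f j)) =
        of_real (w j) * (s * (v j + vsrcS z f j) - sinz z 1 * vsrcC z f j)"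
      unfolding s[symmetric] by (simp add: algebra_simps)
    have "slope_of z f v j - (- z * v (j - 1) * sinz z 1 + slope_of z f v (j - 1) * cosz z 1 - srcC z f (j - 1)) =
       of_real (w j) * (centre_of z f v j * cosz z (L / 2) - vsrcC z f j) \<longleftrightarrow>
       sinz z 1 * (slope_of z f v j - (- z * v (j - 1) * sinz z 1 + slope_of z f v (j - 1) * cosz z 1 - srcC z f (j - 1))) =
       sinz z 1 * (of_real (w j) * (centre_of z f v j * cosz z (L / 2) - vsrcC z f j))"
      using S(1) by simp
    also have "\<dots> \<longleftrightarrow> v (j + 1) + v (j - 1) - (2 * cosz z 1 + of_real (w j) * s) * v j =
        - srcS z f j + cosz z 1 * srcS z f (j - 1) - sinz z 1 * srcC z f (j - 1) +
        of_real (w j) * (s * vsrcS z f j - sinz z 1 * vsrcC z f j)"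
      unfolding l r by (auto simp: algebra_simps)
    finally show ?thesis unfolding s_def rhs_of_def .
  qed
  show ?thesis
    unfolding vertex_system_iff a c fun_eq_iff
  proof (intro iffI conjI allI; (elim conjE)?)
    fix j
    assume *: "\<forall>j. a j = slope_of z f v j \<and> c j = centre_of z f v j \<and>
        a j - (- z * v (j - 1) * sinz z 1 + a (j - 1) * cosz z 1 - srcC z f (j - 1)) =
        of_real (w j) * (c j * cosz z (L / 2) - vsrcC z f j)"
    show "a j = slope_of z f v j" "c j = centre_of z f v j" using * by blast+
    have "slope_of z f v j - (- z * v (j - 1) * sinz z 1 + slope_of z f v (j - 1) * cosz z 1 - srcC z f (j - 1)) =
       of_real (w j) * (centre_of z f v j * cosz z (L / 2) - vsrcC z f j)" using * by metis
    then show "v (j + 1) + v (j - 1) - (2 * cosz z 1 + of_real (w j) * trace_coeff z) * v j = rhs_of z f j"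
      by (rule k[THEN iffD1])
  next
    fix j
    assume *: "\<forall>j. a j = slope_of z f v j" "\<forall>j. c j = centre_of z f v j"
      "\<forall>j. v (j + 1) + v (j - 1) - (2 * cosz z 1 + of_real (w j) * trace_coeff z) * v j = rhs_of z f j"
    show "a j = slope_of z f v j" "c j = centre_of z f v j" using * by blast+
    show "a j - (- z * v (j - 1) * sinz z 1 + a (j - 1) * cosz z 1 - srcC z f (j - 1)) =
        of_real (w j) * (c j * cosz z (L / 2) - vsrcC z f j)"
      using k[of j, THEN iffD2] * by metis
  qed
qed

lemma src_l2:
  "\<exists>K\<ge>0. \<forall>f\<in>X. \<forall>h\<in>{srcS z f, srcC z f, vsrcS z f, vsrcC z f}. l2 h \<and> l2n h \<le> K * nsq f"
proof -
  obtain B where B: "B \<ge> 1" "\<And>t. \<bar>t\<bar> \<le> 1 + L \<Longrightarrow> norm (cosz z t) \<le> B" "\<And>t. \<bar>t\<bar> \<le> 1 + L \<Longrightarrow> norm (sinz z t) \<le> B"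
    using cosz_sinz_bounded[of "1 + L" z] by blast
  define K where "K = B\<^sup>2 * (1 + L)"
  have K: "0 \<le> K" using L by (simp add: K_def)
  have "l2 h \<and> l2n h \<le> K * (1 + 1 / \<mu>) * nsq f" if f: "f \<in> X" and h: "h \<in> {srcS z f, srcC z f, vsrcS z f, vsrcC z f}" for f h
  proof -
    have fL2: "f \<in> L2_graph L \<mu>" using f by (auto simp: L2_antisym_def)
    note fs = edge_norms_le[OF fL2]
    have foe: "on_edge L f e \<in> L2_on (edge_lo L e) (edge_hi L e)" for e
      using fL2 by (simp add: L2_graph_iff)
    have sq: "(norm x)\<^sup>2 \<le> K * m" if "norm x \<le> B * sqrt (l * n)" "0 \<le> n" "n \<le> m" "0 \<le> l" "l \<le> 1 + L" for x :: complex and n m l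
    proof -
      have "(norm x)\<^sup>2 \<le> (B * sqrt (l * n))\<^sup>2" using that(1) by (intro power_mono) auto
      also have "\<dots> = B\<^sup>2 * (l * n)" using that by (simp add: power_mult_distrib)
      also have "\<dots> \<le> B\<^sup>2 * ((1 + L) * m)" using that L by (intro mult_left_mono mult_mono) auto
      finally show ?thesis by (simp add: K_def mult.assoc)
    qed
    have U: "(norm (integral {of_int j..of_int j + 1} (\<lambda>s. y (of_int j + 1 - s) * f (s, L / 2))))\<^sup>2 \<le> K * edge_norm_sq L f (Upper j)"
      if y: "continuous_on UNIV y" "\<And>t. \<bar>t\<bar> \<le> 1 + L \<Longrightarrow> norm (y t) \<le> B" for j y
    proof (rule sq[OF norm_integral_mult_le_L2_norm])
      show "(\<lambda>s. f (s, L / 2)) \<in> L2_on (of_int j) (of_int j + 1)" using foe[of "Upper j"] by simp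
      show "continuous_on {of_int j..of_int j + 1} (\<lambda>s. y (of_int j + 1 - s))"
        by (rule continuous_on_compose2[OF y(1)]) (auto intro!: continuous_intros)
      show "norm (y (of_int j + 1 - s)) \<le> B" if "s \<in> {of_int j..of_int j + 1}" for s
        by (rule y(2)) (use that L in auto)
    qed (use L in \<open>auto simp: L2_norm_sq_nonneg edge_norm_sq_def\<close>)
    have V: "(norm (integral {0..L / 2} (\<lambda>s. y (L / 2 - s) * f (of_int j, s))))\<^sup>2 \<le> K * edge_norm_sq L f (Vertical j)"
      if y: "continuous_on UNIV y" "\<And>t. \<bar>t\<bar> \<le> 1 + L \<Longrightarrow> norm (y t) \<le> B" for j y
    proof (rule sq[OF norm_integral_mult_le_L2_norm])
      have fV: "(\<lambda>s. f (of_int j, s)) \<in> L2_on (- L / 2) (L / 2)"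
        using foe[of "Vertical j"] by simp
      show "(\<lambda>s. f (of_int j, s)) \<in> L2_on 0 (L / 2)"
        "L2_norm_sq 0 (L / 2) (\<lambda>s. f (of_int j, s)) \<le> edge_norm_sq L f (Vertical j)"
        using L2_on_subinterval[OF fV, of 0 "L / 2"] L by (auto simp: edge_norm_sq_def)
      show "continuous_on {0..L / 2} (\<lambda>s. y (L / 2 - s))"
        by (rule continuous_on_compose2[OF y(1)]) (auto intro!: continuous_intros)
      show "norm (y (L / 2 - s)) \<le> B" if "s \<in> {0..L / 2}" for s
        by (rule y(2)) (use that L in auto)
    qed (use L in \<open>auto simp: L2_norm_sq_nonneg\<close>)
    have cont: "continuous_on UNIV (sinz z)" "continuous_on UNIV (cosz z)"
      using continuous_on_sinz[of UNIV "\<lambda>t. t" z] continuous_on_cosz[of UNIV "\<lambda>t. t" z] by (auto intro: continuous_on_id)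
    have fin: "l2 g \<and> l2n g \<le> K * (1 + 1 / \<mu>) * nsq f"
      if "\<And>j. (norm (g j))\<^sup>2 \<le> K * edge_norm_sq L f (e j)" "(\<lambda>j. edge_norm_sq L f (e j)) summable_on UNIV"
        "(\<Sum>\<^sub>\<infinity>j. edge_norm_sq L f (e j)) \<le> (1 + 1 / \<mu>) * nsq f" for g e
    proof -
      note * = l2I[OF that(1) summable_on_cmult_right[OF that(2)]]
      have "l2n g \<le> K * (\<Sum>\<^sub>\<infinity>j. edge_norm_sq L f (e j))" using *(2) by (simp add: infsum_cmult_right')
      also have "\<dots> \<le> K * ((1 + 1 / \<mu>) * nsq f)" by (rule mult_left_mono[OF that(3) K])
      finally show ?thesis using *(1) by (simp add: mult.assoc)
    qed
    have "l2 (srcS z f) \<and> l2n (srcS z f) \<le> K * (1 + 1 / \<mu>) * nsq f"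
      by (rule fin[of _ Upper]) (use U[OF cont(1) B(3)] fs in \<open>auto simp: srcS_def\<close>)
    moreover have "l2 (srcC z f) \<and> l2n (srcC z f) \<le> K * (1 + 1 / \<mu>) * nsq f"
      by (rule fin[of _ Upper]) (use U[OF cont(2) B(2)] fs in \<open>auto simp: srcC_def\<close>)
    moreover have "l2 (vsrcS z f) \<and> l2n (vsrcS z f) \<le> K * (1 + 1 / \<mu>) * nsq f"
      by (rule fin[of _ Vertical]) (use V[OF cont(1) B(3)] fs in \<open>auto simp: vsrcS_def\<close>)
    moreover have "l2 (vsrcC z f) \<and> l2n (vsrcC z f) \<le> K * (1 + 1 / \<mu>) * nsq f"
      by (rule fin[of _ Vertical]) (use V[OF cont(2) B(2)] fs in \<open>auto simp: vsrcC_def\<close>)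
    ultimately show ?thesis using h by blast
  qed
  moreover have "0 \<le> K * (1 + 1 / \<mu>)" using K mu by simp
  ultimately show ?thesis by blast
qed

text \<open>
  The bounds for composite right-hand sides must depend on the coefficients only, not on the
  function; they are propagated in the form ``square-summable, with norm at most \<open>K * n\<close>''.
\<close>

lemma l2_combine:
  assumes "l2 g \<and> l2n g \<le> K1 * n" "l2 h \<and> l2n h \<le> K2 * n"
  shows "l2 (\<lambda>j. x * g j + y * h j) \<and> l2n (\<lambda>j. x * g j + y * h j) \<le> (2 * (norm x)\<^sup>2 * K1 + 2 * (norm y)\<^sup>2 * K2) * n"
proof -
  have l: "l2 (\<lambda>j. x * g j)" "l2 (\<lambda>j. y * h j)" using assms by (auto intro: l2_scale)
  have "l2n (\<lambda>j. x * g j + y * h j) \<le> 2 * ((norm x)\<^sup>2 * l2n g) + 2 * ((norm y)\<^sup>2 * l2n h)"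
    using l2_add(2)[OF l] assms by (simp add: l2_scale(2))
  also have "\<dots> \<le> 2 * ((norm x)\<^sup>2 * (K1 * n)) + 2 * ((norm y)\<^sup>2 * (K2 * n))"
    using assms by (intro add_mono mult_left_mono) auto
  finally show ?thesis using l2_add(1)[OF l] by (simp add: algebra_simps)
qed

lemma l2_shift:
  "l2 (\<lambda>j. h (j + k)) \<longleftrightarrow> l2 h" "l2n (\<lambda>j. h (j + k)) = l2n h"
  using l2_reindex[OF bij_int_shift(1)[of k], of h] by auto

lemma l2_weighted:
  assumes "l2 h \<and> l2n h \<le> K * n"
  shows "l2 (\<lambda>j. of_real (w j) * h j) \<and> l2n (\<lambda>j. of_real (w j) * h j) \<le> ((1 + \<mu>)\<^sup>2 * K) * n"
proof -
  have le: "(norm (of_real (w j) * h j))\<^sup>2 \<le> (1 + \<mu>)\<^sup>2 * (norm (h j))\<^sup>2" for j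
  proof -
    have "(w j)\<^sup>2 \<le> (1 + \<mu>)\<^sup>2"
      using weight_bounds(1,2)[of "Vertical j"] by (intro power_mono) (auto simp: w_def)
    then show ?thesis by (simp add: norm_mult power_mult_distrib mult_right_mono)
  qed
  have s: "(\<lambda>j. (1 + \<mu>)\<^sup>2 * (norm (h j))\<^sup>2) summable_on UNIV"
    using assms by (intro summable_on_cmult_right) (simp add: l2_def)
  have "l2n (\<lambda>j. of_real (w j) * h j) \<le> (1 + \<mu>)\<^sup>2 * l2n h"
    using l2I(2)[OF le s] by (simp add: l2n_def infsum_cmult_right')
  also have "\<dots> \<le> (1 + \<mu>)\<^sup>2 * (K * n)" using assms by (intro mult_left_mono) auto
  finally show ?thesis using l2I(1)[OF le s] by (simp add: mult.assoc)
qed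

text \<open>
  The right-hand side of the recurrence is square-summable with norm controlled by \<open>f\<close>, so the recurrence
  can be inverted on square-summable sequences; the slopes are then read off.
\<close>

lemma resolvent_exists:
  assumes S: "sinz z 1 \<noteq> 0" "sinz z (L / 2) \<noteq> 0"
    and r: "r \<noteq> 0" "norm r < 1" "r + 1 / r = 2 * cosz z 1 + trace_coeff z"
    and D: "1 / r - r \<noteq> of_real (1 - \<mu>) * trace_coeff z"
  shows "\<exists>K\<ge>0. \<forall>f\<in>X. \<exists>v a c. l2 v \<and> vertex_system z f v a c \<and>
      (glue z f v a c, \<lambda>p. f p + z * glue z f v a c p) \<in> A \<and> nsq (glue z f v a c) \<le> K * nsq f"
proof -
  define s where "s = trace_coeff z"
  obtain K1 where K1: "K1 \<ge> 0" "\<And>f h. f \<in> X \<Longrightarrow> h \<in> {srcS z f, srcC z f, vsrcS z f, vsrcC z f} \<Longrightarrow> l2 h \<and> l2n h \<le> K1 * nsq f"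
    using src_l2[of z] by blast
  obtain K2 where K2: "K2 \<ge> 0" "\<And>h. l2 h \<Longrightarrow> \<exists>v. l2 v \<and> l2n v \<le> K2 * l2n h \<and>
    (\<forall>j. v (j + 1) + v (j - 1) - (r + 1 / r) * v j + (if j = 0 then (of_real (1 - \<mu>) * s) * v 0 else 0) = h j)"
    using second_order_recurrence_l2[OF r(1,2) D] unfolding s_def by blast
  obtain K3 where K3: "K3 \<ge> 0" "\<And>f v a c. f \<in> X \<Longrightarrow> l2 v \<Longrightarrow> l2 a \<Longrightarrow> l2 c \<Longrightarrow> vertex_system z f v a c \<Longrightarrow>
     (glue z f v a c, \<lambda>p. f p + z * glue z f v a c p) \<in> A \<and>
     nsq (glue z f v a c) \<le> K3 * (l2n v + l2n a + l2n c + nsq f)"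
    using solution_of_vertex_system[of z] by blast
  define C where "C = 2 * (norm (1::complex))\<^sup>2 * (2 * (norm (1::complex))\<^sup>2 *
      (2 * (norm (- 1 :: complex))\<^sup>2 * K1 + 2 * (norm (cosz z 1))\<^sup>2 * K1) + 2 * (norm (- sinz z 1))\<^sup>2 * K1) +
      2 * (norm (1::complex))\<^sup>2 * ((1 + \<mu>)\<^sup>2 * (2 * (norm s)\<^sup>2 * K1 + 2 * (norm (- sinz z 1))\<^sup>2 * K1))"
  have C: "l2 (rhs_of z f) \<and> l2n (rhs_of z f) \<le> C * nsq f" if f: "f \<in> X" for f
  proof -
    have sh: "l2 (\<lambda>j. srcS z f (j - 1)) \<and> l2n (\<lambda>j. srcS z f (j - 1)) \<le> K1 * nsq f"
      "l2 (\<lambda>j. srcC z f (j - 1)) \<and> l2n (\<lambda>j. srcC z f (j - 1)) \<le> K1 * nsq f"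
      using K1(2)[OF f, of "srcS z f"] K1(2)[OF f, of "srcC z f"] l2_shift[of "srcS z f" "-1"] l2_shift[of "srcC z f" "-1"]
      by auto
    have src: "l2 (srcS z f) \<and> l2n (srcS z f) \<le> K1 * nsq f" "l2 (vsrcS z f) \<and> l2n (vsrcS z f) \<le> K1 * nsq f"
      "l2 (vsrcC z f) \<and> l2n (vsrcC z f) \<le> K1 * nsq f"
      using K1(2)[OF f] by blast+
    have eq: "rhs_of z f = (\<lambda>j. 1 * (1 * (- 1 * srcS z f j + cosz z 1 * srcS z f (j - 1)) + (- sinz z 1) * srcC z f (j - 1)) +
        1 * (of_real (w j) * (s * vsrcS z f j + (- sinz z 1) * vsrcC z f j)))"
      by (auto simp: rhs_of_def s_def)
    show ?thesis
      unfolding eq C_def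
      by (rule l2_combine[OF l2_combine[OF l2_combine[OF src(1) sh(1), of "- 1" "cosz z 1"] sh(2), of 1 "- sinz z 1"]
            l2_weighted[OF l2_combine[OF src(2,3), of s "- sinz z 1"]], of 1 1])
  qed
  define Ka where "Ka = 2 * (norm (1 / sinz z 1))\<^sup>2 * (2 * (norm (1::complex))\<^sup>2 * (K2 * C) + 2 * (norm (- cosz z 1))\<^sup>2 * (K2 * C)) + 2 * (norm (1 / sinz z 1))\<^sup>2 * K1"
  define Kc where "Kc = 2 * (norm (1 / sinz z (L / 2)))\<^sup>2 * (K2 * C) + 2 * (norm (1 / sinz z (L / 2)))\<^sup>2 * K1"
  define K where "K = \<bar>K3 * (K2 * C + Ka + Kc + 1)\<bar>"
  have "\<exists>v a c. l2 v \<and> vertex_system z f v a c \<and>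
      (glue z f v a c, \<lambda>p. f p + z * glue z f v a c p) \<in> A \<and> nsq (glue z f v a c) \<le> K * nsq f"
    if f: "f \<in> X" for f
  proof -
    obtain v where v: "l2 v" "l2n v \<le> K2 * l2n (rhs_of z f)"
      "\<And>j. v (j + 1) + v (j - 1) - (r + 1 / r) * v j + (if j = 0 then (of_real (1 - \<mu>) * s) * v 0 else 0) = rhs_of z f j"
      using K2(2)[OF C[OF f, THEN conjunct1]] by blast
    have "K2 * l2n (rhs_of z f) \<le> K2 * (C * nsq f)"
      using C[OF f] K2(1) by (intro mult_left_mono) auto
    with v have vn: "l2 v \<and> l2n v \<le> (K2 * C) * nsq f" by (simp add: mult.assoc)
    have vs: "l2 (\<lambda>j. v (j + 1)) \<and> l2n (\<lambda>j. v (j + 1)) \<le> (K2 * C) * nsq f"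
      using vn l2_shift[of v 1] by simp
    have an: "l2 (slope_of z f v) \<and> l2n (slope_of z f v) \<le> Ka * nsq f"
    proof -
      have "slope_of z f v = (\<lambda>j. (1 / sinz z 1) * (1 * v (j + 1) + (- cosz z 1) * v j) + (1 / sinz z 1) * srcS z f j)"
        by (auto simp: slope_of_def add_divide_distrib diff_divide_distrib)
      then show ?thesis
        using l2_combine[OF l2_combine[OF vs vn, of 1 "- cosz z 1"] K1(2)[OF f, of "srcS z f"], of "1 / sinz z 1" "1 / sinz z 1"]
        unfolding Ka_def by simp
    qed
    have cn: "l2 (centre_of z f v) \<and> l2n (centre_of z f v) \<le> Kc * nsq f"
    proof -
      have "centre_of z f v = (\<lambda>j. (1 / sinz z (L / 2)) * v j + (1 / sinz z (L / 2)) * vsrcS z f j)"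
        by (auto simp: centre_of_def add_divide_distrib)
      then show ?thesis
        using l2_combine[OF vn K1(2)[OF f, of "vsrcS z f"], of "1 / sinz z (L / 2)" "1 / sinz z (L / 2)"]
        unfolding Kc_def by simp
    qed
    have sys: "vertex_system z f v (slope_of z f v) (centre_of z f v)"
      unfolding vertex_system_iff_recurrence[OF S]
    proof (intro conjI refl allI)
      fix j
      show "v (j + 1) + v (j - 1) - (2 * cosz z 1 + of_real (w j) * trace_coeff z) * v j = rhs_of z f j"
        using v(3)[of j] by (cases "j = 0") (auto simp: r(3) s_def w_simps algebra_simps)
    qed
    note G = K3(2)[OF f v(1) an[THEN conjunct1] cn[THEN conjunct1] sys]
    have "nsq (glue z f v (slope_of z f v) (centre_of z f v)) \<le>
        K3 * (l2n v + l2n (slope_of z f v) + l2n (centre_of z f v) + nsq f)" using G by blast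
    also have "\<dots> \<le> K3 * ((K2 * C) * nsq f + Ka * nsq f + Kc * nsq f + nsq f)"
      using vn an cn K3(1) by (intro mult_left_mono add_mono) auto
    also have "\<dots> = K3 * (K2 * C + Ka + Kc + 1) * nsq f" by (simp add: algebra_simps)
    also have "\<dots> \<le> K * nsq f" unfolding K_def by (intro mult_right_mono nsq_nonneg) auto
    finally show ?thesis using v(1) sys G by blast
  qed
  moreover have "0 \<le> K" by (simp add: K_def)
  ultimately show ?thesis by blast
qed

text \<open>
  By antisymmetry a function is determined on the ladder by its values on the upper edges and on the
  upper halves of the vertical ones.
\<close>

lemma ladder_eqI:
  assumes "antisymmetric L u" "antisymmetric L u'"
    and U: "\<And>j t. t \<in> {of_int j..of_int j + 1} \<Longrightarrow> u (t, L / 2) = u' (t, L / 2)"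
    and V: "\<And>j t. t \<in> {0..L / 2} \<Longrightarrow> u (of_int j, t) = u' (of_int j, t)"
    and p: "p \<in> ladder L"
  shows "u p = u' p"
proof -
  obtain x y where xy: "p = (x, y)" by (cases p)
  have "of_int \<lfloor>x\<rfloor> \<le> x" "x \<le> of_int \<lfloor>x\<rfloor> + 1" by linarith+
  then have up: "u (x, L / 2) = u' (x, L / 2)" using U[of x "\<lfloor>x\<rfloor>"] by simp
  have "y = L / 2 \<or> y = - L / 2 \<or> (\<exists>j. x = of_int j \<and> y \<in> {- L / 2..L / 2})"
    using p by (auto simp: xy mem_ladder_iff elim: Ints_cases)
  then consider "y = L / 2" | "y = - L / 2" | j where "x = of_int j" "y \<in> {- L / 2..L / 2}" by blast
  then show ?thesis
  proof cases
    case 1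
    show ?thesis unfolding xy 1 by (rule up)
  next
    case 2
    show ?thesis unfolding xy 2
      using up antisymmetricD(1)[OF assms(1), of x] antisymmetricD(1)[OF assms(2), of x] by simp
  next
    case 3
    show ?thesis
    proof (cases "0 \<le> y")
      case True then show ?thesis using V[of y j] 3 by (simp add: xy)
    next
      case False
      then have "- y \<in> {0..L / 2}" using 3 by auto
      from V[OF this, of j] show ?thesis
        using antisymmetricD(2)[OF assms(1), of y j] antisymmetricD(2)[OF assms(2), of y j] 3 by (simp add: xy)
    qed
  qed
qed

lemma nsq_cong:
  assumes "\<And>p. p \<in> ladder L \<Longrightarrow> u p = u' p"
  shows "nsq u = nsq u'"
proof -
  have "edge_norm_sq L u e = edge_norm_sq L u' e" for e
    unfolding edge_norm_sq_def
    by (rule L2_on_cong(2)) (use edge_image_subset_ladder[of e] in \<open>auto simp: on_edge_def intro!: assms\<close>)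
  then show ?thesis by (simp add: nsq_def)
qed

lemma glue_eq_solution:
  assumes asym: "antisymmetric L u" and sys: "vertex_system z f v a c"
    and U: "\<And>j t. t \<in> {of_int j..of_int j + 1} \<Longrightarrow> u (t, L / 2) = upper_val z f v a j t"
    and V: "\<And>j t. t \<in> {0..L / 2} \<Longrightarrow> u (of_int j, t) = vertical_val z f c j t"
    and p: "p \<in> ladder L"
  shows "u p = glue z f v a c p"
proof (rule ladder_eqI[OF asym glue_antisymmetric[OF sys] _ _ p])
  show "u (t, L / 2) = glue z f v a c (t, L / 2)" if "t \<in> {of_int j..of_int j + 1}" for j t
    using U[OF that] glue_upper(1)[OF sys that] by simp
  show "u (of_int j, t) = glue z f v a c (of_int j, t)" if "t \<in> {0..L / 2}" for j t
    using V[OF that] glue_vertical[OF sys, of t j] that L by auto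
qed

lemma A_in_X:
  assumes "(u, g) \<in> A"
  shows "u \<in> X" "g \<in> X" "(\<lambda>p. g p - z * u p) \<in> X"
proof -
  show u: "u \<in> X" and g: "g \<in> X" using assms by (auto simp: Laplacian_antisym_def)
  show "(\<lambda>p. g p - z * u p) \<in> X"
    using u g L2_graph_diff[of g u z] by (auto simp: L2_antisym_def antisymmetric_def split: prod.splits)
qed

text \<open>
  The norm bound for arbitrary solutions follows from that for the constructed one by uniqueness: the
  difference of two solutions decays, hence is a multiple of \<open>r ^ \<bar>j\<bar>\<close>, and the equation at the vertex
  \<open>0\<close> excludes a non-zero multiple.
\<close>

lemma mem_resolvent_set:
  assumes S: "sinz z 1 \<noteq> 0" "sinz z (L / 2) \<noteq> 0"
    and r: "r \<noteq> 0" "norm r < 1" "r + 1 / r = 2 * cosz z 1 + trace_coeff z"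
    and D: "1 / r - r \<noteq> of_real (1 - \<mu>) * trace_coeff z"
  shows "z \<in> resolvent_set X N A"
proof -
  obtain K where K: "K \<ge> 0" "\<And>f. f \<in> X \<Longrightarrow> \<exists>v a c. l2 v \<and> vertex_system z f v a c \<and>
      (glue z f v a c, \<lambda>p. f p + z * glue z f v a c p) \<in> A \<and> nsq (glue z f v a c) \<le> K * nsq f"
    using resolvent_exists[OF assms] by blast
  have "\<exists>(u, g)\<in>A. N (\<lambda>p. g p - z * u p - f p) = 0" if f: "f \<in> X" for f
  proof -
    obtain v a c where "(glue z f v a c, \<lambda>p. f p + z * glue z f v a c p) \<in> A" using K(2)[OF f] by blast
    then show ?thesis
      by (rule bexI[rotated]) (simp add: N_eq nsq_def edge_norm_sq_def L2_norm_sq_def on_edge_def)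
  qed
  moreover have "N u \<le> sqrt K * N (\<lambda>p. g p - z * u p)" if ug: "(u, g) \<in> A" for u g
  proof -
    define f where "f p = g p - z * u p" for p
    have f: "f \<in> X" using A_in_X(3)[OF ug, of z] by (simp add: f_def[abs_def])
    obtain v a c where sys: "vertex_system z f v a c" "l2 v"
      and U: "\<And>j t. t \<in> {of_int j..of_int j + 1} \<Longrightarrow> u (t, L / 2) = upper_val z f v a j t"
      and V: "\<And>j t. t \<in> {0..L / 2} \<Longrightarrow> u (of_int j, t) = vertical_val z f c j t"
      by (rule vertex_system_of_solution[OF ug f_def]) (rule that, assumption+)
    obtain v' a' c' where sys': "l2 v'" "vertex_system z f v' a' c'" and n: "nsq (glue z f v' a' c') \<le> K * nsq f"
      using K(2)[OF f] by blast
    note R = sys(1)[unfolded vertex_system_iff_recurrence[OF S]] sys'(2)[unfolded vertex_system_iff_recurrence[OF S]]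
    define d where "d j = v j - v' j" for j
    have drec: "d (j + 1) + d (j - 1) - (2 * cosz z 1 + of_real (w j) * trace_coeff z) * d j = 0" for j
    proof -
      have "v (j + 1) + v (j - 1) - (2 * cosz z 1 + of_real (w j) * trace_coeff z) * v j =
          v' (j + 1) + v' (j - 1) - (2 * cosz z 1 + of_real (w j) * trace_coeff z) * v' j"
        using R by simp
      then show ?thesis by (simp add: d_def algebra_simps)
    qed
    have "decays d" unfolding d_def by (intro decays_diff l2_decays sys(2) sys'(1))
    then have d: "d j = d 0 * r ^ nat \<bar>j\<bar>" for j
      by (intro recurrence_decaying_int) (use r drec in \<open>auto simp: w_simps algebra_simps\<close>)
    have "d 0 = 0"
    proof (rule ccontr)
      assume "d 0 \<noteq> 0"
      have "d 0 * (2 * r - (2 * cosz z 1 + of_real \<mu> * trace_coeff z)) = 0"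
        using drec[of 0] d[of 1] d[of "-1"] by (simp add: w_simps algebra_simps)
      then have "2 * r = 2 * cosz z 1 + of_real \<mu> * trace_coeff z" using \<open>d 0 \<noteq> 0\<close> by simp
      then have "1 / r - r = (2 * cosz z 1 + trace_coeff z) - (2 * cosz z 1 + of_real \<mu> * trace_coeff z)"
        unfolding r(3)[symmetric] by (metis add_diff_cancel_left' diff_diff_eq mult_2)
      then have "1 / r - r = of_real (1 - \<mu>) * trace_coeff z" by (simp add: algebra_simps)
      then show False using D by simp
    qed
    then have "v = v'" using d by (auto simp: d_def fun_eq_iff)
    then have "a = a'" "c = c'" using R by auto
    have "antisymmetric L u" using A_in_X(1)[OF ug] by (simp add: L2_antisym_def)
    then have "nsq u = nsq (glue z f v a c)"
      by (intro nsq_cong glue_eq_solution[OF _ sys(1) U V])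
    then have "nsq u \<le> K * nsq f" using n \<open>v = v'\<close> \<open>a = a'\<close> \<open>c = c'\<close> by simp
    then show ?thesis by (simp add: N_eq f_def[abs_def] flip: real_sqrt_mult)
  qed
  ultimately show ?thesis unfolding resolvent_set_def by blast
qed

end

section \<open>Eigenvalues and spectrum\<close>

context weighted_ladder begin

lemma integral_cong_AE_weighted:
  fixes f f' k :: "real \<Rightarrow> complex"
  assumes "AE t in lebesgue_on {a<..<b}. f t = f' t" "a \<le> c" "d \<le> b"
  shows "integral {c..d} (\<lambda>s. k s * f s) = integral {c..d} (\<lambda>s. k s * f' s)"
proof -
  obtain M where M: "negligible M" "\<forall>t\<in>{a..b} - M. f t = f' t"
    using assms(1) unfolding AE_lebesgue_on_interval_iff by blast
  show ?thesis
    by (rule integral_spike[OF M(1)]) (use M(2) assms(2,3) in auto)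
qed

lemma source_cong:
  assumes ae: "\<And>e. AE t in lebesgue_on {edge_lo L e<..<edge_hi L e}. on_edge L f e t = on_edge L f' e t"
  shows "srcS z f = srcS z f'" "srcC z f = srcC z f'" "vsrcS z f = vsrcS z f'" "vsrcC z f = vsrcC z f'"
    "t \<in> {of_int j..of_int j + 1} \<Longrightarrow> upper_val z f v a j t = upper_val z f' v a j t"
    "t' \<in> {0..L / 2} \<Longrightarrow> vertical_val z f c j t' = vertical_val z f' c j t'"
proof -
  have U: "AE t in lebesgue_on {of_int j<..<of_int j + 1}. f (t, L / 2) = f' (t, L / 2)" for j
    using ae[of "Upper j"] by (simp only: edge_lo.simps edge_hi.simps on_edge_simps)
  have V: "AE t in lebesgue_on {- L / 2<..<L / 2}. f (of_int j, t) = f' (of_int j, t)" for j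
    using ae[of "Vertical j"] by (simp only: edge_lo.simps edge_hi.simps on_edge_simps)
  show "srcS z f = srcS z f'"
  proof (rule ext)
    show "srcS z f j = srcS z f' j" for j
      unfolding srcS_def by (rule integral_cong_AE_weighted[OF U[of j]]) simp_all
  qed
  show "srcC z f = srcC z f'"
  proof (rule ext)
    show "srcC z f j = srcC z f' j" for j
      unfolding srcC_def by (rule integral_cong_AE_weighted[OF U[of j]]) simp_all
  qed
  show "vsrcS z f = vsrcS z f'"
  proof (rule ext)
    show "vsrcS z f j = vsrcS z f' j" for j
      unfolding vsrcS_def by (rule integral_cong_AE_weighted[OF V[of j]]) (use L in simp_all)
  qed
  show "vsrcC z f = vsrcC z f'"
  proof (rule ext)
    show "vsrcC z f j = vsrcC z f' j" for j
      unfolding vsrcC_def by (rule integral_cong_AE_weighted[OF V[of j]]) (use L in simp_all)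
  qed
  show "upper_val z f v a j t = upper_val z f' v a j t" if "t \<in> {of_int j..of_int j + 1}"
    unfolding upper_val_def Duhamel_def
    using integral_cong_AE_weighted[OF U[of j], of "of_int j" t "\<lambda>s. sinz z (t - s)"] that by simp
  show "vertical_val z f c j t' = vertical_val z f' c j t'" if "t' \<in> {0..L / 2}"
    unfolding vertical_val_def Duhamel_def
    using integral_cong_AE_weighted[OF V[of j], of 0 t' "\<lambda>s. sinz z (t' - s)"] that L by simp
qed

lemma AE_eq_if_N_diff_0:
  assumes "f \<in> L2_graph L \<mu>" "f' \<in> L2_graph L \<mu>" "N (\<lambda>p. f p - f' p) = 0"
  shows "AE t in lebesgue_on {edge_lo L e<..<edge_hi L e}. on_edge L f e t = on_edge L f' e t"
proof -
  have "(\<lambda>p. f p - f' p) \<in> L2_graph L \<mu>" using L2_graph_diff[OF assms(1,2), of 1] by simp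
  with assms(3) have "AE t in lebesgue_on {edge_lo L e<..<edge_hi L e}. on_edge L (\<lambda>p. f p - f' p) e t = 0"
    using N_eq_0_iff by blast
  then show ?thesis by eventually_elim (simp add: on_edge_def)
qed

text \<open>
  The vertex system depends on the right-hand side only up to null sets, so it may be used with any
  representative.
\<close>

lemma vertex_system_of_solution_mod_null:
  assumes ug: "(u, g) \<in> A" and f: "f \<in> L2_graph L \<mu>" and null: "N (\<lambda>p. g p - z * u p - f p) = 0"
  obtains v a c where "vertex_system z f v a c" "l2 v" "l2 a" "\<And>p. p \<in> ladder L \<Longrightarrow> u p = glue z f v a c p"
proof -
  define f' where "f' p = g p - z * u p" for p
  have f': "f' \<in> L2_graph L \<mu>" using A_in_X(3)[OF ug, of z] by (simp add: f'_def[abs_def] L2_antisym_def)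
  have ae: "AE t in lebesgue_on {edge_lo L e<..<edge_hi L e}. on_edge L f' e t = on_edge L f e t" for e
    by (rule AE_eq_if_N_diff_0[OF f' f]) (use null in \<open>simp add: f'_def\<close>)
  note cong = source_cong[OF ae]
  obtain v a c where sys: "vertex_system z f' v a c" "l2 v" "l2 a"
    and U: "\<And>j t. t \<in> {of_int j..of_int j + 1} \<Longrightarrow> u (t, L / 2) = upper_val z f' v a j t"
    and V: "\<And>j t. t \<in> {0..L / 2} \<Longrightarrow> u (of_int j, t) = vertical_val z f' c j t"
    by (rule vertex_system_of_solution[OF ug f'_def]) (rule that, assumption+)
  have sys': "vertex_system z f v a c"
    using sys(1) unfolding vertex_system_iff cong(1-4) .
  have "antisymmetric L u" using A_in_X(1)[OF ug] by (simp add: L2_antisym_def)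
  then have "u p = glue z f v a c p" if "p \<in> ladder L" for p
    by (rule glue_eq_solution[OF _ sys' _ _ that]) (use U V cong(5,6) in auto)
  with that sys' sys(2,3) show ?thesis by blast
qed

lemma zero_in_X: "(\<lambda>_. 0) \<in> X"
proof -
  have "edge_norm_sq L (\<lambda>_. 0) = (\<lambda>_. 0)"
    by (auto simp: edge_norm_sq_def on_edge_def L2_norm_sq_def)
  then have "(\<lambda>_. 0) \<in> L2_graph L \<mu>"
    unfolding L2_graph_iff by (auto simp: on_edge_def intro: L2_on_continuous)
  then show ?thesis by (auto simp: L2_antisym_def antisymmetric_def)
qed

lemma sources_zero [simp]:
  "srcS z (\<lambda>_. 0) = (\<lambda>_. 0)" "srcC z (\<lambda>_. 0) = (\<lambda>_. 0)"
  "vsrcS z (\<lambda>_. 0) = (\<lambda>_. 0)" "vsrcC z (\<lambda>_. 0) = (\<lambda>_. 0)"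
  by (auto simp: srcS_def srcC_def vsrcS_def vsrcC_def)

lemma upper_val_zero: "upper_val z (\<lambda>_. 0) v a j t = v j * cosz z (t - of_int j) + a j * sinz z (t - of_int j)"
  by (simp add: upper_val_def Duhamel_def)

lemma vertical_val_zero: "vertical_val z (\<lambda>_. 0) c j t = c j * sinz z t"
  by (simp add: vertical_val_def Duhamel_def)

abbreviation glue0 where "glue0 z \<equiv> glue z (\<lambda>_. 0)"
abbreviation vertex_system0 where "vertex_system0 z \<equiv> vertex_system z (\<lambda>_. 0)"

lemma N_zero: "N (\<lambda>_. 0) = 0"
  using N_eq_0_iff[of "\<lambda>_. 0"] zero_in_X by (simp add: L2_antisym_def on_edge_def)

lemma eigenspace_structure:
  assumes "u \<in> eigenspace N A z"
  obtains v a c where "vertex_system0 z v a c" "l2 v" "l2 a" "\<And>p. p \<in> ladder L \<Longrightarrow> u p = glue0 z v a c p"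
proof -
  obtain g where g: "(u, g) \<in> A" "N (\<lambda>p. g p - z * u p) = 0" using assms by (auto simp: eigenspace_def)
  have z: "(\<lambda>_. 0) \<in> L2_graph L \<mu>" using zero_in_X by (simp add: L2_antisym_def)
  show ?thesis
    by (rule vertex_system_of_solution_mod_null[OF g(1) z, of z]) (use g(2) that in auto)
qed

lemma glue0_in_eigenspace:
  assumes "vertex_system0 z v a c" "l2 v" "l2 a" "l2 c"
  shows "glue0 z v a c \<in> eigenspace N A z"
proof -
  have "(glue0 z v a c, \<lambda>p. 0 + z * glue0 z v a c p) \<in> A"
    using solution_of_vertex_system[of z] zero_in_X assms by blast
  then show ?thesis unfolding eigenspace_def using N_zero by (auto intro!: exI[of _ "\<lambda>p. z * glue0 z v a c p"])
qed

lemma eigenspace_in_X: "u \<in> eigenspace N A z \<Longrightarrow> u \<in> X"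
  by (auto simp: eigenspace_def Laplacian_antisym_def)

lemma eigenspace_continuous: "u \<in> eigenspace N A z \<Longrightarrow> continuous_on (ladder L) u"
  by (auto simp: eigenspace_def Laplacian_antisym_def Laplacian_def Laplacian_domain_def H2_graph_def)

lemma zero_on_ladder_if_N_0:
  assumes "u \<in> L2_graph L \<mu>" "continuous_on (ladder L) u" "N u = 0" "t \<in> {edge_lo L e..edge_hi L e}"
  shows "on_edge L u e t = 0"
  using eq_if_AE_eq_continuous[OF edge_lo_less[of e] continuous_on_on_edge[OF assms(2), of e], of "\<lambda>_. 0" t]
    N_eq_0_iff[OF assms(1)] assms(3,4) by auto

lemma N_0_if_zero_on_ladder:
  assumes "\<And>p. p \<in> ladder L \<Longrightarrow> u p = 0"
  shows "N u = 0"
  using nsq_cong[of u "\<lambda>_. 0"] assms N_zero by (simp add: N_eq)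

lemma glue0_zero: "glue0 z (\<lambda>_. 0) (\<lambda>_. 0) (\<lambda>_. 0) p = 0"
  by (auto simp: glue_def upper_val_zero vertical_val_zero split: prod.splits)

text \<open>
  The two solutions of \<open>r + 1 / r = h\<close> are inverse to each other, so one lies in the closed unit disc.
\<close>

lemma exists_root:
  obtains r :: complex where "r \<noteq> 0" "norm r \<le> 1" "r + 1 / r = h"
proof -
  define q where "q = (h + csqrt (h\<^sup>2 - 4)) / 2"
  have "2 * q = h + csqrt (h\<^sup>2 - 4)" by (simp add: q_def field_simps)
  then have "2 * q - h = csqrt (h\<^sup>2 - 4)" by simp
  then have "(2 * q - h)\<^sup>2 = h\<^sup>2 - 4" by simp
  then have "4 * (q * q - h * q + 1) = 0" by (simp add: power2_eq_square algebra_simps)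
  then have q: "q * q - h * q + 1 = 0" by (metis mult_eq_0_iff zero_neq_numeral)
  then have q0: "q \<noteq> 0" by auto
  have qh: "q + 1 / q = h" using q q0 by (simp add: field_simps)
  show ?thesis
  proof (cases "norm q \<le> 1")
    case True then show ?thesis using that[of q] q0 qh by blast
  next
    case False
    then have "1 < norm q" by simp
    then have "norm (1 / q) \<le> 1" by (simp add: norm_divide divide_le_eq_1)
    then show ?thesis using that[of "1 / q"] q0 qh by (simp add: add.commute)
  qed
qed

text \<open>
  The eigenvalue condition.  Away from the exceptional zeros of the sines, an eigenfunction decays
  geometrically in both directions, and the equation at the perturbed vertex fixes the ratio.
\<close>

lemma eigenvalue_imp:
  assumes ev: "is_eigenvalue N A z"
  shows "(sinz z 1 = 0 \<and> sinz z (L / 2) = 0) \<or>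
    (sinz z 1 \<noteq> 0 \<and> sinz z (L / 2) \<noteq> 0 \<and>
      (\<exists>r. r \<noteq> 0 \<and> norm r < 1 \<and> r + 1 / r = 2 * cosz z 1 + trace_coeff z \<and>
        1 / r - r = of_real (1 - \<mu>) * trace_coeff z))"
proof -
  obtain u where u: "u \<in> eigenspace N A z" "N u \<noteq> 0" using ev by (auto simp: is_eigenvalue_def)
  obtain v a c where sys: "vertex_system0 z v a c" and l2: "l2 v" "l2 a"
    and eq: "\<And>p. p \<in> ladder L \<Longrightarrow> u p = glue0 z v a c p"
    by (rule eigenspace_structure[OF u(1)]) (rule that, assumption+)
  have nz: "v \<noteq> (\<lambda>_. 0) \<or> a \<noteq> (\<lambda>_. 0) \<or> c \<noteq> (\<lambda>_. 0)"
    using u(2) N_0_if_zero_on_ladder[of u] eq glue0_zero by auto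
  have s: "v (j + 1) = v j * cosz z 1 + a j * sinz z 1" "v j = c j * sinz z (L / 2)"
    "a j - (- z * v (j - 1) * sinz z 1 + a (j - 1) * cosz z 1) = of_real (w j) * (c j * cosz z (L / 2))" for j
    using sys[unfolded vertex_system_iff sources_zero, rule_format, of j] unfolding diff_0_right by blast+
  have w0: "of_real (w j) \<noteq> (0 :: complex)" for j using weight_bounds(1)[of "Vertical j"] by (simp add: w_def)
  show ?thesis
  proof (cases "sinz z 1 = 0")
    case True
    have "cosz z 1 * cosz z 1 = 1" using cosz_sinz_sq[of z 1] True by simp
    then have c1: "norm (cosz z 1) = 1" by (auto simp: square_eq_1_iff)
    have "norm (v (j + 1)) = norm (v j)" for j using s(1)[of j] True c1 by (simp add: norm_mult)
    then have v0: "v j = 0" for j using constant_modulus_decaying[OF _ l2_decays[OF l2(1)]] by blast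
    have "sinz z (L / 2) = 0"
    proof (rule ccontr)
      assume "sinz z (L / 2) \<noteq> 0"
      then have c0: "c j = 0" for j using s(2)[of j] v0[of j] by simp
      have "norm (a (j + 1)) = norm (a j)" for j
        using s(3)[of "j + 1"] v0 c0 c1 by (simp add: norm_mult)
      then have "a j = 0" for j using constant_modulus_decaying[OF _ l2_decays[OF l2(2)]] by blast
      then show False using nz v0 c0 by (auto simp: fun_eq_iff)
    qed
    then show ?thesis using True by simp
  next
    case S1: False
    have SL: "sinz z (L / 2) \<noteq> 0"
    proof
      assume SL: "sinz z (L / 2) = 0"
      have v0: "v j = 0" for j using s(2)[of j] SL by simp
      have a0: "a j = 0" for j using s(1)[of j] v0 S1 by simp
      have "cosz z (L / 2) \<noteq> 0" using cosz_sinz_sq[of z "L / 2"] SL by auto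
      then have "c j = 0" for j using s(3)[of j] v0 a0 w0[of j] by simp
      then show False using nz v0 a0 by (auto simp: fun_eq_iff)
    qed
    obtain r where r: "r \<noteq> 0" "norm r \<le> 1" "r + 1 / r = 2 * cosz z 1 + trace_coeff z"
      by (rule exists_root)
    note R = sys[unfolded vertex_system_iff_recurrence[OF S1 SL]]
    have rec: "v (j + 1) + v (j - 1) = (2 * cosz z 1 + of_real (w j) * trace_coeff z) * v j" for j
      using R by (simp add: rhs_of_def)
    have v: "v j = v 0 * r ^ nat \<bar>j\<bar>" for j
      by (rule recurrence_decaying_int[OF r(1,2) _ l2_decays[OF l2(1)]]) (use rec r(3) in \<open>simp add: w_simps\<close>)
    have v0: "v 0 \<noteq> 0"
    proof
      assume "v 0 = 0"
      then have "v j = 0" for j using v[of j] by simp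
      then have "v = (\<lambda>_. 0)" by blast
      then show False using nz R by (auto simp: fun_eq_iff slope_of_def centre_of_def)
    qed
    have "norm r < 1"
    proof (rule ccontr)
      assume "\<not> norm r < 1"
      then have "norm r = 1" using r(2) by simp
      then have n: "norm (v j) = norm (v 0)" for j unfolding v[of j] by (simp add: norm_mult norm_power)
      have "norm (v (j + 1)) = norm (v j)" for j using n[of "j + 1"] n[of j] by simp
      then have "v 0 = 0" using constant_modulus_decaying[OF _ l2_decays[OF l2(1)]] by blast
      then show False using v0 by simp
    qed
    moreover have "1 / r - r = of_real (1 - \<mu>) * trace_coeff z"
    proof -
      have "(2 * r) * v 0 = (2 * cosz z 1 + of_real \<mu> * trace_coeff z) * v 0"
        using rec[of 0] v[of 1] v[of "-1"] by (simp add: w_simps algebra_simps)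
      then have "2 * r = 2 * cosz z 1 + of_real \<mu> * trace_coeff z" using v0 by simp
      then have "1 / r - r = (2 * cosz z 1 + trace_coeff z) - (2 * cosz z 1 + of_real \<mu> * trace_coeff z)"
        unfolding r(3)[symmetric] by (metis add_diff_cancel_left' diff_diff_eq mult_2)
      then show ?thesis by (simp add: algebra_simps)
    qed
    ultimately show ?thesis using S1 SL r by blast
  qed
qed

lemma summable_on_if_finite_support:
  fixes g :: "'z \<Rightarrow> real"
  assumes "finite {x. g x \<noteq> 0}"
  shows "g summable_on UNIV"
  using summable_on_cong_neutral[of UNIV "{x. g x \<noteq> 0}" g g] summable_on_finite[OF assms, of g] by auto

lemma finite_l2_nonzero: "finite {j. h j \<noteq> 0} \<Longrightarrow> l2 h"
  unfolding l2_def by (rule summable_on_if_finite_support) simp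

text \<open>
  The sequence \<open>r ^ \<bar>j\<bar>\<close> solves the recurrence and glues to an eigenfunction; any other solution decays and is
  a multiple of it.
\<close>

lemma eigenvalue_if:
  assumes S: "sinz z 1 \<noteq> 0" "sinz z (L / 2) \<noteq> 0"
    and r: "r \<noteq> 0" "norm r < 1" "r + 1 / r = 2 * cosz z 1 + trace_coeff z"
    and ev: "1 / r - r = of_real (1 - \<mu>) * trace_coeff z"
  shows "is_eigenvalue N A z" "finite_multiplicity N A z"
proof -
  define \<rho> where "\<rho> j = r ^ nat \<bar>j\<bar>" for j
  define a where "a = slope_of z (\<lambda>_. 0) \<rho>"
  define c where "c = centre_of z (\<lambda>_. 0) \<rho>"
  have \<rho>l2: "l2 \<rho>" unfolding \<rho>_def by (rule l2_geometric[OF r(2)])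
  have al2: "l2 a"
  proof -
    have a: "a = (\<lambda>j. (1 / sinz z 1) * (\<rho> (j + 1) + (- cosz z 1) * \<rho> j))"
      by (auto simp: a_def slope_of_def)
    have "l2 (\<lambda>j. \<rho> (j + 1))" using \<rho>l2 l2_shift(1)[of \<rho> 1] by simp
    then show ?thesis unfolding a by (intro l2_scale(1) l2_add(1) \<rho>l2)
  qed
  have cl2: "l2 c"
  proof -
    have c: "c = (\<lambda>j. (1 / sinz z (L / 2)) * \<rho> j)" by (auto simp: c_def centre_of_def)
    show ?thesis unfolding c by (intro l2_scale(1) \<rho>l2)
  qed
  have "\<rho> (j + 1) + \<rho> (j - 1) - (2 * cosz z 1 + of_real (w j) * trace_coeff z) * \<rho> j = 0" for j
  proof -
    have e: "2 * cosz z 1 + of_real (w j) * trace_coeff z = r + 1 / r + of_real (w j - 1) * trace_coeff z"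
      using r(3) by (simp add: algebra_simps)
    consider "j = 0" | n where "j = int (Suc n)" | n where "j = - int (Suc n)"
      by (cases j rule: int_cases3) (auto dest: gr0_implies_Suc)
    then show ?thesis
    proof cases
      case 1
      have m: "of_real (\<mu> - 1) * trace_coeff z = - (1 / r - r)" unfolding ev by (simp add: algebra_simps)
      have "2 * cosz z 1 + of_real \<mu> * trace_coeff z = r + 1 / r + of_real (\<mu> - 1) * trace_coeff z"
        using r(3) by (simp add: algebra_simps)
      also have "\<dots> = 2 * r" unfolding m by simp
      finally have h: "2 * cosz z 1 + of_real \<mu> * trace_coeff z = 2 * r" .
      have "\<rho> (j + 1) + \<rho> (j - 1) = 2 * r" "\<rho> j = 1" by (simp_all add: 1 \<rho>_def)
      then show ?thesis unfolding 1 w_simps(1) h by simp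
    next
      case 2
      then have "nat \<bar>j + 1\<bar> = Suc (Suc n)" "nat \<bar>j - 1\<bar> = n" "nat \<bar>j\<bar> = Suc n" "j \<noteq> 0" by auto
      then show ?thesis using r(1) unfolding e by (simp add: \<rho>_def field_simps w_simps)
    next
      case 3
      then have "nat \<bar>j + 1\<bar> = n" "nat \<bar>j - 1\<bar> = Suc (Suc n)" "nat \<bar>j\<bar> = Suc n" "j \<noteq> 0" by auto
      then show ?thesis using r(1) unfolding e by (simp add: \<rho>_def field_simps w_simps)
    qed
  qed
  then have sys: "vertex_system0 z \<rho> a c"
    unfolding vertex_system_iff_recurrence[OF S] a_def c_def by (simp add: rhs_of_def)
  define U where "U = glue0 z \<rho> a c"
  have U: "U \<in> eigenspace N A z" unfolding U_def by (rule glue0_in_eigenspace[OF sys \<rho>l2 al2 cl2])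
  have "U (0, L / 2) = 1"
    unfolding U_def using glue_upper(1)[OF sys, of 0 0] by (simp add: upper_val_zero \<rho>_def)
  then have NU: "N U \<noteq> 0"
    using zero_on_ladder_if_N_0[of U 0 "Upper 0"] eigenspace_in_X[OF U] eigenspace_continuous[OF U]
    by (auto simp: L2_antisym_def)
  then show "is_eigenvalue N A z" using U by (auto simp: is_eigenvalue_def)
  have "\<exists>k. N (\<lambda>p. u p - (\<Sum>b\<in>{U}. k b * b p)) = 0" if u: "u \<in> eigenspace N A z" for u
  proof -
    obtain v a' c' where sys': "vertex_system0 z v a' c'" and vl2: "l2 v"
      and eq: "\<And>p. p \<in> ladder L \<Longrightarrow> u p = glue0 z v a' c' p"
      by (rule eigenspace_structure[OF u]) (rule that, assumption+)
    note R = sys'[unfolded vertex_system_iff_recurrence[OF S]]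
    have rec: "v (j + 1) + v (j - 1) = (2 * cosz z 1 + of_real (w j) * trace_coeff z) * v j" for j
      using R by (simp add: rhs_of_def)
    have v: "v j = v 0 * \<rho> j" for j
      unfolding \<rho>_def
      by (rule recurrence_decaying_int[OF r(1) _ _ l2_decays[OF vl2]]) (use rec r in \<open>simp_all add: w_simps\<close>)
    have a': "a' j = v 0 * a j" and c': "c' j = v 0 * c j" for j
    proof -
      have "a' j = (v (j + 1) - cosz z 1 * v j) / sinz z 1" using R by (simp add: slope_of_def)
      also have "\<dots> = v 0 * a j" unfolding v[of "j + 1"] v[of j] by (simp add: a_def slope_of_def algebra_simps)
      finally show "a' j = v 0 * a j" .
      have "c' j = v j / sinz z (L / 2)" using R by (simp add: centre_of_def)
      also have "\<dots> = v 0 * c j" unfolding v[of j] by (simp add: c_def centre_of_def)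
      finally show "c' j = v 0 * c j" .
    qed
    have "glue0 z v a' c' p = v 0 * U p" for p
      unfolding U_def glue_def upper_val_zero vertical_val_zero
      by (auto simp: a' c' v[of "\<lfloor>_\<rfloor>"] algebra_simps split: prod.splits)
    then have "N (\<lambda>p. u p - (\<Sum>b\<in>{U}. v 0 * b p)) = 0"
      using eq by (intro N_0_if_zero_on_ladder) simp
    then show ?thesis by (intro exI[of _ "\<lambda>_. v 0"])
  qed
  then show "finite_multiplicity N A z"
    unfolding finite_multiplicity_def using U by (intro exI[of _ "{U}"]) auto
qed

lemma sinz_not_identically_0: "\<exists>t\<in>{0..1}. sinz z t \<noteq> 0"
proof (rule ccontr)
  assume *: "\<not> ?thesis"
  have d0: "(sinz z has_vector_derivative 0) (at 0 within {0..1})"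
    by (rule has_vector_derivative_transform[OF _ _ has_vector_derivative_const[of 0]]) (use * in auto)
  have d1: "(sinz z has_vector_derivative 1) (at 0 within {0..1})"
    using has_vector_derivative_sinz[of z 0 "{0..1}"] by simp
  have "(0::complex) = 1"
    by (rule vector_derivative_unique_within[OF _ d0 d1]) (simp add: trivial_limit_within)
  then show False by simp
qed

text \<open>
  If both sines vanish, each pair of opposite horizontal edges carries an eigenfunction supported
  there and on the two adjacent vertical edges.
\<close>

lemma infinite_multiplicity:
  assumes S: "sinz z 1 = 0" "sinz z (L / 2) = 0"
  shows "\<not> finite_multiplicity N A z"
proof
  assume "finite_multiplicity N A z"
  then obtain B where B: "finite B" "B \<subseteq> eigenspace N A z"
    "\<And>u. u \<in> eigenspace N A z \<Longrightarrow> \<exists>k. N (\<lambda>p. u p - (\<Sum>b \<in> B. k b * b p)) = 0"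
    unfolding finite_multiplicity_def by blast
  have cL: "cosz z (L / 2) \<noteq> 0" using cosz_sinz_sq[of z "L / 2"] S by auto
  have w0: "of_real (w j) \<noteq> (0 :: complex)" for j using weight_bounds(1)[of "Vertical j"] by (simp add: w_def)
  define \<delta> :: "int \<Rightarrow> int \<Rightarrow> complex" where "\<delta> k j = (if j = k then 1 else 0)" for k j
  define c where "c k j = (\<delta> k j - cosz z 1 * \<delta> k (j - 1)) / (of_real (w j) * cosz z (L / 2))" for k j
  have sys: "vertex_system0 z (\<lambda>_. 0) (\<delta> k) (c k)" for k
  proof -
    have "of_real (w j) * (c k j * cosz z (L / 2)) = \<delta> k j - cosz z 1 * \<delta> k (j - 1)" for j
      using cL w0[of j] by (simp add: c_def)
    then show ?thesis unfolding vertex_system_iff using S by (simp add: mult.commute)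
  qed
  have l2: "l2 (\<lambda>_. 0)" "l2 (\<delta> k)" "l2 (c k)" for k
  proof -
    show "l2 (\<lambda>_. 0)" by (rule finite_l2_nonzero) simp
    show "l2 (\<delta> k)" by (rule finite_l2_nonzero) (simp add: \<delta>_def)
    have "{j. c k j \<noteq> 0} \<subseteq> {k, k + 1}" by (auto simp: c_def \<delta>_def)
    then show "l2 (c k)" by (intro finite_l2_nonzero) (rule finite_subset, auto)
  qed
  define U where "U k = glue0 z (\<lambda>_. 0) (\<delta> k) (c k)" for k
  have U: "U k \<in> eigenspace N A z" for k unfolding U_def by (rule glue0_in_eigenspace[OF sys l2])
  \<comment> \<open>evaluation at \<open>j + t0\<close> reads off the slope on the edge \<open>Upper j\<close>\<close>
  obtain t0 where t0: "t0 \<in> {0..1}" "sinz z t0 \<noteq> 0"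
    using sinz_not_identically_0[of z] by blast
  define ev :: "graph_fun \<Rightarrow> int \<Rightarrow> complex" where "ev u j = u (of_int j + t0, L / 2) / sinz z t0" for u j
  have evU: "ev (U k) = \<delta> k" for k
  proof
    fix j
    have "U k (of_int j + t0, L / 2) = \<delta> k j * sinz z t0"
      unfolding U_def using glue_upper(1)[OF sys, of "of_int j + t0" j k] t0(1) by (simp add: upper_val_zero)
    then show "ev (U k) j = \<delta> k j" using t0(2) by (simp add: ev_def)
  qed
  have span: "\<exists>k. \<forall>j. \<delta> m j = (\<Sum>b\<in>B. k b * ev b j)" for m
  proof -
    obtain k where k: "N (\<lambda>p. U m p - (\<Sum>b \<in> B. k b * b p)) = 0" using B(3)[OF U] by blast
    have sumL2: "(\<lambda>p. \<Sum>b \<in> F. k b * b p) \<in> L2_graph L \<mu>" if "finite F" "F \<subseteq> B" for F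
      using that
    proof (induction F rule: finite_induct)
      case empty
      then show ?case using zero_in_X by (simp add: L2_antisym_def)
    next
      case (insert b F)
      then have "b \<in> L2_graph L \<mu>" using B(2) eigenspace_in_X[of b z] by (auto simp: L2_antisym_def)
      then show ?case using insert L2_graph_add[OF L2_graph_scale[of b "k b"]] by simp
    qed
    have Um: "U m \<in> L2_graph L \<mu>" using eigenspace_in_X[OF U[of m]] by (simp add: L2_antisym_def)
    have d: "(\<lambda>p. U m p - (\<Sum>b \<in> B. k b * b p)) \<in> L2_graph L \<mu>"
      using L2_graph_diff[OF Um sumL2[OF B(1) order.refl], of 1] by simp
    have cont: "continuous_on (ladder L) (\<lambda>p. U m p - (\<Sum>b \<in> B. k b * b p))"
      using B(2) by (intro continuous_intros eigenspace_continuous[OF U] eigenspace_continuous) auto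
    have "\<delta> m j = (\<Sum>b\<in>B. k b * ev b j)" for j
    proof -
      have "U m (of_int j + t0, L / 2) = (\<Sum>b \<in> B. k b * b (of_int j + t0, L / 2))"
        using zero_on_ladder_if_N_0[OF d cont k, of "of_int j + t0" "Upper j"] t0(1) by simp
      then have "ev (U m) j = (\<Sum>b\<in>B. k b * ev b j)"
        by (simp add: ev_def sum_divide_distrib)
      then show ?thesis by (simp add: evU)
    qed
    then show ?thesis by blast
  qed
  interpret vs: vector_space "\<lambda>(x::complex) (f::int \<Rightarrow> complex) j. x * f j"
    by unfold_locales (auto simp: fun_eq_iff algebra_simps)
  have sum_fun: "(\<Sum>x\<in>F. G x) j = (\<Sum>x\<in>F. G x j)" for F :: "'z set" and G :: "'z \<Rightarrow> int \<Rightarrow> complex" and j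
    by (induction F rule: infinite_finite_induct) auto
  define D where "D = \<delta> ` {0..int (card B)}"
  have inj: "inj_on \<delta> T" for T by (rule inj_onI) (metis \<delta>_def zero_neq_one)
  have cardD: "card D = Suc (card B)" unfolding D_def by (simp add: card_image[OF inj])
  have "vs.independent D"
  proof (rule vs.independent_if_scalars_zero)
    show "finite D" by (simp add: D_def)
    fix k x assume z: "(\<Sum>x\<in>D. (\<lambda>j. k x * x j)) = 0" and x: "x \<in> D"
    obtain m where m: "m \<in> {0..int (card B)}" "x = \<delta> m" using x by (auto simp: D_def)
    have "(\<Sum>x\<in>D. k x * x m) = 0" using fun_cong[OF z, of m] by (simp add: sum_fun)
    moreover have "(\<Sum>x\<in>D. k x * x m) = (\<Sum>i\<in>{0..int (card B)}. k (\<delta> i) * \<delta> i m)"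
      unfolding D_def by (simp add: sum.reindex[OF inj] o_def)
    moreover have "\<dots> = k (\<delta> m)"
      using m(1) by (subst sum.remove[of _ m]) (auto simp: \<delta>_def intro!: sum.neutral)
    ultimately show "k x = 0" using m(2) by simp
  qed
  moreover have "D \<subseteq> vs.span (ev ` B)"
  proof
    fix x assume "x \<in> D"
    then obtain m where m: "x = \<delta> m" by (auto simp: D_def)
    obtain k where k: "\<And>j. \<delta> m j = (\<Sum>b\<in>B. k b * ev b j)" using span by blast
    have "x = (\<Sum>b\<in>B. (\<lambda>j. k b * ev b j))" by (auto simp: fun_eq_iff sum_fun m k)
    also have "\<dots> \<in> vs.span (ev ` B)" by (intro vs.span_sum vs.span_scale vs.span_base) auto
    finally show "x \<in> vs.span (ev ` B)" .
  qed
  ultimately have "card D \<le> card (ev ` B)"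
    using vs.independent_span_bound[of "ev ` B" D] B(1) by simp
  also have "\<dots> \<le> card B" using B(1) by (rule card_image_le)
  finally show False using cardD by simp
qed

text \<open>
  In the bands the resolvent equation is not solvable for a right-hand side supported on one pair
  of horizontal edges: off that pair a solution has constant modulus or grows, so it vanishes there,
  and then its values at the two ends are incompatible with the source.
\<close>

lemma source_on_one_edge:
  obtains f where "f \<in> X" "\<And>j. j \<noteq> 0 \<Longrightarrow> srcS z f j = 0" "\<And>j. j \<noteq> 0 \<Longrightarrow> srcC z f j = 0"
    "vsrcS z f = (\<lambda>_. 0)" "vsrcC z f = (\<lambda>_. 0)" "srcS z f 0 \<noteq> 0"
proof -
  define \<phi> where "\<phi> t = cnj (sinz z (1 - t))" for t
  define f :: graph_fun where "f p = (case p of (x, y) \<Rightarrow>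
     if 0 < x \<and> x < 1 then (if y = L / 2 then \<phi> x else if y = - L / 2 then - \<phi> x else 0) else 0)" for p
  have \<phi>: "continuous_on S \<phi>" for S unfolding \<phi>_def by (intro continuous_intros)
  have U: "f (t, L / 2) = (if j = 0 then \<phi> t else 0)" if "t \<in> {of_int j<..<of_int j + 1}" for t j
  proof -
    have "0 < t \<and> t < 1 \<longleftrightarrow> j = 0"
    proof
      assume "0 < t \<and> t < 1"
      then have "of_int j < (1::real)" "-1 < (of_int j :: real)" using that by auto
      then have "j < 1" "-1 < j" by linarith+
      then show "j = 0" by simp
    qed (use that in auto)
    then show ?thesis by (simp add: f_def)
  qed
  have Lo: "f (t, - L / 2) = - f (t, L / 2)" for t using L by (simp add: f_def)
  have V: "f (of_int j, t) = 0" for j t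
  proof -
    have "\<not> (0 < real_of_int j \<and> real_of_int j < 1)"
    proof
      assume "0 < real_of_int j \<and> real_of_int j < 1"
      then have "0 < j" "j < 1" by simp_all
      then show False by simp
    qed
    then show ?thesis by (auto simp: f_def)
  qed
  have oe: "on_edge L f e \<in> L2_on (edge_lo L e) (edge_hi L e)" for e
  proof (cases e)
    case (Upper j)
    have "(\<lambda>t. if j = 0 then \<phi> t else 0) \<in> L2_on (of_int j) (of_int j + 1)"
      by (rule L2_on_continuous) (cases "j = 0"; simp add: \<phi>)
    then show ?thesis using L2_on_cong(1)[OF U[of _ j]] Upper by simp
  next
    case (Lower j)
    have "(\<lambda>t. if j = 0 then - \<phi> t else 0) \<in> L2_on (of_int j) (of_int j + 1)"
      by (rule L2_on_continuous) (cases "j = 0"; simp add: \<phi> continuous_on_minus)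
    then show ?thesis
      using L2_on_cong(1)[of "of_int j" "of_int j + 1" "\<lambda>t. f (t, - L / 2)" "\<lambda>t. if j = 0 then - \<phi> t else 0"] Lower U[of _ j] Lo
      by simp
  next
    case (Vertical j)
    then show ?thesis by (simp add: V L2_on_continuous)
  qed
  have z: "edge_norm_sq L f (Upper j) = 0" "edge_norm_sq L f (Lower j) = 0" if "j \<noteq> 0" for j
  proof -
    have "edge_norm_sq L f (Upper j) = L2_norm_sq (of_int j) (of_int j + 1) (\<lambda>_. 0)"
      "edge_norm_sq L f (Lower j) = L2_norm_sq (of_int j) (of_int j + 1) (\<lambda>_. 0)"
      unfolding edge_norm_sq_def on_edge_simps edge_lo.simps edge_hi.simps
      by (rule L2_on_cong(2); use that U[of _ j] Lo in simp)+
    then show "edge_norm_sq L f (Upper j) = 0" "edge_norm_sq L f (Lower j) = 0" by (simp_all add: L2_norm_sq_def)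
  qed
  have zV: "edge_norm_sq L f (Vertical j) = 0" for j by (simp add: edge_norm_sq_def V L2_norm_sq_def)
  have fin: "{e. edge_norm_sq L f e \<noteq> 0} \<subseteq> {Upper 0, Lower 0}"
  proof
    fix e assume "e \<in> {e. edge_norm_sq L f e \<noteq> 0}"
    then show "e \<in> {Upper 0, Lower 0}" using z zV by (cases e) auto
  qed
  have "edge_norm_sq L f summable_on UNIV"
    by (rule summable_on_if_finite_support, rule finite_subset[OF fin]) simp
  then have fL2: "f \<in> L2_graph L \<mu>" using oe by (simp add: L2_graph_iff)
  have fX: "f \<in> X"
    using fL2 L by (auto simp: L2_antisym_def antisymmetric_def f_def)
  have i0: "integral {of_int j..of_int j + 1} (\<lambda>s. k s * f (s, L / 2)) = 0" if "j \<noteq> 0" for j k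
  proof -
    have "integral {of_int j..of_int j + 1} (\<lambda>s. k s * f (s, L / 2)) = integral {real_of_int j<..<real_of_int j + 1} (\<lambda>s. k s * f (s, L / 2))"
      by (simp add: integral_open_interval_real)
    also have "\<dots> = integral {real_of_int j<..<real_of_int j + 1} (\<lambda>s. 0)"
      by (rule Henstock_Kurzweil_Integration.integral_cong) (use U[of _ j] that in simp)
    finally show ?thesis by simp
  qed
  have "srcS z f 0 = integral {0<..<1} (\<lambda>s. sinz z (1 - s) * f (s, L / 2))"
    by (simp add: srcS_def integral_open_interval_real)
  also have "\<dots> = integral {0<..<1} (\<lambda>s. of_real ((norm (sinz z (1 - s)))\<^sup>2))"
    by (rule Henstock_Kurzweil_Integration.integral_cong)
       (use U[of _ 0] in \<open>simp add: \<phi>_def complex_norm_square[symmetric] del: of_real_power\<close>)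
  also have "\<dots> = of_real (integral {0..1} (\<lambda>s. (norm (sinz z (1 - s)))\<^sup>2))"
  proof -
    have "(\<lambda>s. (norm (sinz z (1 - s)))\<^sup>2) integrable_on {0..1}"
      by (intro integrable_continuous_real continuous_intros)
    from integral_unique[OF has_integral_of_real[OF integrable_integral[OF this], where ?'b = complex]]
    show ?thesis by (simp only: integral_open_interval_real)
  qed
  finally have s0: "srcS z f 0 = of_real (integral {0..1} (\<lambda>s. (norm (sinz z (1 - s)))\<^sup>2))" .
  have "integral {0..1} (\<lambda>s. (norm (sinz z (1 - s)))\<^sup>2) \<noteq> 0"
  proof
    assume "integral {0..1} (\<lambda>s. (norm (sinz z (1 - s)))\<^sup>2) = 0"
    then have "\<forall>s\<in>{0..1}. (norm (sinz z (1 - s)))\<^sup>2 = 0"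
      by (subst (asm) integral_eq_0_iff) (auto intro!: continuous_intros)
    then have *: "sinz z t = 0" if "t \<in> {0..1}" for t using that by (auto dest!: bspec[of _ _ "1 - t"])
    then show False using sinz_not_identically_0[of z] by blast
  qed
  then have "srcS z f 0 \<noteq> 0" using s0 by simp
  moreover have "srcS z f j = 0" "srcC z f j = 0" if "j \<noteq> 0" for j
    unfolding srcS_def srcC_def by (rule i0[OF that])+
  moreover have "vsrcS z f = (\<lambda>_. 0)" "vsrcC z f = (\<lambda>_. 0)"
    by (simp_all add: vsrcS_def vsrcC_def fun_eq_iff V)
  ultimately show ?thesis by (intro that[OF fX])
qed

lemma half_line_zero:
  fixes v :: "nat \<Rightarrow> complex"
  assumes "\<And>n. norm (v (Suc n)) = norm (v n)" "v \<longlonglongrightarrow> 0"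
  shows "v n = 0"
proof -
  have c0: "norm (v m) = norm (v 0)" for m by (induction m) (auto simp: assms(1))
  have c: "norm (v m) = norm (v n)" for m using c0[of m] c0[of n] by simp
  have "(\<lambda>m. norm (v m)) \<longlonglongrightarrow> 0" by (rule tendsto_norm_zero[OF assms(2)])
  moreover have "(\<lambda>m. norm (v m)) = (\<lambda>m. norm (v n))" using c by blast
  ultimately have "(\<lambda>m. norm (v n)) \<longlonglongrightarrow> 0" by metis
  then show ?thesis by (simp add: LIMSEQ_const_iff)
qed

lemma mem_spectrum:
  assumes band: "sinz z 1 = 0 \<or> (sinz z 1 \<noteq> 0 \<and> sinz z (L / 2) \<noteq> 0 \<and>
    (\<exists>r. norm r = 1 \<and> r + 1 / r = 2 * cosz z 1 + trace_coeff z))"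
  shows "z \<in> op_spectrum X N A"
proof -
  have "z \<notin> resolvent_set X N A"
  proof
    assume res: "z \<in> resolvent_set X N A"
    obtain f where f: "f \<in> X" and f0: "\<And>j. j \<noteq> 0 \<Longrightarrow> srcS z f j = 0" "\<And>j. j \<noteq> 0 \<Longrightarrow> srcC z f j = 0"
      "vsrcS z f = (\<lambda>_. 0)" "vsrcC z f = (\<lambda>_. 0)" "srcS z f 0 \<noteq> 0"
      by (rule source_on_one_edge) (rule that, assumption+)
    obtain u g where ug: "(u, g) \<in> A" "N (\<lambda>p. g p - z * u p - f p) = 0"
      using res f unfolding resolvent_set_def by blast
    have fL2: "f \<in> L2_graph L \<mu>" using f by (simp add: L2_antisym_def)
    obtain v a c where sys: "vertex_system z f v a c" and l2: "l2 v"
      by (rule vertex_system_of_solution_mod_null[OF ug(1) fL2 ug(2)]) (rule that, assumption+)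
    have lim: "(\<lambda>n. v (int n)) \<longlonglongrightarrow> 0" "(\<lambda>n. v (- int n)) \<longlonglongrightarrow> 0"
      using l2_decays[OF l2] by (auto simp: decays_def)
    have lim1: "(\<lambda>n. v (1 + int n)) \<longlonglongrightarrow> 0"
      using LIMSEQ_Suc[OF lim(1)] by simp
    have "v 1 = 0 \<and> v 0 = 0 \<and> (sinz z 1 \<noteq> 0 \<longrightarrow> v (- 1) = 0)"
    proof (cases "sinz z 1 = 0")
      case True
      have "cosz z 1 * cosz z 1 = 1" using cosz_sinz_sq[of z 1] True by simp
      then have c1: "norm (cosz z 1) = 1" by (auto simp: square_eq_1_iff)
      have step: "norm (v (j + 1)) = norm (v j)" if "j \<noteq> 0" for j
      proof -
        have "v (j + 1) = v j * cosz z 1 + a j * sinz z 1 - srcS z f j"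
          using sys unfolding vertex_system_iff by blast
        then show ?thesis using f0(1)[OF that] True c1 by (simp add: norm_mult)
      qed
      have "v (1 + int n) = 0" for n
        by (rule half_line_zero[OF _ lim1]) (use step[of "1 + int _"] in \<open>simp add: add.commute add.left_commute\<close>)
      from this[of 0] have "v 1 = 0" by simp
      moreover have "v (- int n) = 0" for n
        by (rule half_line_zero[OF _ lim(2)]) (use step[of "- int (Suc _)"] in simp)
      from this[of 0] have "v 0 = 0" by simp
      ultimately show ?thesis using True by simp
    next
      case False
      then obtain r where SL: "sinz z (L / 2) \<noteq> 0" and r: "norm r = 1" "r + 1 / r = 2 * cosz z 1 + trace_coeff z"
        using band by blast
      have r0: "r \<noteq> 0" "norm r \<le> 1" using r(1) by auto
      have rec: "v (j + 1) + v (j - 1) = (r + 1 / r) * v j" if "j \<noteq> 0" "j \<noteq> 1" for j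
      proof -
        have "v (j + 1) + v (j - 1) - (2 * cosz z 1 + of_real (w j) * trace_coeff z) * v j = rhs_of z f j"
          using sys unfolding vertex_system_iff_recurrence[OF False SL] by blast
        moreover have "rhs_of z f j = 0" using that f0 by (simp add: rhs_of_def)
        ultimately show ?thesis using that r(2) by (simp add: w_simps)
      qed
      have geo: "w' n = 0" if w': "\<And>n. w' (Suc (Suc n)) + w' n = (r + 1 / r) * w' (Suc n)" "w' \<longlonglongrightarrow> 0" for w' :: "nat \<Rightarrow> complex" and n
      proof -
        have e: "w' n = w' 0 * r ^ n" for n by (rule recurrence_decaying_nat[OF r0 w'])
        have n: "norm (w' n) = norm (w' 0)" for n
          using r(1) by (subst e) (simp add: norm_mult norm_power)
        have "norm (w' (Suc m)) = norm (w' m)" for m using n[of "Suc m"] n[of m] by simp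
        then show ?thesis by (rule half_line_zero[OF _ w'(2)])
      qed
      have "v (1 + int n) = 0" for n
        by (rule geo[OF _ lim1]) (use rec[of "2 + int _"] in \<open>simp add: algebra_simps\<close>)
      from this[of 0] have "v 1 = 0" by simp
      moreover have m: "v (- int n) = 0" for n
        by (rule geo[OF _ lim(2)]) (use rec[of "- 1 - int _"] in \<open>simp add: algebra_simps\<close>)
      from m[of 0] have "v 0 = 0" by simp
      moreover from m[of 1] have "v (- 1) = 0" by simp
      ultimately show ?thesis by simp
    qed
    then have v: "v 1 = 0" "v 0 = 0" "sinz z 1 \<noteq> 0 \<Longrightarrow> v (- 1) = 0" by auto
    show False
    proof (cases "sinz z 1 = 0")
      case True
      then show False using sys[unfolded vertex_system_iff, rule_format, of 0] v f0(5) by simp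
    next
      case False
      then have SL: "sinz z (L / 2) \<noteq> 0" using band by blast
      have "v (0 + 1) + v (0 - 1) - (2 * cosz z 1 + of_real (w 0) * trace_coeff z) * v 0 = rhs_of z f 0"
        using sys[unfolded vertex_system_iff_recurrence[OF False SL]] by blast
      then have "rhs_of z f 0 = 0" using v False by simp
      then show False using f0 by (simp add: rhs_of_def)
    qed
  qed
  then show ?thesis by (simp add: op_spectrum_def)
qed

end

section \<open>Counting the eigenvalues in a gap\<close>

lemma cot_add_zero_of_sin: "sin p = 0 \<Longrightarrow> cot (x + p) = cot x" for p x :: real
proof -
  assume "sin p = 0"
  moreover from this have "cos p \<noteq> 0" by (metis sin_zero_abs_cos_one abs_zero zero_neq_one)
  ultimately show ?thesis by (simp add: cot_def sin_add cos_add)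
qed

lemma cot_affine_at_right:
  fixes a b p :: real
  assumes a: "a > 0" and p: "sin (a * p + b) = 0"
  shows "filterlim (\<lambda>w. cot (a * w + b)) at_top (at_right p)"
proof -
  have "(\<lambda>x. cot (a * (x + p) + b)) = (\<lambda>x. cos (a * x) * inverse (sin (a * x)))"
  proof
    fix x
    have "cot (a * (x + p) + b) = cot (a * x + (a * p + b))" by (simp add: algebra_simps)
    also have "\<dots> = cot (a * x)" by (rule cot_add_zero_of_sin[OF p])
    finally show "cot (a * (x + p) + b) = cos (a * x) * inverse (sin (a * x))"
      by (simp add: cot_def divide_inverse)
  qed
  moreover have "filterlim (\<lambda>x. cos (a * x) * inverse (sin (a * x))) at_top (at_right 0)"
  proof (rule filterlim_tendsto_pos_mult_at_top)
    show "((\<lambda>x. cos (a * x)) \<longlongrightarrow> 1) (at_right 0)"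
      using tendsto_cos[OF tendsto_mult[OF tendsto_const[of a] tendsto_ident_at[of 0 "{0<..}"]]] by simp
    show "filterlim (\<lambda>x. inverse (sin (a * x))) at_top (at_right 0)"
    proof (rule filterlim_inverse_at_top)
      show "((\<lambda>x. sin (a * x)) \<longlongrightarrow> 0) (at_right 0)"
        using tendsto_sin[OF tendsto_mult[OF tendsto_const[of a] tendsto_ident_at[of 0 "{0<..}"]]] by simp
      have "eventually (\<lambda>x. x \<in> {0<..<pi / a}) (at_right 0)"
        using a by (intro eventually_at_right_real) simp
      then show "eventually (\<lambda>x. 0 < sin (a * x)) (at_right 0)"
        by eventually_elim (use a in \<open>auto intro!: sin_gt_zero simp: field_simps\<close>)
    qed
  qed simp
  ultimately show ?thesis by (subst filterlim_at_right_to_0) simp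
qed

lemma cot_affine_at_left:
  fixes a b p :: real
  assumes a: "a > 0" and p: "sin (a * p + b) = 0"
  shows "filterlim (\<lambda>w. cot (a * w + b)) at_bot (at_left p)"
proof -
  have "sin (a * (- p) + (- b)) = 0"
    using p sin_minus[of "a * p + b"] by simp
  then have "filterlim (\<lambda>w. cot (a * w + (- b))) at_top (at_right (- p))"
    by (rule cot_affine_at_right[OF a])
  moreover have "cot (a * w + (- b)) = - cot (a * (- w) + b)" for w
    using cot_minus[of "a * (- w) + b"] by simp
  ultimately have "filterlim (\<lambda>w. - cot (a * (- w) + b)) at_top (at_right (- p))" by simp
  then show ?thesis
    by (subst filterlim_at_left_to_right) (simp add: filterlim_uminus_at_bot)
qed

lemma cot_affine_antimono:
  fixes a b x y :: real
  assumes a: "a > 0" and xy: "x \<le> y" and nz: "\<And>w. w \<in> {x..y} \<Longrightarrow> sin (a * w + b) \<noteq> 0"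
  shows "cot (a * y + b) \<le> cot (a * x + b)"
proof (rule DERIV_nonpos_imp_nonincreasing[OF xy])
  fix w assume "x \<le> w" "w \<le> y"
  then have "((\<lambda>w. cot (a * w + b)) has_real_derivative - inverse ((sin (a * w + b))\<^sup>2) * a) (at w)"
  proof -
    have "sin (a * w + b) \<noteq> 0" using nz \<open>x \<le> w\<close> \<open>w \<le> y\<close> by simp
    moreover have "((\<lambda>w. a * w + b) has_real_derivative a) (at w)"
      by (auto intro!: derivative_eq_intros)
    ultimately show ?thesis by (rule DERIV_chain2[OF DERIV_cot])
  qed
  moreover have "- inverse ((sin (a * w + b))\<^sup>2) * a \<le> 0" using a by simp
  ultimately show "\<exists>d. ((\<lambda>w. cot (a * w + b)) has_real_derivative d) (at w) \<and> d \<le> 0" by blast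
qed

definition Phi :: "real \<Rightarrow> real \<Rightarrow> real \<Rightarrow> real" where
  "Phi L k w = 4 * cot w + k * cot (w * L / 2) - 4 * tan (w * L / 2)"

definition pole :: "real \<Rightarrow> real \<Rightarrow> bool" where
  "pole L w \<longleftrightarrow> sin w = 0 \<or> sin (w * L / 2) = 0 \<or> cos (w * L / 2) = 0"

lemma pole_iff_sin: "pole L w \<longleftrightarrow> sin w = 0 \<or> sin (L * w) = 0"
proof -
  have "sin (L * w) = 2 * sin (w * L / 2) * cos (w * L / 2)"
    using sin_double[of "w * L / 2"] by (simp add: mult.commute)
  then show ?thesis by (auto simp: pole_def)
qed

lemma Phi_eq: "Phi L k w = 4 * cot (1 * w + 0) + k * cot (L / 2 * w + 0) + 4 * cot (L / 2 * w + pi / 2)"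
proof -
  have "cot (L / 2 * w + pi / 2) = - tan (w * L / 2)"
    by (simp add: cot_def tan_def sin_add cos_add mult.commute)
  then show ?thesis by (simp add: Phi_def mult.commute)
qed

lemma not_pole_cot_args:
  assumes "\<not> pole L w"
  shows "sin (1 * w + 0) \<noteq> 0" "sin (L / 2 * w + 0) \<noteq> 0" "sin (L / 2 * w + pi / 2) \<noteq> 0"
  using assms by (auto simp: pole_def sin_add mult.commute)

lemma Phi_has_derivative:
  assumes "\<not> pole L w"
  shows "(Phi L k has_real_derivative
    - 4 * inverse ((sin w)\<^sup>2) - k * (inverse ((sin (w * L / 2))\<^sup>2) * (L / 2)) - 4 * (inverse ((cos (w * L / 2))\<^sup>2) * (L / 2))) (at w)"
proof -
  have nz: "sin w \<noteq> 0" "sin (w * L / 2) \<noteq> 0" "cos (w * L / 2) \<noteq> 0" using assms by (auto simp: pole_def)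
  have d: "((\<lambda>w. w * L / 2) has_real_derivative L / 2) (at w)"
    by (auto intro!: derivative_eq_intros)
  have "((\<lambda>w. 4 * cot w + k * cot (w * L / 2) - 4 * tan (w * L / 2)) has_real_derivative
      4 * (- inverse ((sin w)\<^sup>2)) + k * (- inverse ((sin (w * L / 2))\<^sup>2) * (L / 2)) - 4 * (inverse ((cos (w * L / 2))\<^sup>2) * (L / 2))) (at w)"
    by (intro DERIV_diff DERIV_add DERIV_cmult DERIV_cot DERIV_chain2[OF DERIV_cot d] DERIV_chain2[OF DERIV_tan d] nz)
  then show ?thesis by (simp add: Phi_def[abs_def])
qed

lemma Phi_strict_antimono:
  assumes "L > 0" "k \<ge> 0" "a < b" and np: "\<And>w. w \<in> {a..b} \<Longrightarrow> \<not> pole L w"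
  shows "Phi L k b < Phi L k a"
proof (rule DERIV_neg_imp_decreasing[OF assms(3)])
  fix w assume "a \<le> w" "w \<le> b"
  then have p: "\<not> pole L w" using np by simp
  then have "0 < inverse ((sin w)\<^sup>2)" by (simp add: pole_def)
  moreover have "0 \<le> k * (inverse ((sin (w * L / 2))\<^sup>2) * (L / 2))" "0 \<le> inverse ((cos (w * L / 2))\<^sup>2) * (L / 2)"
    using assms(1,2) by simp_all
  ultimately have "- 4 * inverse ((sin w)\<^sup>2) - k * (inverse ((sin (w * L / 2))\<^sup>2) * (L / 2)) - 4 * (inverse ((cos (w * L / 2))\<^sup>2) * (L / 2)) < 0"
    by linarith
  then show "\<exists>d. (Phi L k has_real_derivative d) (at w) \<and> d < 0" using Phi_has_derivative[OF p] by blast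
qed

lemma sin_zeros_around:
  fixes a w0 :: real
  assumes a: "a > 0" and w0: "sin (a * w0) \<noteq> 0" "0 < w0"
  obtains p q where "0 \<le> p" "p < w0" "w0 < q" "sin (a * p) = 0" "sin (a * q) = 0"
    "\<And>w. p < w \<Longrightarrow> w < q \<Longrightarrow> sin (a * w) \<noteq> 0"
proof -
  define n where "n = \<lfloor>a * w0 / pi\<rfloor>"
  define p where "p = of_int n * pi / a"
  define q where "q = (of_int n + 1) * pi / a"
  have ap: "a * p = of_int n * pi" and aq: "a * q = of_int (n + 1) * pi"
    using a by (simp_all add: p_def q_def)
  have sp: "sin (a * p) = 0" and sq: "sin (a * q) = 0"
    unfolding ap aq sin_zero_iff_int2 by blast+
  have "of_int n \<le> a * w0 / pi" "a * w0 / pi < of_int n + 1" unfolding n_def by linarith+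
  then have "of_int n * pi \<le> a * w0" "a * w0 < (of_int n + 1) * pi"
    by (simp_all add: field_simps)
  then have "p \<le> w0" "w0 < q" using a by (simp_all add: p_def q_def field_simps)
  moreover have "p \<noteq> w0" using sp w0 by auto
  moreover have "0 \<le> p"
  proof -
    have "0 \<le> a * w0 / pi" using a w0 by simp
    then have "0 \<le> n" unfolding n_def by simp
    then show ?thesis using a by (simp add: p_def)
  qed
  moreover have "sin (a * w) \<noteq> 0" if "p < w" "w < q" for w
  proof
    assume "sin (a * w) = 0"
    then obtain i where i: "a * w = of_int i * pi" unfolding sin_zero_iff_int2 by blast
    have "a * p < a * w" "a * w < a * q" using that a by simp_all
    then have "of_int n * pi < of_int i * pi" "of_int i * pi < of_int (n + 1) * pi"
      unfolding ap aq i by simp_all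
    then have "n < i" "i < n + 1" by (simp_all only: mult_less_cancel_right_pos[OF pi_gt_zero] of_int_less_iff)
    then show False by simp
  qed
  ultimately show ?thesis using that sp sq by (metis order_le_neq_trans)
qed

text \<open>
  Every summand of \<open>Phi\<close> is a decreasing cotangent, so on a maximal interval without poles \<open>Phi\<close> falls from
  \<open>\<infinity>\<close> to \<open>- \<infinity>\<close>: at each end one summand diverges and the others are bounded on the correct side by
  their value at \<open>w0\<close>.
\<close>

lemma pole_free_interval_zero:
  assumes L: "L > 0" and k: "k > 0" and w0: "0 < w0" "\<not> pole L w0"
  obtains p q w1 where "0 \<le> p" "p < w0" "w0 < q" "p < w1" "w1 < q" "Phi L k w1 = 0"
    "\<And>w. p < w \<Longrightarrow> w < q \<Longrightarrow> \<not> pole L w"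
proof -
  have np0: "sin (1 * w0) \<noteq> 0" "sin (L * w0) \<noteq> 0" using w0(2) by (auto simp: pole_iff_sin)
  obtain p1 q1 where 1: "0 \<le> p1" "p1 < w0" "w0 < q1" "sin (1 * p1) = 0" "sin (1 * q1) = 0"
    "\<And>w. p1 < w \<Longrightarrow> w < q1 \<Longrightarrow> sin (1 * w) \<noteq> 0"
    by (rule sin_zeros_around[OF zero_less_one np0(1) w0(1)]) (rule that, assumption+)
  obtain p2 q2 where 2: "0 \<le> p2" "p2 < w0" "w0 < q2" "sin (L * p2) = 0" "sin (L * q2) = 0"
    "\<And>w. p2 < w \<Longrightarrow> w < q2 \<Longrightarrow> sin (L * w) \<noteq> 0"
    by (rule sin_zeros_around[OF L np0(2) w0(1)]) (rule that, assumption+)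
  define p where "p = max p1 p2"
  define q where "q = min q1 q2"
  have pq: "0 \<le> p" "p < w0" "w0 < q" "pole L p" "pole L q"
    using 1 2 by (auto simp: p_def q_def max_def min_def pole_iff_sin)
  have np: "\<not> pole L w" if "p < w" "w < q" for w
    using 1(6)[of w] 2(6)[of w] that by (auto simp: pole_iff_sin p_def q_def)
  define T1 where "T1 w = cot (1 * w + 0)" for w :: real
  define T2 where "T2 w = cot (L / 2 * w + 0)" for w
  define T3 where "T3 w = cot (L / 2 * w + pi / 2)" for w
  have Phi: "Phi L k w = 4 * T1 w + k * T2 w + 4 * T3 w" for w
    by (simp only: Phi_eq T1_def T2_def T3_def)
  have mono: "T1 y \<le> T1 x \<and> T2 y \<le> T2 x \<and> T3 y \<le> T3 x" if "p < x" "x \<le> y" "y < q" for x y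
  proof -
    have nz: "sin (1 * w + 0) \<noteq> 0" "sin (L / 2 * w + 0) \<noteq> 0" "sin (L / 2 * w + pi / 2) \<noteq> 0" if "w \<in> {x..y}" for w
      using not_pole_cot_args[OF np[of w]] that \<open>p < x\<close> \<open>y < q\<close> by auto
    show ?thesis
      unfolding T1_def T2_def T3_def
      using cot_affine_antimono[OF _ \<open>x \<le> y\<close> nz(1)] cot_affine_antimono[OF _ \<open>x \<le> y\<close> nz(2)]
        cot_affine_antimono[OF _ \<open>x \<le> y\<close> nz(3)] L by simp
  qed
  have L2: "0 < L / 2" using L by simp
  have nearp: "eventually (\<lambda>w. p < w \<and> w < w0) (at_right p)"
    using eventually_at_right_real[OF pq(2)] by (auto elim: eventually_mono)
  have nearq: "eventually (\<lambda>w. w0 < w \<and> w < q) (at_left q)"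
    using eventually_at_left_real[OF pq(3)] by (auto elim: eventually_mono)
  obtain x where x: "p < x" "x < w0" "0 < Phi L k x"
  proof -
    have large: "\<exists>x. p < x \<and> x < w0 \<and> B < T x" if "filterlim T at_top (at_right p)" for T :: "real \<Rightarrow> real" and B
    proof -
      have "eventually (\<lambda>w. B < T w) (at_right p)" using that by (simp add: filterlim_at_top_dense)
      with nearp have "eventually (\<lambda>w. p < w \<and> w < w0 \<and> B < T w) (at_right p)"
        by eventually_elim auto
      then show ?thesis using eventually_happens'[of "at_right p"] trivial_limit_at_right_real by blast
    qed
    from pq(4) consider "sin (1 * p + 0) = 0" | "sin (L / 2 * p + 0) = 0" | "sin (L / 2 * p + pi / 2) = 0"
      by (auto simp: pole_def sin_add mult.commute)
    then have "\<exists>x. p < x \<and> x < w0 \<and> 0 < Phi L k x"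
    proof cases
      case 1
      obtain x where x: "p < x" "x < w0" "- (k * T2 w0 + 4 * T3 w0) / 4 < T1 x"
        using large[OF cot_affine_at_right[OF zero_less_one 1], folded T1_def] by blast
      have m: "k * T2 w0 \<le> k * T2 x" "T3 w0 \<le> T3 x" using mono[of x w0] x pq k by (auto intro: mult_left_mono)
      have "- (k * T2 w0 + 4 * T3 w0) < 4 * T1 x" using x(3) by simp
      then show ?thesis using x m unfolding Phi by (intro exI[of _ x]) linarith
    next
      case 2
      obtain x where x: "p < x" "x < w0" "- (4 * T1 w0 + 4 * T3 w0) / k < T2 x"
        using large[OF cot_affine_at_right[OF L2 2], folded T2_def] by blast
      have m: "T1 w0 \<le> T1 x" "T3 w0 \<le> T3 x" using mono[of x w0] x pq by auto
      have "- (4 * T1 w0 + 4 * T3 w0) < k * T2 x" using x(3) k by (simp add: pos_divide_less_eq mult.commute)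
      then show ?thesis using x m unfolding Phi by (intro exI[of _ x]) linarith
    next
      case 3
      obtain x where x: "p < x" "x < w0" "- (4 * T1 w0 + k * T2 w0) / 4 < T3 x"
        using large[OF cot_affine_at_right[OF L2 3], folded T3_def] by blast
      have m: "k * T2 w0 \<le> k * T2 x" "T1 w0 \<le> T1 x" using mono[of x w0] x pq k by (auto intro: mult_left_mono)
      have "- (4 * T1 w0 + k * T2 w0) < 4 * T3 x" using x(3) by simp
      then show ?thesis using x m unfolding Phi by (intro exI[of _ x]) linarith
    qed
    then show ?thesis using that by blast
  qed
  obtain y where y: "w0 < y" "y < q" "Phi L k y < 0"
  proof -
    have small: "\<exists>x. w0 < x \<and> x < q \<and> T x < B" if "filterlim T at_bot (at_left q)" for T :: "real \<Rightarrow> real" and B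
    proof -
      have "eventually (\<lambda>w. T w < B) (at_left q)" using that by (simp add: filterlim_at_bot_dense)
      with nearq have "eventually (\<lambda>w. w0 < w \<and> w < q \<and> T w < B) (at_left q)"
        by eventually_elim auto
      then show ?thesis using eventually_happens'[of "at_left q"] trivial_limit_at_left_real by blast
    qed
    from pq(5) consider "sin (1 * q + 0) = 0" | "sin (L / 2 * q + 0) = 0" | "sin (L / 2 * q + pi / 2) = 0"
      by (auto simp: pole_def sin_add mult.commute)
    then have "\<exists>x. w0 < x \<and> x < q \<and> Phi L k x < 0"
    proof cases
      case 1
      obtain x where x: "w0 < x" "x < q" "T1 x < - (k * T2 w0 + 4 * T3 w0) / 4"
        using small[OF cot_affine_at_left[OF zero_less_one 1], folded T1_def] by blast
      have m: "k * T2 x \<le> k * T2 w0" "T3 x \<le> T3 w0" using mono[of w0 x] x pq k by (auto intro: mult_left_mono)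
      have "4 * T1 x < - (k * T2 w0 + 4 * T3 w0)" using x(3) by simp
      then show ?thesis using x m unfolding Phi by (intro exI[of _ x]) linarith
    next
      case 2
      obtain x where x: "w0 < x" "x < q" "T2 x < - (4 * T1 w0 + 4 * T3 w0) / k"
        using small[OF cot_affine_at_left[OF L2 2], folded T2_def] by blast
      have m: "T1 x \<le> T1 w0" "T3 x \<le> T3 w0" using mono[of w0 x] x pq by auto
      have "k * T2 x < - (4 * T1 w0 + 4 * T3 w0)" using x(3) k by (simp add: pos_less_divide_eq mult.commute)
      then show ?thesis using x m unfolding Phi by (intro exI[of _ x]) linarith
    next
      case 3
      obtain x where x: "w0 < x" "x < q" "T3 x < - (4 * T1 w0 + k * T2 w0) / 4"
        using small[OF cot_affine_at_left[OF L2 3], folded T3_def] by blast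
      have m: "k * T2 x \<le> k * T2 w0" "T1 x \<le> T1 w0" using mono[of w0 x] x pq k by (auto intro: mult_left_mono)
      have "4 * T3 x < - (4 * T1 w0 + k * T2 w0)" using x(3) by simp
      then show ?thesis using x m unfolding Phi by (intro exI[of _ x]) linarith
    qed
    then show ?thesis using that by blast
  qed
  have "\<exists>w. x \<le> w \<and> w \<le> y \<and> Phi L k w = 0"
  proof (rule IVT2)
    show "\<forall>w. x \<le> w \<and> w \<le> y \<longrightarrow> isCont (Phi L k) w"
    proof (intro allI impI)
      fix w assume "x \<le> w \<and> w \<le> y"
      then have "\<not> pole L w" using x y by (intro np) auto
      then show "isCont (Phi L k) w" by (rule DERIV_isCont[OF Phi_has_derivative])
    qed
  qed (use x y in auto)
  then obtain w1 where "x \<le> w1" "w1 \<le> y" "Phi L k w1 = 0" by blast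
  then show ?thesis using that[of p q w1] pq np x y by auto
qed

definition half_trace :: "real \<Rightarrow> real \<Rightarrow> real" where
  "half_trace L w = 2 * cos w + sin w * cot (w * L / 2)"

text \<open>
  The band condition: \<open>half_trace\<close> exceeds \<open>2\<close> in modulus exactly where \<open>cot\<close> and \<open>Phi L 1\<close> have the
  same sign.
\<close>

lemma half_trace_sq:
  assumes "\<not> pole L w"
  shows "(half_trace L w)\<^sup>2 - 4 = (sin w)\<^sup>2 * (cot (w * L / 2) * Phi L 1 w)"
proof -
  define c where "c = cot (w * L / 2)"
  have c: "c \<noteq> 0" "tan (w * L / 2) = 1 / c" using assms by (auto simp: c_def cot_def tan_def pole_def)
  have s: "sin w \<noteq> 0" using assms by (auto simp: pole_def)
  have cs: "(cos w)\<^sup>2 = 1 - (sin w)\<^sup>2" by (rule cos_squared_eq)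
  have "(sin w)\<^sup>2 * (c * Phi L 1 w) = 4 * (sin w * cos w) * c + (sin w)\<^sup>2 * c\<^sup>2 - 4 * (sin w)\<^sup>2"
    using c s by (simp add: Phi_def flip: c_def) (simp add: cot_def power2_eq_square field_simps)
  also have "\<dots> = (half_trace L w)\<^sup>2 - 4"
    using cs by (simp add: half_trace_def power2_sum power_mult_distrib flip: c_def)
  finally show ?thesis by (simp add: c_def)
qed

lemma half_trace_gt_iff:
  assumes "\<not> pole L w"
  shows "\<bar>half_trace L w\<bar> > 2 \<longleftrightarrow> cot (w * L / 2) * Phi L 1 w > 0"
proof -
  have s: "0 < (sin w)\<^sup>2" using assms by (simp add: pole_def)
  have "\<bar>half_trace L w\<bar> > 2 \<longleftrightarrow> (half_trace L w)\<^sup>2 - 4 > 0"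
    using abs_le_square_iff[of "half_trace L w" 2] by auto
  also have "\<dots> \<longleftrightarrow> cot (w * L / 2) * Phi L 1 w > 0"
    unfolding half_trace_sq[OF assms] using s by (simp add: zero_less_mult_iff)
  finally show ?thesis .
qed

lemma cot_sign_constant:
  assumes np: "\<And>w. w \<in> {a..b} \<Longrightarrow> \<not> pole L w" and xy: "x \<in> {a..b}" "y \<in> {a..b}" "cot (x * L / 2) > 0"
  shows "cot (y * L / 2) > 0"
proof (rule ccontr)
  assume n: "\<not> ?thesis"
  have cont: "continuous_on {a..b} (\<lambda>w. cot (w * L / 2))"
    using np by (intro continuous_intros) (auto simp: pole_def)
  have "connected ((\<lambda>w. cot (w * L / 2)) ` {a..b})"
    by (rule connected_continuous_image[OF cont]) simp
  moreover have "cot (y * L / 2) \<le> 0" "0 \<le> cot (x * L / 2)" using n xy(3) by simp_all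
  ultimately have "0 \<in> (\<lambda>w. cot (w * L / 2)) ` {a..b}"
    using xy by (auto intro: connectedD_interval[of _ "cot (y * L / 2)" "cot (x * L / 2)" 0])
  then obtain w where "w \<in> {a..b}" "cot (w * L / 2) = 0" by auto
  then show False using np[of w] by (auto simp: pole_def cot_def)
qed

text \<open>
  On an interval without poles \<open>cot (w * L / 2)\<close> keeps its sign and \<open>Phi L 1\<close> decreases, so the set where
  their product is positive is an initial or a final segment.
\<close>

lemma gap_condition_between:
  assumes L: "L > 0" and np: "\<And>w. w \<in> {a..b} \<Longrightarrow> \<not> pole L w"
    and ab: "cot (a * L / 2) * Phi L 1 a > 0" "cot (b * L / 2) * Phi L 1 b > 0" and w: "w \<in> {a..b}"
  shows "cot (w * L / 2) * Phi L 1 w > 0"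
proof -
  have e: "a \<in> {a..b}" "b \<in> {a..b}" using w by auto
  have mono: "Phi L 1 y \<le> Phi L 1 x" if "x \<in> {a..b}" "y \<in> {a..b}" "x \<le> y" for x y
    using Phi_strict_antimono[OF L, of 1 x y] np that by (cases "x = y") (auto intro: less_imp_le)
  show ?thesis
  proof (cases "cot (w * L / 2) > 0")
    case True
    then have "cot (b * L / 2) > 0" using cot_sign_constant[OF np w e(2)] by blast
    then have "Phi L 1 b > 0" using ab(2) by (simp add: zero_less_mult_iff)
    then show ?thesis using True mono[OF w e(2)] w by (simp add: zero_less_mult_iff)
  next
    case False
    then have "\<not> cot (a * L / 2) > 0" using cot_sign_constant[OF np e(1) w] by blast
    then have "Phi L 1 a < 0" using ab(1) by (simp add: zero_less_mult_iff)
    moreover have "cot (w * L / 2) \<noteq> 0" using np[OF w] by (auto simp: pole_def cot_def)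
    ultimately show ?thesis using False mono[OF e(1) w] w by (simp add: zero_less_mult_iff)
  qed
qed

lemma card_one_or_two:
  fixes E :: "real set"
  assumes "E \<noteq> {}" and no3: "\<And>a b c. a \<in> E \<Longrightarrow> b \<in> E \<Longrightarrow> c \<in> E \<Longrightarrow> a < b \<Longrightarrow> b < c \<Longrightarrow> False"
  shows "card E \<in> {1, 2}"
proof -
  obtain a where a: "a \<in> E" using assms(1) by blast
  show ?thesis
  proof (cases "E = {a}")
    case False
    then obtain b where b: "b \<in> E" "b \<noteq> a" using a by blast
    have "c = a \<or> c = b" if "c \<in> E" for c
      using no3[OF a b(1) that] no3[OF a that b(1)] no3[OF b(1) a that] no3[OF b(1) that a]
        no3[OF that a b(1)] no3[OF that b(1) a] b(2)
        linorder_less_linear[of a b] linorder_less_linear[of a c] linorder_less_linear[of b c] by blast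
    then have "E = {a, b}" using a b by blast
    then show ?thesis using b by simp
  qed simp
qed

text \<open>
  At a zero of \<open>sin (w * L / 2)\<close> the hypotheses leave open whether the point belongs to the essential
  spectrum.  Such a point splits or does not split the surrounding gap; each of the two parts contains
  exactly one zero of \<open>Phi\<close>, so a maximal interval contains one or two in either case.
\<close>

lemma gap_eigenvalue_count:
  fixes L k :: real and ess ev :: "real \<Rightarrow> bool" and I :: "real set"
  assumes L: "L > 0" and k: "0 < k" "k < 1"
    and ess1: "\<And>x. 0 < x \<Longrightarrow> sin (sqrt x) = 0 \<Longrightarrow> ess x"
    and ess2: "\<And>x. 0 < x \<Longrightarrow> sin (sqrt x) \<noteq> 0 \<Longrightarrow> sin (sqrt x * L / 2) \<noteq> 0 \<Longrightarrow> \<bar>half_trace L (sqrt x)\<bar> \<le> 2 \<Longrightarrow> ess x"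
    and ness: "\<And>x. 0 < x \<Longrightarrow> \<not> pole L (sqrt x) \<Longrightarrow> \<bar>half_trace L (sqrt x)\<bar> > 2 \<Longrightarrow> \<not> ess x"
    and ev1: "\<And>x. 0 < x \<Longrightarrow> sin (sqrt x) \<noteq> 0 \<Longrightarrow> ev x \<Longrightarrow> \<not> pole L (sqrt x) \<and> Phi L k (sqrt x) = 0"
    and ev2: "\<And>x. 0 < x \<Longrightarrow> \<not> pole L (sqrt x) \<Longrightarrow> Phi L k (sqrt x) = 0 \<Longrightarrow> ev x"
    and I: "I \<noteq> {}" "open I" "is_interval I" "I \<subseteq> {0<..}" "\<And>x. x \<in> I \<Longrightarrow> \<not> ess x"
    and max: "\<And>J. J \<noteq> {} \<Longrightarrow> open J \<Longrightarrow> is_interval J \<Longrightarrow> J \<subseteq> {0<..} \<Longrightarrow> (\<And>x. x \<in> J \<Longrightarrow> \<not> ess x) \<Longrightarrow> I \<subseteq> J \<Longrightarrow> J = I"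
  shows "card {x \<in> I. ev x} \<in> {1, 2}"
proof (rule card_one_or_two)
  have pos: "0 < x" if "x \<in> I" for x using I(4) that by auto
  have nsin: "sin (sqrt x) \<noteq> 0" if "x \<in> I" for x using ess1[OF pos[OF that]] I(5)[OF that] by blast
  have ncos: "cos (sqrt x * L / 2) \<noteq> 0" if x: "x \<in> I" for x
  proof
    assume c: "cos (sqrt x * L / 2) = 0"
    then have "sin (sqrt x * L / 2) \<noteq> 0" using sin_cos_squared_add[of "sqrt x * L / 2"] by auto
    moreover have "\<bar>half_trace L (sqrt x)\<bar> \<le> 2" using c by (simp add: half_trace_def cot_def abs_le_iff) (use cos_ge_minus_one[of "sqrt x"] cos_le_one[of "sqrt x"] in linarith)
    ultimately show False using ess2[OF pos[OF x] nsin[OF x]] I(5)[OF x] by blast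
  qed
  have big: "\<bar>half_trace L (sqrt x)\<bar> > 2" if "x \<in> I" "sin (sqrt x * L / 2) \<noteq> 0" for x
    using ess2[OF pos[OF that(1)] nsin[OF that(1)] that(2)] I(5)[OF that(1)] by force
  have wI: "w\<^sup>2 \<in> I" if "0 \<le> a" "a \<le> w" "w \<le> b" "a\<^sup>2 \<in> I" "b\<^sup>2 \<in> I" for a b w
  proof -
    have "a\<^sup>2 \<le> w\<^sup>2" "w\<^sup>2 \<le> b\<^sup>2" using that by (auto intro: power_mono)
    then show ?thesis using I(3) that(4,5) unfolding is_interval_1 by blast
  qed
  show "{x \<in> I. ev x} \<noteq> {}"
  proof -
    obtain x where x: "x \<in> I" using I(1) by blast
    define w where "w = sqrt x"
    have w: "0 < w" "w\<^sup>2 = x" using pos[OF x] by (auto simp: w_def)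
    obtain w0 where w0: "0 < w0" "w0\<^sup>2 \<in> I" "sin (w0 * L / 2) \<noteq> 0"
    proof (cases "sin (w * L / 2) = 0")
      case False then show ?thesis using that[of w] w x by simp
    next
      case True
      have "((\<lambda>w. w\<^sup>2) \<longlongrightarrow> w\<^sup>2) (at_right w)" by (intro tendsto_intros)
      then have "eventually (\<lambda>y. y\<^sup>2 \<in> I) (at_right w)" using I(2) x w by (intro topological_tendstoD) auto
      moreover have "eventually (\<lambda>y. y \<in> {w<..<w + 2 * pi / L}) (at_right w)"
        using L by (intro eventually_at_right_real) simp
      ultimately have "eventually (\<lambda>y. y\<^sup>2 \<in> I \<and> y \<in> {w<..<w + 2 * pi / L}) (at_right w)"
        by eventually_elim auto
      then obtain y where y: "y\<^sup>2 \<in> I" "w < y" "y < w + 2 * pi / L"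
        using eventually_happens'[OF trivial_limit_at_right_real[of w]] by auto
      have "0 < sin ((y - w) * L / 2)"
        using y L by (intro sin_gt_zero) (auto simp: field_simps)
      moreover have "sin (y * L / 2) = cos (w * L / 2) * sin ((y - w) * L / 2)"
      proof -
        have "y * L / 2 = w * L / 2 + (y - w) * L / 2" by (simp add: field_simps)
        then show ?thesis using True by (simp only: sin_add)
      qed
      moreover have "cos (w * L / 2) \<noteq> 0" using ncos[OF x] by (simp add: w_def)
      ultimately have "sin (y * L / 2) \<noteq> 0" by simp
      then show ?thesis using that[of y] y w(1) by simp
    qed
    have sq0: "sqrt (w0\<^sup>2) = w0" using w0(1) by simp
    have np0: "\<not> pole L w0" using nsin[OF w0(2), unfolded sq0] ncos[OF w0(2), unfolded sq0] w0(3) by (simp add: pole_def)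
    obtain p q w1 where pq: "0 \<le> p" "p < w0" "w0 < q" "p < w1" "w1 < q" "Phi L k w1 = 0"
      "\<And>w. p < w \<Longrightarrow> w < q \<Longrightarrow> \<not> pole L w"
      by (rule pole_free_interval_zero[OF L k(1) w0(1) np0]) (rule that, assumption+)
    define D where "D w = cot (w * L / 2) * Phi L 1 w" for w
    have D0: "D w0 > 0" using big[OF w0(2), unfolded sq0] w0(3) half_trace_gt_iff[OF np0] by (simp add: D_def)
    have np1: "\<not> pole L w1" using pq by blast
    have D1: "D w1 > 0"
    proof -
      have "Phi L 1 w1 = (1 - k) * cot (w1 * L / 2)"
        using pq(6) by (simp add: Phi_def algebra_simps)
      then have "D w1 = (1 - k) * (cot (w1 * L / 2))\<^sup>2" by (simp add: D_def power2_eq_square)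
      moreover have "cot (w1 * L / 2) \<noteq> 0" using np1 by (auto simp: pole_def cot_def)
      ultimately show ?thesis using k by simp
    qed
    define E where "E = {x. 0 < x \<and> p < sqrt x \<and> sqrt x < q \<and> D (sqrt x) > 0}"
    have "open E"
    proof -
      have W: "open {w \<in> {p<..<q}. D w > 0}"
      proof -
        have "continuous_on {p<..<q} D"
          unfolding D_def Phi_def using pq(7) by (intro continuous_intros) (auto simp: pole_def)
        then have "open ({p<..<q} \<inter> D -` {0<..})" by (intro continuous_open_preimage) auto
        moreover have "{p<..<q} \<inter> D -` {0<..} = {w \<in> {p<..<q}. D w > 0}" by auto
        ultimately show ?thesis by simp
      qed
      have "open ({0<..} \<inter> sqrt -` {w \<in> {p<..<q}. D w > 0})"
        by (intro continuous_open_preimage[OF _ _ W] continuous_intros)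
      moreover have "{0<..} \<inter> sqrt -` {w \<in> {p<..<q}. D w > 0} = E" by (auto simp: E_def)
      ultimately show ?thesis by simp
    qed
    have "is_interval E"
      unfolding is_interval_1
    proof (intro ballI allI impI)
      fix a b x assume ab: "a \<in> E" "b \<in> E" and x: "a \<le> x \<and> x \<le> b"
      have s: "sqrt x \<in> {sqrt a..sqrt b}" using x by simp
      have "D (sqrt x) > 0"
        unfolding D_def
        by (rule gap_condition_between[OF L _ _ _ s]) (use ab pq(7) in \<open>auto simp: E_def D_def\<close>)
      moreover have "p < sqrt x" "sqrt x < q" "0 < x"
        using ab x s unfolding E_def mem_Collect_eq atLeastAtMost_iff by linarith+
      ultimately show "x \<in> E" by (simp add: E_def)
    qed
    have E0: "w0\<^sup>2 \<in> E" using w0(1) pq D0 unfolding E_def mem_Collect_eq sq0 by simp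
    have "I \<union> E = I"
    proof (rule max)
      have "connected (I \<union> E)"
        by (rule connected_Un) (use I(3) \<open>is_interval E\<close> E0 w0(2) in \<open>auto simp: is_interval_connected_1\<close>)
      then show "is_interval (I \<union> E)" by (simp add: is_interval_connected_1)
      show "\<not> ess x" if "x \<in> I \<union> E" for x
      proof (cases "x \<in> I")
        case True then show ?thesis by (rule I(5))
      next
        case False
        then have "x \<in> E" using that by simp
        then have x: "0 < x" "\<not> pole L (sqrt x)" "D (sqrt x) > 0" using pq(7) by (auto simp: E_def)
        then show ?thesis using ness[OF x(1,2)] half_trace_gt_iff[OF x(2)] by (simp add: D_def)
      qed
    qed (use I \<open>open E\<close> in \<open>auto simp: E_def\<close>)
    moreover have sq1: "0 < w1\<^sup>2" "sqrt (w1\<^sup>2) = w1" using pq by auto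
    then have "w1\<^sup>2 \<in> E" using pq D1 by (simp add: E_def)
    ultimately have "w1\<^sup>2 \<in> I" by blast
    moreover have "ev (w1\<^sup>2)" using ev2[OF sq1(1)] np1 pq(6) sq1(2) by simp
    ultimately show ?thesis by blast
  qed
  \<comment> \<open>two eigenvalues are separated by a pole, and in a gap the only poles are zeros of the middle
    sine, two of which are separated by a zero of the cosine\<close>
  have sep: "\<exists>w. sqrt x < w \<and> w < sqrt y \<and> sin (w * L / 2) = 0"
    if x: "x \<in> I" "ev x" and y: "y \<in> I" "ev y" and xy: "x < y" for x y
  proof -
    have zx: "\<not> pole L (sqrt x)" "Phi L k (sqrt x) = 0" using ev1[OF pos[OF x(1)] nsin[OF x(1)] x(2)] by auto
    have zy: "\<not> pole L (sqrt y)" "Phi L k (sqrt y) = 0" using ev1[OF pos[OF y(1)] nsin[OF y(1)] y(2)] by auto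
    have "\<exists>w\<in>{sqrt x..sqrt y}. pole L w"
    proof (rule ccontr)
      assume "\<not> ?thesis"
      then have "Phi L k (sqrt y) < Phi L k (sqrt x)"
        using xy k by (intro Phi_strict_antimono[OF L]) auto
      then show False using zx zy by simp
    qed
    then obtain w where w: "w \<in> {sqrt x..sqrt y}" "pole L w" by blast
    have "w\<^sup>2 \<in> I" by (rule wI[of "sqrt x" _ "sqrt y"]) (use w x y pos[OF x(1)] pos[OF y(1)] in auto)
    moreover have w0: "0 < w" using real_sqrt_gt_zero[OF pos[OF x(1)]] w(1) unfolding atLeastAtMost_iff by linarith
    then have sw: "sqrt (w\<^sup>2) = w" by simp
    ultimately have "sin (w * L / 2) = 0"
      using w(2) nsin[of "w\<^sup>2", unfolded sw] ncos[of "w\<^sup>2", unfolded sw] unfolding pole_def by blast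
    moreover have "w \<noteq> sqrt x" "w \<noteq> sqrt y" using w(2) zx zy by auto
    ultimately show ?thesis using w(1) by (intro exI[of _ w]) auto
  qed
  fix a b c assume abc: "a \<in> {x \<in> I. ev x}" "b \<in> {x \<in> I. ev x}" "c \<in> {x \<in> I. ev x}" "a < b" "b < c"
  obtain w1 where w1: "sqrt a < w1" "w1 < sqrt b" "sin (w1 * L / 2) = 0" using sep[of a b] abc by blast
  obtain w2 where w2: "sqrt b < w2" "w2 < sqrt c" "sin (w2 * L / 2) = 0" using sep[of b c] abc by blast
  obtain i where i: "w1 * L / 2 = of_int i * pi" using w1(3) unfolding sin_zero_iff_int2 by blast
  obtain j where j: "w2 * L / 2 = of_int j * pi" using w2(3) unfolding sin_zero_iff_int2 by blast
  have "w1 * L / 2 < w2 * L / 2" using w1 w2 L by simp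
  then have "of_int i * pi < of_int j * pi" using i j by simp
  then have ij: "i < j" by (simp only: mult_less_cancel_right_pos[OF pi_gt_zero] of_int_less_iff)
  define w where "w = w1 + pi / L"
  have wt: "w * L / 2 = of_int i * pi + pi / 2" using i L by (simp add: w_def field_simps)
  have "cos (w * L / 2) = 0"
    unfolding wt cos_add using sin_zero_iff_int2[of "of_int i * pi"] by auto
  moreover have "w\<^sup>2 \<in> I"
  proof (rule wI[of "sqrt a" _ "sqrt c"])
    have "w * L / 2 \<le> w2 * L / 2"
    proof -
      have "of_int i * pi + pi / 2 \<le> of_int (i + 1) * pi" by (simp add: algebra_simps)
      also have "\<dots> \<le> of_int j * pi" using ij by (intro mult_right_mono) (auto simp del: of_int_add)
      finally show ?thesis using wt j by simp
    qed
    then show "w \<le> sqrt c" using L w2(2) by simp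
    show "sqrt a \<le> w" using w1(1) L by (simp add: w_def add_increasing2)
  qed (use abc pos[of a] pos[of c] in simp_all)
  moreover have "0 < w"
  proof -
    have "0 \<le> sqrt a" using abc(1) pos[of a] by simp
    moreover have "0 < pi / L" using L by simp
    ultimately show ?thesis using w1(1) unfolding w_def by linarith
  qed
  then have "sqrt (w\<^sup>2) = w" by simp
  ultimately show False using ncos[of "w\<^sup>2"] by metis
qed

section \<open>The characteristic equation\<close>

lemma csqrt_of_pos_real: "0 < x \<Longrightarrow> csqrt (of_real x) = of_real (sqrt x)"
  by simp

lemma eq_or_inverse_if_same_sum:
  fixes r q :: complex
  assumes "r \<noteq> 0" "q \<noteq> 0" "r + 1 / r = q + 1 / q"
  shows "r = q \<or> r * q = 1"
proof -
  have "(r * r + 1) * q = (q * q + 1) * r" using assms by (simp add: field_simps)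
  then have "(r - q) * (r * q - 1) = 0" by (simp add: algebra_simps)
  then show ?thesis by simp
qed

text \<open>
  Squaring \<open>1 / r - r = (1 - m) * s\<close> and using \<open>r + 1 / r = 2 * cos w + s\<close> removes \<open>r\<close> from the
  eigenvalue condition; what is left factors as follows.
\<close>

lemma characteristic_identity:
  fixes w c s m :: complex
  assumes "sin w \<noteq> 0" "c \<noteq> 0" "s = sin w * c"
  shows "(2 * cos w + s)\<^sup>2 - 4 - ((1 - m) * s)\<^sup>2 = (sin w)\<^sup>2 * c * (4 * cot w + m * (2 - m) * c - 4 / c)"
proof -
  have cs: "cos w * cos w = 1 - sin w * sin w" using sin_cos_squared_add3[of w] by (simp add: algebra_simps)
  have "(sin w)\<^sup>2 * c * (4 * cot w + m * (2 - m) * c - 4 / c) =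
      4 * (sin w * cos w) * c + m * (2 - m) * (sin w * c) * (sin w * c) - 4 * (sin w * sin w)"
    using assms(1,2) by (simp add: cot_def power2_eq_square field_simps)
  also have "\<dots> = (2 * cos w + s)\<^sup>2 - 4 - ((1 - m) * s)\<^sup>2"
    unfolding assms(3) using cs by algebra
  finally show ?thesis by simp
qed

context weighted_ladder begin

definition kap :: real where "kap = \<mu> * (2 - \<mu>)"

definition PhiC :: "complex \<Rightarrow> complex" where
  "PhiC \<omega> = 4 * cot \<omega> + of_real kap * cot (\<omega> * of_real L / 2) - 4 * tan (\<omega> * of_real L / 2)"

lemma PhiC_of_real: "PhiC (of_real \<omega>) = of_real (Phi L kap \<omega>)"
proof -
  have "of_real \<omega> * of_real L / 2 = (of_real (\<omega> * L / 2) :: complex)" by simp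
  then show ?thesis
    unfolding PhiC_def Phi_def by (simp only: cot_of_real tan_of_real of_real_mult of_real_add of_real_diff of_real_numeral)
qed

lemma sinz_half: "z \<noteq> 0 \<Longrightarrow> sinz z (L / 2) = sin (csqrt z * of_real L / 2) / csqrt z"
  and cosz_half: "cosz z (L / 2) = cos (csqrt z * of_real L / 2)"
  and sinz_1: "z \<noteq> 0 \<Longrightarrow> sinz z 1 = sin (csqrt z) / csqrt z"
  and cosz_1: "cosz z 1 = cos (csqrt z)"
  by (simp_all add: sinz_def cosz_def)

lemma trace_coeff_eq: "z \<noteq> 0 \<Longrightarrow> trace_coeff z = sin (csqrt z) * cot (csqrt z * of_real L / 2)"
  by (simp add: trace_coeff_def sinz_half cosz_half sinz_1 cot_def)

text \<open>
  A solution of the eigenvalue condition is a zero of \<open>PhiC\<close>; complex parameters are needed because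
  isolated points of the spectrum are isolated in the complex plane.
\<close>

lemma PhiC_zero_if_condition:
  assumes z: "z \<noteq> 0" and S: "sinz z 1 \<noteq> 0" "sinz z (L / 2) \<noteq> 0"
    and r: "r \<noteq> 0" "norm r < 1" "r + 1 / r = 2 * cosz z 1 + trace_coeff z"
    and ev: "1 / r - r = of_real (1 - \<mu>) * trace_coeff z"
  shows "cos (csqrt z * of_real L / 2) \<noteq> 0" "PhiC (csqrt z) = 0"
proof -
  define \<omega> where "\<omega> = csqrt z"
  define c where "c = cot (\<omega> * of_real L / 2)"
  have s: "trace_coeff z = sin \<omega> * c" using trace_coeff_eq[OF z] by (simp add: \<omega>_def c_def)
  have sw: "sin \<omega> \<noteq> 0" "sin (\<omega> * of_real L / 2) \<noteq> 0"
    using S z by (auto simp: sinz_half sinz_1 \<omega>_def)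
  show cL: "cos (csqrt z * of_real L / 2) \<noteq> 0"
  proof
    assume "cos (csqrt z * of_real L / 2) = 0"
    then have "trace_coeff z = 0" by (simp add: s c_def cot_def \<omega>_def)
    then have "r * r = 1" using ev r(1) by (simp add: field_simps)
    then have "r = 1 \<or> r = - 1" by (simp add: square_eq_1_iff)
    then show False using r(2) by auto
  qed
  have c0: "c \<noteq> 0" using cL sw by (simp add: c_def cot_def \<omega>_def)
  have "(2 * cos \<omega> + trace_coeff z)\<^sup>2 - 4 - ((1 - of_real \<mu>) * trace_coeff z)\<^sup>2 = (r + 1 / r)\<^sup>2 - 4 - (1 / r - r)\<^sup>2"
    using r(3) ev by (simp add: cosz_1 \<omega>_def)
  also have "\<dots> = 0" using r(1) by (simp add: power2_sum power2_diff power_divide)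
  finally have "(sin \<omega>)\<^sup>2 * c * (4 * cot \<omega> + of_real \<mu> * (2 - of_real \<mu>) * c - 4 / c) = 0"
    unfolding characteristic_identity[OF sw(1) c0 s] .
  then have "4 * cot \<omega> + of_real \<mu> * (2 - of_real \<mu>) * c - 4 / c = 0" using sw(1) c0 by simp
  moreover have "4 / c = 4 * tan (\<omega> * of_real L / 2)" by (simp add: c_def cot_def tan_def)
  ultimately show "PhiC (csqrt z) = 0" by (simp add: PhiC_def kap_def \<omega>_def c_def)
qed

lemma real_data:
  assumes x: "0 < x"
  shows "sinz (of_real x) 1 = 0 \<longleftrightarrow> sin (sqrt x) = 0"
    "sinz (of_real x) (L / 2) = 0 \<longleftrightarrow> sin (sqrt x * L / 2) = 0"
    "cosz (of_real x) 1 = of_real (cos (sqrt x))"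
    "trace_coeff (of_real x) = of_real (sin (sqrt x) * cot (sqrt x * L / 2))"
    "2 * cosz (of_real x) 1 + trace_coeff (of_real x) = of_real (half_trace L (sqrt x))"
proof -
  have z: "(of_real x :: complex) \<noteq> 0" using x by simp
  have h: "of_real (sqrt x) * of_real L / 2 = (of_real (sqrt x * L / 2) :: complex)" by simp
  show "sinz (of_real x) 1 = 0 \<longleftrightarrow> sin (sqrt x) = 0"
    unfolding sinz_1[OF z] csqrt_of_pos_real[OF x] sin_of_real using x by simp
  show "sinz (of_real x) (L / 2) = 0 \<longleftrightarrow> sin (sqrt x * L / 2) = 0"
    unfolding sinz_half[OF z] csqrt_of_pos_real[OF x] h sin_of_real using x by simp
  show c: "cosz (of_real x) 1 = of_real (cos (sqrt x))"
    unfolding cosz_1 csqrt_of_pos_real[OF x] cos_of_real ..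
  show t: "trace_coeff (of_real x) = of_real (sin (sqrt x) * cot (sqrt x * L / 2))"
    unfolding trace_coeff_eq[OF z] csqrt_of_pos_real[OF x] h by (simp only: sin_of_real cot_of_real of_real_mult)
  show "2 * cosz (of_real x) 1 + trace_coeff (of_real x) = of_real (half_trace L (sqrt x))"
    unfolding c t half_trace_def by (simp only: of_real_add of_real_mult of_real_numeral)
qed

abbreviation "spec \<equiv> op_spectrum X N A"
abbreviation "disc \<equiv> discrete_spectrum X N A"
abbreviation "ess \<equiv> essential_spectrum X N A"

lemma ess_if_sin_zero:
  assumes "sinz z 1 = 0"
  shows "z \<in> ess"
proof -
  have "z \<in> spec" using mem_spectrum assms by blast
  moreover have "z \<notin> disc"
  proof
    assume "z \<in> disc"
    then have "is_eigenvalue N A z" "finite_multiplicity N A z" by (auto simp: discrete_spectrum_def)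
    then show False using eigenvalue_imp infinite_multiplicity assms by blast
  qed
  ultimately show ?thesis by (simp add: essential_spectrum_def)
qed

text \<open>
  For real \<open>h\<close> with \<open>\<bar>h\<bar> \<le> 2\<close> both solutions of \<open>r + 1 / r = h\<close> lie on the unit circle, so the recurrence has no
  decaying solution and \<open>z\<close> is a point of the spectrum that is not an eigenvalue.
\<close>

lemma ess_if_band:
  assumes S: "sinz z 1 \<noteq> 0" "sinz z (L / 2) \<noteq> 0" and h: "2 * cosz z 1 + trace_coeff z = of_real h" "\<bar>h\<bar> \<le> 2"
  shows "z \<in> ess"
proof -
  define r where "r = Complex (h / 2) (sqrt (1 - (h / 2)\<^sup>2))"
  have "(h / 2)\<^sup>2 \<le> 1" using h(2) by (simp add: abs_square_le_1)
  then have n: "norm r = 1" by (simp add: r_def norm_complex_def)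
  then have r0: "r \<noteq> 0" by auto
  have "r * cnj r = 1" using complex_norm_square[of r] n by simp
  then have "1 / r = cnj r" using r0 by (simp add: field_simps)
  then have rh: "r + 1 / r = 2 * cosz z 1 + trace_coeff z"
    by (simp add: h(1) complex_add_cnj) (simp add: r_def)
  have "z \<in> spec" using mem_spectrum[of z] S n rh by blast
  moreover have "z \<notin> disc"
  proof
    assume "z \<in> disc"
    then have "is_eigenvalue N A z" by (simp add: discrete_spectrum_def)
    then obtain q where q: "q \<noteq> 0" "norm q < 1" "q + 1 / q = 2 * cosz z 1 + trace_coeff z"
      using eigenvalue_imp[of z] S by blast
    then have "r = q \<or> r * q = 1" using eq_or_inverse_if_same_sum[OF r0 q(1)] rh by simp
    then show False using n q(2) by (metis less_irrefl mult.left_neutral norm_mult norm_one)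
  qed
  ultimately show ?thesis by (simp add: essential_spectrum_def)
qed

lemma eigenvalue_real_imp:
  assumes x: "0 < x" and s: "sin (sqrt x) \<noteq> 0" and ev: "is_eigenvalue N A (of_real x)"
  shows "\<not> pole L (sqrt x)" "Phi L kap (sqrt x) = 0"
proof -
  have z: "(of_real x :: complex) \<noteq> 0" using x by simp
  obtain r where S: "sinz (of_real x) 1 \<noteq> 0" "sinz (of_real x) (L / 2) \<noteq> 0"
    and r: "r \<noteq> 0" "norm r < 1" "r + 1 / r = 2 * cosz (of_real x) 1 + trace_coeff (of_real x)"
        "1 / r - r = of_real (1 - \<mu>) * trace_coeff (of_real x)"
    using eigenvalue_imp[OF ev] s real_data(1)[OF x] by blast
  note P = PhiC_zero_if_condition[OF z S r]
  have h: "csqrt (of_real x) * of_real L / 2 = (of_real (sqrt x * L / 2) :: complex)"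
    using csqrt_of_pos_real[OF x] by simp
  have "cos (sqrt x * L / 2) \<noteq> 0" using P(1) unfolding h cos_of_real by simp
  then show "\<not> pole L (sqrt x)" using s S(2) real_data(2)[OF x] by (simp add: pole_def)
  show "Phi L kap (sqrt x) = 0" using P(2) unfolding csqrt_of_pos_real[OF x] PhiC_of_real by simp
qed

text \<open>
  A zero of \<open>Phi\<close> makes \<open>r = cos \<omega> + \<mu> * s / 2\<close> and \<open>r' = cos \<omega> + (1 - \<mu> / 2) * s\<close> inverse to each other; that
  \<open>r\<close> is the one inside the unit disc is where \<open>\<mu> < 1\<close> enters.
\<close>

lemma eigenvalue_real_if:
  assumes x: "0 < x" and np: "\<not> pole L (sqrt x)" and Phi: "Phi L kap (sqrt x) = 0" and mu1: "\<mu> < 1"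
  shows "is_eigenvalue N A (of_real x)"
proof -
  define \<omega> where "\<omega> = sqrt x"
  define c where "c = cot (\<omega> * L / 2)"
  define s where "s = sin \<omega> * c"
  define C where "C = cos \<omega>"
  define r where "r = C + \<mu> * s / 2"
  define r' where "r' = C + (1 - \<mu> / 2) * s"
  have nz: "sin \<omega> \<noteq> 0" "sin (\<omega> * L / 2) \<noteq> 0" "cos (\<omega> * L / 2) \<noteq> 0" using np by (auto simp: pole_def \<omega>_def)
  have c0: "c \<noteq> 0" using nz by (simp add: c_def cot_def)
  have t: "tan (\<omega> * L / 2) = 1 / c" by (simp add: c_def cot_def tan_def)
  have Phi': "4 * cot \<omega> + kap * c - 4 / c = 0" using Phi t by (simp add: Phi_def \<omega>_def c_def)
  have cs: "C * C = 1 - sin \<omega> * sin \<omega>" using sin_cos_squared_add3[of \<omega>] by (simp add: C_def algebra_simps)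
  \<comment> \<open>multiplying \<open>Phi = 0\<close> by \<open>(sin \<omega>)\<^sup>2 * c\<close>\<close>
  have key: "4 * C * s + kap * (s * s) = 4 * (sin \<omega> * sin \<omega>)"
  proof -
    have "sin \<omega> * sin \<omega> * c * (4 * cot \<omega> + kap * c - 4 / c) = 4 * C * s + kap * (s * s) - 4 * (sin \<omega> * sin \<omega>)"
      using nz c0 by (simp add: s_def C_def cot_def field_simps)
    then show ?thesis using Phi' by simp
  qed
  have rr': "r * r' = 1"
  proof -
    have "4 * (r * r') = 4 * (C * C) + (4 * C * s + kap * (s * s))"
      by (simp add: r_def r'_def kap_def field_simps)
    then show ?thesis using key cs by simp
  qed
  then have r0: "r \<noteq> 0" by auto
  with rr' have r': "r' = 1 / r" by (simp add: eq_divide_eq mult.commute)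
  have sum: "r + r' = 2 * C + s" and diff: "r' - r = (1 - \<mu>) * s"
    by (simp_all add: r_def r'_def field_simps)
  have "\<bar>r\<bar> < 1"
  proof -
    have "r' * r' - r * r = (r' - r) * (r + r')" by (simp add: algebra_simps)
    also have "\<dots> = (1 - \<mu>) * (2 * C * s + s * s)" unfolding sum diff by (simp add: algebra_simps)
    also have "\<dots> > 0"
    proof (rule mult_pos_pos)
      have "kap < 1"
      proof -
        have "0 < (1 - \<mu>)\<^sup>2" using mu1 by simp
        then show ?thesis by (simp add: kap_def power2_eq_square algebra_simps)
      qed
      then have "0 \<le> (2 - kap) * (s * s)" by simp
      moreover have "0 < sin \<omega> * sin \<omega>" using nz(1) zero_less_power2[of "sin \<omega>"] by (simp add: power2_eq_square)
      moreover have "2 * (2 * C * s + s * s) = 4 * (sin \<omega> * sin \<omega>) + (2 - kap) * (s * s)"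
        unfolding key[symmetric] by (simp add: algebra_simps)
      ultimately have "0 < 2 * (2 * C * s + s * s)" by (simp only:)
      then show "0 < 2 * C * s + s * s" by simp
    qed (use mu1 in simp)
    finally have "r\<^sup>2 < r'\<^sup>2" by (simp add: power2_eq_square)
    then have lt: "\<bar>r\<bar> < \<bar>r'\<bar>" using abs_le_square_iff[of r' r] by (simp add: not_le[symmetric])
    have "\<bar>r\<bar> * \<bar>r'\<bar> = 1" using rr' by (metis abs_mult abs_one)
    moreover have "\<bar>r\<bar> * \<bar>r\<bar> < \<bar>r\<bar> * \<bar>r'\<bar>" by (rule mult_strict_left_mono[OF lt]) (use r0 in simp)
    ultimately have "\<bar>r\<bar> * \<bar>r\<bar> < 1" by linarith
    then show ?thesis using abs_square_less_1[of "r"] by (simp add: power2_eq_square)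
  qed
  then have n: "norm (of_real r :: complex) < 1" by simp
  have S: "sinz (of_real x) 1 \<noteq> 0" "sinz (of_real x) (L / 2) \<noteq> 0"
    using real_data(1,2)[OF x] nz by (auto simp: \<omega>_def)
  have tc: "trace_coeff (of_real x) = of_real s" using real_data(4)[OF x] by (simp add: s_def c_def \<omega>_def)
  show ?thesis
  proof (rule eigenvalue_if(1)[OF S _ n])
    show "(of_real r :: complex) \<noteq> 0" using r0 by simp
    have "of_real r + 1 / of_real r = (of_real (r + r') :: complex)" by (simp add: r')
    then show "of_real r + 1 / of_real r = 2 * cosz (of_real x) 1 + trace_coeff (of_real x)"
      unfolding sum tc real_data(3)[OF x] by (simp add: C_def \<omega>_def)
    have "1 / of_real r - of_real r = (of_real (r' - r) :: complex)" by (simp add: r')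
    then show "1 / of_real r - of_real r = of_real (1 - \<mu>) * trace_coeff (of_real x)"
      unfolding diff tc by simp
  qed
qed

lemma resolvent_if_gap:
  assumes z: "z \<noteq> 0" and S: "sin (csqrt z) \<noteq> 0" "sin (csqrt z * of_real L / 2) \<noteq> 0"
    and h: "norm (2 * cos (csqrt z) + sin (csqrt z) * cot (csqrt z * of_real L / 2)) > 2"
    and P: "PhiC (csqrt z) \<noteq> 0"
  shows "z \<in> resolvent_set X N A"
proof -
  have S': "sinz z 1 \<noteq> 0" "sinz z (L / 2) \<noteq> 0" using S z by (auto simp: sinz_1 sinz_half)
  obtain r where r: "r \<noteq> 0" "norm r \<le> 1" "r + 1 / r = 2 * cosz z 1 + trace_coeff z" by (rule exists_root)
  have "norm r \<noteq> 1"
  proof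
    assume "norm r = 1"
    then have "norm (r + 1 / r) \<le> 2"
      using norm_triangle_ineq[of r "1 / r"] by (simp add: norm_divide)
    then show False using h unfolding r(3) cosz_1 trace_coeff_eq[OF z] by simp
  qed
  then have "norm r < 1" using r(2) by simp
  then show ?thesis
    using mem_resolvent_set[OF S' r(1) _ r(3)] PhiC_zero_if_condition(2)[OF z S' r(1) _ r(3)] P by blast
qed

lemma DERIV_nonzero_isolates:
  fixes f :: "complex \<Rightarrow> complex"
  assumes f: "(f has_field_derivative d) (at a)" and d: "d \<noteq> 0"
  shows "eventually (\<lambda>w. f w \<noteq> 0) (at a)"
proof (cases "f a = 0")
  case True
  have "((\<lambda>w. (f w - f a) / (w - a)) \<longlongrightarrow> d) (at a)" using f by (simp add: has_field_derivative_iff)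
  then have "eventually (\<lambda>w. (f w - f a) / (w - a) \<noteq> 0) (at a)" using d by (rule tendsto_imp_eventually_ne)
  then show ?thesis by eventually_elim (use True in auto)
next
  case False
  have "(f \<longlongrightarrow> f a) (at a)" using DERIV_isCont[OF f] by (simp add: isCont_def)
  then show ?thesis using False by (rule tendsto_imp_eventually_ne)
qed

text \<open>
  Near \<open>x\<close>, in the complex plane, the recurrence keeps its decaying solution and \<open>PhiC\<close> has no zero except
  possibly at \<open>x\<close>; hence a punctured neighbourhood lies in the resolvent set, and \<open>x\<close> is in the resolvent
  set too or is an isolated eigenvalue of multiplicity one.
\<close>

lemma not_ess_if_gap:
  assumes x: "0 < x" and np: "\<not> pole L (sqrt x)" and h: "\<bar>half_trace L (sqrt x)\<bar> > 2" and mu1: "\<mu> < 1"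
  shows "of_real x \<notin> ess"
proof -
  define w0 :: complex where "w0 = of_real (sqrt x)"
  have z0: "(of_real x :: complex) \<noteq> 0" using x by simp
  have cs: "csqrt (of_real x) = w0" using csqrt_of_pos_real[OF x] by (simp add: w0_def)
  have nz: "sin (sqrt x) \<noteq> 0" "sin (sqrt x * L / 2) \<noteq> 0" "cos (sqrt x * L / 2) \<noteq> 0"
    using np by (auto simp: pole_def)
  have hl: "w0 * of_real L / 2 = of_real (sqrt x * L / 2)" by (simp add: w0_def)
  have nzc: "sin w0 \<noteq> 0" "sin (w0 * of_real L / 2) \<noteq> 0" "cos (w0 * of_real L / 2) \<noteq> 0"
    unfolding hl unfolding w0_def sin_of_real cos_of_real using nz by simp_all
  \<comment> \<open>\<open>PhiC\<close> has non-zero (real, negative) derivative at \<open>w0\<close>, so it has no other zero nearby\<close>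
  have kap: "0 < kap" using mu mu1 by (simp add: kap_def)
  have "eventually (\<lambda>w. PhiC w \<noteq> 0) (at w0)"
  proof (rule DERIV_nonzero_isolates)
    define d :: real where "d = 4 * (- inverse ((sin (sqrt x))\<^sup>2)) + kap * (- inverse ((sin (sqrt x * L / 2))\<^sup>2) * (L / 2))
        - 4 * (inverse ((cos (sqrt x * L / 2))\<^sup>2) * (L / 2))"
    have dl: "((\<lambda>w. w * of_real L / 2) has_field_derivative of_real L / 2) (at w0)"
      by (auto intro!: derivative_eq_intros)
    have "((\<lambda>w. 4 * cot w + of_real kap * cot (w * of_real L / 2) - 4 * tan (w * of_real L / 2)) has_field_derivative
      4 * (- inverse ((sin w0)\<^sup>2)) + of_real kap * (- inverse ((sin (w0 * of_real L / 2))\<^sup>2) * (of_real L / 2))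
        - 4 * (inverse ((cos (w0 * of_real L / 2))\<^sup>2) * (of_real L / 2))) (at w0)"
      by (intro DERIV_diff DERIV_add DERIV_cmult DERIV_cot DERIV_chain2[OF DERIV_cot dl] DERIV_chain2[OF DERIV_tan dl] nzc)
    moreover have "4 * (- inverse ((sin w0)\<^sup>2)) + of_real kap * (- inverse ((sin (w0 * of_real L / 2))\<^sup>2) * (of_real L / 2))
        - 4 * (inverse ((cos (w0 * of_real L / 2))\<^sup>2) * (of_real L / 2)) = of_real d"
      unfolding hl unfolding w0_def sin_of_real cos_of_real by (simp add: d_def)
    ultimately show "(PhiC has_field_derivative of_real d) (at w0)"
      by (simp add: PhiC_def[abs_def])
    have "0 < inverse ((sin (sqrt x))\<^sup>2)" using nz by simp
    moreover have "0 \<le> kap * (inverse ((sin (sqrt x * L / 2))\<^sup>2) * (L / 2))" "0 \<le> inverse ((cos (sqrt x * L / 2))\<^sup>2) * (L / 2)"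
      using L kap by simp_all
    ultimately have "d < 0" unfolding d_def by linarith
    then show "of_real d \<noteq> (0::complex)" by simp
  qed
  moreover have "eventually (\<lambda>w. sin w \<noteq> 0) (at w0)"
    by (rule tendsto_imp_eventually_ne[OF _ nzc(1)]) (intro tendsto_intros)
  moreover have "eventually (\<lambda>w. sin (w * of_real L / 2) \<noteq> 0) (at w0)"
    by (rule tendsto_imp_eventually_ne[OF _ nzc(2)]) (intro tendsto_intros, simp)
  moreover have "eventually (\<lambda>w. w \<noteq> 0) (at w0)"
    by (rule tendsto_imp_eventually_ne[of "\<lambda>w. w" w0]) (use x in \<open>auto simp: w0_def\<close>)
  moreover have "eventually (\<lambda>w. norm (2 * cos w + sin w * cot (w * of_real L / 2)) > 2) (at w0)"
  proof -
    have "isCont (\<lambda>w. 2 * cos w + sin w * cot (w * of_real L / 2)) w0"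
      unfolding cot_def using nzc by (intro continuous_intros) auto
    then have "((\<lambda>w. norm (2 * cos w + sin w * cot (w * of_real L / 2))) \<longlongrightarrow>
        norm (2 * cos w0 + sin w0 * cot (w0 * of_real L / 2))) (at w0)"
      unfolding isCont_def by (rule tendsto_norm)
    moreover have "2 * cos w0 + sin w0 * cot (w0 * of_real L / 2) = of_real (half_trace L (sqrt x))"
      unfolding hl unfolding w0_def half_trace_def
      by (simp only: sin_of_real cos_of_real cot_of_real of_real_add of_real_mult of_real_numeral)
    ultimately show ?thesis using h by (intro order_tendstoD(1)) simp_all
  qed
  ultimately have ev: "eventually (\<lambda>w. w \<noteq> 0 \<and> sin w \<noteq> 0 \<and> sin (w * of_real L / 2) \<noteq> 0 \<and>
      norm (2 * cos w + sin w * cot (w * of_real L / 2)) > 2 \<and> PhiC w \<noteq> 0) (at w0)"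
    by eventually_elim auto
  have "filterlim csqrt (at w0) (at (of_real x))"
  proof (rule filterlim_atI)
    have "(of_real x :: complex) \<notin> \<real>\<^sub>\<le>\<^sub>0" using x by simp
    then show "(csqrt \<longlongrightarrow> w0) (at (of_real x))"
      using continuous_at_csqrt[of "of_real x"] cs by (simp add: isCont_def)
    show "eventually (\<lambda>z. csqrt z \<noteq> w0) (at (of_real x))"
      unfolding eventually_at_filter
    proof (rule always_eventually, intro allI impI)
      fix z :: complex assume "z \<noteq> of_real x"
      then show "csqrt z \<noteq> w0" using cs csqrt_sq[of z] csqrt_sq[of "of_real x"] by metis
    qed
  qed
  from eventually_compose_filterlim[OF ev this]
  have res: "eventually (\<lambda>z. z \<in> resolvent_set X N A) (at (of_real x))"
    by eventually_elim (rule resolvent_if_gap; auto)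
  show ?thesis
  proof (cases "of_real x \<in> spec")
    case False then show ?thesis by (simp add: essential_spectrum_def)
  next
    case True
    then have nres: "of_real x \<notin> resolvent_set X N A" by (simp add: op_spectrum_def)
    obtain T where T: "open T" "of_real x \<in> T" "\<And>z. z \<in> T \<Longrightarrow> z \<noteq> of_real x \<Longrightarrow> z \<in> resolvent_set X N A"
      using res unfolding eventually_at_topological by blast
    have "T \<inter> spec = {of_real x}" using T True by (auto simp: op_spectrum_def)
    then have iso: "of_real x isolated_in spec" using T(1) True by (auto simp: isolated_in_def)
    have S': "sinz (of_real x) 1 \<noteq> 0" "sinz (of_real x) (L / 2) \<noteq> 0" using real_data(1,2)[OF x] nz by auto
    have "PhiC w0 = 0"
    proof (rule ccontr)
      assume "PhiC w0 \<noteq> 0"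
      then have "of_real x \<in> resolvent_set X N A"
        using resolvent_if_gap[OF z0] nzc h real_data(5)[OF x] cosz_1[of "of_real x"] trace_coeff_eq[OF z0] unfolding cs by simp
      then show False using nres by simp
    qed
    then have Phi0: "Phi L kap (sqrt x) = 0" using PhiC_of_real[of "sqrt x"] by (simp add: w0_def)
    have e: "is_eigenvalue N A (of_real x)" by (rule eigenvalue_real_if[OF x np Phi0 mu1])
    then obtain r where "r \<noteq> 0" "norm r < 1" "r + 1 / r = 2 * cosz (of_real x) 1 + trace_coeff (of_real x)"
        "1 / r - r = of_real (1 - \<mu>) * trace_coeff (of_real x)"
      using eigenvalue_imp[OF e] S' by blast
    then have "finite_multiplicity N A (of_real x)" by (rule eigenvalue_if(2)[OF S'])
    then have "of_real x \<in> disc" using e iso by (simp add: discrete_spectrum_def)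
    then show ?thesis by (simp add: essential_spectrum_def)
  qed
qed

text \<open>
  For \<open>\<mu> \<ge> 1\<close> and a positive spectral parameter \<open>r\<close> is real, and \<open>s = r + 1 / r - 2 * cos w\<close> has
  the sign of \<open>r\<close>, as has \<open>1 / r - r = (1 - \<mu>) * s\<close>: a contradiction.
\<close>

lemma no_positive_eigenvalue:
  assumes x: "0 < x" and mu1: "\<mu> \<ge> 1"
    and r: "r \<noteq> 0" "norm r < 1" "r + 1 / r = 2 * cosz (of_real x) 1 + trace_coeff (of_real x)"
    and ev: "1 / r - r = of_real (1 - \<mu>) * trace_coeff (of_real x)"
  shows False
proof -
  define s where "s = sin (sqrt x) * cot (sqrt x * L / 2)"
  define C where "C = cos (sqrt x)"
  have 1: "r + 1 / r = of_real (2 * C + s)" using r(3) real_data(3,4)[OF x] by (simp add: s_def C_def)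
  have 2: "1 / r - r = of_real ((1 - \<mu>) * s)" using ev real_data(4)[OF x] by (simp add: s_def)
  have "2 * r = (r + 1 / r) - (1 / r - r)" by simp
  also have "\<dots> = of_real ((2 * C + s) - (1 - \<mu>) * s)" unfolding 1 2 by simp
  finally have e: "2 * r = of_real ((2 * C + s) - (1 - \<mu>) * s)" .
  have "r = (2 * r) / 2" by simp
  also have "\<dots> = of_real (((2 * C + s) - (1 - \<mu>) * s) / 2)" unfolding e by simp
  finally have "r = of_real (((2 * C + s) - (1 - \<mu>) * s) / 2)" .
  then obtain q where q: "r = of_real q" by blast
  have q0: "q \<noteq> 0" "\<bar>q\<bar> < 1" using r(1,2) q by auto
  have "of_real (q + 1 / q) = (of_real (2 * C + s) :: complex)" using 1 q by simp
  then have e1: "q + 1 / q = 2 * C + s" using of_real_eq_iff by blast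
  have "of_real (1 / q - q) = (of_real ((1 - \<mu>) * s) :: complex)" using 2 q by simp
  then have e2: "1 / q - q = (1 - \<mu>) * s" using of_real_eq_iff by blast
  have "q * q < 1" using q0(2) abs_square_less_1[of q] by (simp add: power2_eq_square)
  then have sq: "0 < 1 - q * q" by simp
  have "C \<le> 1" "- 1 \<le> C" by (simp_all add: C_def)
  have m: "q * ((1 - \<mu>) * s) = 1 - q * q" unfolding e2[symmetric] using q0(1) by (simp add: field_simps)
  have "q * s = q * (q + 1 / q - 2 * C)" using e1 by simp
  also have "\<dots> = q * q + 1 - 2 * (q * C)" using q0(1) by (simp add: field_simps)
  finally have qs: "q * s = q * q + 1 - 2 * (q * C)" .
  have "\<bar>q * C\<bar> \<le> \<bar>q\<bar>" unfolding abs_mult using \<open>C \<le> 1\<close> \<open>- 1 \<le> C\<close> by (intro mult_right_le_one_le) auto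
  moreover have "0 \<le> (1 - \<bar>q\<bar>)\<^sup>2" by simp
  then have "2 * \<bar>q\<bar> \<le> q * q + 1" by (simp add: power2_eq_square algebra_simps)
  ultimately have "0 \<le> q * s" unfolding qs by linarith
  then have "(1 - \<mu>) * (q * s) \<le> 0" using mu1 by (intro mult_nonpos_nonneg) auto
  then show False using m sq by (simp add: algebra_simps)
qed

lemma zeros_real:
  assumes z: "\<nexists>x. 0 < x \<and> z = of_real x" and t: "0 < t"
  shows "sinz z t \<noteq> 0" "cosz z t \<noteq> 0"
proof -
  have real: False if "z \<noteq> 0" "csqrt z * of_real t = of_real y" for y
  proof -
    have "csqrt z = of_real (y / t)" using that(2) t by (simp add: field_simps)
    then have "z = of_real ((y / t)\<^sup>2)" by (metis of_real_power power2_csqrt)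
    moreover have "(y / t)\<^sup>2 > 0" using calculation that(1) by (metis of_real_0 zero_less_power2 zero_power2)
    ultimately show False using z by blast
  qed
  show "sinz z t \<noteq> 0"
  proof (cases "z = 0")
    case True then show ?thesis using t by (simp add: sinz_def)
  next
    case False
    show ?thesis
    proof
      assume "sinz z t = 0"
      then have "sin (csqrt z * of_real t) = 0" using False by (simp add: sinz_def)
      then obtain n :: int where "csqrt z * of_real t = of_real (of_int n * pi)"
        unfolding sin_eq_0 by blast
      then show False by (rule real[OF False])
    qed
  qed
  show "cosz z t \<noteq> 0"
  proof
    assume c: "cosz z t = 0"
    then have z0: "z \<noteq> 0" by (auto simp: cosz_def)
    from c obtain n :: int where "csqrt z * of_real t = of_real (n * pi) + of_real pi / 2"
      by (auto simp: cosz_def cos_eq_0)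
    then have "csqrt z * of_real t = of_real (n * pi + pi / 2)" by simp
    then show False by (rule real[OF z0])
  qed
qed

text \<open>
  Since \<open>z\<close> is off the positive half-axis, some \<open>w \<mapsto> Re (k * w)\<close> is non-negative at \<open>1\<close> and
  non-positive at \<open>z\<close>, and not zero at both.  Green's identity then makes \<open>Re (k * cosz z t / sinz z t)\<close> positive and
  \<open>Re (k * z * sinz z t / cosz z t)\<close> non-positive for \<open>t > 0\<close>.  Testing the recurrence with the conjugate
  of \<open>r ^ \<bar>j\<bar>\<close> gives \<open>2 * cosz z 1 + \<kappa> * trace_coeff z = \<rho>\<close> with a mean weight \<open>\<kappa> > 0\<close> and a real \<open>\<rho>\<close> of modulus
  at most \<open>2\<close>.  After division by \<open>sinz z 1\<close>, the half-angle formulas write \<open>\<rho> - 2 * cosz z 1\<close> as a combination of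
  the two quotients at \<open>t = 1 / 2\<close> on which the functional is non-positive, while it is positive on the vertical term.
\<close>

lemma no_eigenvalue_off_positive:
  assumes z: "\<nexists>x. 0 < x \<and> z = of_real x"
    and r: "r \<noteq> 0" "norm r < 1" "r + 1 / r = 2 * cosz z 1 + trace_coeff z"
    and ev: "1 / r - r = of_real (1 - \<mu>) * trace_coeff z"
  shows False
proof -
  obtain k where k: "0 \<le> Re k" "Re (k * z) \<le> 0" "0 < Re k \<or> Re (k * z) < 0"
  proof -
    consider "Im z > 0" | "Im z < 0" | "Im z = 0" by linarith
    then show ?thesis
    proof cases
      case 1 then show ?thesis using that[of \<i>] by simp
    next
      case 2 then show ?thesis using that[of "- \<i>"] by simp
    next
      case 3
      then have "z = of_real (Re z)" by (simp add: complex_eq_iff)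
      then have "Re z \<le> 0" using z by (metis not_le)
      then show ?thesis using that[of 1] by simp
    qed
  qed
  have dS: "(sinz z has_vector_derivative cosz z t) (at t)" and dC: "(cosz z has_vector_derivative - z * sinz z t) (at t)" for t
    using has_vector_derivative_sinz[of z t UNIV] has_vector_derivative_cosz[of z t UNIV] by auto
  have dRe: "((\<lambda>t. Re (k * f t)) has_real_derivative Re (k * f')) (at t)" if "(f has_vector_derivative f') (at t)" for f f' t
  proof -
    have "((\<lambda>t. k * f t) has_vector_derivative k * f') (at t)"
      using has_vector_derivative_mult[OF has_vector_derivative_const that, of k] by simp
    from bounded_linear.has_vector_derivative[OF bounded_linear_Re this]
    show ?thesis by (simp add: has_real_derivative_iff_has_vector_derivative)
  qed
  have dcnj: "((\<lambda>t. cnj (f t)) has_vector_derivative cnj f') (at t)" if "(f has_vector_derivative f') (at t)" for f f' t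
    using bounded_linear.has_vector_derivative[OF bounded_linear_cnj that] .
  define q where "q t = Re (k * (cosz z t * cnj (sinz z t)))" for t
  define p where "p t = Re (k * (z * sinz z t * cnj (cosz z t)))" for t
  have dq: "(q has_real_derivative (Re k * (norm (cosz z t))\<^sup>2 - Re (k * z) * (norm (sinz z t))\<^sup>2)) (at t)" for t
  proof -
    have "(q has_real_derivative Re (k * (cosz z t * cnj (cosz z t) + - z * sinz z t * cnj (sinz z t)))) (at t)"
      unfolding q_def[abs_def] by (intro dRe has_vector_derivative_mult dC dcnj dS)
    moreover have "Re (k * (cosz z t * cnj (cosz z t) + - z * sinz z t * cnj (sinz z t))) =
        Re (k * of_real ((norm (cosz z t))\<^sup>2) - (k * z) * of_real ((norm (sinz z t))\<^sup>2))"
      by (simp only: complex_norm_square) (simp add: algebra_simps)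
    ultimately show ?thesis by simp
  qed
  have dp: "(p has_real_derivative (Re (k * z) * (norm (cosz z t))\<^sup>2 - Re k * (norm (z * sinz z t))\<^sup>2)) (at t)" for t
  proof -
    have "((\<lambda>t. z * sinz z t) has_vector_derivative z * cosz z t) (at t)"
      using has_vector_derivative_mult[OF has_vector_derivative_const dS, of z] by simp
    then have "(p has_real_derivative Re (k * (z * sinz z t * cnj (- z * sinz z t) + z * cosz z t * cnj (cosz z t)))) (at t)"
      unfolding p_def[abs_def] by (intro dRe has_vector_derivative_mult dC dcnj)
    moreover have "Re (k * (z * sinz z t * cnj (- z * sinz z t) + z * cosz z t * cnj (cosz z t))) =
        Re ((k * z) * of_real ((norm (cosz z t))\<^sup>2) - k * of_real ((norm (z * sinz z t))\<^sup>2))"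
      by (simp only: complex_norm_square) (simp add: algebra_simps)
    ultimately show ?thesis by simp
  qed
  have q: "0 < q t" if t: "0 < t" for t
  proof -
    obtain \<xi> where \<xi>: "0 < \<xi>" "\<xi> < t"
      "q t - q 0 = (t - 0) * (Re k * (norm (cosz z \<xi>))\<^sup>2 - Re (k * z) * (norm (sinz z \<xi>))\<^sup>2)"
      using MVT2[OF t, of q "\<lambda>t. Re k * (norm (cosz z t))\<^sup>2 - Re (k * z) * (norm (sinz z t))\<^sup>2"] dq by blast
    have n: "0 < (norm (cosz z \<xi>))\<^sup>2" "0 < (norm (sinz z \<xi>))\<^sup>2" using zeros_real[OF z \<xi>(1)] by auto
    have "0 \<le> Re k * (norm (cosz z \<xi>))\<^sup>2" "Re (k * z) * (norm (sinz z \<xi>))\<^sup>2 \<le> 0"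
      using k(1,2) by (auto intro: mult_nonpos_nonneg)
    moreover have "0 < Re k * (norm (cosz z \<xi>))\<^sup>2 \<or> Re (k * z) * (norm (sinz z \<xi>))\<^sup>2 < 0"
      using k(3) n by (auto intro: mult_neg_pos)
    ultimately have "0 < Re k * (norm (cosz z \<xi>))\<^sup>2 - Re (k * z) * (norm (sinz z \<xi>))\<^sup>2" by linarith
    then have "0 < q t - q 0" unfolding \<xi>(3) using t by (intro mult_pos_pos) auto
    then show ?thesis by (simp add: q_def)
  qed
  have p: "p t \<le> 0" if t: "0 < t" for t
  proof -
    obtain \<xi> where \<xi>: "0 < \<xi>" "\<xi> < t"
      "p t - p 0 = (t - 0) * (Re (k * z) * (norm (cosz z \<xi>))\<^sup>2 - Re k * (norm (z * sinz z \<xi>))\<^sup>2)"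
      using MVT2[OF t, of p "\<lambda>t. Re (k * z) * (norm (cosz z t))\<^sup>2 - Re k * (norm (z * sinz z t))\<^sup>2"] dp by blast
    have "0 \<le> Re k * (norm (z * sinz z \<xi>))\<^sup>2" "Re (k * z) * (norm (cosz z \<xi>))\<^sup>2 \<le> 0"
      using k(1,2) by (auto intro: mult_nonpos_nonneg)
    then have "p t - p 0 \<le> 0" unfolding \<xi>(3) using t by (intro mult_nonneg_nonpos) auto
    then show ?thesis by (simp add: p_def)
  qed
  have quot: "Re (k * (a / b)) = Re (k * (a * cnj b)) / (norm b)\<^sup>2" for a b :: complex
  proof -
    have "k * (a / b) = (k * (a * cnj b)) / of_real ((norm b)\<^sup>2)"
      by (subst complex_div_cnj) simp
    then show ?thesis by (simp only: Re_divide_of_real)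
  qed
  define C where "C = cosz z (1 / 2)"
  define S where "S = sinz z (1 / 2)"
  have CS: "C \<noteq> 0" "S \<noteq> 0" using zeros_real[OF z, of "1 / 2"] by (auto simp: C_def S_def)
  have C1: "cosz z 1 = C * C - z * S * S" and S1: "sinz z 1 = 2 * S * C" and one: "C * C + z * S * S = 1"
    using cosz_add[of z "1 / 2" "1 / 2"] sinz_add[of z "1 / 2" "1 / 2"] cosz_sinz_sq[of z "1 / 2"]
    by (auto simp: C_def S_def algebra_simps)
  define Q where "Q = (norm r)\<^sup>2"
  have Q: "0 \<le> Q" "Q < 1" using r(2) abs_square_less_1[of "norm r"] by (auto simp: Q_def)
  define \<rho> where "\<rho> = 4 * Re r / (1 + Q)"
  define \<kappa> where "\<kappa> = (\<mu> * (1 - Q) + 2 * Q) / (1 + Q)"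
  have \<kappa>: "0 < \<kappa>" using Q mu by (simp add: \<kappa>_def add_pos_nonneg)
  have \<rho>: "\<bar>\<rho>\<bar> \<le> 2"
  proof -
    have "0 \<le> (1 - norm r)\<^sup>2" by simp
    then have "2 * norm r \<le> 1 + Q" by (simp add: Q_def power2_eq_square algebra_simps)
    then have "\<bar>4 * Re r\<bar> \<le> 2 * (1 + Q)" using abs_Re_le_cmod[of r] by simp
    then show ?thesis using Q by (simp add: \<rho>_def abs_divide divide_le_eq)
  qed
  have rel: "of_real \<rho> = 2 * cosz z 1 + of_real \<kappa> * trace_coeff z"
  proof -
    define s where "s = trace_coeff z"
    have e2: "2 * r = 2 * cosz z 1 + of_real \<mu> * s"
    proof -
      have "2 * r = (r + 1 / r) - (1 / r - r)" by simp
      also have "\<dots> = 2 * cosz z 1 + of_real \<mu> * s" unfolding r(3) ev by (simp add: s_def algebra_simps)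
      finally show ?thesis .
    qed
    have rc: "of_real Q = r * cnj r" unfolding Q_def by (rule complex_norm_square)
    have "of_real (2 * Q) * (r + 1 / r) + of_real (1 - Q) * (2 * r) = 2 * r + 2 * (of_real Q * (1 / r))"
      by (simp add: algebra_simps)
    also have "of_real Q * (1 / r) = cnj r" unfolding rc using r(1) by simp
    also have "2 * r + 2 * cnj r = of_real (4 * Re r)" by (simp add: complex_eq_iff)
    finally have f: "of_real (2 * Q) * (r + 1 / r) + of_real (1 - Q) * (2 * r) = of_real (4 * Re r)" .
    have "of_real (4 * Re r) = of_real (2 * Q) * (2 * cosz z 1 + s) + of_real (1 - Q) * (2 * cosz z 1 + of_real \<mu> * s)"
      using f unfolding r(3) e2 s_def by (rule sym)
    also have "\<dots> = of_real (1 + Q) * (2 * cosz z 1) + of_real (\<mu> * (1 - Q) + 2 * Q) * s"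
      by (simp add: algebra_simps)
    finally have m: "of_real (4 * Re r) = of_real (1 + Q) * (2 * cosz z 1) + of_real (\<mu> * (1 - Q) + 2 * Q) * s" .
    have nz: "(of_real (1 + Q) :: complex) \<noteq> 0" using Q by (simp only: of_real_eq_0_iff)
    have "of_real \<rho> = of_real (4 * Re r) / (of_real (1 + Q) :: complex)" by (simp add: \<rho>_def)
    also have "\<dots> = 2 * cosz z 1 + of_real (\<mu> * (1 - Q) + 2 * Q) * s / of_real (1 + Q)"
      unfolding m using nz by (simp add: add_divide_distrib)
    also have "\<dots> = 2 * cosz z 1 + of_real \<kappa> * s" by (simp add: \<kappa>_def)
    finally show ?thesis by (simp add: s_def)
  qed
  have "of_real \<kappa> * (cosz z (L / 2) / sinz z (L / 2)) =
      of_real ((2 + \<rho>) / 2) * (z * S / C) - of_real ((2 - \<rho>) / 2) * (C / S)"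
  proof -
    have "of_real \<kappa> * trace_coeff z = of_real \<rho> * (C * C + z * S * S) - 2 * (C * C - z * S * S)"
      using rel unfolding one C1 by simp
    also have "\<dots> = of_real (2 + \<rho>) * (z * S * S) - of_real (2 - \<rho>) * (C * C)"
      by (simp add: algebra_simps)
    finally have "sinz z 1 * (of_real \<kappa> * (cosz z (L / 2) / sinz z (L / 2))) =
        of_real (2 + \<rho>) * (z * S * S) - of_real (2 - \<rho>) * (C * C)"
      by (simp add: trace_coeff_def mult_ac)
    also have "\<dots> = sinz z 1 * (of_real ((2 + \<rho>) / 2) * (z * S / C) - of_real ((2 - \<rho>) / 2) * (C / S))"
      unfolding S1 using CS by (simp add: field_simps)
    finally have m: "sinz z 1 * (of_real \<kappa> * (cosz z (L / 2) / sinz z (L / 2))) =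
        sinz z 1 * (of_real ((2 + \<rho>) / 2) * (z * S / C) - of_real ((2 - \<rho>) / 2) * (C / S))" .
    have "sinz z 1 \<noteq> 0" unfolding S1 using CS by simp
    from mult_left_cancel[OF this, THEN iffD1, OF m] show ?thesis .
  qed
  then have "Re (k * (of_real \<kappa> * (cosz z (L / 2) / sinz z (L / 2)))) =
      Re (k * (of_real ((2 + \<rho>) / 2) * (z * S / C) - of_real ((2 - \<rho>) / 2) * (C / S)))" by simp
  moreover have "k * (of_real a * x - of_real b * y) = of_real a * (k * x) - of_real b * (k * y)" for a b :: real and x y
    by (simp add: algebra_simps)
  moreover have "k * (of_real a * x) = of_real a * (k * x)" for a :: real and x by (simp add: mult_ac)
  ultimately have "\<kappa> * Re (k * (cosz z (L / 2) / sinz z (L / 2))) =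
      (2 + \<rho>) / 2 * Re (k * (z * S / C)) - (2 - \<rho>) / 2 * Re (k * (C / S))"
    by (simp only: minus_complex.sel Re_complex_of_real times_complex.sel Im_complex_of_real mult_zero_left diff_0_right)
  moreover have "0 < Re (k * (cosz z (L / 2) / sinz z (L / 2)))"
    unfolding quot using q[of "L / 2"] zeros_real(1)[OF z, of "L / 2"] L by (simp add: q_def)
  moreover have "Re (k * (z * S / C)) \<le> 0"
    unfolding quot using p[of "1 / 2"] by (simp add: p_def S_def C_def divide_nonpos_nonneg)
  moreover have "0 \<le> Re (k * (C / S))"
    unfolding quot using q[of "1 / 2"] by (simp add: q_def S_def C_def)
  ultimately have "0 < (2 + \<rho>) / 2 * Re (k * (z * S / C)) - (2 - \<rho>) / 2 * Re (k * (C / S))"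
    using \<kappa> by (metis mult_pos_pos)
  moreover have "(2 + \<rho>) / 2 * Re (k * (z * S / C)) \<le> 0"
    using \<rho> \<open>Re (k * (z * S / C)) \<le> 0\<close> by (intro mult_nonneg_nonpos) auto
  moreover have "0 \<le> (2 - \<rho>) / 2 * Re (k * (C / S))"
    using \<rho> \<open>0 \<le> Re (k * (C / S))\<close> by (intro mult_nonneg_nonneg) auto
  ultimately show False by linarith
qed

lemma discrete_spectrum_empty:
  assumes mu1: "\<mu> \<ge> 1"
  shows "disc = {}"
proof (rule ccontr)
  assume "disc \<noteq> {}"
  then obtain z where z: "is_eigenvalue N A z" "finite_multiplicity N A z" by (auto simp: discrete_spectrum_def)
  then obtain r where r: "r \<noteq> 0" "norm r < 1" "r + 1 / r = 2 * cosz z 1 + trace_coeff z"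
      "1 / r - r = of_real (1 - \<mu>) * trace_coeff z"
    using eigenvalue_imp[OF z(1)] infinite_multiplicity[of z] by blast
  show False
  proof (cases "\<exists>x. 0 < x \<and> z = of_real x")
    case True then show False using no_positive_eigenvalue mu1 r by blast
  next
    case False then show False using no_eigenvalue_off_positive r by blast
  qed
qed

lemma gap_count:
  assumes mu1: "\<mu> < 1" and gap: "is_gap X N A I"
  shows "card {x \<in> I. is_eigenvalue N A (of_real x)} \<in> {1, 2}"
proof (rule gap_eigenvalue_count[OF L, where k = kap and ess = "\<lambda>x. of_real x \<in> ess"])
  show "0 < kap" using mu mu1 by (simp add: kap_def)
  have "0 < (1 - \<mu>)\<^sup>2" using mu1 by simp
  then show "kap < 1" by (simp add: kap_def power2_eq_square algebra_simps)
  have free: "free_interval ess J \<longleftrightarrow> J \<noteq> {} \<and> open J \<and> is_interval J \<and> J \<subseteq> {0<..} \<and> (\<forall>x\<in>J. of_real x \<notin> ess)" for J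
    unfolding free_interval_def by blast
  have gap': "free_interval ess I" "\<And>J. free_interval ess J \<Longrightarrow> I \<subseteq> J \<Longrightarrow> J = I"
    using gap unfolding is_gap_def by blast+
  show "I \<noteq> {}" "open I" "is_interval I" "I \<subseteq> {0<..}" "\<And>x. x \<in> I \<Longrightarrow> of_real x \<notin> ess"
    using gap'(1) unfolding free by blast+
  show "J = I" if "J \<noteq> {}" "open J" "is_interval J" "J \<subseteq> {0<..}" "\<And>x. x \<in> J \<Longrightarrow> of_real x \<notin> ess" "I \<subseteq> J" for J
    using gap'(2)[of J] that unfolding free by blast
  show "of_real x \<in> ess" if "0 < x" "sin (sqrt x) = 0" for x
    using ess_if_sin_zero real_data(1)[OF that(1)] that(2) by blast
  show "of_real x \<in> ess" if "0 < x" "sin (sqrt x) \<noteq> 0" "sin (sqrt x * L / 2) \<noteq> 0" "\<bar>half_trace L (sqrt x)\<bar> \<le> 2" for x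
    using ess_if_band[OF _ _ real_data(5)[OF that(1)] that(4)] real_data(1,2)[OF that(1)] that(2,3) by blast
  show "of_real x \<notin> ess" if "0 < x" "\<not> pole L (sqrt x)" "2 < \<bar>half_trace L (sqrt x)\<bar>" for x
    by (rule not_ess_if_gap[OF that mu1])
  show "\<not> pole L (sqrt x) \<and> Phi L kap (sqrt x) = 0"
    if "0 < x" "sin (sqrt x) \<noteq> 0" "is_eigenvalue N A (of_real x)" for x
    using eigenvalue_real_imp[OF that] by blast
  show "is_eigenvalue N A (of_real x)" if "0 < x" "\<not> pole L (sqrt x)" "Phi L kap (sqrt x) = 0" for x
    by (rule eigenvalue_real_if[OF that mu1])
qed

end

theorem theorem2:
  fixes L \<mu> :: real
  assumes "L > 0" and "\<mu> > 0"
  shows "(\<mu> \<ge> 1 \<longrightarrow>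
            discrete_spectrum (L2_antisym L \<mu>) (L2_graph_norm L \<mu>) (Laplacian_antisym L \<mu>) = {}) \<and>
         (\<mu> < 1 \<longrightarrow>
            (\<forall>I. is_gap (L2_antisym L \<mu>) (L2_graph_norm L \<mu>) (Laplacian_antisym L \<mu>) I \<longrightarrow>
               card {x \<in> I. is_eigenvalue (L2_graph_norm L \<mu>) (Laplacian_antisym L \<mu>) (of_real x)}
                 \<in> {1, 2}))"
proof -
  interpret weighted_ladder L \<mu> by unfold_locales (rule assms)+
  show ?thesis using discrete_spectrum_empty gap_count by blast
qed

end
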